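(* Let $\mathcal D$ be a system of causal SDEs that is essentially uniquely solvable w.r.t. every $O\subseteq V$, and let $A,B,C\subseteq V$ be pairwise disjoint. Then: 1. (Insertion/deletion of observation.) If $A\perp^\sigma_{G(\mathcal D)}B\mid C$, then $\mathbb P(X_A\mid X_B,X_C)=\mathbb P(X_A\mid X_C)$ holds $\mathbb P(X_B,X_C)$-a.s. 2. (Action/observation exchange.) If $A\perp^\sigma_{G(\mathcal D)_{\mathrm{do}(R_B)}}R_B\mid B\cup C$ and $\mathbb P(X_C\mid X_B=x_B)\ll\mathbb P(X_C\mid\mathrm{do}(X_B=x_B))$ for $\mathbb P(X_B)$-a.a. $x_B$, then $\mathbb P(X_A\mid\mathrm{do}(X_B),X_C)=\mathbb P(X_A\mid X_B,X_C)$ holds $\mathbb P(X_B,X_C)$-a.s. 3. (Insertion/deletion of action.) If $A\perp^\sigma_{G(\mathcal D)_{\mathrm{do}(R_B)}}R_B\mid C$, then for every $x_B\in\mathcal X_B$ such that $\mathbb P(X_C)\ll\mathbb P(X_C\mid\mathrm{do}(X_B=x_B))$, $\mathbb P(X_A\mid\mathrm{do}(X_B=x_B),X_C)=\mathbb P(X_A\mid X_C)$ holds $\mathbb P(X_C)$-a.s.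
   Context: Fix $T<\infty$ and a filtered probability space $(\Omega,\mathcal F,\mathbb P)$, $\mathcal F=(\mathcal F_t)_{t\in[0,T]}$, satisfying the usual conditions. $D([0,T],\mathbb R^n)$ denotes the càdlàg functions $[0,T]\to\mathbb R^n$ with the Skorokhod $J_1$ topology and its Borel $\sigma$-algebra; $\mathbb S([0,T],\mathbb R^n)$ denotes the $\mathbb R^n$-valued semimartingales; $x^{\wedge t}(s):=x(s\wedge t)$. A measurable $f:[0,T]\times D([0,T],\mathbb R^m)\to\mathbb R^n$ is càdlàg if $t\mapsto f(t,x)\in D([0,T],\mathbb R^n)$ for all $x$, and adapted if $f(t,x)=f(t,x^{\wedge t})$ for all $t,x$. A map $\varphi$ between path spaces is adapted if $(t,x)\mapsto\varphi(x)(t)$ is adapted. System of causal SDEs: a tuple $\mathcal D=(V,W,X_W,f,g,h)$ with $V,W$ finite disjoint index sets, mutually independent processes $X_w\in\mathbb S([0,T],\mathbb R)$ ($w\in W$), and for each $v\in V$ an equation $$X_v(t)=f_v(t,X_{\alpha(v)})+\int_0^t g_v(s-,X_v,X_{\beta(v)})\,\mathrm dh_v(s,X_{\gamma(v)}),\quad t\in[0,T],$$ with $\alpha(v)\subseteq V\cup W$, $\beta(v)\subseteq (V\cup W)\setminus\{v\}$, $\gamma(v)\subseteq W$, some $m_v\in\mathbb N\cup\{0\}$, and measurable càdlàg adapted $f_v:[0,T]\times D([0,T],\mathbb R^{|\alpha(v)|})\to\mathbb R$, $g_v:[0,T]\times D([0,T],\mathbb R^{|\beta(v)|+1})\to\mathbb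 R^{m_v}$, $h_v:[0,T]\times D([0,T],\mathbb R^{|\gamma(v)|})\to\mathbb R^{m_v}$ with $h_v(\cdot,X_{\gamma(v)})\in\mathbb S([0,T],\mathbb R^{m_v})$; integrals are Itô integrals. Pathwise form: $\mathcal X_a:=D([0,T],\mathbb R)$ and $\mathcal X_A:=\prod_{a\in A}\mathcal X_a$ for $A\subseteq V\cup W$. Fix (for each $m$) a measurable adapted map $\Psi:D([0,T],\mathbb R^m)^2\to D([0,T],\mathbb R)$ such that for every càdlàg adapted process $G$ and semimartingale $H$, $\Psi(G,H)$ is a càdlàg version of $\int_0^\cdot G(s-)\,\mathrm dH(s)$ (such a map is known to exist). Put $\Phi_v(x_V,x_W):=f_v(\cdot,x_{\alpha(v)})+\Psi(g_v(\cdot,x_v,x_{\beta(v)}),h_v(\cdot,x_{\gamma(v)}))$ and $\Phi_O:=(\Phi_v)_{v\in O}$. Essential unique solvability: for $O\subseteq V$ and $S:=V\setminus O$, $\mathcal D$ is essentially uniquely solvable w.r.t. $O$ if there is a measurable adapted $I^{[O]}:\mathcal X_S\times\mathcal X_W\to\mathcal X_O$ such that for every measurable adapted $\varphi_S:\mathcal X_W\to\mathcal X_S$: (1) $I^{[O]}(\varphi_S(X_W),X_W)=\Phi_O(I^{[O]}(\varphi_S(X_W),X_W),\varphi_S(X_W),X_W)$ a.s.; and (2) every measurable adapted $\varphi_O:\mathcal X_W\to\mathcal X_O$ with $\varphi_O(X_W)=\Phi_O(\varphi_O(X_W),\varphi_S(X_W),X_W)$ a.s. satisfies $\varphi_O(X_W)=I^{[O]}(\varphi_S(X_W),X_W)$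 a.s. Solutions and distributions: a (strong) solution of $\mathcal D$ is a process $X_V=\varphi_V(X_W)$, with $\varphi_V$ measurable and adapted, satisfying all equations a.s.; $\mathbb P(X_V)$ is its law (observational distribution). $\mathcal D_{\mathrm{do}(X_B=x_B)}$ replaces the equation of each $v\in B$ by $X_v(t)=x_v(t)$ and leaves the others unchanged; $\mathbb P(X_{V\setminus B}\mid\mathrm{do}(X_B=x_B))$ is the law of $X_{V\setminus B}$ in its solution, i.e. the law of $I^{[V\setminus B]}(x_B,X_W)$; it is a Markov kernel in $x_B$. $\mathbb P(X_C\mid\mathrm{do}(X_B=x_B))$ is its $C$-marginal and $\mathbb P(X_A\mid\mathrm{do}(X_B=x_B),X_C)$ is the conditional distribution of $X_A$ given $X_C$ under it; $\mathbb P(X_A\mid\mathrm{do}(X_B),X_C)$ is this viewed as a Markov kernel in $(x_B,x_C)$. $\ll$ is absolute continuity. Graphs: let $G^+(\mathcal D)$ be the directed graph on $V\cup W$ with edges $u\to v$ ($v\in V$) whenever $u\in\alpha(v)$ and $f_v$ is not constant in $x_u$, or $u\in\{v\}\cup\beta(v)$ and $g_v$ is not constant in $x_u$, or $u\in\gamma(v)$ and $h_v$ is not constant in $x_u$. The causal graph $G(\mathcal D)$ is the directed mixed graph on $V$ with the directed edges of $G^+(\mathcal D)$ between vertices of $V$, and a bidirected edge $i\leftrightarrow j$ ($i\ne j\in V$) whenever $i\leftarrow k\to j$ in $G^+(\mathcal D)$ for some $k\in W$. $G(\mathcal D)_{\mathrm{do}(R_B)}$ is $G(\mathcal D)$ with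 an additional vertex $R_v$ and edge $R_v\to v$ for each $v\in B$; $R_B:=\{R_v:v\in B\}$. $\sigma$-separation: in a graph $G$, $\mathrm{Anc}(C)$ is $C$ together with all vertices having a directed path to some vertex of $C$; a strongly connected component is a maximal set of vertices any two of which are joined by directed paths in both directions. On a walk (vertices may repeat), a non-endpoint occurrence of a vertex is a collider if both adjacent walk edges have an arrowhead at it, and otherwise a non-collider; a non-collider is blockable if it points (along a directed walk edge) to a neighbouring node on the walk that is not in its strongly connected component. A walk is $\sigma$-blocked by $C$ if it has an end-point or a blockable non-collider in $C$, or a collider not in $\mathrm{Anc}(C)$. $A\perp^\sigma_G B\mid C$ means that all walks between $A$ and $B$ are $\sigma$-blocked by $C$. *)

theory Defs
  imports "HOL-Probability.Probability"
begin

section \<open>Cadlag paths and the Skorokhod space\<close>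

text \<open>Paths on \<open>[0,T]\<close> are functions on the reals that are extensional outside \<open>{0..T}\<close>.\<close>

type_synonym path = "real \<Rightarrow> real"

definition cadlag :: "real \<Rightarrow> path set" where
  "cadlag T = {x \<in> extensional {0..T}.
     (\<forall>t\<in>{0..<T}. (x \<longlongrightarrow> x t) (at_right t)) \<and>
     (\<forall>t\<in>{0<..T}. \<exists>l. (x \<longlongrightarrow> l) (at_left t))}"

text \<open>A cadlag path with values in \<open>\<real>\<^sup>I\<close> (\<open>I\<close> a finite index set) is given by its family of
  coordinate paths.\<close>

definition cadlag_fam :: "real \<Rightarrow> 'i set \<Rightarrow> ('i \<Rightarrow> path) set" where
  "cadlag_fam T I = (\<Pi>\<^sub>E i\<in>I. cadlag T)"

definition time_changes :: "real \<Rightarrow> (real \<Rightarrow> real) set" where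
  "time_changes T = {l. strict_mono_on {0..T} l \<and> l ` {0..T} = {0..T}}"

text \<open>The Skorokhod metric on \<open>\<real>\<^sup>I\<close>-valued paths; all coordinates share one time change, so this
  metrizes \<open>J\<^sub>1\<close> on \<open>D([0,T],\<real>\<^sup>I)\<close> and not the coarser product of the coordinate topologies.\<close>

definition skorokhod_dist :: "real \<Rightarrow> 'i set \<Rightarrow> ('i \<Rightarrow> path) \<Rightarrow> ('i \<Rightarrow> path) \<Rightarrow> real" where
  "skorokhod_dist T I x y = Inf {e. 0 \<le> e \<and> (\<exists>l\<in>time_changes T. \<forall>t\<in>{0..T}.
      \<bar>l t - t\<bar> \<le> e \<and> (\<forall>i\<in>I. \<bar>x i t - y i (l t)\<bar> \<le> e))}"

definition dist_borel :: "'p set \<Rightarrow> ('p \<Rightarrow> 'p \<Rightarrow> real) \<Rightarrow> 'p measure" where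
  "dist_borel S d = sigma S {U. U \<subseteq> S \<and> (\<forall>x\<in>U. \<exists>e>0. \<forall>y\<in>S. d x y < e \<longrightarrow> y \<in> U)}"

definition D_fam :: "real \<Rightarrow> 'i set \<Rightarrow> ('i \<Rightarrow> path) measure" where
  "D_fam T I = dist_borel (cadlag_fam T I) (skorokhod_dist T I)"

definition D_real :: "real \<Rightarrow> path measure" where
  "D_real T = dist_borel (cadlag T) (\<lambda>x y. skorokhod_dist T {()} (\<lambda>_. x) (\<lambda>_. y))"

definition path_space :: "real \<Rightarrow> 'i set \<Rightarrow> ('i \<Rightarrow> path) measure" where
  "path_space T A = (\<Pi>\<^sub>M a\<in>A. D_real T)"

definition stop_path :: "real \<Rightarrow> real \<Rightarrow> path \<Rightarrow> path" where
  "stop_path T t x = (\<lambda>s\<in>{0..T}. x (min s t))"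

definition stop_fam :: "real \<Rightarrow> 'i set \<Rightarrow> real \<Rightarrow> ('i \<Rightarrow> path) \<Rightarrow> 'i \<Rightarrow> path" where
  "stop_fam T I t x = (\<lambda>i\<in>I. stop_path T t (x i))"

definition meas_cadlag_adapted :: "real \<Rightarrow> 'i set \<Rightarrow> (real \<Rightarrow> ('i \<Rightarrow> path) \<Rightarrow> real) \<Rightarrow> bool" where
  "meas_cadlag_adapted T I f \<longleftrightarrow>
     (\<lambda>(t, x). f t x) \<in> borel_measurable (restrict_space borel {0..T} \<Otimes>\<^sub>M D_fam T I) \<and>
     (\<forall>x\<in>cadlag_fam T I. (\<lambda>t\<in>{0..T}. f t x) \<in> cadlag T) \<and>
     (\<forall>t\<in>{0..T}. \<forall>x\<in>cadlag_fam T I. f t x = f t (stop_fam T I t x))"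

definition meas_adapted_map ::
    "real \<Rightarrow> 'i set \<Rightarrow> 'j set \<Rightarrow> (('i \<Rightarrow> path) \<Rightarrow> 'j \<Rightarrow> path) \<Rightarrow> bool" where
  "meas_adapted_map T A B \<phi> \<longleftrightarrow>
     \<phi> \<in> path_space T A \<rightarrow>\<^sub>M path_space T B \<and>
     (\<forall>t\<in>{0..T}. \<forall>x\<in>cadlag_fam T A. \<forall>b\<in>B. \<phi> x b t = \<phi> (stop_fam T A t x) b t)"

definition meas_adapted_map2 :: "real \<Rightarrow> 'i set \<Rightarrow> 'k set \<Rightarrow> 'j set \<Rightarrow>
    (('i \<Rightarrow> path) \<times> ('k \<Rightarrow> path) \<Rightarrow> 'j \<Rightarrow> path) \<Rightarrow> bool" where
  "meas_adapted_map2 T A A' B \<phi> \<longleftrightarrow>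
     \<phi> \<in> path_space T A \<Otimes>\<^sub>M path_space T A' \<rightarrow>\<^sub>M path_space T B \<and>
     (\<forall>t\<in>{0..T}. \<forall>x\<in>cadlag_fam T A. \<forall>y\<in>cadlag_fam T A'. \<forall>b\<in>B.
        \<phi> (x, y) b t = \<phi> (stop_fam T A t x, stop_fam T A' t y) b t)"

section \<open>Semimartingales and the Ito integral\<close>

locale usual_filtered_prob_space = prob_space M + complete_measure M
  for M :: "'a measure" +
  fixes F :: "real \<Rightarrow> 'a measure" and T :: real
  assumes T_pos: "0 < T"
    and subalg: "t \<in> {0..T} \<Longrightarrow> subalgebra M (F t)"
    and sets_mono: "0 \<le> s \<Longrightarrow> s \<le> t \<Longrightarrow> t \<le> T \<Longrightarrow> sets (F s) \<subseteq> sets (F t)"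
    and null_F0: "null_sets M \<subseteq> sets (F 0)"
    and right_cont: "t \<in> {0..<T} \<Longrightarrow> sets (F t) = (\<Inter>s\<in>{t<..T}. sets (F s))"

definition adapted_process :: "(real \<Rightarrow> 'a measure) \<Rightarrow> real \<Rightarrow> ('a \<Rightarrow> path) \<Rightarrow> bool" where
  "adapted_process F T X \<longleftrightarrow> (\<forall>t\<in>{0..T}. (\<lambda>\<omega>. X \<omega> t) \<in> borel_measurable (F t))"

definition cadlag_adapted ::
    "'a measure \<Rightarrow> (real \<Rightarrow> 'a measure) \<Rightarrow> real \<Rightarrow> ('a \<Rightarrow> path) \<Rightarrow> bool" where
  "cadlag_adapted M F T X \<longleftrightarrow> (\<forall>\<omega>\<in>space M. X \<omega> \<in> cadlag T) \<and> adapted_process F T X"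

definition stop_time ::
    "'a measure \<Rightarrow> (real \<Rightarrow> 'a measure) \<Rightarrow> real \<Rightarrow> ('a \<Rightarrow> real) \<Rightarrow> bool" where
  "stop_time M F T \<tau> \<longleftrightarrow> (\<forall>\<omega>\<in>space M. \<tau> \<omega> \<in> {0..T}) \<and>
     (\<forall>t\<in>{0..T}. {\<omega>\<in>space M. \<tau> \<omega> \<le> t} \<in> sets (F t))"

text \<open>Measurability with respect to the \<open>\<sigma>\<close>-algebra of events prior to \<open>\<tau>\<close>.\<close>

definition stop_time_measurable ::
    "'a measure \<Rightarrow> (real \<Rightarrow> 'a measure) \<Rightarrow> real \<Rightarrow> ('a \<Rightarrow> real) \<Rightarrow> ('a \<Rightarrow> real) \<Rightarrow> bool" where
  "stop_time_measurable M F T \<tau> \<xi> \<longleftrightarrow>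
     (\<forall>E\<in>sets borel. \<forall>t\<in>{0..T}. {\<omega>\<in>space M. \<xi> \<omega> \<in> E \<and> \<tau> \<omega> \<le> t} \<in> sets (F t))"

definition is_martingale ::
    "'a measure \<Rightarrow> (real \<Rightarrow> 'a measure) \<Rightarrow> real \<Rightarrow> ('a \<Rightarrow> path) \<Rightarrow> bool" where
  "is_martingale M F T N \<longleftrightarrow> adapted_process F T N \<and>
     (\<forall>t\<in>{0..T}. integrable M (\<lambda>\<omega>. N \<omega> t)) \<and>
     (\<forall>s\<in>{0..T}. \<forall>t\<in>{s..T}. AE \<omega> in M. real_cond_exp M (F s) (\<lambda>\<omega>. N \<omega> t) \<omega> = N \<omega> s)"

text \<open>Stopping times are truncated at the horizon \<open>T\<close>, so a localizing sequence is one that is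
  almost surely eventually equal to \<open>T\<close>.\<close>

definition is_local_martingale ::
    "'a measure \<Rightarrow> (real \<Rightarrow> 'a measure) \<Rightarrow> real \<Rightarrow> ('a \<Rightarrow> path) \<Rightarrow> bool" where
  "is_local_martingale M F T N \<longleftrightarrow> cadlag_adapted M F T N \<and>
     (\<exists>\<tau>. (\<forall>n. stop_time M F T (\<tau> n)) \<and>
          (AE \<omega> in M. incseq (\<lambda>n. \<tau> n \<omega>) \<and> (\<forall>\<^sub>F n in sequentially. \<tau> n \<omega> = T)) \<and>
          (\<forall>n. is_martingale M F T (\<lambda>\<omega>. stop_path T (\<tau> n \<omega>) (N \<omega>))))"

definition finite_variation :: "real \<Rightarrow> path \<Rightarrow> bool" where
  "finite_variation T a \<longleftrightarrow> (\<exists>c. \<forall>n. \<forall>s::nat \<Rightarrow> real. mono s \<and> range s \<subseteq> {0..T} \<longrightarrow>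
     (\<Sum>i<n. \<bar>a (s (Suc i)) - a (s i)\<bar>) \<le> c)"

definition semimartingale ::
    "'a measure \<Rightarrow> (real \<Rightarrow> 'a measure) \<Rightarrow> real \<Rightarrow> ('a \<Rightarrow> path) \<Rightarrow> bool" where
  "semimartingale M F T X \<longleftrightarrow> cadlag_adapted M F T X \<and>
     (\<exists>N A. is_local_martingale M F T N \<and> cadlag_adapted M F T A \<and>
        (\<forall>\<omega>\<in>space M. N \<omega> 0 = 0 \<and> A \<omega> 0 = 0 \<and> finite_variation T (A \<omega>)) \<and>
        (AE \<omega> in M. \<forall>t\<in>{0..T}. X \<omega> t = X \<omega> 0 + N \<omega> t + A \<omega> t))"

text \<open>Simple predictable processes \<open>\<Sum>i<n. \<xi>\<^sub>i 1\<^bsub>(\<tau>\<^sub>i,\<tau>\<^sub>i\<^sub>+\<^sub>1]\<^esub>\<close> and their elementary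
  integrals.  No mass is placed at time \<open>0\<close>: the integrals considered are over \<open>(0,t]\<close>.\<close>

definition simple_predictable :: "'a measure \<Rightarrow> (real \<Rightarrow> 'a measure) \<Rightarrow> real \<Rightarrow>
    nat \<Rightarrow> (nat \<Rightarrow> 'a \<Rightarrow> real) \<Rightarrow> (nat \<Rightarrow> 'a \<Rightarrow> real) \<Rightarrow> bool" where
  "simple_predictable M F T n \<tau> \<xi> \<longleftrightarrow>
     (\<forall>i\<le>n. stop_time M F T (\<tau> i)) \<and>
     (\<forall>i<n. \<forall>\<omega>\<in>space M. \<tau> i \<omega> \<le> \<tau> (Suc i) \<omega>) \<and>
     (\<forall>i<n. stop_time_measurable M F T (\<tau> i) (\<xi> i))"

definition simple_value ::
    "nat \<Rightarrow> (nat \<Rightarrow> 'a \<Rightarrow> real) \<Rightarrow> (nat \<Rightarrow> 'a \<Rightarrow> real) \<Rightarrow> 'a \<Rightarrow> path" where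
  "simple_value n \<tau> \<xi> \<omega> t = (\<Sum>i<n. \<xi> i \<omega> * indicator {\<tau> i \<omega><..\<tau> (Suc i) \<omega>} t)"

definition simple_integral ::
    "nat \<Rightarrow> (nat \<Rightarrow> 'a \<Rightarrow> real) \<Rightarrow> (nat \<Rightarrow> 'a \<Rightarrow> real) \<Rightarrow> ('a \<Rightarrow> path) \<Rightarrow> 'a \<Rightarrow> path" where
  "simple_integral n \<tau> \<xi> H \<omega> t =
     (\<Sum>i<n. \<xi> i \<omega> * (H \<omega> (min (\<tau> (Suc i) \<omega>) t) - H \<omega> (min (\<tau> i \<omega>) t)))"

definition ucp_tendsto ::
    "'a measure \<Rightarrow> real set \<Rightarrow> (nat \<Rightarrow> 'a \<Rightarrow> path) \<Rightarrow> ('a \<Rightarrow> path) \<Rightarrow> bool" where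
  "ucp_tendsto M J Y Z \<longleftrightarrow> (\<forall>e>0.
     (\<lambda>k. measure M {\<omega>\<in>space M. \<exists>t\<in>J. \<bar>Y k \<omega> t - Z \<omega> t\<bar> > e}) \<longlonglongrightarrow> 0)"

text \<open>\<open>Y\<close> is (a cadlag version of) \<open>\<integral>\<^sub>0\<^sup>\<cdot> G(s-) dH(s)\<close>, for a cadlag adapted process \<open>G\<close> and a
  semimartingale \<open>H\<close>, where the Ito integral is the ucp-continuous extension of the elementary
  integral from simple predictable to left-continuous adapted integrands.\<close>

definition ito_integral1 :: "'a measure \<Rightarrow> (real \<Rightarrow> 'a measure) \<Rightarrow> real \<Rightarrow>
    ('a \<Rightarrow> path) \<Rightarrow> ('a \<Rightarrow> path) \<Rightarrow> ('a \<Rightarrow> path) \<Rightarrow> bool" where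
  "ito_integral1 M F T G H Y \<longleftrightarrow> cadlag_adapted M F T Y \<and>
     (\<forall>n \<tau> \<xi>. (\<forall>k. simple_predictable M F T (n k) (\<tau> k) (\<xi> k)) \<and>
        ucp_tendsto M {0<..T} (\<lambda>k. simple_value (n k) (\<tau> k) (\<xi> k))
          (\<lambda>\<omega> t. Lim (at_left t) (G \<omega>)) \<longrightarrow>
        ucp_tendsto M {0..T} (\<lambda>k. simple_integral (n k) (\<tau> k) (\<xi> k) H) Y)"

text \<open>\<open>\<real>\<^sup>m\<close>-valued processes have coordinates indexed by \<open>{..<m}\<close>; the integral of a vector
  integrand against a vector semimartingale is the sum of the coordinate integrals.\<close>

definition ito_integral :: "'a measure \<Rightarrow> (real \<Rightarrow> 'a measure) \<Rightarrow> real \<Rightarrow> nat \<Rightarrow>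
    ('a \<Rightarrow> nat \<Rightarrow> path) \<Rightarrow> ('a \<Rightarrow> nat \<Rightarrow> path) \<Rightarrow> ('a \<Rightarrow> path) \<Rightarrow> bool" where
  "ito_integral M F T m G H Y \<longleftrightarrow>
     (\<exists>Z. (\<forall>k<m. ito_integral1 M F T (\<lambda>\<omega>. G \<omega> k) (\<lambda>\<omega>. H \<omega> k) (Z k)) \<and>
          (AE \<omega> in M. \<forall>t\<in>{0..T}. Y \<omega> t = (\<Sum>k<m. Z k \<omega> t)))"

definition cadlag_adapted_vec ::
    "'a measure \<Rightarrow> (real \<Rightarrow> 'a measure) \<Rightarrow> real \<Rightarrow> nat \<Rightarrow> ('a \<Rightarrow> nat \<Rightarrow> path) \<Rightarrow> bool" where
  "cadlag_adapted_vec M F T m G \<longleftrightarrow> (\<forall>\<omega>\<in>space M. G \<omega> \<in> cadlag_fam T {..<m}) \<and>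
     (\<forall>k<m. cadlag_adapted M F T (\<lambda>\<omega>. G \<omega> k))"

definition semimartingale_vec ::
    "'a measure \<Rightarrow> (real \<Rightarrow> 'a measure) \<Rightarrow> real \<Rightarrow> nat \<Rightarrow> ('a \<Rightarrow> nat \<Rightarrow> path) \<Rightarrow> bool" where
  "semimartingale_vec M F T m H \<longleftrightarrow> (\<forall>\<omega>\<in>space M. H \<omega> \<in> cadlag_fam T {..<m}) \<and>
     (\<forall>k<m. semimartingale M F T (\<lambda>\<omega>. H \<omega> k))"

text \<open>The pathwise integral map.  Adaptedness is required almost surely along the processes at
  which the map represents the integral, not at every pair of cadlag paths.  The latter cannot be
  met together with the last clause when \<open>m > 0\<close>: take continuous \<open>x\<close>, \<open>y\<close> with \<open>y\<close> of finite
  variation on each \<open>[0,t]\<close>, \<open>t < u \<le> T\<close>, such that \<open>\<integral>\<^sub>0\<^sup>t x dy\<close> has no limit as \<open>t \<up> u\<close>.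
  The paths stopped at \<open>t\<close> are admissible deterministic processes, so everywhere-adaptedness would
  force \<open>\<Psi> (x, y) t = \<integral>\<^sub>0\<^sup>t x dy\<close> for \<open>t < u\<close>, which is not cadlag.\<close>

definition ito_map :: "'a measure \<Rightarrow> (real \<Rightarrow> 'a measure) \<Rightarrow> real \<Rightarrow>
    (nat \<Rightarrow> (nat \<Rightarrow> path) \<times> (nat \<Rightarrow> path) \<Rightarrow> path) \<Rightarrow> bool" where
  "ito_map M F T \<Psi> \<longleftrightarrow> (\<forall>m.
     \<Psi> m \<in> D_fam T {..<m} \<Otimes>\<^sub>M D_fam T {..<m} \<rightarrow>\<^sub>M D_real T \<and>
     (\<forall>G H. cadlag_adapted_vec M F T m G \<and> semimartingale_vec M F T m H \<longrightarrow>
        (\<forall>t\<in>{0..T}. AE \<omega> in M. \<Psi> m (G \<omega>, H \<omega>) t =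
           \<Psi> m (stop_fam T {..<m} t (G \<omega>), stop_fam T {..<m} t (H \<omega>)) t) \<and>
        ito_integral M F T m G H (\<lambda>\<omega>. \<Psi> m (G \<omega>, H \<omega>))))"

section \<open>Systems of causal SDEs\<close>

record ('n, 'a) causal_sde =
  endo :: "'n set"
  exo :: "'n set"
  noise :: "'n \<Rightarrow> 'a \<Rightarrow> path"
  args_f :: "'n \<Rightarrow> 'n set"
  args_g :: "'n \<Rightarrow> 'n set"
  args_h :: "'n \<Rightarrow> 'n set"
  dim :: "'n \<Rightarrow> nat"
  coeff_f :: "'n \<Rightarrow> real \<Rightarrow> ('n \<Rightarrow> path) \<Rightarrow> real"
  coeff_g :: "'n \<Rightarrow> real \<Rightarrow> ('n \<Rightarrow> path) \<Rightarrow> nat \<Rightarrow> real"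
  coeff_h :: "'n \<Rightarrow> real \<Rightarrow> ('n \<Rightarrow> path) \<Rightarrow> nat \<Rightarrow> real"

text \<open>\<open>args_f\<close>, \<open>args_g\<close>, \<open>args_h\<close> are \<open>\<alpha>\<close>, \<open>\<beta>\<close>, \<open>\<gamma>\<close>.  The argument \<open>(X\<^sub>v, X\<^bsub>\<beta>(v)\<^esub>)\<close> of \<open>g\<^sub>v\<close> is a
  family indexed by \<open>insert v (args_g D v)\<close>.\<close>

definition noise_path :: "('n, 'a) causal_sde \<Rightarrow> 'a \<Rightarrow> 'n \<Rightarrow> path" where
  "noise_path D \<omega> = (\<lambda>w\<in>exo D. noise D w \<omega>)"

definition f_path :: "real \<Rightarrow> ('n, 'a) causal_sde \<Rightarrow> 'n \<Rightarrow> ('n \<Rightarrow> path) \<Rightarrow> path" where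
  "f_path T D v x = (\<lambda>t\<in>{0..T}. coeff_f D v t (restrict x (args_f D v)))"

definition g_path :: "real \<Rightarrow> ('n, 'a) causal_sde \<Rightarrow> 'n \<Rightarrow> ('n \<Rightarrow> path) \<Rightarrow> nat \<Rightarrow> path" where
  "g_path T D v x =
     (\<lambda>k\<in>{..<dim D v}. \<lambda>t\<in>{0..T}. coeff_g D v t (restrict x (insert v (args_g D v))) k)"

definition h_path :: "real \<Rightarrow> ('n, 'a) causal_sde \<Rightarrow> 'n \<Rightarrow> ('n \<Rightarrow> path) \<Rightarrow> nat \<Rightarrow> path" where
  "h_path T D v x =
     (\<lambda>k\<in>{..<dim D v}. \<lambda>t\<in>{0..T}. coeff_h D v t (restrict x (args_h D v)) k)"

definition causal_sde_system ::
    "'a measure \<Rightarrow> (real \<Rightarrow> 'a measure) \<Rightarrow> real \<Rightarrow> ('n, 'a) causal_sde \<Rightarrow> bool" where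
  "causal_sde_system M F T D \<longleftrightarrow>
     finite (endo D) \<and> finite (exo D) \<and> endo D \<inter> exo D = {} \<and>
     (\<forall>w\<in>exo D. semimartingale M F T (noise D w)) \<and>
     prob_space.indep_vars M (\<lambda>_. D_real T) (noise D) (exo D) \<and>
     (\<forall>v\<in>endo D.
        args_f D v \<subseteq> endo D \<union> exo D \<and>
        args_g D v \<subseteq> (endo D \<union> exo D) - {v} \<and>
        args_h D v \<subseteq> exo D \<and>
        meas_cadlag_adapted T (args_f D v) (coeff_f D v) \<and>
        (\<forall>k<dim D v.
           meas_cadlag_adapted T (insert v (args_g D v)) (\<lambda>t x. coeff_g D v t x k) \<and>
           meas_cadlag_adapted T (args_h D v) (\<lambda>t x. coeff_h D v t x k)) \<and>
        semimartingale_vec M F T (dim D v) (\<lambda>\<omega>. h_path T D v (noise_path D \<omega>)))"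

definition sde_map :: "real \<Rightarrow> (nat \<Rightarrow> (nat \<Rightarrow> path) \<times> (nat \<Rightarrow> path) \<Rightarrow> path) \<Rightarrow>
    ('n, 'a) causal_sde \<Rightarrow> 'n \<Rightarrow> ('n \<Rightarrow> path) \<times> ('n \<Rightarrow> path) \<Rightarrow> path" where
  "sde_map T \<Psi> D v xx = (let x = merge (endo D) (exo D) xx in
     (\<lambda>t\<in>{0..T}. f_path T D v x t + \<Psi> (dim D v) (g_path T D v x, h_path T D v x) t))"

definition essential_solution_map :: "'a measure \<Rightarrow> real \<Rightarrow>
    (nat \<Rightarrow> (nat \<Rightarrow> path) \<times> (nat \<Rightarrow> path) \<Rightarrow> path) \<Rightarrow> ('n, 'a) causal_sde \<Rightarrow> 'n set \<Rightarrow>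
    (('n \<Rightarrow> path) \<times> ('n \<Rightarrow> path) \<Rightarrow> 'n \<Rightarrow> path) \<Rightarrow> bool" where
  "essential_solution_map M T \<Psi> D U I \<longleftrightarrow>
     (let S = endo D - U; W = exo D; XW = noise_path D;
          solves = (\<lambda>xU xS xW. \<forall>v\<in>U. xU v = sde_map T \<Psi> D v (merge U S (xU, xS), xW))
      in meas_adapted_map2 T S W U I \<and>
         (\<forall>\<phi>S. meas_adapted_map T W S \<phi>S \<longrightarrow>
            (AE \<omega> in M. solves (I (\<phi>S (XW \<omega>), XW \<omega>)) (\<phi>S (XW \<omega>)) (XW \<omega>)) \<and>
            (\<forall>\<phi>U. meas_adapted_map T W U \<phi>U \<and>
               (AE \<omega> in M. solves (\<phi>U (XW \<omega>)) (\<phi>S (XW \<omega>)) (XW \<omega>)) \<longrightarrow>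
               (AE \<omega> in M. \<phi>U (XW \<omega>) = I (\<phi>S (XW \<omega>), XW \<omega>)))))"

definition ess_uniquely_solvable :: "'a measure \<Rightarrow> real \<Rightarrow>
    (nat \<Rightarrow> (nat \<Rightarrow> path) \<times> (nat \<Rightarrow> path) \<Rightarrow> path) \<Rightarrow> ('n, 'a) causal_sde \<Rightarrow> 'n set \<Rightarrow> bool" where
  "ess_uniquely_solvable M T \<Psi> D U \<longleftrightarrow> (\<exists>I. essential_solution_map M T \<Psi> D U I)"

text \<open>Strong solutions of the system in which the equation of each \<open>v \<in> B\<close> is replaced by
  \<open>X\<^sub>v = x\<^sub>v\<close>; \<open>B = {}\<close> gives the solutions of the system itself.\<close>

definition do_solution :: "'a measure \<Rightarrow> real \<Rightarrow>
    (nat \<Rightarrow> (nat \<Rightarrow> path) \<times> (nat \<Rightarrow> path) \<Rightarrow> path) \<Rightarrow> ('n, 'a) causal_sde \<Rightarrow> 'n set \<Rightarrow>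
    ('n \<Rightarrow> path) \<Rightarrow> (('n \<Rightarrow> path) \<Rightarrow> 'n \<Rightarrow> path) \<Rightarrow> bool" where
  "do_solution M T \<Psi> D B xB \<phi> \<longleftrightarrow> meas_adapted_map T (exo D) (endo D) \<phi> \<and>
     (AE \<omega> in M. \<forall>v\<in>endo D. \<phi> (noise_path D \<omega>) v =
        (if v \<in> B then xB v else sde_map T \<Psi> D v (\<phi> (noise_path D \<omega>), noise_path D \<omega>)))"

abbreviation solution :: "'a measure \<Rightarrow> real \<Rightarrow>
    (nat \<Rightarrow> (nat \<Rightarrow> path) \<times> (nat \<Rightarrow> path) \<Rightarrow> path) \<Rightarrow> ('n, 'a) causal_sde \<Rightarrow>
    (('n \<Rightarrow> path) \<Rightarrow> 'n \<Rightarrow> path) \<Rightarrow> bool" where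
  "solution M T \<Psi> D \<equiv> do_solution M T \<Psi> D {} (\<lambda>_. undefined)"

text \<open>The two laws below are used only for systems that are essentially uniquely solvable with
  respect to \<open>endo D\<close> and \<open>endo D - B\<close>; then a solution exists and any two agree almost surely, so
  that the law does not depend on the one chosen.\<close>

definition obs_dist :: "'a measure \<Rightarrow> real \<Rightarrow>
    (nat \<Rightarrow> (nat \<Rightarrow> path) \<times> (nat \<Rightarrow> path) \<Rightarrow> path) \<Rightarrow> ('n, 'a) causal_sde \<Rightarrow>
    ('n \<Rightarrow> path) measure" where
  "obs_dist M T \<Psi> D = distr M (path_space T (endo D))
     (\<lambda>\<omega>. (SOME \<phi>. solution M T \<Psi> D \<phi>) (noise_path D \<omega>))"

definition do_dist :: "'a measure \<Rightarrow> real \<Rightarrow>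
    (nat \<Rightarrow> (nat \<Rightarrow> path) \<times> (nat \<Rightarrow> path) \<Rightarrow> path) \<Rightarrow> ('n, 'a) causal_sde \<Rightarrow> 'n set \<Rightarrow>
    ('n \<Rightarrow> path) \<Rightarrow> ('n \<Rightarrow> path) measure" where
  "do_dist M T \<Psi> D B xB = distr M (path_space T (endo D - B))
     (\<lambda>\<omega>. restrict ((SOME \<phi>. do_solution M T \<Psi> D B xB \<phi>) (noise_path D \<omega>)) (endo D - B))"

section \<open>Marginals and conditional distributions\<close>

definition marginal :: "real \<Rightarrow> ('n \<Rightarrow> path) measure \<Rightarrow> 'n set \<Rightarrow> ('n \<Rightarrow> path) measure" where
  "marginal T \<mu> A = distr \<mu> (path_space T A) (\<lambda>x. restrict x A)"

definition marginal2 :: "real \<Rightarrow> ('n \<Rightarrow> path) measure \<Rightarrow> 'n set \<Rightarrow> 'n set \<Rightarrow>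
    (('n \<Rightarrow> path) \<times> ('n \<Rightarrow> path)) measure" where
  "marginal2 T \<mu> B C = distr \<mu> (path_space T B \<Otimes>\<^sub>M path_space T C) (\<lambda>x. (restrict x B, restrict x C))"

text \<open>\<open>\<kappa>\<close> is a (regular) conditional distribution of the random variable \<open>Y\<close> given \<open>Z\<close> under \<open>\<mu>\<close>.\<close>

definition cond_dist :: "'o measure \<Rightarrow> 'y measure \<Rightarrow> ('o \<Rightarrow> 'y) \<Rightarrow> 'z measure \<Rightarrow> ('o \<Rightarrow> 'z) \<Rightarrow>
    ('z \<Rightarrow> 'y measure) \<Rightarrow> bool" where
  "cond_dist \<mu> NY Y NZ Z \<kappa> \<longleftrightarrow> \<kappa> \<in> NZ \<rightarrow>\<^sub>M prob_algebra NY \<and>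
     (\<forall>E\<in>sets NY. \<forall>G\<in>sets NZ. emeasure \<mu> {\<omega>\<in>space \<mu>. Y \<omega> \<in> E \<and> Z \<omega> \<in> G} =
        (\<integral>\<^sup>+z\<in>G. emeasure (\<kappa> z) E \<partial>(distr \<mu> NZ Z)))"

definition path_cond_dist :: "real \<Rightarrow> ('n \<Rightarrow> path) measure \<Rightarrow> 'n set \<Rightarrow> 'n set \<Rightarrow>
    (('n \<Rightarrow> path) \<Rightarrow> ('n \<Rightarrow> path) measure) \<Rightarrow> bool" where
  "path_cond_dist T \<mu> A C \<kappa> \<longleftrightarrow>
     cond_dist \<mu> (path_space T A) (\<lambda>x. restrict x A) (path_space T C) (\<lambda>x. restrict x C) \<kappa>"

definition path_cond_dist2 :: "real \<Rightarrow> ('n \<Rightarrow> path) measure \<Rightarrow> 'n set \<Rightarrow> 'n set \<Rightarrow> 'n set \<Rightarrow>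
    (('n \<Rightarrow> path) \<times> ('n \<Rightarrow> path) \<Rightarrow> ('n \<Rightarrow> path) measure) \<Rightarrow> bool" where
  "path_cond_dist2 T \<mu> A B C \<kappa> \<longleftrightarrow>
     cond_dist \<mu> (path_space T A) (\<lambda>x. restrict x A)
       (path_space T B \<Otimes>\<^sub>M path_space T C) (\<lambda>x. (restrict x B, restrict x C)) \<kappa>"

text \<open>\<open>\<bbbP>(X\<^sub>A | do(X\<^sub>B), X\<^sub>C)\<close> as a Markov kernel in \<open>(x\<^sub>B, x\<^sub>C)\<close>.\<close>

definition do_cond_kernel :: "'a measure \<Rightarrow> real \<Rightarrow>
    (nat \<Rightarrow> (nat \<Rightarrow> path) \<times> (nat \<Rightarrow> path) \<Rightarrow> path) \<Rightarrow> ('n, 'a) causal_sde \<Rightarrow>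
    'n set \<Rightarrow> 'n set \<Rightarrow> 'n set \<Rightarrow>
    (('n \<Rightarrow> path) \<times> ('n \<Rightarrow> path) \<Rightarrow> ('n \<Rightarrow> path) measure) \<Rightarrow> bool" where
  "do_cond_kernel M T \<Psi> D A B C \<kappa> \<longleftrightarrow>
     \<kappa> \<in> path_space T B \<Otimes>\<^sub>M path_space T C \<rightarrow>\<^sub>M prob_algebra (path_space T A) \<and>
     (\<forall>xB\<in>cadlag_fam T B. path_cond_dist T (do_dist M T \<Psi> D B xB) A C (\<lambda>xC. \<kappa> (xB, xC)))"

section \<open>Directed mixed graphs and sigma-separation\<close>

record 'v mixed_graph =
  verts :: "'v set"
  dir_edges :: "('v \<times> 'v) set"
  bidir_edges :: "('v \<times> 'v) set"

definition anc :: "'v mixed_graph \<Rightarrow> 'v set \<Rightarrow> 'v set" where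
  "anc G C = {u. \<exists>c\<in>C. (u, c) \<in> (dir_edges G)\<^sup>*}"

definition same_scc :: "'v mixed_graph \<Rightarrow> 'v \<Rightarrow> 'v \<Rightarrow> bool" where
  "same_scc G u v \<longleftrightarrow> (u, v) \<in> (dir_edges G)\<^sup>* \<and> (v, u) \<in> (dir_edges G)\<^sup>*"

datatype walk_edge = Forward | Backward | Bidirected

text \<open>The walk with nodes \<open>vs\<close> has the edge of kind \<open>es ! i\<close> between \<open>vs ! i\<close> and \<open>vs ! Suc i\<close>.
  Recording the kind distinguishes parallel edges.\<close>

definition walk :: "'v mixed_graph \<Rightarrow> 'v list \<Rightarrow> walk_edge list \<Rightarrow> bool" where
  "walk G vs es \<longleftrightarrow> length vs = Suc (length es) \<and> set vs \<subseteq> verts G \<and>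
     (\<forall>i<length es. case es ! i of
        Forward \<Rightarrow> (vs ! i, vs ! Suc i) \<in> dir_edges G
      | Backward \<Rightarrow> (vs ! Suc i, vs ! i) \<in> dir_edges G
      | Bidirected \<Rightarrow> (vs ! i, vs ! Suc i) \<in> bidir_edges G)"

text \<open>For \<open>collider\<close> and \<open>blockable\<close>, \<open>i\<close> is an inner position: \<open>0 < i < length es\<close>.\<close>

definition collider :: "walk_edge list \<Rightarrow> nat \<Rightarrow> bool" where
  "collider es i \<longleftrightarrow> es ! (i - 1) \<in> {Forward, Bidirected} \<and> es ! i \<in> {Backward, Bidirected}"

definition blockable :: "'v mixed_graph \<Rightarrow> 'v list \<Rightarrow> walk_edge list \<Rightarrow> nat \<Rightarrow> bool" where
  "blockable G vs es i \<longleftrightarrow> \<not> collider es i \<and>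
     (es ! (i - 1) = Backward \<and> \<not> same_scc G (vs ! i) (vs ! (i - 1)) \<or>
      es ! i = Forward \<and> \<not> same_scc G (vs ! i) (vs ! Suc i))"

definition sigma_blocked ::
    "'v mixed_graph \<Rightarrow> 'v list \<Rightarrow> walk_edge list \<Rightarrow> 'v set \<Rightarrow> bool" where
  "sigma_blocked G vs es C \<longleftrightarrow> hd vs \<in> C \<or> last vs \<in> C \<or>
     (\<exists>i. 0 < i \<and> i < length es \<and>
        (blockable G vs es i \<and> vs ! i \<in> C \<or> collider es i \<and> vs ! i \<notin> anc G C))"

definition sigma_separated :: "'v mixed_graph \<Rightarrow> 'v set \<Rightarrow> 'v set \<Rightarrow> 'v set \<Rightarrow> bool" where
  "sigma_separated G A B C \<longleftrightarrow>
     (\<forall>vs es. walk G vs es \<and> hd vs \<in> A \<and> last vs \<in> B \<longrightarrow> sigma_blocked G vs es C)"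

section \<open>The causal graph\<close>

text \<open>Edges of \<open>G\<^sup>+(D)\<close>; non-constancy is meant at the level of the coefficient functions.\<close>

definition nonconst_in :: "real \<Rightarrow> 'n set \<Rightarrow> 'n \<Rightarrow> (real \<Rightarrow> ('n \<Rightarrow> path) \<Rightarrow> 'r) \<Rightarrow> bool" where
  "nonconst_in T A u f \<longleftrightarrow> (\<exists>t\<in>{0..T}. \<exists>x\<in>cadlag_fam T A. \<exists>y\<in>cadlag_fam T A.
     (\<forall>a\<in>A - {u}. x a = y a) \<and> f t x \<noteq> f t y)"

definition aug_edges :: "real \<Rightarrow> ('n, 'a) causal_sde \<Rightarrow> ('n \<times> 'n) set" where
  "aug_edges T D = {(u, v). v \<in> endo D \<and>
     (u \<in> args_f D v \<and> nonconst_in T (args_f D v) u (coeff_f D v) \<or>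
      u \<in> insert v (args_g D v) \<and>
        (\<exists>k<dim D v. nonconst_in T (insert v (args_g D v)) u (\<lambda>t x. coeff_g D v t x k)) \<or>
      u \<in> args_h D v \<and>
        (\<exists>k<dim D v. nonconst_in T (args_h D v) u (\<lambda>t x. coeff_h D v t x k)))}"

definition causal_graph :: "real \<Rightarrow> ('n, 'a) causal_sde \<Rightarrow> 'n mixed_graph" where
  "causal_graph T D = \<lparr>verts = endo D,
     dir_edges = {(u, v) \<in> aug_edges T D. u \<in> endo D \<and> v \<in> endo D},
     bidir_edges = {(i, j). i \<in> endo D \<and> j \<in> endo D \<and> i \<noteq> j \<and>
       (\<exists>k\<in>exo D. (k, i) \<in> aug_edges T D \<and> (k, j) \<in> aug_edges T D)}\<rparr>"

text \<open>In the graph with regime nodes, \<open>Inl v\<close> is the original vertex \<open>v\<close> and \<open>Inr v\<close> is \<open>R\<^sub>v\<close>.\<close>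

definition do_graph :: "'v mixed_graph \<Rightarrow> 'v set \<Rightarrow> ('v + 'v) mixed_graph" where
  "do_graph G B = \<lparr>verts = Inl ` verts G \<union> Inr ` B,
     dir_edges = map_prod Inl Inl ` dir_edges G \<union> (\<lambda>v. (Inr v, Inl v)) ` B,
     bidir_edges = map_prod Inl Inl ` bidir_edges G\<rparr>"

end

theory Submission
  imports Defs
begin

text \<open>
  To prove the second and third rule, a fair coin decides between the observational and the
  interventional regime and, independently, a law for \<open>x\<^sub>B\<close> is fixed; the rules then say that
  \<open>X\<^sub>A\<close> is conditionally independent of the regime, so that all three rules follow from the same
  argument.  \<open>\<sigma>\<close>-separation divides an ancestral set into two unions of strongly connected components
  that use disjoint, hence independent, noises and whose parents on the other side lie in \<open>C\<close>.  By
  essential unique solvability every component is almost surely a measurable function of its parents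
  and its own noise (irrelevant noises are replaced by a generic realisation, by Fubini).  Hence the
  independence of the two blocks of noises given the observed paths propagates from component to
  component along a topological order.  Measurability of these functions is reduced to evaluations:
  the Borel \<open>\<sigma>\<close>-algebra of the \<open>J\<^sub>1\<close> topology is generated by them, as one sees by discretising paths.
\<close>


section \<open>Measurability on the Skorokhod space\<close>

text \<open>Solvability constrains a block of equations only for inputs that are adapted maps of the
  noise, and only almost surely. A block can therefore not be solved pointwise in its parents: every
  substitution, of a constant path for a non-parent or of a frozen realisation for foreign noises,
  has to be an adapted map again before uniqueness applies. On a cycle no node is a function of
  nodes treated earlier, which makes strongly connected components the units of the induction. The
  coefficients are measurable for the joint Borel algebra \<open>D_fam\<close>, whereas solution
  maps live on products of \<open>D_real\<close>; generation by evaluations makes the two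
  compatible. The law of \<open>x_B\<close> is a parameter of the mixture: the law of
  \<open>X_B\<close> for the second rule, which speaks of almost all \<open>x_B\<close>, and the
  point mass at the given \<open>x_B\<close> for the third, which claims every \<open>x_B\<close>.
  For the first rule the set of intervened nodes is empty. The version of the conditional law shared
  by both regimes is determined only up to null sets of each; absolute continuity carries the
  interventional null sets over to the observational law.\<close>

lemma cadlag_right: "x \<in> cadlag T \<Longrightarrow> 0 \<le> t \<Longrightarrow> t < T \<Longrightarrow> (x \<longlongrightarrow> x t) (at_right t)"
  by (simp add: cadlag_def)

lemma cadlag_left: "x \<in> cadlag T \<Longrightarrow> 0 < t \<Longrightarrow> t \<le> T \<Longrightarrow> \<exists>l. (x \<longlongrightarrow> l) (at_left t)"
  by (simp add: cadlag_def)

lemma cadlag_eqI: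
  assumes "x \<in> cadlag T" "y \<in> cadlag T" "\<And>t. t \<in> {0..T} \<Longrightarrow> x t = y t"
  shows "x = y"
  by (rule extensionalityI[of x "{0..T}" y]) (use assms in \<open>auto simp: cadlag_def\<close>)

text \<open>The one-sided limits at \<open>u\<close> confine large oscillation near \<open>u\<close>
  to a jump at \<open>u\<close> itself, and compactness, in the form of bisection, leaves finitely
  many such points. They have to avoid the half-open \<open>{s<..t}\<close> because by right
  continuity a jump at \<open>k\<close> separates \<open>k\<close> only from what precedes
  it.\<close>

lemma cadlag_oscillation1:
  assumes x: "x \<in> cadlag T" and e: "0 < e"
  obtains K where "finite K"
    "\<And>s t. 0 \<le> s \<Longrightarrow> s \<le> t \<Longrightarrow> t \<le> T \<Longrightarrow> K \<inter> {s<..t} = {} \<Longrightarrow> \<bar>x s - x t\<bar> \<le> e"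
proof (cases "0 \<le> T")
  case True
  define P where "P a b \<longleftrightarrow> (\<exists>K. finite K \<and> (\<forall>s t. 0 \<le> s \<and> a \<le> s \<and> s \<le> t \<and> t \<le> b \<and> t \<le> T \<and> K \<inter> {s<..t} = {} \<longrightarrow> \<bar>x s - x t\<bar> \<le> e))" for a b
  have "P 0 T"
  proof (rule Bolzano[of 0 T P])
    fix a b c assume "P a b" "P b c" and le: "a \<le> b" "b \<le> c"
    then obtain K1 K2 where K: "finite K1" "finite K2"
      "\<And>s t. 0 \<le> s \<and> a \<le> s \<and> s \<le> t \<and> t \<le> b \<and> t \<le> T \<and> K1 \<inter> {s<..t} = {} \<Longrightarrow> \<bar>x s - x t\<bar> \<le> e"
      "\<And>s t. 0 \<le> s \<and> b \<le> s \<and> s \<le> t \<and> t \<le> c \<and> t \<le> T \<and> K2 \<inter> {s<..t} = {} \<Longrightarrow> \<bar>x s - x t\<bar> \<le> e"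
      unfolding P_def by metis
    show "P a c" unfolding P_def
    \<comment> \<open>The junction \<open>b\<close> joins the exceptional set, so that an interval
      avoiding this set lies entirely in one of the two halves.\<close>
    proof (intro exI[of _ "insert b (K1 \<union> K2)"] conjI allI impI)
      fix s t assume *: "0 \<le> s \<and> a \<le> s \<and> s \<le> t \<and> t \<le> c \<and> t \<le> T \<and> insert b (K1 \<union> K2) \<inter> {s<..t} = {}"
      then consider "b \<le> s" | "t \<le> b" by force
      then show "\<bar>x s - x t\<bar> \<le> e"
        by cases (use * K(3)[of s t] K(4)[of s t] in blast)+
    qed (use K in auto)
  next
    fix u assume u: "0 \<le> u" "u \<le> T"
    have R: "\<exists>d>0. \<forall>s t. u \<le> s \<and> s \<le> t \<and> t < u + d \<and> t \<le> T \<longrightarrow> \<bar>x s - x t\<bar> \<le> e"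
    proof (cases "u < T")
      case True
      have "\<forall>\<^sub>F s in at_right u. dist (x s) (x u) < e/2"
        using cadlag_right[OF x u(1) True] e by (intro tendstoD) auto
      then obtain v where v: "v > u" "\<And>s. u < s \<Longrightarrow> s < v \<Longrightarrow> dist (x s) (x u) < e/2"
        unfolding eventually_at_right_field by auto
      have *: "\<bar>x s - x u\<bar> < e/2" if "u \<le> s" "s < v" for s
        using v(2)[of s] that e by (cases "s = u") (auto simp: dist_real_def)
      show ?thesis
      proof (intro exI[of _ "v - u"] conjI allI impI)
        fix s t assume "u \<le> s \<and> s \<le> t \<and> t < u + (v - u) \<and> t \<le> T"
        then have "\<bar>x s - x u\<bar> < e/2" "\<bar>x t - x u\<bar> < e/2" using *[of s] *[of t] by auto
        then show "\<bar>x s - x t\<bar> \<le> e" by linarith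
      qed (use v in auto)
    next
      case False
      then have "u = T" using u by simp
      show ?thesis
      proof (intro exI[of _ 1] conjI allI impI)
        fix s t assume "u \<le> s \<and> s \<le> t \<and> t < u + 1 \<and> t \<le> T"
        then have "s = t" using \<open>u = T\<close> by linarith
        then show "\<bar>x s - x t\<bar> \<le> e" using e by simp
      qed simp
    qed
    have L: "\<exists>d>0. \<forall>s t. 0 \<le> s \<and> u - d < s \<and> s \<le> t \<and> t < u \<longrightarrow> \<bar>x s - x t\<bar> \<le> e"
    proof (cases "0 < u")
      case True
      obtain l where l: "(x \<longlongrightarrow> l) (at_left u)" using cadlag_left[OF x True u(2)] by auto
      have "\<forall>\<^sub>F s in at_left u. dist (x s) l < e/2"
        using l e by (intro tendstoD) auto
      then obtain v where v: "v < u" "\<And>s. v < s \<Longrightarrow> s < u \<Longrightarrow> dist (x s) l < e/2"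
        unfolding eventually_at_left_field by auto
      show ?thesis
      proof (intro exI[of _ "u - v"] conjI allI impI)
        fix s t assume "0 \<le> s \<and> u - (u - v) < s \<and> s \<le> t \<and> t < u"
        then have "\<bar>x s - l\<bar> < e/2" "\<bar>x t - l\<bar> < e/2"
          using v(2)[of s] v(2)[of t] by (auto simp: dist_real_def)
        then show "\<bar>x s - x t\<bar> \<le> e" by linarith
      qed (use v in auto)
    next
      case False then show ?thesis by (intro exI[of _ 1]) auto
    qed
    from R L obtain d1 d2 where d: "d1 > 0" "d2 > 0"
      "\<And>s t. u \<le> s \<and> s \<le> t \<and> t < u + d1 \<and> t \<le> T \<Longrightarrow> \<bar>x s - x t\<bar> \<le> e"
      "\<And>s t. 0 \<le> s \<and> u - d2 < s \<and> s \<le> t \<and> t < u \<Longrightarrow> \<bar>x s - x t\<bar> \<le> e" by metis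
    show "\<exists>d>0. \<forall>a b. a \<le> u \<and> u \<le> b \<and> b - a < d \<longrightarrow> P a b"
    proof (intro exI[of _ "min d1 d2"] conjI allI impI)
      fix a b assume ab: "a \<le> u \<and> u \<le> b \<and> b - a < min d1 d2"
      show "P a b" unfolding P_def
      proof (intro exI[of _ "{u}"] conjI allI impI)
        fix s t assume *: "0 \<le> s \<and> a \<le> s \<and> s \<le> t \<and> t \<le> b \<and> t \<le> T \<and> {u} \<inter> {s<..t} = {}"
        then consider "u \<le> s" | "t < u" by force
        then show "\<bar>x s - x t\<bar> \<le> e"
          by cases (use * ab d(3)[of s t] d(4)[of s t] in auto)
      qed simp
    qed (use d in auto)
  qed (use True in auto)
  then show ?thesis using that unfolding P_def by metis
qed (use that[of "{}"] in auto)

lemma cadlag_oscillation: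
  assumes "finite I" "\<And>i. i \<in> I \<Longrightarrow> x i \<in> cadlag T" and e: "0 < e"
  obtains K where "finite K"
    "\<And>s t i. i \<in> I \<Longrightarrow> 0 \<le> s \<Longrightarrow> s \<le> t \<Longrightarrow> t \<le> T \<Longrightarrow> K \<inter> {s<..t} = {} \<Longrightarrow> \<bar>x i s - x i t\<bar> \<le> e"
proof -
  have "\<exists>K. \<forall>i\<in>I. finite (K i) \<and> (\<forall>s t. 0 \<le> s \<longrightarrow> s \<le> t \<longrightarrow> t \<le> T \<longrightarrow> K i \<inter> {s<..t} = {} \<longrightarrow> \<bar>x i s - x i t\<bar> \<le> e)"
    by (rule bchoice) (metis assms(2) e cadlag_oscillation1)
  then obtain K where K: "\<And>i. i \<in> I \<Longrightarrow> finite (K i)"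
    "\<And>i s t. i \<in> I \<Longrightarrow> 0 \<le> s \<Longrightarrow> s \<le> t \<Longrightarrow> t \<le> T \<Longrightarrow> K i \<inter> {s<..t} = {} \<Longrightarrow> \<bar>x i s - x i t\<bar> \<le> e" by metis
  show ?thesis
  proof (rule that[of "\<Union>(K ` I)"])
    show "finite (\<Union>(K ` I))" using assms(1) K(1) by blast
    fix s t i assume *: "i \<in> I" "0 \<le> s" "s \<le> t" "t \<le> T" "\<Union>(K ` I) \<inter> {s<..t} = {}"
    then have "K i \<inter> {s<..t} = {}" by blast
    with * show "\<bar>x i s - x i t\<bar> \<le> e" by (intro K(2))
  qed
qed

text \<open>Every value is within 1 of the value at the last point of \<open>K\<close> or at 0 that
  precedes it, so finitely many values control the paths.\<close>

lemma cadlag_bounded: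
  assumes "finite I" "\<And>i. i \<in> I \<Longrightarrow> x i \<in> cadlag T"
  obtains B where "\<And>i t. i \<in> I \<Longrightarrow> t \<in> {0..T} \<Longrightarrow> \<bar>x i t\<bar> \<le> B"
proof -
  obtain K where K: "finite K" "\<And>s t i. i \<in> I \<Longrightarrow> 0 \<le> s \<Longrightarrow> s \<le> t \<Longrightarrow> t \<le> T \<Longrightarrow> K \<inter> {s<..t} = {} \<Longrightarrow> \<bar>x i s - x i t\<bar> \<le> 1"
    using cadlag_oscillation[of I x T 1] assms by (metis zero_less_one)
  define B where "B = (\<Sum>i\<in>I. \<Sum>k\<in>insert 0 K. \<bar>x i k\<bar>) + 1"
  show ?thesis
  proof (rule that[of B])
    fix i t assume i: "i \<in> I" and t: "t \<in> {0..T}"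
    define k where "k = Max (insert 0 K \<inter> {0..t})"
    have kin: "k \<in> insert 0 K \<inter> {0..t}" unfolding k_def using K t by (intro Max_in) auto
    have "K \<inter> {k<..t} = {}"
    proof (rule ccontr)
      assume "K \<inter> {k<..t} \<noteq> {}"
      then obtain j where j: "j \<in> K" "k < j" "j \<le> t" by auto
      have "j \<le> k" unfolding k_def using K j kin by (intro Max_ge) auto
      with j show False by simp
    qed
    then have "\<bar>x i k - x i t\<bar> \<le> 1" using K(2)[OF i, of k t] kin t by auto
    moreover have "\<bar>x i k\<bar> \<le> (\<Sum>k\<in>insert 0 K. \<bar>x i k\<bar>)" using K kin
      by (intro member_le_sum[of k _ "\<lambda>k. \<bar>x i k\<bar>"]) auto
    moreover have "\<dots> \<le> (\<Sum>i\<in>I. \<Sum>k\<in>insert 0 K. \<bar>x i k\<bar>)"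
      using assms(1) i by (intro member_le_sum[of i I "\<lambda>i. \<Sum>k\<in>insert 0 K. \<bar>x i k\<bar>"]) (auto intro: sum_nonneg)
    ultimately show "\<bar>x i t\<bar> \<le> B" unfolding B_def by linarith
  qed
qed

section \<open>Time changes and closeness in the Skorokhod sense\<close>

lemma time_changes_range: "l \<in> time_changes T \<Longrightarrow> t \<in> {0..T} \<Longrightarrow> l t \<in> {0..T}"
  unfolding time_changes_def by blast

lemma time_changes_id: "(\<lambda>t. t) \<in> time_changes T"
  by (auto simp: time_changes_def strict_mono_on_def)

lemma time_changes_comp: "l \<in> time_changes T \<Longrightarrow> l' \<in> time_changes T \<Longrightarrow> (\<lambda>t. l' (l t)) \<in> time_changes T"
proof -
  assume l: "l \<in> time_changes T" and l': "l' \<in> time_changes T"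
  have "(\<lambda>t. l' (l t)) ` {0..T} = l' ` (l ` {0..T})" by auto
  also have "\<dots> = {0..T}" using l l' by (simp add: time_changes_def)
  finally have "(\<lambda>t. l' (l t)) ` {0..T} = {0..T}" .
  moreover have "strict_mono_on {0..T} (\<lambda>t. l' (l t))"
  proof (rule strict_mono_onI)
    fix r s assume "r \<in> {0..T}" "s \<in> {0..T}" "r < s"
    with time_changes_range[OF l, of r] time_changes_range[OF l, of s] l l' show "l' (l r) < l' (l s)"
      unfolding time_changes_def by (blast dest: strict_mono_onD)
  qed
  ultimately show ?thesis by (simp add: time_changes_def)
qed

lemma time_changes_inv:
  assumes l: "l \<in> time_changes T"
  obtains l' where "l' \<in> time_changes T" "\<And>t. t \<in> {0..T} \<Longrightarrow> l (l' t) = t"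
proof -
  have mono: "strict_mono_on {0..T} l" and im: "l ` {0..T} = {0..T}" using l by (auto simp: time_changes_def)
  then have bij: "bij_betw l {0..T} {0..T}"
    by (simp add: bij_betw_def strict_mono_on_imp_inj_on)
  define l' where "l' = the_inv_into {0..T} l"
  have inv: "\<And>t. t \<in> {0..T} \<Longrightarrow> l (l' t) = t"
    unfolding l'_def using bij by (metis f_the_inv_into_f_bij_betw)
  have bij': "bij_betw l' {0..T} {0..T}" unfolding l'_def by (rule bij_betw_the_inv_into[OF bij])
  have "strict_mono_on {0..T} l'"
  proof (rule strict_mono_onI)
    fix r s assume rs: "r \<in> {0..T}" "s \<in> {0..T}" "r < s"
    have "l' r \<in> {0..T}" "l' s \<in> {0..T}" using bij' rs by (auto simp: bij_betw_def)
    then show "l' r < l' s"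
      using inv[OF rs(1)] inv[OF rs(2)] rs(3) strict_mono_on_leD[OF mono, of "l' s" "l' r"] by force
  qed
  then show ?thesis using that[of l'] bij' inv by (auto simp: time_changes_def bij_betw_def)
qed

text \<open>The horizon cannot be moved. Evaluation at \<open>T\<close> is therefore continuous for
  J1, unlike evaluation at interior times.\<close>

lemma time_changes_T:
  assumes "l \<in> time_changes T" "0 \<le> T"
  shows "l T = T"
proof -
  obtain t where t: "t \<in> {0..T}" "l t = T" using assms unfolding time_changes_def by force
  have "l t \<le> l T" using assms t strict_mono_on_leD[of "{0..T}" l t T] by (auto simp: time_changes_def)
  moreover have "l T \<le> T" using time_changes_range[OF assms(1), of T] assms(2) by auto
  ultimately show ?thesis using t by simp
qed

text \<open>Membership of \<open>e\<close> in the set whose infimum is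
  \<open>skorokhod_dist\<close>. Symmetry and the triangle inequality are proved for this relation,
  by inverting and composing time changes, so that no infimum has to be manipulated.\<close>

definition skor_close :: "real \<Rightarrow> 'i set \<Rightarrow> real \<Rightarrow> ('i \<Rightarrow> path) \<Rightarrow> ('i \<Rightarrow> path) \<Rightarrow> bool" where
  "skor_close T I e x y \<longleftrightarrow> 0 \<le> e \<and> (\<exists>l\<in>time_changes T. \<forall>t\<in>{0..T}.
      \<bar>l t - t\<bar> \<le> e \<and> (\<forall>i\<in>I. \<bar>x i t - y i (l t)\<bar> \<le> e))"

lemma skor_close_sym:
  assumes "skor_close T I e x y" shows "skor_close T I e y x"
proof -
  from assms obtain l where e: "0 \<le> e" and l: "l \<in> time_changes T" 
    and le: "\<And>t. t \<in> {0..T} \<Longrightarrow> \<bar>l t - t\<bar> \<le> e" "\<And>t i. t \<in> {0..T} \<Longrightarrow> i \<in> I \<Longrightarrow> \<bar>x i t - y i (l t)\<bar> \<le> e"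
    unfolding skor_close_def by blast
  from time_changes_inv[OF l] obtain l' where l': "l' \<in> time_changes T" "\<And>t. t \<in> {0..T} \<Longrightarrow> l (l' t) = t" by blast
  show ?thesis unfolding skor_close_def
  proof (intro conjI e bexI[OF _ l'(1)] ballI)
    fix t assume t: "t \<in> {0..T}"
    note t' = time_changes_range[OF l'(1) t]
    show "\<bar>l' t - t\<bar> \<le> e" using le(1)[OF t'] l'(2)[OF t] by simp
    fix i assume "i \<in> I"
    then show "\<bar>y i t - x i (l' t)\<bar> \<le> e" using le(2)[OF t', of i] l'(2)[OF t] by simp
  qed
qed

lemma skor_close_trans:
  assumes "skor_close T I e x y" "skor_close T I e' y z" shows "skor_close T I (e + e') x z"
proof -
  from assms(1) obtain l where e: "0 \<le> e" and l: "l \<in> time_changes T" 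
    and le: "\<And>t. t \<in> {0..T} \<Longrightarrow> \<bar>l t - t\<bar> \<le> e" "\<And>t i. t \<in> {0..T} \<Longrightarrow> i \<in> I \<Longrightarrow> \<bar>x i t - y i (l t)\<bar> \<le> e"
    unfolding skor_close_def by blast
  from assms(2) obtain l' where e': "0 \<le> e'" and l': "l' \<in> time_changes T" 
    and le': "\<And>t. t \<in> {0..T} \<Longrightarrow> \<bar>l' t - t\<bar> \<le> e'" "\<And>t i. t \<in> {0..T} \<Longrightarrow> i \<in> I \<Longrightarrow> \<bar>y i t - z i (l' t)\<bar> \<le> e'"
    unfolding skor_close_def by blast
  show ?thesis unfolding skor_close_def
  proof (intro conjI bexI[OF _ time_changes_comp[OF l l']] ballI)
    fix t assume t: "t \<in> {0..T}"
    note t' = time_changes_range[OF l t]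
    show "\<bar>l' (l t) - t\<bar> \<le> e + e'" using le(1)[OF t] le'(1)[OF t'] by linarith
    fix i assume i: "i \<in> I"
    then show "\<bar>x i t - z i (l' (l t))\<bar> \<le> e + e'" using le(2)[OF t i] le'(2)[OF t' i] by linarith
  qed (use e e' in auto)
qed

lemma skorokhod_dist_eq: "skorokhod_dist T I x y = Inf {e. skor_close T I e x y}"
  by (simp only: skorokhod_dist_def skor_close_def)

lemma skorokhod_dist_le: "skor_close T I e x y \<Longrightarrow> skorokhod_dist T I x y \<le> e"
  unfolding skorokhod_dist_eq
  by (rule cInf_lower) (simp, rule bdd_belowI[of _ 0], simp add: skor_close_def)

lemma skor_close_sup:
  assumes "\<And>t i. t \<in> {0..T} \<Longrightarrow> i \<in> I \<Longrightarrow> \<bar>x i t - y i t\<bar> \<le> e" "0 \<le> e"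
  shows "skor_close T I e x y"
  unfolding skor_close_def
  by (intro conjI assms(2) bexI[OF _ time_changes_id] ballI) (use assms in simp_all)

text \<open>Boundedness makes the set of admissible \<open>e\<close> nonempty, so that its infimum is meaningful.\<close>

lemma skor_close_less:
  assumes "finite I" "\<And>i. i \<in> I \<Longrightarrow> x i \<in> cadlag T" "\<And>i. i \<in> I \<Longrightarrow> y i \<in> cadlag T"
    and d: "skorokhod_dist T I x y < e"
  obtains e' where "e' < e" "skor_close T I e' x y"
proof -
  obtain B where B: "\<And>i t. i \<in> I \<Longrightarrow> t \<in> {0..T} \<Longrightarrow> \<bar>x i t\<bar> \<le> B"
    using cadlag_bounded[of I x T] assms by blast
  obtain B' where B': "\<And>i t. i \<in> I \<Longrightarrow> t \<in> {0..T} \<Longrightarrow> \<bar>y i t\<bar> \<le> B'"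
    using cadlag_bounded[of I y T] assms by blast
  have "skor_close T I (\<bar>B\<bar> + \<bar>B'\<bar>) x y"
  proof (rule skor_close_sup)
    fix t i assume ti: "t \<in> {0..T}" "i \<in> I"
    show "\<bar>x i t - y i t\<bar> \<le> \<bar>B\<bar> + \<bar>B'\<bar>" using B[OF ti(2,1)] B'[OF ti(2,1)] by linarith
  qed simp
  then have ne: "{e. skor_close T I e x y} \<noteq> {}" by auto
  have "\<exists>e'\<in>{e. skor_close T I e x y}. e' < e"
    using cInf_lessD[OF ne] d unfolding skorokhod_dist_eq by blast
  then show ?thesis using that by auto
qed

subsection \<open>Discretisation\<close>

definition grid_floor :: "real \<Rightarrow> nat \<Rightarrow> real \<Rightarrow> real" where
  "grid_floor T n t = of_int \<lfloor>t * real n / T\<rfloor> * T / real n"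

text \<open>For positive \<open>n\<close> this step path reads \<open>x\<close> at
  \<open>n + 1\<close> grid points only. The grid contains \<open>T\<close>, so the value at the
  horizon is kept.\<close>

definition discretise :: "real \<Rightarrow> nat \<Rightarrow> path \<Rightarrow> path" where
  "discretise T n x = (\<lambda>t\<in>{0..T}. x (grid_floor T n t))"

definition grid_ceil :: "real \<Rightarrow> nat \<Rightarrow> real \<Rightarrow> real" where
  "grid_ceil T n t = of_int \<lceil>t * real n / T\<rceil> * T / real n"

context
  fixes T :: real and n :: nat
  assumes T: "0 < T" and n: "0 < n"
begin

lemma grid_floor_le: "grid_floor T n t \<le> t"
proof -
  have "of_int \<lfloor>t * real n / T\<rfloor> \<le> t * real n / T" by simp
  from pos_le_divide_eq[THEN iffD1, OF T this]
  show ?thesis unfolding grid_floor_def using n by (subst pos_divide_le_eq) auto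
qed

lemma grid_floor_nonneg: "0 \<le> t \<Longrightarrow> 0 \<le> grid_floor T n t"
  unfolding grid_floor_def using T n by simp

text \<open>Rounding down is adjoint to the inclusion of the grid into the line. Applied to grid
  points of the form \<open>grid_ceil T n k\<close>, it shows that rounding never crosses a knot
  that has been moved onto the grid.\<close>

lemma grid_floor_ge_iff: "of_int j * T / real n \<le> grid_floor T n t \<longleftrightarrow> of_int j * T / real n \<le> t"
proof -
  have "of_int j * T / real n \<le> grid_floor T n t \<longleftrightarrow> j \<le> \<lfloor>t * real n / T\<rfloor>"
    unfolding grid_floor_def using T n by (simp add: divide_le_cancel mult_le_cancel_right)
  also have "\<dots> \<longleftrightarrow> of_int j \<le> t * real n / T" by (simp add: le_floor_iff)
  also have "\<dots> \<longleftrightarrow> of_int j * T / real n \<le> t" using T n by (simp add: field_simps)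
  finally show ?thesis .
qed

lemma grid_ceil_le_grid: "t \<le> grid_floor T n s \<Longrightarrow> grid_ceil T n t \<le> grid_floor T n s"
proof -
  assume "t \<le> grid_floor T n s"
  then have "t * real n / T \<le> of_int \<lfloor>s * real n / T\<rfloor>"
    unfolding grid_floor_def using T n by (simp add: field_simps)
  then have "\<lceil>t * real n / T\<rceil> \<le> \<lfloor>s * real n / T\<rfloor>" by (simp add: ceiling_le_iff)
  then show ?thesis unfolding grid_floor_def grid_ceil_def using T n
    by (simp add: divide_le_cancel mult_le_cancel_right)
qed

lemma grid_ceil_le_floor_iff: "grid_ceil T n t \<le> grid_floor T n s \<longleftrightarrow> grid_ceil T n t \<le> s"
  unfolding grid_ceil_def by (rule grid_floor_ge_iff)

lemma grid_ceil_ge: "t \<le> grid_ceil T n t"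
proof -
  have "t * real n / T \<le> of_int \<lceil>t * real n / T\<rceil>" by simp
  from pos_divide_le_eq[THEN iffD1, OF T this]
  show ?thesis unfolding grid_ceil_def using n by (subst pos_le_divide_eq) auto
qed

lemma grid_ceil_less: "grid_ceil T n t \<le> t + T / real n"
proof -
  have "of_int \<lceil>t * real n / T\<rceil> \<le> t * real n / T + 1" by linarith
  then show ?thesis unfolding grid_ceil_def using T n by (simp add: field_simps)
qed

lemma grid_ceil_T: "grid_ceil T n T = T"
  unfolding grid_ceil_def using T n by simp

lemma eventually_grid_floor_right: "\<forall>\<^sub>F s in at_right t. grid_floor T n s = grid_floor T n t"
proof -
  let ?u = "(of_int \<lfloor>t * real n / T\<rfloor> + 1) * T / real n"
  have "t * real n / T < of_int \<lfloor>t * real n / T\<rfloor> + 1" by linarith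
  then have "t < ?u" using T n by (simp add: field_simps)
  then show ?thesis unfolding eventually_at_right_field
  proof (intro exI[of _ ?u] conjI allI impI)
    fix s assume s: "t < s" "s < ?u"
    have "s * real n / T < of_int \<lfloor>t * real n / T\<rfloor> + 1" using s(2) T n by (simp add: field_simps)
    moreover have "of_int \<lfloor>t * real n / T\<rfloor> \<le> s * real n / T"
    proof -
      have "t * real n / T \<le> s * real n / T" using s(1) T n by (simp add: divide_right_mono)
      then show ?thesis by linarith
    qed
    ultimately have "\<lfloor>s * real n / T\<rfloor> = \<lfloor>t * real n / T\<rfloor>" by linarith
    then show "grid_floor T n s = grid_floor T n t" by (simp add: grid_floor_def)
  qed
qed

lemma eventually_grid_floor_left: "\<exists>g. \<forall>\<^sub>F s in at_left t. grid_floor T n s = g"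
proof -
  let ?u = "(of_int \<lceil>t * real n / T\<rceil> - 1) * T / real n"
  have "t * real n / T > of_int \<lceil>t * real n / T\<rceil> - 1" by linarith
  then have u: "t > ?u" using T n by (simp add: field_simps)
  show ?thesis unfolding eventually_at_left_field
  proof (intro exI[of _ ?u] conjI allI impI u)
    fix s assume s: "s < t" "?u < s"
    have "s * real n / T > of_int \<lceil>t * real n / T\<rceil> - 1" using s(2) T n by (simp add: field_simps)
    moreover have "s * real n / T < t * real n / T" using s(1) T n by (simp add: divide_strict_right_mono)
    ultimately have "\<lfloor>s * real n / T\<rfloor> = \<lceil>t * real n / T\<rceil> - 1" by linarith
    then show "grid_floor T n s = ?u" by (simp add: grid_floor_def)
  qed
qed

lemma grid_floor_in: "t \<in> {0..T} \<Longrightarrow> grid_floor T n t \<in> {0..T}"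
  using grid_floor_le[of t] grid_floor_nonneg[of t] by auto

lemma discretise_cadlag: "discretise T n x \<in> cadlag T"
  unfolding cadlag_def
proof (intro CollectI conjI ballI)
  show "discretise T n x \<in> extensional {0..T}" by (simp add: discretise_def)
  fix t assume t: "t \<in> {0..<T}"
  have "\<forall>\<^sub>F s in at_right t. s < T" using t by (auto simp: eventually_at_right_field)
  then have "\<forall>\<^sub>F s in at_right t. discretise T n x s = discretise T n x t"
    using eventually_grid_floor_right[of t] eventually_at_right_less[of t]
    by eventually_elim (use t in \<open>auto simp: discretise_def\<close>)
  then show "(discretise T n x \<longlongrightarrow> discretise T n x t) (at_right t)" by (rule tendsto_eventually)
next
  fix t assume t: "t \<in> {0<..T}"
  have "\<forall>\<^sub>F s in at_left t. 0 < s \<and> s < t" using t by (auto simp: eventually_at_left_field)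
  moreover obtain g where "\<forall>\<^sub>F s in at_left t. grid_floor T n s = g" using eventually_grid_floor_left by blast
  ultimately have "\<forall>\<^sub>F s in at_left t. discretise T n x s = x g"
    by eventually_elim (use t in \<open>auto simp: discretise_def\<close>)
  then show "\<exists>l. (discretise T n x \<longlongrightarrow> l) (at_left t)" by (blast intro: tendsto_eventually)
qed

end


section \<open>Convergence of the discretisations\<close>

definition bump :: "real \<Rightarrow> real \<Rightarrow> real \<Rightarrow> real" where
  "bump d k t = max 0 (1 - \<bar>t - k\<bar> / d)"

lemma bump_lipschitz: "0 < d \<Longrightarrow> \<bar>bump d k t - bump d k s\<bar> \<le> \<bar>t - s\<bar> / d"
proof -
  assume d: "0 < d"
  have "\<bar>bump d k t - bump d k s\<bar> \<le> \<bar>\<bar>t - k\<bar> / d - \<bar>s - k\<bar> / d\<bar>"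
    unfolding bump_def by (auto simp: max_def)
  also have "\<dots> = \<bar>\<bar>t - k\<bar> - \<bar>s - k\<bar>\<bar> / d" using d by (simp add: diff_divide_distrib[symmetric])
  also have "\<dots> \<le> \<bar>t - s\<bar> / d" using d by (intro divide_right_mono) auto
  finally show ?thesis .
qed

lemma bump_bounds: "0 < d \<Longrightarrow> 0 \<le> bump d k t \<and> bump d k t \<le> 1"
  by (auto simp: bump_def)

lemma bump_far: "0 < d \<Longrightarrow> d \<le> \<bar>t - k\<bar> \<Longrightarrow> bump d k t = 0"
  by (auto simp: bump_def max_def)

lemma finite_separation:
  fixes P :: "real set"
  assumes "finite P" obtains d where "0 < d" "\<And>a b. a \<in> P \<Longrightarrow> b \<in> P \<Longrightarrow> a \<noteq> b \<Longrightarrow> d \<le> \<bar>a - b\<bar>"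
proof
  \<comment> \<open>The extra 1 keeps the minimum defined when \<open>P\<close> has fewer than two
    points.\<close>
  let ?D = "insert 1 ((\<lambda>(a, b). \<bar>a - b\<bar>) ` ((P \<times> P) \<inter> {(a, b). a \<noteq> b}))"
  have fin: "finite ?D" using assms by auto
  show "0 < Min ?D" using fin by (subst Min_gr_iff) auto
  fix a b assume "a \<in> P" "b \<in> P" "a \<noteq> b"
  then show "Min ?D \<le> \<bar>a - b\<bar>" using fin by (intro Min_le) force+
qed

text \<open>The time change moves every jump-partition point \<open>k\<close> to the next grid point, adding to the
  identity small multiples of tent functions of total slope less than 1.\<close>

lemma discretise_close:
  assumes fin: "finite I" and T: "0 < T" and x: "\<And>i. i \<in> I \<Longrightarrow> x i \<in> cadlag T" and e: "0 < e"
  shows "\<forall>\<^sub>F n in sequentially. skor_close T I e x (\<lambda>i. discretise T n (x i))"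
proof -
  obtain K0 where K0: "finite K0" "\<And>s t i. i \<in> I \<Longrightarrow> 0 \<le> s \<Longrightarrow> s \<le> t \<Longrightarrow> t \<le> T \<Longrightarrow> K0 \<inter> {s<..t} = {} \<Longrightarrow> \<bar>x i s - x i t\<bar> \<le> e"
    using cadlag_oscillation[of I x T e] fin x e by metis
  \<comment> \<open>Points outside \<open>{0<..T}\<close> never lie in an interval
    \<open>{s<..t}\<close> with \<open>0 \<le> s\<close> and \<open>t \<le> T\<close>. Dropping 0
    keeps it fixed under the time change.\<close>
  define K where "K = K0 \<inter> {0<..T}"
  have K: "finite K" "K \<subseteq> {0<..T}" using K0 by (auto simp: K_def)
  have osc: "\<bar>x i s - x i t\<bar> \<le> e" if "i \<in> I" "0 \<le> s" "s \<le> t" "t \<le> T" "K \<inter> {s<..t} = {}" for s t i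
  proof -
    have "K0 \<inter> {s<..t} = K \<inter> {s<..t}" using that by (auto simp: K_def)
    then show ?thesis using K0(2)[of i s t] that by simp
  qed
  \<comment> \<open>Knots and end points are pairwise \<open>d\<close> apart, so the tent of
    half-width \<open>d\<close> around a knot vanishes at every other knot and end point.\<close>
  obtain d where d: "0 < d" "\<And>a b. a \<in> insert 0 (insert T K) \<Longrightarrow> b \<in> insert 0 (insert T K) \<Longrightarrow> a \<noteq> b \<Longrightarrow> d \<le> \<bar>a - b\<bar>"
    using finite_separation[of "insert 0 (insert T K)"] K by blast
  define c where "c = real (card K)"
  have c: "0 \<le> c" by (simp add: c_def)
  have "(\<lambda>n. (c * T) * (1 / real n)) \<longlonglongrightarrow> c * T * 0" by (intro tendsto_mult_left lim_1_over_n)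
  \<comment> \<open>There are \<open>c\<close> tents of slope \<open>1/d\<close> with factors at
    most \<open>T/n\<close>. The bound \<open>d\<close> keeps their total slope below 1, which makes
    \<open>l\<close> strictly increasing; the bound \<open>e\<close> keeps \<open>l\<close> close to
    the identity.\<close>
  then have "\<forall>\<^sub>F n in sequentially. (c * T) * (1 / real n) < min d e"
    using d e by (intro order_tendstoD(2)[of _ 0]) auto
  then show ?thesis using eventually_gt_at_top[of 0]
  proof eventually_elim
    fix n :: nat assume nd: "(c * T) * (1 / real n) < min d e" and n: "0 < n"
    define u where "u = grid_ceil T n"
    define l where "l t = t + (\<Sum>k\<in>K. (u k - k) * bump d k t)" for t
    have u: "0 \<le> u k - k" "u k - k \<le> T / real n" for k
      using grid_ceil_ge[OF T n, of k] grid_ceil_less[OF T n, of k] by (auto simp: u_def)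
    have sumle: "\<bar>\<Sum>k\<in>K. (u k - k) * g k\<bar> \<le> c * T / real n * b" if "\<And>k. k \<in> K \<Longrightarrow> \<bar>g k\<bar> \<le> b" for g b
    proof -
      have "\<bar>\<Sum>k\<in>K. (u k - k) * g k\<bar> \<le> (\<Sum>k\<in>K. \<bar>(u k - k) * g k\<bar>)" by (rule sum_abs)
      also have "\<dots> \<le> (\<Sum>k\<in>K. T / real n * b)"
      proof (rule sum_mono)
        fix k assume "k \<in> K"
        have "\<bar>(u k - k) * g k\<bar> = (u k - k) * \<bar>g k\<bar>" using u(1)[of k] by (simp add: abs_mult)
        also have "\<dots> \<le> T / real n * b"
          using u(1)[of k] u(2)[of k] that[OF \<open>k \<in> K\<close>] T n by (intro mult_mono) auto
        finally show "\<bar>(u k - k) * g k\<bar> \<le> T / real n * b" .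
      qed
      also have "\<dots> = c * T / real n * b" by (simp add: c_def)
      finally show ?thesis .
    qed
    have knot: "l j = (if j \<in> K then u j else j)" if j: "j \<in> insert 0 (insert T K)" for j
    proof -
      have "(\<Sum>k\<in>K. (u k - k) * bump d k j) = (\<Sum>k\<in>K. if k = j then u j - j else 0)"
      proof (intro sum.cong refl)
        fix k assume k: "k \<in> K"
        show "(u k - k) * bump d k j = (if k = j then u j - j else 0)"
          using bump_far[OF d(1), of j k] d(2)[of j k] j k by (cases "k = j") (auto simp: bump_def)
      qed
      also have "\<dots> = (if j \<in> K then u j - j else 0)" using K by simp
      finally show ?thesis by (simp add: l_def)
    qed
    have l0: "l 0 = 0" using knot[of 0] K by auto
    have lT: "l T = T" using knot[of T] grid_ceil_T[OF T n] by (auto simp: u_def)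
    have less: "l s < l t" if "s < t" for s t
    proof -
      have "\<bar>\<Sum>k\<in>K. (u k - k) * (bump d k s - bump d k t)\<bar> \<le> c * T / real n * ((t - s) / d)"
        by (rule sumle) (use bump_lipschitz[OF d(1), of _ s t] that in auto)
      also have "\<dots> = (c * T * (1 / real n)) / d * (t - s)" by simp
      also have "\<dots> < 1 * (t - s)"
      proof (rule mult_strict_right_mono)
        show "c * T * (1 / real n) / d < 1" using nd d(1) by (subst pos_divide_less_eq) auto
      qed (use that in simp)
      finally have "\<bar>(\<Sum>k\<in>K. (u k - k) * bump d k s) - (\<Sum>k\<in>K. (u k - k) * bump d k t)\<bar> < t - s"
        by (simp add: right_diff_distrib sum_subtractf)
      then show ?thesis unfolding l_def by linarith
    qed
    then have le: "l s \<le> l t" if "s \<le> t" for s t using that by (cases "s = t") (auto simp: less_imp_le)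
    have cont: "continuous_on {0..T} l" unfolding l_def bump_def using d by (intro continuous_intros) auto
    have tc: "l \<in> time_changes T" unfolding time_changes_def
    proof (intro CollectI conjI)
      show "strict_mono_on {0..T} l" using less by (auto intro: strict_mono_onI)
      show "l ` {0..T} = {0..T}"
      proof
        show "l ` {0..T} \<subseteq> {0..T}" using le[of 0] le[of _ T] l0 lT by auto
        show "{0..T} \<subseteq> l ` {0..T}"
        proof
          fix y assume "y \<in> {0..T}"
          then have "\<exists>s\<ge>0. s \<le> T \<and> l s = y" using IVT'[of l 0 y T] l0 lT T cont by auto
          then show "y \<in> l ` {0..T}" by auto
        qed
      qed
    qed
    show "skor_close T I e x (\<lambda>i. discretise T n (x i))" unfolding skor_close_def
    proof (intro conjI bexI[OF _ tc] ballI)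
      fix t assume t: "t \<in> {0..T}"
      have "\<bar>\<Sum>k\<in>K. (u k - k) * bump d k t\<bar> \<le> c * T / real n * 1"
        by (rule sumle) (metis bump_bounds[OF d(1)] abs_of_nonneg)
      then show "\<bar>l t - t\<bar> \<le> e" using nd by (simp add: l_def)
      fix i assume i: "i \<in> I"
      define g where "g = grid_floor T n (l t)"
      have lt: "l t \<in> {0..T}" using time_changes_range[OF tc t] .
      have g: "g \<in> {0..T}" unfolding g_def by (rule grid_floor_in[OF T n lt])
      \<comment> \<open>No knot separates \<open>t\<close> from \<open>g\<close>:
        \<open>k \<le> t\<close> holds iff \<open>u k \<le> l t\<close>, and this iff
        \<open>u k \<le> g\<close>, because \<open>u k\<close> is a grid point. Hence
        \<open>A\<close> and \<open>B\<close>, and the oscillation bound applies to \<open>t\<close>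
        and \<open>g\<close> in either order.\<close>
      have A: "K \<inter> {t<..g} = {}"
      proof (rule ccontr)
        assume "K \<inter> {t<..g} \<noteq> {}"
        then obtain k where k: "k \<in> K" "t < k" "k \<le> g" by auto
        have "l t < u k" using less[OF k(2)] knot[of k] k by simp
        moreover have "u k \<le> g" unfolding u_def g_def using k(3) grid_ceil_le_grid[OF T n] by (simp add: g_def)
        moreover have "g \<le> l t" unfolding g_def by (rule grid_floor_le[OF T n])
        ultimately show False by simp
      qed
      have B: "K \<inter> {g<..t} = {}"
      proof (rule ccontr)
        assume "K \<inter> {g<..t} \<noteq> {}"
        then obtain k where k: "k \<in> K" "g < k" "k \<le> t" by auto
        have "u k \<le> l t" using le[OF k(3)] knot[of k] k by simp
        then have "u k \<le> g" unfolding u_def g_def using grid_ceil_le_floor_iff[OF T n] by simp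
        with k(2) u(1)[of k] show False by simp
      qed
      have "\<bar>x i t - x i g\<bar> \<le> e"
        using osc[OF i, of t g] osc[OF i, of g t] A B t g by (cases "t \<le> g") auto
      then show "\<bar>x i t - discretise T n (x i) (l t)\<bar> \<le> e"
        using lt by (simp add: discretise_def g_def)
    qed (use e in auto)
  qed
qed

section \<open>The Borel algebra of the Skorokhod topology and evaluations\<close>

lemma skor_close_mono: "skor_close T I e x y \<Longrightarrow> e \<le> e' \<Longrightarrow> skor_close T I e' x y"
  unfolding skor_close_def by (meson order_trans)

text \<open>Treats \<open>D_fam\<close> and \<open>D_real\<close> at once: \<open>emb\<close> views
  a point as a family of paths, and \<open>dsc\<close> is discretisation on the level of
  points.\<close>

locale skor_space =
  fixes T :: real and I :: "'i set" and S :: "'p set" and emb :: "'p \<Rightarrow> 'i \<Rightarrow> path"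
    and dsc :: "nat \<Rightarrow> 'p \<Rightarrow> 'p"
  assumes fin: "finite I" and T: "0 < T"
    and emb: "\<And>x i. x \<in> S \<Longrightarrow> i \<in> I \<Longrightarrow> emb x i \<in> cadlag T"
    and dsc: "\<And>n x. 0 < n \<Longrightarrow> x \<in> S \<Longrightarrow> dsc n x \<in> S"
    and emb_dsc: "\<And>n x i. 0 < n \<Longrightarrow> x \<in> S \<Longrightarrow> i \<in> I \<Longrightarrow> emb (dsc n x) i = discretise T n (emb x i)"
begin

definition opn :: "'p set \<Rightarrow> bool" where
  "opn U \<longleftrightarrow> U \<subseteq> S \<and> (\<forall>x\<in>U. \<exists>e>0. \<forall>y\<in>S. skor_close T I e (emb x) (emb y) \<longrightarrow> y \<in> U)"

definition B :: "'p measure" where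
  "B = dist_borel S (\<lambda>x y. skorokhod_dist T I (emb x) (emb y))"

lemma opn_iff:
  "opn U \<longleftrightarrow> U \<subseteq> S \<and> (\<forall>x\<in>U. \<exists>e>0. \<forall>y\<in>S. skorokhod_dist T I (emb x) (emb y) < e \<longrightarrow> y \<in> U)"
proof -
  have "(\<exists>e>0. \<forall>y\<in>S. skor_close T I e (emb x) (emb y) \<longrightarrow> y \<in> U) \<longleftrightarrow>
      (\<exists>e>0. \<forall>y\<in>S. skorokhod_dist T I (emb x) (emb y) < e \<longrightarrow> y \<in> U)" if x: "x \<in> S" for x
  proof
    assume "\<exists>e>0. \<forall>y\<in>S. skor_close T I e (emb x) (emb y) \<longrightarrow> y \<in> U"
    then obtain e where e: "e > 0" "\<And>y. y \<in> S \<Longrightarrow> skor_close T I e (emb x) (emb y) \<Longrightarrow> y \<in> U" by blast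
    show "\<exists>e>0. \<forall>y\<in>S. skorokhod_dist T I (emb x) (emb y) < e \<longrightarrow> y \<in> U"
    proof (intro exI[of _ e] conjI ballI impI e)
      fix y assume y: "y \<in> S" "skorokhod_dist T I (emb x) (emb y) < e"
      obtain e' where "e' < e" "skor_close T I e' (emb x) (emb y)"
        using skor_close_less[OF fin emb[OF x] emb[OF y(1)] y(2)] by blast
      then show "skor_close T I e (emb x) (emb y)" by (meson less_imp_le skor_close_mono)
    qed
  next
    assume "\<exists>e>0. \<forall>y\<in>S. skorokhod_dist T I (emb x) (emb y) < e \<longrightarrow> y \<in> U"
    then obtain e where e: "e > 0" "\<And>y. y \<in> S \<Longrightarrow> skorokhod_dist T I (emb x) (emb y) < e \<Longrightarrow> y \<in> U" by blast
    show "\<exists>e>0. \<forall>y\<in>S. skor_close T I e (emb x) (emb y) \<longrightarrow> y \<in> U"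
    \<comment> \<open>Closeness bounds the distance only weakly; halving the radius yields the
      strict inequality.\<close>
    proof (intro exI[of _ "e/2"] conjI ballI impI)
      fix y assume y: "y \<in> S" "skor_close T I (e/2) (emb x) (emb y)"
      from skorokhod_dist_le[OF y(2)] e y(1) show "y \<in> U" by (intro e(2)) auto
    qed (use e in auto)
  qed
  then show ?thesis unfolding opn_def by blast
qed

lemma B_eq: "B = sigma S {U. opn U}"
  unfolding B_def dist_borel_def opn_iff ..

lemma space_B: "space B = S" unfolding B_eq by (auto simp: opn_def intro!: space_measure_of)

lemma opn_sets: "opn U \<Longrightarrow> U \<in> sets B"
  unfolding B_eq by (subst sets_measure_of) (auto simp: opn_def)

text \<open>\<open>dsc n\<close> factors through finitely many grid values, and points with nearby
  grid values have nearby discretisations. The preimage of an open set is therefore open in a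
  finite-dimensional space and a countable union of boxes with rational centres. This takes the
  place of separability of the Skorokhod space.\<close>

lemma measurable_dsc:
  assumes f: "\<And>w. w \<in> space N \<Longrightarrow> f w \<in> S"
    and ev: "\<And>i t. i \<in> I \<Longrightarrow> t \<in> {0..T} \<Longrightarrow> (\<lambda>w. emb (f w) i t) \<in> borel_measurable N"
    and U: "opn U" and n: "0 < n"
  shows "{w \<in> space N. dsc n (f w) \<in> U} \<in> sets N"
proof -
  define J where "J = I \<times> {0..n}"
  define v where "v x = (\<lambda>(i, j). emb x i (real j * T / real n))" for x
  define bx where "bx q m = {x \<in> S. \<forall>p\<in>J. \<bar>v x p - q p\<bar> < 1 / real (Suc m)}" for q m
  have finJ: "finite J" using fin by (simp add: J_def)
  have grid: "\<exists>j\<le>n. grid_floor T n t = real j * T / real n" if "t \<in> {0..T}" for t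
  proof (intro exI[of _ "nat \<lfloor>t * real n / T\<rfloor>"] conjI)
    have "t * real n / T \<le> real n" using that T n by (simp add: field_simps)
    then show "nat \<lfloor>t * real n / T\<rfloor> \<le> n" by linarith
    have "0 \<le> t * real n / T" using that T n by simp
    then show "grid_floor T n t = real (nat \<lfloor>t * real n / T\<rfloor>) * T / real n"
      unfolding grid_floor_def by simp
  qed
  have gridT: "real j * T / real n \<in> {0..T}" if "j \<le> n" for j
    using that T n by (auto simp: field_simps)
  have near: "skor_close T I a (emb (dsc n x)) (emb (dsc n y))"
    if x: "x \<in> S" and y: "y \<in> S" and a: "0 \<le> a" and *: "\<And>p. p \<in> J \<Longrightarrow> \<bar>v x p - v y p\<bar> \<le> a" for x y a
  proof (rule skor_close_sup)
    fix t i assume t: "t \<in> {0..T}" and i: "i \<in> I"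
    obtain j where j: "j \<le> n" "grid_floor T n t = real j * T / real n" using grid[OF t] by auto
    have "\<bar>v x (i, j) - v y (i, j)\<bar> \<le> a" using i j by (intro *) (auto simp: J_def)
    then show "\<bar>emb (dsc n x) i t - emb (dsc n y) i t\<bar> \<le> a"
      using t i j by (simp add: emb_dsc[OF n x i] emb_dsc[OF n y i] discretise_def v_def)
  qed (rule a)
  define Q where "Q = {(q, m). q \<in> PiE J (\<lambda>_. \<rat>) \<and> (\<forall>x\<in>bx q m. dsc n x \<in> U)}"
  have "countable Q"
  proof (rule countable_subset)
    show "Q \<subseteq> PiE J (\<lambda>_. \<rat>) \<times> (UNIV :: nat set)" by (auto simp: Q_def)
    show "countable (PiE J (\<lambda>_. \<rat> :: real set) \<times> (UNIV :: nat set))"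
      using finJ by (intro countable_SIGMA countable_PiE) (auto simp: countable_rat)
  qed
  have eq: "{w \<in> space N. dsc n (f w) \<in> U} = (\<Union>(q, m)\<in>Q. {w \<in> space N. f w \<in> bx q m})"
  proof (intro set_eqI iffI)
    fix w assume w: "w \<in> {w \<in> space N. dsc n (f w) \<in> U}"
    then have fS: "f w \<in> S" using f by auto
    from w U obtain e where e: "e > 0" "\<And>y. y \<in> S \<Longrightarrow> skor_close T I e (emb (dsc n (f w))) (emb y) \<Longrightarrow> y \<in> U"
      unfolding opn_def by blast
    \<comment> \<open>Two points of one box differ by up to \<open>2 / real (Suc m)\<close>, hence
      the bound \<open>e / 2\<close> for its radius.\<close>
    obtain m :: nat where m: "1 / real (Suc m) < e / 2" using e nat_approx_posE[of "e/2"] by auto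
    have "\<forall>p\<in>J. \<exists>r\<in>\<rat>. \<bar>v (f w) p - r\<bar> < 1 / real (Suc m)"
    proof
      fix p assume "p \<in> J"
      obtain r where r: "r \<in> \<rat>" "v (f w) p < r" "r < v (f w) p + 1 / real (Suc m)"
        using Rats_dense_in_real[of "v (f w) p" "v (f w) p + 1 / real (Suc m)"] by auto
      then show "\<exists>r\<in>\<rat>. \<bar>v (f w) p - r\<bar> < 1 / real (Suc m)" by (intro bexI[of _ r]) auto
    qed
    then obtain q0 where q0: "\<And>p. p \<in> J \<Longrightarrow> q0 p \<in> \<rat> \<and> \<bar>v (f w) p - q0 p\<bar> < 1 / real (Suc m)" by metis
    define q where "q = restrict q0 J"
    have "(q, m) \<in> Q"
      unfolding Q_def
    proof (intro CollectI case_prodI conjI ballI)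
      show "q \<in> PiE J (\<lambda>_. \<rat>)" using q0 by (auto simp: q_def)
      fix x assume x: "x \<in> bx q m"
      have "skor_close T I (2 / real (Suc m)) (emb (dsc n (f w))) (emb (dsc n x))"
      proof (rule near[OF fS])
        fix p assume p: "p \<in> J"
        have "\<bar>v x p - q0 p\<bar> < 1 / real (Suc m)" using x p by (auto simp: bx_def q_def)
        with q0[OF p] have "\<bar>v (f w) p - v x p\<bar> \<le> 1 / real (Suc m) + 1 / real (Suc m)" by linarith
        then show "\<bar>v (f w) p - v x p\<bar> \<le> 2 / real (Suc m)" by simp
      qed (use x in \<open>auto simp: bx_def\<close>)
      then have "skor_close T I e (emb (dsc n (f w))) (emb (dsc n x))"
        using m by (intro skor_close_mono[of _ _ "2 / real (Suc m)" _ _ e]) auto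
      then show "dsc n x \<in> U" using x dsc[OF n] by (intro e(2)) (auto simp: bx_def)
    qed
    moreover have "f w \<in> bx q m" using fS q0 by (auto simp: bx_def q_def)
    ultimately show "w \<in> (\<Union>(q, m)\<in>Q. {w \<in> space N. f w \<in> bx q m})" using w by blast
  qed (auto simp: Q_def)
  have "{w \<in> space N. f w \<in> bx q m} \<in> sets N" for q m
  proof -
    have "{w \<in> space N. f w \<in> bx q m} = {w \<in> space N. \<forall>p\<in>J. \<bar>v (f w) p - q p\<bar> < 1 / real (Suc m)}"
      using f by (auto simp: bx_def)
    also have "\<dots> \<in> sets N"
    proof (rule sets.sets_Collect_finite_All[OF _ finJ])
      fix p assume "p \<in> J"
      then have [measurable]: "(\<lambda>w. v (f w) p) \<in> borel_measurable N"
        unfolding v_def J_def using ev gridT by (cases p) auto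
      show "{w \<in> space N. \<bar>v (f w) p - q p\<bar> < 1 / real (Suc m)} \<in> sets N" by measurable
    qed
    finally show ?thesis .
  qed
  then show ?thesis unfolding eq using \<open>countable Q\<close> by (intro sets.countable_UN') auto
qed

text \<open>\<open>f w\<close> is the limit of its discretisations, whose membership in open sets is
  measurable. Eventual membership in \<open>U\<close> itself would not characterise
  \<open>f w \<in> U\<close>, since a limit may leave an open set. The sets \<open>V k\<close> add a
  margin: their points have a ball of radius above \<open>1 / real (Suc k)\<close> inside
  \<open>U\<close>, so being close to such a point forces \<open>f w\<close> into
  \<open>U\<close>.\<close>

lemma measurable_B:
  assumes f: "\<And>w. w \<in> space N \<Longrightarrow> f w \<in> S"
    and ev: "\<And>i t. i \<in> I \<Longrightarrow> t \<in> {0..T} \<Longrightarrow> (\<lambda>w. emb (f w) i t) \<in> borel_measurable N"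
  shows "f \<in> N \<rightarrow>\<^sub>M B"
  unfolding B_eq
proof (rule measurable_measure_of)
  show "{U. opn U} \<subseteq> Pow S" by (auto simp: opn_def)
  show "f \<in> space N \<rightarrow> S" using f by auto
  fix U assume "U \<in> {U. opn U}"
  then have U: "opn U" by simp
  define V where "V k = {y \<in> S. \<exists>d>1 / real (Suc k). \<forall>z\<in>S. skor_close T I d (emb y) (emb z) \<longrightarrow> z \<in> U}" for k :: nat
  have V: "opn (V k)" for k unfolding opn_def
  proof (intro conjI ballI)
    fix y assume "y \<in> V k"
    then obtain d where d: "y \<in> S" "d > 1 / real (Suc k)" "\<And>z. z \<in> S \<Longrightarrow> skor_close T I d (emb y) (emb z) \<Longrightarrow> z \<in> U"
      by (auto simp: V_def)
    \<comment> \<open>Half the excess of the radius over \<open>1 / real (Suc k)\<close>: moving by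
      \<open>h\<close> costs \<open>h\<close> of the radius and still leaves a positive
      excess.\<close>
    define h where "h = (d - 1 / real (Suc k)) / 2"
    show "\<exists>e>0. \<forall>y'\<in>S. skor_close T I e (emb y) (emb y') \<longrightarrow> y' \<in> V k"
    proof (intro exI[of _ h] conjI ballI impI)
      show "0 < h" using d by (simp add: h_def)
      fix y' assume y': "y' \<in> S" "skor_close T I h (emb y) (emb y')"
      show "y' \<in> V k" unfolding V_def
      proof (intro CollectI conjI y' exI[of _ "d - h"] ballI impI)
        show "1 / real (Suc k) < d - h" using d(2) unfolding h_def by argo
        fix z assume "z \<in> S" "skor_close T I (d - h) (emb y') (emb z)"
        with skor_close_trans[OF y'(2), of "d - h"] show "z \<in> U" by (intro d(3)) auto
      qed
    qed
  qed (auto simp: V_def)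
  have "{w \<in> space N. f w \<in> U} = {w \<in> space N. \<exists>k. \<exists>m. \<forall>n\<ge>m. dsc (Suc n) (f w) \<in> V k}"
  proof (intro Collect_cong conj_cong refl)
    fix w assume "w \<in> space N"
    then have fS: "f w \<in> S" by (rule f)
    have conv: "\<exists>m. \<forall>n\<ge>m. skor_close T I e (emb (f w)) (emb (dsc (Suc n) (f w)))" if "0 < e" for e
    proof -
      have "\<forall>\<^sub>F n in sequentially. skor_close T I e (emb (f w)) (\<lambda>i. discretise T n (emb (f w) i))"
        by (rule discretise_close[OF fin T emb[OF fS] that])
      then obtain m where m: "\<And>n. n \<ge> m \<Longrightarrow> skor_close T I e (emb (f w)) (\<lambda>i. discretise T n (emb (f w) i))"
        by (auto simp: eventually_sequentially)
      show ?thesis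
      proof (intro exI[of _ m] allI impI)
        fix n assume "n \<ge> m"
        then have "skor_close T I e (emb (f w)) (\<lambda>i. discretise T (Suc n) (emb (f w) i))" by (intro m) auto
        then show "skor_close T I e (emb (f w)) (emb (dsc (Suc n) (f w)))"
          using emb_dsc[of "Suc n", OF _ fS] by (auto simp: skor_close_def)
      qed
    qed
    show "f w \<in> U \<longleftrightarrow> (\<exists>k m. \<forall>n\<ge>m. dsc (Suc n) (f w) \<in> V k)"
    proof
      assume "f w \<in> U"
      with U obtain e where e: "e > 0" "\<And>y. y \<in> S \<Longrightarrow> skor_close T I e (emb (f w)) (emb y) \<Longrightarrow> y \<in> U"
        unfolding opn_def by blast
      obtain k :: nat where k: "1 / real (Suc k) < e / 2" using e nat_approx_posE[of "e/2"] by auto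
      obtain m where m: "\<And>n. n \<ge> m \<Longrightarrow> skor_close T I (e/2) (emb (f w)) (emb (dsc (Suc n) (f w)))"
        using conv[of "e/2"] e by auto
      show "\<exists>k m. \<forall>n\<ge>m. dsc (Suc n) (f w) \<in> V k"
      proof (rule exI[of _ k], rule exI[of _ m], intro allI impI)
        fix n assume n: "n \<ge> m"
        show "dsc (Suc n) (f w) \<in> V k" unfolding V_def
        proof (intro CollectI conjI exI[of _ "e/2"] ballI impI)
          show "1 / real (Suc k) < e / 2" by (rule k)
          show "dsc (Suc n) (f w) \<in> S" using dsc fS by simp
          fix z assume "z \<in> S" "skor_close T I (e/2) (emb (dsc (Suc n) (f w))) (emb z)"
          with skor_close_trans[OF m[OF n], of "e/2"] show "z \<in> U" by (intro e(2)) auto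
        qed
      qed
    next
      assume "\<exists>k m. \<forall>n\<ge>m. dsc (Suc n) (f w) \<in> V k"
      then obtain k m where km: "\<And>n. n \<ge> m \<Longrightarrow> dsc (Suc n) (f w) \<in> V k" by auto
      obtain m' where m': "\<And>n. n \<ge> m' \<Longrightarrow> skor_close T I (1 / real (Suc k)) (emb (f w)) (emb (dsc (Suc n) (f w)))"
        using conv[of "1 / real (Suc k)"] by auto
      define n where "n = max m m'"
      have "dsc (Suc n) (f w) \<in> V k" by (rule km) (simp add: n_def)
      then obtain d where d: "d > 1 / real (Suc k)"
        "\<And>z. z \<in> S \<Longrightarrow> skor_close T I d (emb (dsc (Suc n) (f w))) (emb z) \<Longrightarrow> z \<in> U"
        by (auto simp: V_def)
      have "skor_close T I (1 / real (Suc k)) (emb (dsc (Suc n) (f w))) (emb (f w))"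
        by (rule skor_close_sym, rule m') (simp add: n_def)
      from skor_close_mono[OF this, of d] d(1) show "f w \<in> U" by (intro d(2) fS) auto
    qed
  qed
  also have "\<dots> \<in> sets N"
    by (intro sets.sets_Collect_countable_Ex sets.sets_Collect_countable_All sets.sets_Collect_imp
        sets.sets_Collect_const measurable_dsc f ev V) auto
  finally show "f -` U \<inter> space N \<in> sets N" by (simp add: vimage_def Int_def conj_commute)
qed

text \<open>Evaluation at \<open>t < T\<close> need not be continuous, but exceeding a level
  somewhere in \<open>(t, r)\<close> is an open condition. Right continuity expresses the value at
  \<open>t\<close> by countably many such conditions. At \<open>T\<close> evaluation is continuous,
  because time changes fix \<open>T\<close>.\<close>

lemma measurable_eval:
  assumes i: "i \<in> I" and t: "t \<in> {0..T}"
  shows "(\<lambda>x. emb x i t) \<in> borel_measurable B"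
proof -
  \<comment> \<open>The value at \<open>s\<close> reappears, up to \<open>h\<close>, at time
    \<open>l s\<close>, which is near \<open>s\<close> and equals \<open>T\<close> if
    \<open>s = T\<close>.\<close>
  have nbh: "\<exists>e>0. \<forall>y\<in>S. skor_close T I e (emb x) (emb y) \<longrightarrow> (\<exists>r\<in>{0..T}. s - h < r \<and> r < s + h \<and> (s = T \<longrightarrow> r = T) \<and> \<bar>emb x i s - emb y i r\<bar> < h)"
    if s: "s \<in> {0..T}" and h: "h > 0" for s h x
  proof (intro exI[of _ "h/2"] conjI ballI impI)
    fix y assume "y \<in> S" "skor_close T I (h/2) (emb x) (emb y)"
    then obtain l where l: "l \<in> time_changes T" "\<And>t. t \<in> {0..T} \<Longrightarrow> \<bar>l t - t\<bar> \<le> h/2"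
      "\<And>t. t \<in> {0..T} \<Longrightarrow> \<bar>emb x i t - emb y i (l t)\<bar> \<le> h/2"
      using i unfolding skor_close_def by blast
    show "\<exists>r\<in>{0..T}. s - h < r \<and> r < s + h \<and> (s = T \<longrightarrow> r = T) \<and> \<bar>emb x i s - emb y i r\<bar> < h"
    proof (rule bexI[of _ "l s"])
      have "\<bar>l s - s\<bar> < h" "\<bar>emb x i s - emb y i (l s)\<bar> < h" using l(2)[OF s] l(3)[OF s] h by linarith+
      then show "s - h < l s \<and> l s < s + h \<and> (s = T \<longrightarrow> l s = T) \<and> \<bar>emb x i s - emb y i (l s)\<bar> < h"
        using time_changes_T[OF l(1)] T by auto
    qed (rule time_changes_range[OF l(1) s])
  qed (use h in auto)
  have "{x \<in> space B. emb x i t < a} \<in> sets B" for a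
  proof (cases "t = T")
    case True
    have "opn {x \<in> S. emb x i t < a}" unfolding opn_def
    proof (intro conjI ballI)
      fix x assume x: "x \<in> {x \<in> S. emb x i t < a}"
      then obtain e where e: "e > 0" "\<And>y. y \<in> S \<Longrightarrow> skor_close T I e (emb x) (emb y) \<Longrightarrow>
          \<exists>r\<in>{0..T}. (t = T \<longrightarrow> r = T) \<and> \<bar>emb x i t - emb y i r\<bar> < a - emb x i t"
        using nbh[OF t, of "a - emb x i t" x] by (auto simp: Bex_def) meson
      show "\<exists>e>0. \<forall>y\<in>S. skor_close T I e (emb x) (emb y) \<longrightarrow> y \<in> {x \<in> S. emb x i t < a}"
        using e True by (intro exI[of _ e]) force
    qed auto
    then show ?thesis by (simp add: opn_sets space_B)
  next
    case False
    then have tT: "0 \<le> t" "t < T" using t by auto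
    define O1 where "O1 r c = {x \<in> S. \<exists>s\<in>{0..T}. t < s \<and> s < r \<and> c < emb x i s}" for r c
    have O1: "opn (O1 r c)" for r c unfolding opn_def
    proof (intro conjI ballI)
      fix x assume "x \<in> O1 r c"
      then obtain s where s: "s \<in> {0..T}" "t < s" "s < r" "c < emb x i s" by (auto simp: O1_def)
      define h where "h = min (s - t) (min (r - s) (emb x i s - c))"
      have "0 < h" using s by (simp add: h_def)
      from nbh[OF s(1) this, of x] obtain e where e: "e > 0" and ey: "\<And>y. y \<in> S \<Longrightarrow> skor_close T I e (emb x) (emb y) \<Longrightarrow>
          \<exists>q\<in>{0..T}. s - h < q \<and> q < s + h \<and> \<bar>emb x i s - emb y i q\<bar> < h" by blast
      show "\<exists>e>0. \<forall>y\<in>S. skor_close T I e (emb x) (emb y) \<longrightarrow> y \<in> O1 r c"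
      proof (intro exI[of _ e] conjI e ballI impI)
        fix y assume y: "y \<in> S" "skor_close T I e (emb x) (emb y)"
        obtain q where "q \<in> {0..T}" "s - h < q" "q < s + h" "\<bar>emb x i s - emb y i q\<bar> < h" using ey[OF y] by blast
        then show "y \<in> O1 r c" unfolding O1_def using y(1)
          by (intro CollectI conjI bexI[of _ q]) (auto simp: h_def)
      qed
    qed (auto simp: O1_def)
    \<comment> \<open>By right continuity the value at \<open>t\<close> is below \<open>a\<close>
      iff the path stays below some \<open>a - 1 / real (Suc k)\<close> on a short interval to the
      right of \<open>t\<close>. The gap is needed because weak inequalities survive the limit and
      strict ones do not.\<close>
    have "{x \<in> space B. emb x i t < a} = (\<Union>k::nat. \<Union>m::nat. space B - O1 (t + 1 / real (Suc m)) (a - 1 / real (Suc k)))"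
    proof (intro set_eqI iffI)
      fix x assume "x \<in> {x \<in> space B. emb x i t < a}"
      then have x: "x \<in> S" "emb x i t < a" by (auto simp: space_B)
      obtain k :: nat where k: "1 / real (Suc k) < a - emb x i t" using x nat_approx_posE[of "a - emb x i t"] by auto
      have "(emb x i \<longlongrightarrow> emb x i t) (at_right t)" using cadlag_right[OF emb[OF x(1) i]] tT by simp
      then have "\<forall>\<^sub>F s in at_right t. emb x i s < a - 1 / real (Suc k)"
        using k by (intro order_tendstoD) auto
      then obtain b where b: "b > t" "\<And>s. t < s \<Longrightarrow> s < b \<Longrightarrow> emb x i s < a - 1 / real (Suc k)"
        unfolding eventually_at_right_field by auto
      obtain m :: nat where m: "1 / real (Suc m) < b - t" using b nat_approx_posE[of "b - t"] by auto
      have "x \<notin> O1 (t + 1 / real (Suc m)) (a - 1 / real (Suc k))"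
      proof
        assume "x \<in> O1 (t + 1 / real (Suc m)) (a - 1 / real (Suc k))"
        then obtain s where s: "t < s" "s < t + 1 / real (Suc m)" "a - 1 / real (Suc k) < emb x i s"
          by (auto simp: O1_def)
        then have "s < b" using m by linarith
        from b(2)[OF s(1) this] s(3) show False by simp
      qed
      then show "x \<in> (\<Union>k::nat. \<Union>m::nat. space B - O1 (t + 1 / real (Suc m)) (a - 1 / real (Suc k)))"
        using x by (auto simp: space_B)
    next
      fix x assume "x \<in> (\<Union>k::nat. \<Union>m::nat. space B - O1 (t + 1 / real (Suc m)) (a - 1 / real (Suc k)))"
      then obtain k m where x: "x \<in> S" "x \<notin> O1 (t + 1 / real (Suc m)) (a - 1 / real (Suc k))"
        by (auto simp: space_B)
      have lim: "(emb x i \<longlongrightarrow> emb x i t) (at_right t)" using cadlag_right[OF emb[OF x(1) i]] tT by simp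
      have "\<forall>\<^sub>F s in at_right t. emb x i s \<le> a - 1 / real (Suc k)"
        unfolding eventually_at_right_field
      proof (intro exI[of _ "min T (t + 1 / real (Suc m))"] conjI allI impI)
        fix s assume s: "t < s" "s < min T (t + 1 / real (Suc m))"
        have "s \<in> {0..T}" using s tT by simp
        with x s show "emb x i s \<le> a - 1 / real (Suc k)" by (force simp: O1_def simp del: of_nat_Suc)
      qed (use tT in auto)
      then have "emb x i t \<le> a - 1 / real (Suc k)"
        by (rule tendsto_upperbound[OF lim]) simp
      moreover have "1 / real (Suc k) > 0" by simp
      ultimately have "emb x i t < a" by linarith
      then show "x \<in> {x \<in> space B. emb x i t < a}" using x by (simp add: space_B)
    qed
    also have "\<dots> \<in> sets B" using opn_sets[OF O1] by (intro sets.countable_UN') auto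
    finally show ?thesis .
  qed
  then show ?thesis by (simp add: borel_measurable_iff_less)
qed

end


section \<open>Measurability criteria for path spaces\<close>

lemma skor_space_D_fam:
  "finite I \<Longrightarrow> 0 < T \<Longrightarrow> skor_space T I (cadlag_fam T I) (\<lambda>x. x) (\<lambda>n x. \<lambda>i\<in>I. discretise T n (x i))"
  by unfold_locales (auto simp: cadlag_fam_def discretise_cadlag)

lemma skor_space_D_real:
  "0 < T \<Longrightarrow> skor_space T {()} (cadlag T) (\<lambda>x _. x) (discretise T)"
  by unfold_locales (auto simp: discretise_cadlag)

lemma D_fam_eq_B: 
  assumes "finite I" "0 < T"
  shows "D_fam T I = skor_space.B T I (cadlag_fam T I) (\<lambda>x. x)"
  unfolding D_fam_def skor_space.B_def[OF skor_space_D_fam[OF assms]] ..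

lemma D_real_eq_B: 
  assumes "0 < T"
  shows "D_real T = skor_space.B T {()} (cadlag T) (\<lambda>x _. x)"
  unfolding D_real_def skor_space.B_def[OF skor_space_D_real[OF assms]] ..

text \<open>With this criterion elements of \<open>path_space\<close>, a product of one-dimensional
  algebras, can be passed to coefficients that are measurable for the joint J1 algebra.\<close>

lemma measurable_D_famI:
  assumes "finite I" "0 < T" "\<And>w. w \<in> space N \<Longrightarrow> f w \<in> cadlag_fam T I"
    "\<And>i t. i \<in> I \<Longrightarrow> t \<in> {0..T} \<Longrightarrow> (\<lambda>w. f w i t) \<in> borel_measurable N"
  shows "f \<in> N \<rightarrow>\<^sub>M D_fam T I"
  unfolding D_fam_eq_B[OF assms(1,2)]
  by (rule skor_space.measurable_B[OF skor_space_D_fam]) (use assms in auto)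

lemma measurable_D_realI:
  assumes "0 < T" "\<And>w. w \<in> space N \<Longrightarrow> f w \<in> cadlag T"
    "\<And>t. t \<in> {0..T} \<Longrightarrow> (\<lambda>w. f w t) \<in> borel_measurable N"
  shows "f \<in> N \<rightarrow>\<^sub>M D_real T"
  unfolding D_real_eq_B[OF assms(1)]
  by (rule skor_space.measurable_B[OF skor_space_D_real]) (use assms in auto)

lemma measurable_D_real_eval:
  assumes "0 < T" "f \<in> N \<rightarrow>\<^sub>M D_real T" "t \<in> {0..T}"
  shows "(\<lambda>w. f w t) \<in> borel_measurable N"
proof -
  have "(\<lambda>x. x t) \<in> borel_measurable (D_real T)"
    unfolding D_real_eq_B[OF assms(1)]
    by (rule skor_space.measurable_eval[OF skor_space_D_real]) (use assms in auto)
  from measurable_compose[OF assms(2) this] show ?thesis .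
qed

lemma space_D_real: "0 < T \<Longrightarrow> space (D_real T) = cadlag T"
  by (simp add: D_real_eq_B skor_space.space_B[OF skor_space_D_real])

lemma space_path_space: "0 < T \<Longrightarrow> space (path_space T A) = cadlag_fam T A"
  by (simp add: path_space_def space_PiM cadlag_fam_def space_D_real)

lemma cadlag_famD: "x \<in> cadlag_fam T A \<Longrightarrow> a \<in> A \<Longrightarrow> x a \<in> cadlag T"
  by (auto simp: cadlag_fam_def)

lemma cadlag_fam_restrict: "x \<in> cadlag_fam T A \<Longrightarrow> B \<subseteq> A \<Longrightarrow> restrict x B \<in> cadlag_fam T B"
  by (auto simp: cadlag_fam_def)

lemma measurable_path_spaceI:
  assumes "0 < T" "\<And>w. w \<in> space N \<Longrightarrow> f w \<in> cadlag_fam T A"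
    "\<And>a t. a \<in> A \<Longrightarrow> t \<in> {0..T} \<Longrightarrow> (\<lambda>w. f w a t) \<in> borel_measurable N"
  shows "f \<in> N \<rightarrow>\<^sub>M path_space T A"
  unfolding path_space_def
proof (rule measurable_PiM_single')
  fix a assume a: "a \<in> A"
  show "(\<lambda>w. f w a) \<in> N \<rightarrow>\<^sub>M D_real T"
    by (rule measurable_D_realI) (use assms a in \<open>auto intro: cadlag_famD\<close>)
qed (use assms in \<open>auto simp: space_D_real cadlag_fam_def\<close>)

lemma measurable_path_space_component: "f \<in> N \<rightarrow>\<^sub>M path_space T A \<Longrightarrow> a \<in> A \<Longrightarrow> (\<lambda>w. f w a) \<in> N \<rightarrow>\<^sub>M D_real T"
  unfolding path_space_def by (rule measurable_compose[OF _ measurable_component_singleton])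

lemma measurable_path_space_eval:
  "0 < T \<Longrightarrow> f \<in> N \<rightarrow>\<^sub>M path_space T A \<Longrightarrow> a \<in> A \<Longrightarrow> t \<in> {0..T} \<Longrightarrow> (\<lambda>w. f w a t) \<in> borel_measurable N"
  by (rule measurable_D_real_eval[OF _ measurable_path_space_component])

lemma measurable_path_space_in: "0 < T \<Longrightarrow> f \<in> N \<rightarrow>\<^sub>M path_space T A \<Longrightarrow> w \<in> space N \<Longrightarrow> f w \<in> cadlag_fam T A"
  using measurable_space[of f N "path_space T A" w] by (simp add: space_path_space)

lemma measurable_path_space_components:
  assumes "0 < T" "\<And>w. w \<in> space N \<Longrightarrow> f w \<in> extensional A"
    "\<And>a. a \<in> A \<Longrightarrow> (\<lambda>w. f w a) \<in> N \<rightarrow>\<^sub>M D_real T"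
  shows "f \<in> N \<rightarrow>\<^sub>M path_space T A"
  unfolding path_space_def
  by (rule measurable_PiM_single') (use assms measurable_space[OF assms(3)] in \<open>auto simp: PiE_def\<close>)

lemma measurable_restrict_path [measurable (raw)]:
  assumes "f \<in> N \<rightarrow>\<^sub>M path_space T A" "B \<subseteq> A"
  shows "(\<lambda>w. restrict (f w) B) \<in> N \<rightarrow>\<^sub>M path_space T B"
  using measurable_compose[OF assms(1)[unfolded path_space_def] measurable_restrict_subset[OF assms(2)]]
  by (simp add: path_space_def)

lemma cadlag_add:
  assumes "x \<in> cadlag T" "y \<in> cadlag T" shows "(\<lambda>t\<in>{0..T}. x t + y t) \<in> cadlag T"
  unfolding cadlag_def
proof (intro CollectI conjI ballI)
  fix t assume t: "t \<in> {0..<T}"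
  have "\<forall>\<^sub>F s in at_right t. t < s \<and> s < T" using t by (auto simp: eventually_at_right_field)
  then have "\<forall>\<^sub>F s in at_right t. x s + y s = (\<lambda>t\<in>{0..T}. x t + y t) s"
    by eventually_elim (use t in auto)
  moreover have "((\<lambda>s. x s + y s) \<longlongrightarrow> x t + y t) (at_right t)"
    using assms t by (intro tendsto_add) (auto simp: cadlag_def)
  ultimately show "((\<lambda>t\<in>{0..T}. x t + y t) \<longlongrightarrow> (\<lambda>t\<in>{0..T}. x t + y t) t) (at_right t)"
    using t by (auto intro: Lim_transform_eventually)
next
  fix t assume t: "t \<in> {0<..T}"
  have "\<forall>\<^sub>F s in at_left t. 0 < s \<and> s < t" using t by (auto simp: eventually_at_left_field)
  then have ev: "\<forall>\<^sub>F s in at_left t. x s + y s = (\<lambda>t\<in>{0..T}. x t + y t) s"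
    by eventually_elim (use t in auto)
  obtain l l' where "(x \<longlongrightarrow> l) (at_left t)" "(y \<longlongrightarrow> l') (at_left t)" using assms t unfolding cadlag_def by blast
  from Lim_transform_eventually[OF tendsto_add[OF this] ev]
  show "\<exists>l. ((\<lambda>t\<in>{0..T}. x t + y t) \<longlongrightarrow> l) (at_left t)" by blast
qed simp

section \<open>Countable determination of paths and kernels\<close>

definition qtimes :: "real \<Rightarrow> real set" where
  "qtimes T = insert T (\<rat> \<inter> {0..T})"

lemma countable_qtimes: "countable (qtimes T)"
  by (simp add: qtimes_def countable_Int1 countable_rat)

lemma qtimes_sub: "0 < T \<Longrightarrow> qtimes T \<subseteq> {0..T}"
  by (auto simp: qtimes_def)

text \<open>Every time before \<open>T\<close> is approached from the right by rational times. No
  time of \<open>[0,T]\<close> lies to the right of \<open>T\<close>, which is why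
  \<open>qtimes\<close> contains \<open>T\<close> explicitly.\<close>

lemma qtimes_seq:
  assumes "0 \<le> t" "t < T"
  obtains r where "\<And>n::nat. r n \<in> qtimes T" "filterlim r (at_right t) sequentially"
proof -
  have "\<exists>q. q \<in> \<rat> \<and> t < q \<and> q < min T (t + 1 / real (Suc n))" for n
    using Rats_dense_in_real[of t "min T (t + 1 / real (Suc n))"] assms by auto
  then obtain r where r: "\<And>n. r n \<in> \<rat> \<and> t < r n \<and> r n < min T (t + 1 / real (Suc n))" by metis
  show ?thesis
  proof
    show "r n \<in> qtimes T" for n using r[of n] assms by (auto simp: qtimes_def)
    have "(\<lambda>n. t + 1 / real (Suc n)) \<longlonglongrightarrow> t + 0"
      by (intro tendsto_add tendsto_const LIMSEQ_Suc lim_1_over_n)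
    then have "r \<longlonglongrightarrow> t"
      by (intro real_tendsto_sandwich[of "\<lambda>_. t" r _ "\<lambda>n. t + 1 / real (Suc n)"]) 
         (use r in \<open>auto intro!: always_eventually less_imp_le simp del: of_nat_Suc\<close>)
    then show "filterlim r (at_right t) sequentially"
      using r by (auto simp: filterlim_at intro!: always_eventually)
  qed
qed

lemma cadlag_seq:
  assumes "x \<in> cadlag T" "0 \<le> t" "t < T" "filterlim r (at_right t) sequentially"
  shows "(\<lambda>n. x (r n)) \<longlonglongrightarrow> x t"
  using filterlim_compose[OF cadlag_right[OF assms(1-3)] assms(4)] .

lemma cadlag_eq_qtimes:
  assumes "0 < T" "x \<in> cadlag T" "y \<in> cadlag T" "\<And>t. t \<in> qtimes T \<Longrightarrow> x t = y t"
  shows "x = y"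
proof (rule cadlag_eqI[OF assms(2,3)])
  fix t assume t: "t \<in> {0..T}"
  show "x t = y t"
  proof (cases "t = T")
    case False
    with t have tT: "0 \<le> t" "t < T" by auto
    obtain r where r: "\<And>n::nat. r n \<in> qtimes T" "filterlim r (at_right t) sequentially" 
      using qtimes_seq[OF tT] by metis
    have "(\<lambda>n. x (r n)) \<longlonglongrightarrow> x t" "(\<lambda>n. y (r n)) \<longlonglongrightarrow> y t"
      using cadlag_seq[OF _ tT r(2)] assms by auto
    then show ?thesis using assms(4) r(1) by (auto intro: LIMSEQ_unique)
  qed (use assms(4) in \<open>auto simp: qtimes_def\<close>)
qed

text \<open>Cadlag paths coincide once they coincide at countably many times, so coincidence is an
  event. This measurability underlies every exchange of almost-sure quantifiers over equations or
  representations below.\<close>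

lemma pred_eq_D_real:
  assumes T: "0 < T" and f: "f \<in> N \<rightarrow>\<^sub>M D_real T" and g: "g \<in> N \<rightarrow>\<^sub>M D_real T"
  shows "{w \<in> space N. f w = g w} \<in> sets N"
proof -
  have "{w \<in> space N. f w = g w} = {w \<in> space N. \<forall>t\<in>qtimes T. f w t = g w t}"
    using cadlag_eq_qtimes[OF T, of "f _" "g _"] measurable_space[OF f] measurable_space[OF g]
    by (auto simp: space_D_real[OF T])
  also have "\<dots> \<in> sets N"
  proof (rule sets.sets_Collect_countable_All'[OF _ countable_qtimes])
    fix t assume "t \<in> qtimes T"
    then have [measurable]: "(\<lambda>w. f w t) \<in> borel_measurable N" "(\<lambda>w. g w t) \<in> borel_measurable N"
      using measurable_D_real_eval[OF T] f g qtimes_sub[OF T] by blast+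
    show "{w \<in> space N. f w t = g w t} \<in> sets N" by measurable
  qed
  finally show ?thesis .
qed

lemma pred_eq_path_space:
  assumes T: "0 < T" and A: "finite A" and f: "f \<in> N \<rightarrow>\<^sub>M path_space T A" and g: "g \<in> N \<rightarrow>\<^sub>M path_space T A"
  shows "{w \<in> space N. f w = g w} \<in> sets N"
proof -
  have "{w \<in> space N. f w = g w} = {w \<in> space N. \<forall>a\<in>A. f w a = g w a}"
  proof (intro Collect_cong conj_cong refl iffI)
    fix w assume w: "w \<in> space N" "\<forall>a\<in>A. f w a = g w a"
    then show "f w = g w"
      using measurable_path_space_in[OF T f w(1)] measurable_path_space_in[OF T g w(1)]
      unfolding cadlag_fam_def by (intro PiE_ext) auto
  qed auto
  also have "\<dots> \<in> sets N"
    by (rule sets.sets_Collect_finite_All[OF _ A])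
       (intro pred_eq_D_real[OF T] measurable_path_space_component[OF f] measurable_path_space_component[OF g])
  finally show ?thesis .
qed

text \<open>Rational bounds at the times of \<open>qtimes\<close> suffice: other times are right
  limits, and other bounds are limits of rational ones. Countability of the generator is what allows
  kernels to be compared up to one null set.\<close>

lemma path_space_generator:
  assumes T: "0 < T" and A: "finite A"
  obtains G where "countable G" "Int_stable G" "G \<subseteq> Pow (cadlag_fam T A)" "cadlag_fam T A \<in> G"
    "sets (path_space T A) = sigma_sets (cadlag_fam T A) G"
proof -
  define O1 where "O1 = cadlag_fam T A"
  define Bs where "Bs = (\<lambda>(a, t, q). {x \<in> O1. x a t \<le> q}) ` (A \<times> qtimes T \<times> \<rat>)"
  \<comment> \<open>Closing under finite intersections gives Int-stability; intersecting with
    \<open>O1\<close> turns the empty intersection into the whole space.\<close>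
  define G where "G = (\<lambda>F. O1 \<inter> \<Inter>F) ` {F. finite F \<and> F \<subseteq> Bs}"
  have "countable Bs" unfolding Bs_def 
    by (intro countable_image countable_SIGMA) (auto simp: countable_qtimes countable_rat A countable_finite)
  then have "countable G" unfolding G_def by (intro countable_image countable_Collect_finite_subset)
  moreover have "Int_stable G"
  proof (rule Int_stableI)
    fix a b assume "a \<in> G" "b \<in> G"
    then obtain F F' where "finite F" "F \<subseteq> Bs" "finite F'" "F' \<subseteq> Bs" "a = O1 \<inter> \<Inter>F" "b = O1 \<inter> \<Inter>F'"
      by (auto simp: G_def)
    then show "a \<inter> b \<in> G" unfolding G_def by (intro image_eqI[of _ _ "F \<union> F'"]) auto
  qed
  moreover have GP: "G \<subseteq> Pow O1" by (auto simp: G_def)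
  moreover have "O1 \<in> G" unfolding G_def by (intro image_eqI[of _ _ "{}"]) auto
  moreover have "sets (path_space T A) = sigma_sets O1 G"
  proof
    have [measurable]: "(\<lambda>x. x) \<in> path_space T A \<rightarrow>\<^sub>M path_space T A" by simp
    have Bs: "b \<in> sets (path_space T A)" if "b \<in> Bs" for b
    proof -
      obtain a t q where b: "a \<in> A" "t \<in> qtimes T" "b = {x \<in> O1. x a t \<le> q}" using \<open>b \<in> Bs\<close> by (auto simp: Bs_def)
      have "t \<in> {0..T}" using b(2) qtimes_sub[OF T] by blast
      then have [measurable]: "(\<lambda>x. x a t) \<in> borel_measurable (path_space T A)"
        using measurable_path_space_eval[OF T measurable_ident b(1)] by simp
      have "{x \<in> space (path_space T A). x a t \<le> q} \<in> sets (path_space T A)" by measurable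
      then show ?thesis unfolding b(3) O1_def space_path_space[OF T] .
    qed
    have O1s: "O1 \<in> sets (path_space T A)" unfolding O1_def using sets.top[of "path_space T A"] space_path_space[OF T] by metis
    have "O1 \<inter> \<Inter>F \<in> sets (path_space T A)" if "finite F" "F \<subseteq> Bs" for F
      using that
    proof (induction F rule: finite_induct)
      case (insert b F)
      then have "(O1 \<inter> \<Inter>F) \<inter> b \<in> sets (path_space T A)" using Bs by (simp add: sets.Int[of "O1 \<inter> \<Inter>F"])
      moreover have "(O1 \<inter> \<Inter>F) \<inter> b = O1 \<inter> \<Inter>(insert b F)" by auto
      ultimately show ?case by simp
    qed (use O1s in simp)
    then have "G \<subseteq> sets (path_space T A)" by (auto simp: G_def)
    then show "sigma_sets O1 G \<subseteq> sets (path_space T A)"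
      using sets.sigma_sets_subset[of G "path_space T A"] by (simp add: space_path_space[OF T] O1_def)
    let ?S = "sigma O1 G"
    have sp: "space ?S = O1" and se: "sets ?S = sigma_sets O1 G" using GP by auto
    have BG: "b \<in> G" if "b \<in> Bs" for b
      unfolding G_def using that by (intro image_eqI[of _ _ "{b}"]) (auto simp: Bs_def)
    have ev: "(\<lambda>x. x a t) \<in> borel_measurable ?S" if a: "a \<in> A" and t: "t \<in> qtimes T" for a t
    proof (rule borel_measurable_iff_le[THEN iffD2, rule_format])
      fix c :: real
      have "{x \<in> space ?S. x a t \<le> c} = space ?S \<inter> (\<Inter>q\<in>{q\<in>\<rat>. c \<le> q}. {x \<in> O1. x a t \<le> q})"
      proof (intro set_eqI iffI)
        fix x assume x: "x \<in> space ?S \<inter> (\<Inter>q\<in>{q\<in>\<rat>. c \<le> q}. {x \<in> O1. x a t \<le> q})"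
        have "x a t \<le> c"
        proof (rule ccontr)
          assume "\<not> x a t \<le> c"
          then obtain q where "q \<in> \<rat>" "c < q" "q < x a t" using Rats_dense_in_real[of c "x a t"] by auto
          with x show False by force
        qed
        with x show "x \<in> {x \<in> space ?S. x a t \<le> c}" by auto
      qed (auto simp: sp)
      also have "\<dots> \<in> sets ?S"
      proof -
        have ne: "{q\<in>\<rat>. c \<le> q} \<noteq> {}" using Rats_dense_in_real[of c "c+1"] by (auto intro: less_imp_le)
        have co: "countable {q\<in>\<rat>. c \<le> q}" by (rule countable_subset[OF _ countable_rat]) auto
        have "{x \<in> O1. x a t \<le> q} \<in> sets ?S" if "q \<in> \<rat>" for q
          unfolding se using a t that by (intro sigma_sets.Basic BG) (auto simp: Bs_def)
        then show ?thesis by (intro sets.Int sets.top sets.countable_INT'[OF co ne]) auto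
      qed
      finally show "{x \<in> space ?S. x a t \<le> c} \<in> sets ?S" .
    qed
    have "(\<lambda>x. x) \<in> ?S \<rightarrow>\<^sub>M path_space T A"
    proof (rule measurable_path_spaceI[OF T])
      fix a t assume a: "a \<in> A" and t: "t \<in> {0..T}"
      show "(\<lambda>x. x a t) \<in> borel_measurable ?S"
      proof (cases "t = T")
        case True then show ?thesis using ev[OF a] by (auto simp: qtimes_def)
      next
        case False
        then have tT: "0 \<le> t" "t < T" using t by auto
        obtain r where r: "\<And>n::nat. r n \<in> qtimes T" "filterlim r (at_right t) sequentially" 
          using qtimes_seq[OF tT] by metis
        show ?thesis
        proof (rule borel_measurable_LIMSEQ_real[of _ "\<lambda>n x. x a (r n)"])
          fix x assume "x \<in> space ?S"
          then have "x \<in> O1" by (simp only: sp)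
          then have "x \<in> cadlag_fam T A" by (simp only: O1_def)
          then show "(\<lambda>n. x a (r n)) \<longlonglongrightarrow> x a t" by (intro cadlag_seq[OF _ tT r(2)] cadlag_famD[OF _ a])
        qed (rule ev[OF a r(1)])
      qed
    qed (simp only: sp, simp only: O1_def)
    note idm = this
    have "sets (path_space T A) \<subseteq> sets ?S"
    proof
      fix E assume E: "E \<in> sets (path_space T A)"
      have "E \<subseteq> O1" using sets.sets_into_space[OF E] by (simp only: space_path_space[OF T] O1_def)
      moreover have "(\<lambda>x. x) -` E \<inter> O1 \<in> sets ?S" using measurable_sets[OF idm E] by (simp only: sp)
      ultimately show "E \<in> sets ?S" by (simp only: vimage_ident Int_absorb2)
    qed
    then show "sets (path_space T A) \<subseteq> sigma_sets O1 G" unfolding se .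
  qed
  ultimately show ?thesis using that unfolding O1_def by blast
qed

text \<open>Countably many null sets, one for each set of the generator, unite to a null set, and
  probability measures that agree on an Int-stable generator are equal. All three rules are reduced
  in this way to a fixed event \<open>E\<close>.\<close>

lemma AE_kernel_eqI:
  assumes T: "0 < T" and A: "finite A"
    and k: "\<kappa> \<in> N \<rightarrow>\<^sub>M prob_algebra (path_space T A)" "\<kappa>' \<in> N \<rightarrow>\<^sub>M prob_algebra (path_space T A)"
    and sp: "space \<mu> = space N"
    and eq: "\<And>E. E \<in> sets (path_space T A) \<Longrightarrow> AE z in \<mu>. emeasure (\<kappa> z) E = emeasure (\<kappa>' z) E"
  shows "AE z in \<mu>. \<kappa> z = \<kappa>' z"
proof -
  obtain G where G: "countable G" "Int_stable G" "G \<subseteq> Pow (cadlag_fam T A)" "cadlag_fam T A \<in> G"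
    "sets (path_space T A) = sigma_sets (cadlag_fam T A) G" using path_space_generator[OF T A] by blast
  have "AE z in \<mu>. \<forall>E\<in>G. emeasure (\<kappa> z) E = emeasure (\<kappa>' z) E"
    using G by (subst AE_ball_countable) (auto intro!: eq)
  then show ?thesis using AE_space
  proof eventually_elim
    fix z assume eq: "\<forall>E\<in>G. emeasure (\<kappa> z) E = emeasure (\<kappa>' z) E" and z: "z \<in> space \<mu>"
    have "\<kappa> z \<in> space (prob_algebra (path_space T A))" "\<kappa>' z \<in> space (prob_algebra (path_space T A))"
      using measurable_space[OF k(1)] measurable_space[OF k(2)] z sp by auto
    then have s: "sets (\<kappa> z) = sets (path_space T A)" "sets (\<kappa>' z) = sets (path_space T A)"
      and p: "prob_space (\<kappa> z)" by (auto simp: space_prob_algebra)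
    interpret prob_space "\<kappa> z" by (rule p)
    show "\<kappa> z = \<kappa>' z"
      by (rule measure_eqI_generator_eq[OF G(2,3), where A="\<lambda>_. cadlag_fam T A"])
         (use eq s G in auto)
  qed
qed


section \<open>Adapted maps\<close>

lemma stop_path_cadlag:
  assumes "x \<in> cadlag T" "t \<in> {0..T}" shows "stop_path T t x \<in> cadlag T"
  unfolding cadlag_def
proof (intro CollectI conjI ballI)
  fix s assume s: "s \<in> {0..<T}"
  show "(stop_path T t x \<longlongrightarrow> stop_path T t x s) (at_right s)"
  proof (cases "s < t")
    case True
    then have "\<forall>\<^sub>F r in at_right s. s < r \<and> r < t" by (auto simp: eventually_at_right_field)
    then have "\<forall>\<^sub>F r in at_right s. x r = stop_path T t x r"
      by eventually_elim (use s assms in \<open>auto simp: stop_path_def\<close>)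
    moreover have "stop_path T t x s = x s" using True s by (simp add: stop_path_def)
    ultimately show ?thesis using cadlag_right[OF assms(1), of s] s by (auto intro: Lim_transform_eventually)
  next
    case False
    have "\<forall>\<^sub>F r in at_right s. s < r \<and> r < T" using s by (auto simp: eventually_at_right_field)
    then have "\<forall>\<^sub>F r in at_right s. stop_path T t x r = stop_path T t x s"
      by eventually_elim (use s False in \<open>auto simp: stop_path_def min_def\<close>)
    then show ?thesis by (rule tendsto_eventually)
  qed
next
  fix s assume s: "s \<in> {0<..T}"
  show "\<exists>l. (stop_path T t x \<longlongrightarrow> l) (at_left s)"
  proof (cases "s \<le> t")
    case True
    obtain l where l: "(x \<longlongrightarrow> l) (at_left s)" using cadlag_left[OF assms(1), of s] s by auto
    have "\<forall>\<^sub>F r in at_left s. 0 < r \<and> r < s" using s by (auto simp: eventually_at_left_field)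
    then have "\<forall>\<^sub>F r in at_left s. x r = stop_path T t x r"
      by eventually_elim (use s True in \<open>auto simp: stop_path_def\<close>)
    with l show ?thesis by (auto intro: Lim_transform_eventually)
  next
    case False
    have "\<forall>\<^sub>F r in at_left s. max 0 t < r \<and> r < s" using s False unfolding eventually_at_left_field
      by (intro exI[of _ "max 0 t"]) auto
    then have "\<forall>\<^sub>F r in at_left s. stop_path T t x r = x t"
      by eventually_elim (use s False in \<open>auto simp: stop_path_def min_def\<close>)
    then show ?thesis by (blast intro: tendsto_eventually)
  qed
qed (simp add: stop_path_def)

lemma stop_fam_cadlag: "x \<in> cadlag_fam T A \<Longrightarrow> t \<in> {0..T} \<Longrightarrow> stop_fam T A t x \<in> cadlag_fam T A"
  unfolding stop_fam_def cadlag_fam_def restrict_PiE_iff by (blast intro: stop_path_cadlag)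

lemma stop_fam_stop_fam:
  assumes "0 \<le> s" "s \<le> t" "t \<le> T"
  shows "stop_fam T A s (stop_fam T A t x) = stop_fam T A s x"
  unfolding stop_fam_def stop_path_def
proof (rule restrict_ext, rule restrict_ext)
  fix i r assume i: "i \<in> A" and r: "r \<in> {0..T}"
  have "min r s \<in> {0..T}" "min (min r s) t = min r s" using r assms by auto
  then show "(\<lambda>i\<in>A. \<lambda>s\<in>{0..T}. x i (min s t)) i (min r s) = x i (min r s)" using i by simp
qed

definition adp :: "real \<Rightarrow> 'i set \<Rightarrow> (('i \<Rightarrow> path) \<Rightarrow> path) \<Rightarrow> bool" where
  "adp T A h \<longleftrightarrow> (\<forall>t\<in>{0..T}. \<forall>x\<in>cadlag_fam T A. h x t = h (stop_fam T A t x) t)"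

lemma meas_adapted_map_iff:
  "meas_adapted_map T A B \<phi> \<longleftrightarrow> \<phi> \<in> path_space T A \<rightarrow>\<^sub>M path_space T B \<and> (\<forall>b\<in>B. adp T A (\<lambda>x. \<phi> x b))"
  unfolding meas_adapted_map_def adp_def by (simp only: Ball_def) metis

lemma adp_const: "adp T A (\<lambda>_. c)"
  by (simp add: adp_def)

lemma adp_proj: "a \<in> A \<Longrightarrow> adp T A (\<lambda>x. x a)"
  by (simp add: adp_def stop_fam_def stop_path_def)

text \<open>Adaptedness speaks of the output at the stopping time alone. Applied at every
  \<open>u = min s t\<close>, it controls the whole output up to \<open>t\<close>, which is the form
  that composes.\<close>

lemma adp_stop_fam:
  assumes "\<And>b. b \<in> B \<Longrightarrow> adp T A (\<lambda>x. \<psi> x b)" "t \<in> {0..T}" "x \<in> cadlag_fam T A"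
  shows "stop_fam T B t (\<psi> (stop_fam T A t x)) = stop_fam T B t (\<psi> x)"
  unfolding stop_fam_def[of T B] stop_path_def
proof (intro restrict_ext)
  fix b s assume b: "b \<in> B" and s: "s \<in> {0..T}"
  define u where "u = min s t"
  have u: "u \<in> {0..T}" "u \<le> t" using s assms(2) by (auto simp: u_def)
  have "\<psi> (stop_fam T A t x) b u = \<psi> (stop_fam T A u (stop_fam T A t x)) b u"
    using assms(1)[OF b] u(1) stop_fam_cadlag[OF assms(3,2)] unfolding adp_def by blast
  also have "\<dots> = \<psi> (stop_fam T A u x) b u" using u assms(2) by (simp add: stop_fam_stop_fam)
  also have "\<dots> = \<psi> x b u" using assms(1)[OF b] u(1) assms(3) unfolding adp_def by metis
  finally show "\<psi> (stop_fam T A t x) b (min s t) = \<psi> x b (min s t)" by (simp add: u_def)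
qed

lemma adp_compose2:
  assumes I: "\<And>t x y. t \<in> {0..T} \<Longrightarrow> x \<in> cadlag_fam T B \<Longrightarrow> y \<in> cadlag_fam T B' \<Longrightarrow> 
      I (x, y) v t = I (stop_fam T B t x, stop_fam T B' t y) v t"
    and \<psi>: "\<And>b. b \<in> B \<Longrightarrow> adp T A (\<lambda>x. \<psi> x b)" "\<And>x. x \<in> cadlag_fam T A \<Longrightarrow> \<psi> x \<in> cadlag_fam T B"
    and \<zeta>: "\<And>b. b \<in> B' \<Longrightarrow> adp T A (\<lambda>x. \<zeta> x b)" "\<And>x. x \<in> cadlag_fam T A \<Longrightarrow> \<zeta> x \<in> cadlag_fam T B'"
  shows "adp T A (\<lambda>x. I (\<psi> x, \<zeta> x) v)"
  unfolding adp_def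
proof (intro ballI)
  fix t x assume t: "t \<in> {0..T}" and x: "x \<in> cadlag_fam T A"
  note x' = stop_fam_cadlag[OF x t]
  have "I (\<psi> (stop_fam T A t x), \<zeta> (stop_fam T A t x)) v t
      = I (stop_fam T B t (\<psi> (stop_fam T A t x)), stop_fam T B' t (\<zeta> (stop_fam T A t x))) v t"
    by (intro I t \<psi>(2) \<zeta>(2) x')
  also have "\<dots> = I (stop_fam T B t (\<psi> x), stop_fam T B' t (\<zeta> x)) v t"
    using adp_stop_fam[of B T A \<psi> t x] adp_stop_fam[of B' T A \<zeta> t x] \<psi> \<zeta> t x by simp
  also have "\<dots> = I (\<psi> x, \<zeta> x) v t" by (rule I[symmetric]) (intro t \<psi>(2) \<zeta>(2) x)+
  finally show "I (\<psi> x, \<zeta> x) v t = I (\<psi> (stop_fam T A t x), \<zeta> (stop_fam T A t x)) v t" by simp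
qed

lemma meas_adapted_map_compose2:
  assumes T: "0 < T" and I: "meas_adapted_map2 T B B' V I"
    and \<psi>: "meas_adapted_map T A B \<psi>" and \<zeta>: "meas_adapted_map T A B' \<zeta>"
  shows "meas_adapted_map T A V (\<lambda>x. I (\<psi> x, \<zeta> x))"
  unfolding meas_adapted_map_iff
proof (intro conjI ballI)
  have m: "\<psi> \<in> path_space T A \<rightarrow>\<^sub>M path_space T B" "\<zeta> \<in> path_space T A \<rightarrow>\<^sub>M path_space T B'"
    "I \<in> path_space T B \<Otimes>\<^sub>M path_space T B' \<rightarrow>\<^sub>M path_space T V"
    using \<psi> \<zeta> I by (auto simp: meas_adapted_map_iff meas_adapted_map2_def)
  then show "(\<lambda>x. I (\<psi> x, \<zeta> x)) \<in> path_space T A \<rightarrow>\<^sub>M path_space T V"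
    by (intro measurable_compose[OF measurable_Pair m(3)])
  fix v assume v: "v \<in> V"
  show "adp T A (\<lambda>x. I (\<psi> x, \<zeta> x) v)"
  proof (rule adp_compose2)
    show "I (x, y) v t = I (stop_fam T B t x, stop_fam T B' t y) v t" 
      if "t \<in> {0..T}" "x \<in> cadlag_fam T B" "y \<in> cadlag_fam T B'" for t x y
      using I v that unfolding meas_adapted_map2_def by blast
  qed (use m \<psi> \<zeta> in \<open>auto simp: meas_adapted_map_iff measurable_path_space_in[OF T] space_path_space[OF T]\<close>)
qed

lemma meas_adapted_mapD:
  assumes "meas_adapted_map T A B \<phi>"
  shows "\<phi> \<in> path_space T A \<rightarrow>\<^sub>M path_space T B" "b \<in> B \<Longrightarrow> adp T A (\<lambda>x. \<phi> x b)"
    "b \<in> B \<Longrightarrow> (\<lambda>x. \<phi> x b) \<in> path_space T A \<rightarrow>\<^sub>M D_real T"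
proof -
  show 1: "\<phi> \<in> path_space T A \<rightarrow>\<^sub>M path_space T B" using assms by (simp add: meas_adapted_map_iff)
  show "adp T A (\<lambda>x. \<phi> x b)" if "b \<in> B" using assms that by (simp add: meas_adapted_map_iff)
  show "(\<lambda>x. \<phi> x b) \<in> path_space T A \<rightarrow>\<^sub>M D_real T" if "b \<in> B"
    by (rule measurable_path_space_component[OF 1 that])
qed

section \<open>The structural maps\<close>

lemma meas_cadlag_adapted_section:
  assumes "meas_cadlag_adapted T I f" "t \<in> {0..T}"
  shows "f t \<in> borel_measurable (D_fam T I)"
proof -
  have "(\<lambda>x. (t, x)) \<in> D_fam T I \<rightarrow>\<^sub>M restrict_space borel {0..T} \<Otimes>\<^sub>M D_fam T I"
    using assms(2) by (intro measurable_Pair measurable_const measurable_ident_sets[OF refl]) (simp add: space_restrict_space)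
  moreover have "(\<lambda>(t, x). f t x) \<in> borel_measurable (restrict_space borel {0..T} \<Otimes>\<^sub>M D_fam T I)"
    using assms(1) by (simp add: meas_cadlag_adapted_def)
  ultimately have "(\<lambda>x. (\<lambda>(t, x). f t x) (t, x)) \<in> borel_measurable (D_fam T I)" by (rule measurable_compose)
  then show ?thesis by simp
qed

lemma measurable_path_space_D_fam:
  assumes "0 < T" "finite I" "I \<subseteq> A"
  shows "(\<lambda>x. restrict x I) \<in> path_space T A \<rightarrow>\<^sub>M D_fam T I"
proof (rule measurable_D_famI[OF assms(2,1)])
  fix w assume "w \<in> space (path_space T A)"
  then show "restrict w I \<in> cadlag_fam T I" using assms by (auto simp: space_path_space intro: cadlag_fam_restrict)
next
  fix i t assume i: "i \<in> I" and t: "t \<in> {0..T}"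
  then have "i \<in> A" using assms(3) by auto
  from measurable_path_space_eval[OF assms(1) measurable_ident this t]
  show "(\<lambda>w. restrict w I i t) \<in> borel_measurable (path_space T A)" using i by simp
qed

lemma measurable_coeff_path:
  assumes T: "0 < T" and I: "finite I" "I \<subseteq> A" and f: "meas_cadlag_adapted T I f"
  shows "(\<lambda>x. \<lambda>t\<in>{0..T}. f t (restrict x I)) \<in> path_space T A \<rightarrow>\<^sub>M D_real T"
proof (rule measurable_D_realI[OF T])
  fix w assume "w \<in> space (path_space T A)"
  then have "restrict w I \<in> cadlag_fam T I" using T I by (auto simp: space_path_space intro: cadlag_fam_restrict)
  then show "(\<lambda>t\<in>{0..T}. f t (restrict w I)) \<in> cadlag T" using f unfolding meas_cadlag_adapted_def by blast
next
  fix t assume t: "t \<in> {0..T}"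
  from measurable_compose[OF measurable_path_space_D_fam[OF T I] meas_cadlag_adapted_section[OF f t]]
  show "(\<lambda>w. (\<lambda>t\<in>{0..T}. f t (restrict w I)) t) \<in> borel_measurable (path_space T A)" using t by simp
qed

text \<open>Non-constancy concerns one coordinate at a time, so \<open>x\<close> is turned into
  \<open>y\<close> coordinate by coordinate. A step changes nothing either because the coordinates
  agree or because \<open>f\<close> is constant in that coordinate. Finiteness of \<open>A\<close>
  makes the chain end at \<open>y\<close>.\<close>

lemma nonconst_in_cong:
  assumes "finite A" and x: "x \<in> cadlag_fam T A" and y: "y \<in> cadlag_fam T A" and t: "t \<in> {0..T}"
    and eq: "\<And>a. a \<in> A \<Longrightarrow> nonconst_in T A a f \<Longrightarrow> x a = y a"
  shows "f t x = f t y"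
proof -
  define z where "z S = (\<lambda>a\<in>A. if a \<in> S then y a else x a)" for S
  have zc: "z S \<in> cadlag_fam T A" for S using x y by (auto simp: z_def cadlag_fam_def)
  have "S \<subseteq> A \<Longrightarrow> f t x = f t (z S)" if "finite S" for S using that
  proof (induction S rule: finite_induct)
    case empty
    have "z {} = x" using x by (auto simp: z_def cadlag_fam_def PiE_def extensional_restrict)
    then show ?case by simp
  next
    case (insert u S)
    have "f t (z S) = f t (z (insert u S))"
    proof (cases "nonconst_in T A u f")
      case True
      then have "z S = z (insert u S)" using eq[of u] insert.prems by (auto simp: z_def)
      then show ?thesis by simp
    next
      case False
      moreover have "\<forall>a\<in>A - {u}. z S a = z (insert u S) a" by (auto simp: z_def)
      ultimately show ?thesis using t zc unfolding nonconst_in_def by blast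
    qed
    with insert show ?case by simp
  qed
  from this[OF \<open>finite A\<close>] have "f t x = f t (z A)" by simp
  moreover have "z A = y" using y by (auto simp: z_def cadlag_fam_def PiE_def extensional_restrict cong: restrict_cong)
  ultimately show ?thesis by simp
qed

section \<open>Measurability and locality of the structural equations\<close>

locale sde_context = usual_filtered_prob_space M F T
  for M :: "'a measure" and F and T +
  fixes \<Psi> :: "nat \<Rightarrow> (nat \<Rightarrow> path) \<times> (nat \<Rightarrow> path) \<Rightarrow> path"
    and D :: "('n, 'a) causal_sde"
  assumes ito: "ito_map M F T \<Psi>"
    and sys: "causal_sde_system M F T D"
    and solv: "\<And>U. U \<subseteq> endo D \<Longrightarrow> ess_uniquely_solvable M T \<Psi> D U"
begin

abbreviation "V \<equiv> endo D"
abbreviation "W \<equiv> exo D"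
abbreviation "PS \<equiv> path_space T"

lemma fin: "finite V" "finite W" "V \<inter> W = {}"
  using sys unfolding causal_sde_system_def by blast+

lemma fin_sub: "A \<subseteq> V \<Longrightarrow> finite A" "A \<subseteq> W \<Longrightarrow> finite A"
  by (fact finite_subset[OF _ fin(1)]) (fact finite_subset[OF _ fin(2)])

lemma coeff:
  assumes "v \<in> V"
  shows "args_f D v \<subseteq> V \<union> W" "args_g D v \<subseteq> V \<union> W" "args_h D v \<subseteq> W"
    "meas_cadlag_adapted T (args_f D v) (coeff_f D v)"
    "k < dim D v \<Longrightarrow> meas_cadlag_adapted T (insert v (args_g D v)) (\<lambda>t x. coeff_g D v t x k)"
    "k < dim D v \<Longrightarrow> meas_cadlag_adapted T (args_h D v) (\<lambda>t x. coeff_h D v t x k)"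
  using sys assms unfolding causal_sde_system_def by (simp_all, blast)

lemma fin_args:
  assumes "v \<in> V"
  shows "finite (args_f D v)" "finite (insert v (args_g D v))" "finite (args_h D v)"
proof -
  have "finite (V \<union> W)" using fin by simp
  then show "finite (args_f D v)" "finite (insert v (args_g D v))"
    using finite_subset[OF coeff(1)[OF assms]] finite_subset[OF coeff(2)[OF assms]] by simp_all
  show "finite (args_h D v)" using finite_subset[OF coeff(3)[OF assms] fin(2)] .
qed

lemma measurable_Psi: "\<Psi> m \<in> D_fam T {..<m} \<Otimes>\<^sub>M D_fam T {..<m} \<rightarrow>\<^sub>M D_real T"
  using ito by (simp add: ito_map_def)

lemma measurable_coeff_paths:
  fixes m :: nat
  assumes f: "\<And>k. k < m \<Longrightarrow> (\<lambda>x. f x k) \<in> N \<rightarrow>\<^sub>M D_real T"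
  shows "(\<lambda>x. \<lambda>k\<in>{..<m}. f x k) \<in> N \<rightarrow>\<^sub>M D_fam T {..<m}"
proof (rule measurable_D_famI)
  fix w assume "w \<in> space N"
  then show "(\<lambda>k\<in>{..<m}. f w k) \<in> cadlag_fam T {..<m}"
    using measurable_space[OF f] by (auto simp: cadlag_fam_def space_D_real[OF T_pos])
next
  fix k t assume "k \<in> {..<m}" "t \<in> {0..T}"
  then show "(\<lambda>w. (\<lambda>k\<in>{..<m}. f w k) k t) \<in> borel_measurable N"
    using measurable_D_real_eval[OF T_pos f, of k t] by simp
qed (simp_all add: T_pos)

lemma measurable_sde_map:
  assumes v: "v \<in> V"
  shows "sde_map T \<Psi> D v \<in> PS V \<Otimes>\<^sub>M PS W \<rightarrow>\<^sub>M D_real T"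
proof -
  have mrg: "merge V W \<in> PS V \<Otimes>\<^sub>M PS W \<rightarrow>\<^sub>M PS (V \<union> W)"
    unfolding path_space_def by (rule measurable_merge)
  have f: "f_path T D v \<in> PS (V \<union> W) \<rightarrow>\<^sub>M D_real T"
    unfolding f_path_def[abs_def] 
    by (rule measurable_coeff_path[OF T_pos fin_args(1)[OF v] coeff(1)[OF v] coeff(4)[OF v]])
  have sub: "insert v (args_g D v) \<subseteq> V \<union> W" "args_h D v \<subseteq> V \<union> W" using coeff[OF v] v by auto
  have g: "g_path T D v \<in> PS (V \<union> W) \<rightarrow>\<^sub>M D_fam T {..<dim D v}"
    unfolding g_path_def[abs_def] 
    by (intro measurable_coeff_paths measurable_coeff_path[OF T_pos fin_args(2)[OF v] sub(1)] coeff(5)[OF v]) 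
  have h: "h_path T D v \<in> PS (V \<union> W) \<rightarrow>\<^sub>M D_fam T {..<dim D v}"
    unfolding h_path_def[abs_def] 
    by (intro measurable_coeff_paths measurable_coeff_path[OF T_pos fin_args(3)[OF v] sub(2)] coeff(6)[OF v]) 
  have P: "(\<lambda>x. \<Psi> (dim D v) (g_path T D v x, h_path T D v x)) \<in> PS (V \<union> W) \<rightarrow>\<^sub>M D_real T"
    by (rule measurable_compose[OF measurable_Pair[OF g h] measurable_Psi])
  have "(\<lambda>x. \<lambda>t\<in>{0..T}. f_path T D v x t + \<Psi> (dim D v) (g_path T D v x, h_path T D v x) t) \<in> PS (V \<union> W) \<rightarrow>\<^sub>M D_real T"
  proof (rule measurable_D_realI[OF T_pos])
    fix w assume "w \<in> space (PS (V \<union> W))"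
    then show "(\<lambda>t\<in>{0..T}. f_path T D v w t + \<Psi> (dim D v) (g_path T D v w, h_path T D v w) t) \<in> cadlag T"
      using measurable_space[OF f] measurable_space[OF P] by (intro cadlag_add) (auto simp: space_D_real[OF T_pos])
  next
    fix t assume "t \<in> {0..T}"
    with measurable_D_real_eval[OF T_pos f this] measurable_D_real_eval[OF T_pos P this]
    show "(\<lambda>w. (\<lambda>t\<in>{0..T}. f_path T D v w t + \<Psi> (dim D v) (g_path T D v w, h_path T D v w) t) t) \<in> borel_measurable (PS (V \<union> W))"
      by simp
  qed
  from measurable_compose[OF mrg this] show ?thesis by (simp add: sde_map_def[abs_def] Let_def)
qed

text \<open>The link between equations and graph: an equation depends only on its parents in the
  augmented graph, since an edge is present for each argument in which some coefficient is
  non-constant.\<close>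

lemma sde_map_cong:
  assumes v: "v \<in> V" and x: "xV \<in> cadlag_fam T V" "xW \<in> cadlag_fam T W"
    and y: "yV \<in> cadlag_fam T V" "yW \<in> cadlag_fam T W"
    and eq: "\<And>u. u \<in> V \<Longrightarrow> (u, v) \<in> aug_edges T D \<Longrightarrow> xV u = yV u"
      "\<And>u. u \<in> W \<Longrightarrow> (u, v) \<in> aug_edges T D \<Longrightarrow> xW u = yW u"
  shows "sde_map T \<Psi> D v (xV, xW) = sde_map T \<Psi> D v (yV, yW)"
proof -
  let ?x = "merge V W (xV, xW)" and ?y = "merge V W (yV, yW)"
  have c: "?x \<in> cadlag_fam T (V \<union> W)" "?y \<in> cadlag_fam T (V \<union> W)"
    using x y by (auto simp: cadlag_fam_def merge_def intro!: PiE_I dest: PiE_mem)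
  have e: "?x u = ?y u" if "(u, v) \<in> aug_edges T D" "u \<in> V \<union> W" for u
    using that eq[of u] fin by (auto simp: merge_def)
  have sub: "insert v (args_g D v) \<subseteq> V \<union> W" "args_h D v \<subseteq> V \<union> W" using coeff[OF v] v by auto
  have f: "f_path T D v ?x = f_path T D v ?y" unfolding f_path_def
  proof (rule restrict_ext)
    fix t assume t: "t \<in> {0..T}"
    show "coeff_f D v t (restrict ?x (args_f D v)) = coeff_f D v t (restrict ?y (args_f D v))"
    proof (rule nonconst_in_cong[where f = "coeff_f D v", OF fin_args(1)[OF v] _ _ t])
      fix a assume a: "a \<in> args_f D v" "nonconst_in T (args_f D v) a (coeff_f D v)"
      then have "(a, v) \<in> aug_edges T D" unfolding aug_edges_def using v by blast
      with a coeff(1)[OF v] e[of a] show "restrict ?x (args_f D v) a = restrict ?y (args_f D v) a"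
        by auto
    qed (intro cadlag_fam_restrict[OF _ coeff(1)[OF v]] c)+
  qed
  have g: "g_path T D v ?x = g_path T D v ?y" unfolding g_path_def
  proof (rule restrict_ext)
    fix k assume k: "k \<in> {..<dim D v}"
    show "(\<lambda>t\<in>{0..T}. coeff_g D v t (restrict ?x (insert v (args_g D v))) k) = 
      (\<lambda>t\<in>{0..T}. coeff_g D v t (restrict ?y (insert v (args_g D v))) k)"
    proof (rule restrict_ext)
      fix t assume t: "t \<in> {0..T}"
      show "coeff_g D v t (restrict ?x (insert v (args_g D v))) k = coeff_g D v t (restrict ?y (insert v (args_g D v))) k"
      proof (rule nonconst_in_cong[where f = "\<lambda>t x. coeff_g D v t x k", OF fin_args(2)[OF v] _ _ t])
        fix a assume a: "a \<in> insert v (args_g D v)" "nonconst_in T (insert v (args_g D v)) a (\<lambda>t x. coeff_g D v t x k)"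
        then have "(a, v) \<in> aug_edges T D" unfolding aug_edges_def using v k by blast
        with a sub e[of a] show "restrict ?x (insert v (args_g D v)) a = restrict ?y (insert v (args_g D v)) a"
          by auto
      qed (intro cadlag_fam_restrict[OF _ sub(1)] c)+
    qed
  qed
  have h: "h_path T D v ?x = h_path T D v ?y" unfolding h_path_def
  proof (rule restrict_ext)
    fix k assume k: "k \<in> {..<dim D v}"
    show "(\<lambda>t\<in>{0..T}. coeff_h D v t (restrict ?x (args_h D v)) k) = 
      (\<lambda>t\<in>{0..T}. coeff_h D v t (restrict ?y (args_h D v)) k)"
    proof (rule restrict_ext)
      fix t assume t: "t \<in> {0..T}"
      show "coeff_h D v t (restrict ?x (args_h D v)) k = coeff_h D v t (restrict ?y (args_h D v)) k"
      proof (rule nonconst_in_cong[where f = "\<lambda>t x. coeff_h D v t x k", OF fin_args(3)[OF v] _ _ t])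
        fix a assume a: "a \<in> args_h D v" "nonconst_in T (args_h D v) a (\<lambda>t x. coeff_h D v t x k)"
        then have "(a, v) \<in> aug_edges T D" unfolding aug_edges_def using v k by blast
        with a sub e[of a] show "restrict ?x (args_h D v) a = restrict ?y (args_h D v) a"
          by auto
      qed (intro cadlag_fam_restrict[OF _ sub(2)] c)+
    qed
  qed
  show ?thesis unfolding sde_map_def Let_def f g h ..
qed

end


text \<open>The property holds almost surely iff the section of its exceptional set is null, and the
  measure of sections is measurable. This is what exchanging iterated \<open>AE\<close> quantifiers
  requires when the inner statement is itself an \<open>AE\<close>.\<close>

lemma (in sigma_finite_measure) sets_Collect_AE:
  assumes "{z \<in> space (N \<Otimes>\<^sub>M M). P (fst z) (snd z)} \<in> sets (N \<Otimes>\<^sub>M M)"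
  shows "{x \<in> space N. AE y in M. P x y} \<in> sets N"
proof -
  define Q where "Q = space (N \<Otimes>\<^sub>M M) - {z \<in> space (N \<Otimes>\<^sub>M M). P (fst z) (snd z)}"
  have Q: "Q \<in> sets (N \<Otimes>\<^sub>M M)" using assms by (simp add: Q_def)
  have "(AE y in M. P x y) \<longleftrightarrow> emeasure M (Pair x -` Q) = 0" if x: "x \<in> space N" for x
  proof (rule AE_iff_measurable)
    show "Pair x -` Q \<in> sets M" by (rule sets_Pair1[OF Q])
    show "{y \<in> space M. \<not> P x y} = Pair x -` Q" using x by (auto simp: Q_def space_pair_measure)
  qed
  then have "{x \<in> space N. AE y in M. P x y} = {x \<in> space N. emeasure M (Pair x -` Q) = 0}" by auto
  also have "\<dots> \<in> sets N" using measurable_emeasure_Pair[OF Q] by measurable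
  finally show ?thesis .
qed

definition zero_path :: "real \<Rightarrow> path" where "zero_path T = (\<lambda>t\<in>{0..T}. 0)"

lemma zero_path_cadlag: "0 < T \<Longrightarrow> zero_path T \<in> cadlag T"
proof -
  assume T: "0 < T"
  have "discretise T 1 (\<lambda>_. 0) = zero_path T" by (simp add: discretise_def zero_path_def)
  then show ?thesis using discretise_cadlag[OF T, of 1 "\<lambda>_. 0"] by simp
qed

context sde_context
begin

subsection \<open>The law of the noise\<close>

text \<open>Outside \<open>W\<close> a point mass serves as filler, because
  \<open>product_sigma_finite\<close> asks for a measure at every index.\<close>

definition mu_noise :: "'n \<Rightarrow> path measure" where
  "mu_noise w = (if w \<in> W then distr M (D_real T) (noise D w) else return (D_real T) (zero_path T))"

definition PN :: "('n \<Rightarrow> path) measure" where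
  "PN = distr M (PS W) (noise_path D)"

lemma measurable_noise: "w \<in> W \<Longrightarrow> noise D w \<in> M \<rightarrow>\<^sub>M D_real T"
  using sys by (auto simp: causal_sde_system_def indep_vars_def)

lemma measurable_noise_path: "noise_path D \<in> M \<rightarrow>\<^sub>M PS W"
  unfolding noise_path_def[abs_def]
  by (rule measurable_path_space_components[OF T_pos]) (simp_all add: measurable_noise)

lemma prob_space_mu_noise: "prob_space (mu_noise w)"
  unfolding mu_noise_def using zero_path_cadlag[OF T_pos]
  by (auto intro!: prob_space_distr measurable_noise prob_space_return simp: space_D_real[OF T_pos])

sublocale noise: product_sigma_finite mu_noise
  by (intro product_sigma_finite.intro prob_space_imp_sigma_finite prob_space_mu_noise)

lemma sets_PN: "sets PN = sets (PS W)" by (simp add: PN_def)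

lemma space_PN: "space PN = cadlag_fam T W" using sets_eq_imp_space_eq[OF sets_PN] by (simp add: space_path_space[OF T_pos])

lemma measurable_PN: "measurable PN N = measurable (PS W) N"
  by (rule measurable_cong_sets) (simp_all add: sets_PN)

lemma measurable_to_PN: "measurable N PN = measurable N (PS W)"
  by (rule measurable_cong_sets) (simp_all add: sets_PN)

lemma PN_PiM: "PN = PiM W mu_noise"
proof (rule noise.PiM_eqI[OF fin(2)])
  have "sets (PiM W mu_noise) = sets (PS W)"
    unfolding path_space_def by (rule sets_PiM_cong) (auto simp: mu_noise_def)
  then show "sets PN = sets (PiM W mu_noise)" by (simp add: sets_PN)
  fix A assume A: "\<And>w. w \<in> W \<Longrightarrow> A w \<in> sets (mu_noise w)"
  show "emeasure PN (PiE W A) = (\<Prod>w\<in>W. emeasure (mu_noise w) (A w))"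
  \<comment> \<open>The product characterisation of independence used in the other case assumes a
    nonempty index set.\<close>
  proof (cases "W = {}")
    case True
    interpret PN: prob_space PN unfolding PN_def by (rule prob_space_distr[OF measurable_noise_path])
    have "PiE W A = space PN" by (simp add: space_PN cadlag_fam_def True)
    then show ?thesis using True PN.emeasure_space_1 by simp
  next
    case False
    have "PN = PiM W (\<lambda>w. distr M (D_real T) (noise D w))"
      using sys False measurable_noise
        indep_vars_iff_distr_eq_PiM'[OF False, of "noise D" "\<lambda>_. D_real T"]
      by (simp add: PN_def noise_path_def[abs_def] path_space_def causal_sde_system_def)
    also have "\<dots> = PiM W mu_noise" by (rule PiM_cong) (auto simp: mu_noise_def)
    finally show ?thesis using noise.emeasure_PiM[OF fin(2) A] by simp
  qed
qed

sublocale PN: prob_space PN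
  unfolding PN_def by (rule prob_space_distr[OF measurable_noise_path])

text \<open>Moves almost-sure statements from the sample space to the canonical space of noise
  paths, where independence is a product structure and Fubini is available.\<close>

lemma AE_noise_iff:
  assumes "{n \<in> space (PS W). Q n} \<in> sets (PS W)"
  shows "(AE \<omega> in M. Q (noise_path D \<omega>)) \<longleftrightarrow> (AE n in PN. Q n)"
  unfolding PN_def using AE_distr_iff[OF measurable_noise_path assms] by simp

definition splc :: "'n set \<Rightarrow> ('n \<Rightarrow> path) \<Rightarrow> ('n \<Rightarrow> path) \<Rightarrow> 'n \<Rightarrow> path" where
  "splc K n c = (\<lambda>w\<in>W. if w \<in> K then n w else c w)"

lemma splc_in: "n \<in> cadlag_fam T W \<Longrightarrow> c \<in> cadlag_fam T W \<Longrightarrow> splc K n c \<in> cadlag_fam T W"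
  by (auto simp: splc_def cadlag_fam_def)

lemma measurable_splc [measurable (raw)]:
  assumes "f \<in> N \<rightarrow>\<^sub>M PS W" "g \<in> N \<rightarrow>\<^sub>M PS W"
  shows "(\<lambda>z. splc K (f z) (g z)) \<in> N \<rightarrow>\<^sub>M PS W"
proof (rule measurable_path_space_components[OF T_pos])
  fix w assume "w \<in> W"
  then show "(\<lambda>z. splc K (f z) (g z) w) \<in> N \<rightarrow>\<^sub>M D_real T"
    using assms[THEN measurable_path_space_component] by (cases "w \<in> K") (simp_all add: splc_def)
qed (simp add: splc_def)

lemma splc_splc: "splc K (splc K n m) c = splc K n c"
  by (auto simp: splc_def)

text \<open>Resampling the noises outside \<open>K\<close> independently leaves a product law
  unchanged. In this form the independence of the noises enters the choice of a generic realisation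
  as well as the independence of the two blocks.\<close>

lemma distr_splice: "distr (PN \<Otimes>\<^sub>M PN) (PS W) (\<lambda>(n, c). splc K n c) = PN"
proof -
  interpret PP: pair_prob_space PN PN ..
  have m: "(\<lambda>(n, c). splc K n c) \<in> PN \<Otimes>\<^sub>M PN \<rightarrow>\<^sub>M PS W"
    unfolding case_prod_beta
    by (intro measurable_splc) (auto simp: measurable_to_PN[symmetric])
  have "distr (PN \<Otimes>\<^sub>M PN) (PS W) (\<lambda>(n, c). splc K n c) = PiM W mu_noise"
  proof (rule noise.PiM_eqI[OF fin(2)])
    show "sets (distr (PN \<Otimes>\<^sub>M PN) (PS W) (\<lambda>(n, c). splc K n c)) = sets (PiM W mu_noise)"
      using sets_PN by (simp add: PN_PiM)
    fix A assume A: "\<And>w. w \<in> W \<Longrightarrow> A w \<in> sets (mu_noise w)"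
    have sp: "space (mu_noise w) = cadlag T" for w by (simp add: mu_noise_def space_D_real[OF T_pos])
    have AC: "A w \<subseteq> cadlag T" if "w \<in> W" for w using sets.sets_into_space[OF A[OF that]] sp by simp
    \<comment> \<open>A rectangle condition on the spliced noise constrains \<open>n\<close> on
      \<open>K\<close> and \<open>c\<close> off \<open>K\<close>; the remaining factors are the
      whole space and have mass 1.\<close>
    define A1 where "A1 w = (if w \<in> K then A w else space (mu_noise w))" for w
    define A2 where "A2 w = (if w \<in> K then space (mu_noise w) else A w)" for w
    have A12: "A1 w \<in> sets (mu_noise w)" "A2 w \<in> sets (mu_noise w)" if "w \<in> W" for w
      using A[OF that] by (auto simp: A1_def A2_def)
    have PA: "PiE W A \<in> sets (PS W)"
      using sets_PiM_I_finite[OF fin(2), of A mu_noise] A sets_PN unfolding PN_PiM by simp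
    have PA12: "PiE W A1 \<in> sets PN" "PiE W A2 \<in> sets PN"
      unfolding PN_PiM
      using sets_PiM_I_finite[OF fin(2), of A1 mu_noise] sets_PiM_I_finite[OF fin(2), of A2 mu_noise] A12 by auto
    have eq: "(\<lambda>(n, c). splc K n c) -` PiE W A \<inter> space (PN \<Otimes>\<^sub>M PN) = PiE W A1 \<times> PiE W A2"
    proof (intro set_eqI iffI)
      fix z assume z: "z \<in> (\<lambda>(n, c). splc K n c) -` PiE W A \<inter> space (PN \<Otimes>\<^sub>M PN)"
      obtain n c where nc: "z = (n, c)" by (cases z)
      have n: "n \<in> cadlag_fam T W" "c \<in> cadlag_fam T W" and s: "splc K n c \<in> PiE W A"
        using z unfolding nc by (auto simp: space_pair_measure space_PN)
      have "\<forall>w\<in>W. (w \<in> K \<longrightarrow> n w \<in> A w) \<and> (w \<notin> K \<longrightarrow> c w \<in> A w)"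
      proof
        fix w assume "w \<in> W"
        with PiE_mem[OF s this] show "(w \<in> K \<longrightarrow> n w \<in> A w) \<and> (w \<notin> K \<longrightarrow> c w \<in> A w)"
          by (simp add: splc_def split: if_splits)
      qed
      then show "z \<in> PiE W A1 \<times> PiE W A2" using n unfolding nc
        by (auto simp: A1_def A2_def cadlag_fam_def PiE_iff sp split: if_splits)
    next
      fix z assume z: "z \<in> PiE W A1 \<times> PiE W A2"
      obtain n c where nc: "z = (n, c)" by (cases z)
      have "n \<in> cadlag_fam T W" "c \<in> cadlag_fam T W"
        using z AC unfolding nc by (auto simp: A1_def A2_def cadlag_fam_def PiE_iff sp split: if_splits)
      moreover have "splc K n c \<in> PiE W A" using z unfolding nc
        by (auto simp: A1_def A2_def splc_def PiE_iff)
      ultimately show "z \<in> (\<lambda>(n, c). splc K n c) -` PiE W A \<inter> space (PN \<Otimes>\<^sub>M PN)"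
        unfolding nc by (auto simp: space_pair_measure space_PN)
    qed
    have "emeasure (distr (PN \<Otimes>\<^sub>M PN) (PS W) (\<lambda>(n, c). splc K n c)) (PiE W A)
        = emeasure (PN \<Otimes>\<^sub>M PN) (PiE W A1 \<times> PiE W A2)"
      by (simp add: emeasure_distr[OF m PA] eq)
    also have "\<dots> = emeasure PN (PiE W A1) * emeasure PN (PiE W A2)"
      by (rule PN.emeasure_pair_measure_Times[OF PA12])
    also have "\<dots> = (\<Prod>w\<in>W. emeasure (mu_noise w) (A1 w)) * (\<Prod>w\<in>W. emeasure (mu_noise w) (A2 w))"
      unfolding PN_PiM using noise.emeasure_PiM[OF fin(2)] A12 by simp
    also have "\<dots> = (\<Prod>w\<in>W. emeasure (mu_noise w) (A1 w) * emeasure (mu_noise w) (A2 w))"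
      by (simp add: prod.distrib)
    also have "\<dots> = (\<Prod>w\<in>W. emeasure (mu_noise w) (A w))"
      using prob_space.emeasure_space_1[OF prob_space_mu_noise]
      by (intro prod.cong refl) (simp add: A1_def A2_def)
    finally show "emeasure (distr (PN \<Otimes>\<^sub>M PN) (PS W) (\<lambda>(n, c). splc K n c)) (PiE W A) =
      (\<Prod>w\<in>W. emeasure (mu_noise w) (A w))" .
  qed
  then show ?thesis by (simp add: PN_PiM)
qed

lemma AE_splice:
  assumes "{n \<in> space (PS W). Q n} \<in> sets (PS W)"
  shows "(AE n in PN. Q n) \<longleftrightarrow> (AE n in PN. AE c in PN. Q (splc K n c))"
proof -
  interpret PP: pair_prob_space PN PN ..
  have m: "(\<lambda>(n, c). splc K n c) \<in> PN \<Otimes>\<^sub>M PN \<rightarrow>\<^sub>M PS W"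
    unfolding case_prod_beta
    by (intro measurable_splc) (auto simp: measurable_to_PN[symmetric])
  have "(AE n in PN. Q n) \<longleftrightarrow> (AE n in distr (PN \<Otimes>\<^sub>M PN) (PS W) (\<lambda>(n, c). splc K n c). Q n)"
    by (rule arg_cong[where f="\<lambda>\<mu>. AE n in \<mu>. Q n", OF distr_splice[symmetric]])
  also have "\<dots> \<longleftrightarrow> (AE z in PN \<Otimes>\<^sub>M PN. Q (splc K (fst z) (snd z)))"
    by (subst AE_distr_iff[OF m assms]) (simp add: case_prod_beta)
  also have "\<dots> \<longleftrightarrow> (AE n in PN. AE c in PN. Q (splc K n c))"
  proof (rule PP.AE_pair_iff[symmetric])
    show "{x \<in> space (PN \<Otimes>\<^sub>M PN). Q (splc K (fst x) (snd x))} \<in> sets (PN \<Otimes>\<^sub>M PN)"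
      using measurable_sets[OF m assms] measurable_space[OF m]
      by (auto simp: vimage_def Int_def case_prod_beta conj_commute cong: conj_cong)
  qed
  finally show ?thesis .
qed

end


context sde_context
begin

subsection \<open>Solution maps\<close>

definition solves :: "'n set \<Rightarrow> ('n \<Rightarrow> path) \<Rightarrow> ('n \<Rightarrow> path) \<Rightarrow> ('n \<Rightarrow> path) \<Rightarrow> bool" where
  "solves U xU xS xW \<longleftrightarrow> (\<forall>v\<in>U. xU v = sde_map T \<Psi> D v (merge U (V - U) (xU, xS), xW))"

lemma sets_solves:
  assumes U: "U \<subseteq> V" and f: "f \<in> N \<rightarrow>\<^sub>M PS U" and g: "g \<in> N \<rightarrow>\<^sub>M PS (V - U)" and h: "h \<in> N \<rightarrow>\<^sub>M PS W"
  shows "{z \<in> space N. solves U (f z) (g z) (h z)} \<in> sets N"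
  unfolding solves_def
proof (rule sets.sets_Collect_finite_All[OF _ fin_sub(1)[OF U]])
  fix v assume v: "v \<in> U"
  have eq: "U \<union> (V - U) = V" using U by blast
  have mg: "(\<lambda>z. merge U (V - U) (f z, g z)) \<in> N \<rightarrow>\<^sub>M PS V"
    using measurable_compose[OF measurable_Pair[OF f g, unfolded path_space_def] measurable_merge]
    unfolding eq path_space_def .
  have "v \<in> V" using U v by blast
  from measurable_compose[OF measurable_Pair[OF mg h] measurable_sde_map[OF this]]
  show "{z \<in> space N. f z v = sde_map T \<Psi> D v (merge U (V - U) (f z, g z), h z)} \<in> sets N"
    by (intro pred_eq_D_real[OF T_pos] measurable_path_space_component[OF f v])
qed

definition Isol :: "'n set \<Rightarrow> ('n \<Rightarrow> path) \<times> ('n \<Rightarrow> path) \<Rightarrow> 'n \<Rightarrow> path" where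
  "Isol U = (SOME I. essential_solution_map M T \<Psi> D U I)"

lemma Isol: "U \<subseteq> V \<Longrightarrow> essential_solution_map M T \<Psi> D U (Isol U)"
  unfolding Isol_def using someI_ex[of "essential_solution_map M T \<Psi> D U"] solv[of U]
  by (simp add: ess_uniquely_solvable_def)

lemma Isol_adapted: "U \<subseteq> V \<Longrightarrow> meas_adapted_map2 T (V - U) W U (Isol U)"
  using Isol[of U] by (simp add: essential_solution_map_def Let_def)

lemma measurable_Isol:
  assumes "U \<subseteq> V" "f \<in> N \<rightarrow>\<^sub>M PS (V - U)" "g \<in> N \<rightarrow>\<^sub>M PS W"
  shows "(\<lambda>z. Isol U (f z, g z)) \<in> N \<rightarrow>\<^sub>M PS U"
proof -
  have "Isol U \<in> PS (V - U) \<Otimes>\<^sub>M PS W \<rightarrow>\<^sub>M PS U"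
    using Isol_adapted[OF assms(1)] by (simp add: meas_adapted_map2_def)
  from measurable_compose[OF measurable_Pair[OF assms(2,3)] this] show ?thesis .
qed

lemma AE_solves_iff:
  assumes "U \<subseteq> V" "f \<in> PS W \<rightarrow>\<^sub>M PS U" "g \<in> PS W \<rightarrow>\<^sub>M PS (V - U)"
  shows "(AE \<omega> in M. solves U (f (noise_path D \<omega>)) (g (noise_path D \<omega>)) (noise_path D \<omega>)) \<longleftrightarrow>
    (AE n in PN. solves U (f n) (g n) n)"
  by (rule AE_noise_iff) (intro sets_solves assms measurable_ident_sets refl)

lemma adapted_Isol:
  assumes "U \<subseteq> V" "meas_adapted_map T W (V - U) \<phi>S" "meas_adapted_map T W W \<zeta>"
  shows "meas_adapted_map T W U (\<lambda>n. Isol U (\<phi>S n, \<zeta> n))"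
  by (rule meas_adapted_map_compose2[OF T_pos Isol_adapted]) (use assms in auto)

lemma adapted_id: "meas_adapted_map T W W (\<lambda>n. n)"
  by (simp add: meas_adapted_map_iff adp_proj)

lemma Isol_solves:
  assumes U: "U \<subseteq> V" and S: "meas_adapted_map T W (V - U) \<phi>S"
  shows "AE n in PN. solves U (Isol U (\<phi>S n, n)) (\<phi>S n) n"
proof -
  have "AE \<omega> in M. solves U (Isol U (\<phi>S (noise_path D \<omega>), noise_path D \<omega>)) (\<phi>S (noise_path D \<omega>)) (noise_path D \<omega>)"
    using Isol[OF U] S by (simp add: essential_solution_map_def Let_def solves_def)
  then show ?thesis
    using meas_adapted_mapD(1)[OF adapted_Isol[OF U S adapted_id]] meas_adapted_mapD(1)[OF S]
    by (subst (asm) AE_solves_iff[OF U]) auto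
qed

lemma Isol_unique:
  assumes U: "U \<subseteq> V" and S: "meas_adapted_map T W (V - U) \<phi>S" and \<phi>: "meas_adapted_map T W U \<phi>"
    and sol: "AE n in PN. solves U (\<phi> n) (\<phi>S n) n"
  shows "AE n in PN. \<phi> n = Isol U (\<phi>S n, n)"
proof -
  note m = meas_adapted_mapD(1)[OF S] meas_adapted_mapD(1)[OF \<phi>] meas_adapted_mapD(1)[OF adapted_Isol[OF U S adapted_id]]
  have "AE \<omega> in M. solves U (\<phi> (noise_path D \<omega>)) (\<phi>S (noise_path D \<omega>)) (noise_path D \<omega>)"
    using AE_solves_iff[OF U m(2,1)] sol by simp
  then have "AE \<omega> in M. \<phi> (noise_path D \<omega>) = Isol U (\<phi>S (noise_path D \<omega>), noise_path D \<omega>)"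
    using Isol[OF U] S \<phi> by (simp add: essential_solution_map_def Let_def solves_def)
  then show ?thesis
    by (subst (asm) AE_noise_iff) (intro pred_eq_path_space[OF T_pos fin_sub(1)[OF U]] m)+
qed

section \<open>Blocks of equations as functions of their parents\<close>

definition pa :: "'n set \<Rightarrow> 'n set" where
  "pa U = {u \<in> V - U. \<exists>v\<in>U. (u, v) \<in> aug_edges T D}"

definition nz :: "'n set \<Rightarrow> 'n set" where
  "nz U = {w \<in> W. \<exists>v\<in>U. (w, v) \<in> aug_edges T D}"

text \<open>\<open>Isol U\<close> expects paths on all of \<open>V - U\<close>. Those that do not
  feed into \<open>U\<close> are set to a fixed path, so that the result can depend on the parents
  alone.\<close>

definition cut :: "'n set \<Rightarrow> ('n \<Rightarrow> path) \<Rightarrow> 'n \<Rightarrow> path" where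
  "cut U x = (\<lambda>s\<in>V - U. if s \<in> pa U then x s else zero_path T)"

lemma solves_cong:
  assumes U: "U \<subseteq> V" and x: "xU \<in> cadlag_fam T U" "xS \<in> cadlag_fam T (V - U)" "xW \<in> cadlag_fam T W"
    and y: "yS \<in> cadlag_fam T (V - U)" "yW \<in> cadlag_fam T W"
    and eq: "\<And>u. u \<in> pa U \<Longrightarrow> xS u = yS u" "\<And>u. u \<in> nz U \<Longrightarrow> xW u = yW u"
  shows "solves U xU xS xW \<longleftrightarrow> solves U xU yS yW"
proof -
  have mc: "merge U (V - U) (xU, z) \<in> cadlag_fam T V" if "z \<in> cadlag_fam T (V - U)" for z
    using x(1) that U by (auto simp: cadlag_fam_def merge_def PiE_iff extensional_def)
  have "sde_map T \<Psi> D v (merge U (V - U) (xU, xS), xW) = sde_map T \<Psi> D v (merge U (V - U) (xU, yS), yW)" if v: "v \<in> U" for v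
  proof (rule sde_map_cong)
    show "merge U (V - U) (xU, xS) u = merge U (V - U) (xU, yS) u" if "u \<in> V" "(u, v) \<in> aug_edges T D" for u
      using that v eq(1)[of u] by (auto simp: merge_def pa_def)
    show "xW u = yW u" if "u \<in> W" "(u, v) \<in> aug_edges T D" for u
      using that v by (intro eq(2)) (auto simp: nz_def)
  qed (use v U x y mc in auto)
  then show ?thesis by (simp add: solves_def)
qed

lemma pa_sub: "pa U \<subseteq> V - U" by (auto simp: pa_def)
lemma nz_sub: "nz U \<subseteq> W" by (auto simp: nz_def)

lemma measurable_cut:
  assumes "f \<in> N \<rightarrow>\<^sub>M PS P" "pa U \<subseteq> P"
  shows "(\<lambda>z. cut U (f z)) \<in> N \<rightarrow>\<^sub>M PS (V - U)"
proof (rule measurable_path_space_components[OF T_pos])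
  fix u assume u: "u \<in> V - U"
  show "(\<lambda>z. cut U (f z) u) \<in> N \<rightarrow>\<^sub>M D_real T"
  proof (cases "u \<in> pa U")
    case True
    then show ?thesis using u measurable_path_space_component[OF assms(1), of u] assms(2)
      by (auto simp: cut_def)
  next
    case False
    then show ?thesis using u zero_path_cadlag[OF T_pos] by (simp add: cut_def space_D_real[OF T_pos])
  qed
qed (simp add: cut_def)

lemma cut_in: "x \<in> cadlag_fam T P \<Longrightarrow> pa U \<subseteq> P \<Longrightarrow> cut U x \<in> cadlag_fam T (V - U)"
  using zero_path_cadlag[OF T_pos] by (auto simp: cut_def cadlag_fam_def PiE_iff)

lemma adapted_cut:
  assumes "meas_adapted_map T W P \<phi>" "pa U \<subseteq> P"
  shows "meas_adapted_map T W (V - U) (\<lambda>n. cut U (\<phi> n))"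
  unfolding meas_adapted_map_iff
proof (intro conjI ballI)
  show "(\<lambda>n. cut U (\<phi> n)) \<in> PS W \<rightarrow>\<^sub>M PS (V - U)"
    by (rule measurable_cut[OF meas_adapted_mapD(1)[OF assms(1)] assms(2)])
  fix u assume u: "u \<in> V - U"
  show "adp T W (\<lambda>n. cut U (\<phi> n) u)"
    using u assms meas_adapted_mapD(2)[OF assms(1), of u] by (cases "u \<in> pa U") (auto simp: cut_def adp_const)
qed

lemma adapted_splc:
  assumes "c \<in> cadlag_fam T W"
  shows "meas_adapted_map T W W (\<lambda>n. splc K n c)"
  unfolding meas_adapted_map_iff
proof (intro conjI ballI)
  show "(\<lambda>n. splc K n c) \<in> PS W \<rightarrow>\<^sub>M PS W"
    using assms by (intro measurable_splc measurable_ident_sets refl measurable_const) (simp add: space_path_space[OF T_pos])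
  fix w assume "w \<in> W"
  then show "adp T W (\<lambda>n. splc K n c w)" by (cases "w \<in> K") (auto simp: splc_def adp_const adp_proj)
qed

lemma adapted_comp:
  assumes "meas_adapted_map T W P \<phi>" "meas_adapted_map T W W \<zeta>"
  shows "meas_adapted_map T W P (\<lambda>n. \<phi> (\<zeta> n))"
proof -
  have "meas_adapted_map2 T W W P (\<lambda>(x, y). \<phi> y)"
    using meas_adapted_mapD(1)[OF assms(1)] assms(1)
    by (auto simp: meas_adapted_map2_def meas_adapted_map_def case_prod_beta)
  from meas_adapted_map_compose2[OF T_pos this adapted_id assms(2)] show ?thesis by simp
qed

text \<open>The solution of the equations of \<open>U\<close> as a function of the parents of \<open>U\<close> only: the other
  endogenous arguments are replaced by a constant path, the other noises by a fixed realisation \<open>c\<close>.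
  Since equality with the actual solution is only known almost surely, \<open>c\<close> has to be generic.\<close>

definition Jsol :: "'n set \<Rightarrow> ('n \<Rightarrow> path) \<Rightarrow> ('n \<Rightarrow> path) \<times> ('n \<Rightarrow> path) \<Rightarrow> 'n \<Rightarrow> path" where
  "Jsol U c = (\<lambda>(x, n). Isol U (cut U x, splc (nz U) n c))"

lemma measurable_Jsol:
  assumes "U \<subseteq> V" "f \<in> N \<rightarrow>\<^sub>M PS P" "pa U \<subseteq> P" "g \<in> N \<rightarrow>\<^sub>M PS W" "h \<in> N \<rightarrow>\<^sub>M PS W"
  shows "(\<lambda>z. Jsol U (h z) (f z, g z)) \<in> N \<rightarrow>\<^sub>M PS U"
  unfolding Jsol_def split
  by (intro measurable_Isol measurable_cut[OF assms(2,3)] measurable_splc assms)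

lemma Jsol_cong:
  "restrict x (pa U) = restrict y (pa U) \<Longrightarrow> restrict n (nz U) = restrict m (nz U) \<Longrightarrow> Jsol U c (x, n) = Jsol U c (y, m)"
proof -
  assume *: "restrict x (pa U) = restrict y (pa U)" "restrict n (nz U) = restrict m (nz U)"
  have x: "x s = y s" if "s \<in> pa U" for s using *(1) that by (metis restrict_apply')
  have n: "n s = m s" if "s \<in> nz U" for s using *(2) that by (metis restrict_apply')
  have "cut U x = cut U y" unfolding cut_def by (rule restrict_ext) (simp add: x)
  moreover have "splc (nz U) n c = splc (nz U) m c" unfolding splc_def by (rule restrict_ext) (simp add: n)
  ultimately show ?thesis by (simp add: Jsol_def)
qed

text \<open>For a generic fixed \<open>c\<close> the cut and spliced input still yields a solution
  of the original equations, since these do not see what has been replaced. That solution is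
  adapted, so uniqueness identifies it with \<open>\<phi>\<close>. The work lies in showing that
  \<open>Isol\<close> solves its equations at these inputs, which is known only almost surely for
  each single adapted input.\<close>

lemma AE_generic:
  assumes U: "U \<subseteq> V" and S: "meas_adapted_map T W (V - U) \<phi>S" and \<phi>: "meas_adapted_map T W U \<phi>"
    and sol: "AE n in PN. solves U (\<phi> n) (\<phi>S n) n"
  shows "AE c in PN. AE n in PN. \<phi> n = Jsol U c (\<phi>S n, n)"
proof -
  interpret PP: pair_prob_space PN PN ..
  interpret P3: pair_prob_space PN "PN \<Otimes>\<^sub>M PN" ..
  define K where "K = nz U"
  \<comment> \<open>Here the input \<open>\<phi>S\<close> is driven by \<open>n\<close>, while the
    foreign noises of the equations come from \<open>c\<close>. The two disagree off
    \<open>K\<close>, so solvability does not apply to \<open>R\<close> directly.\<close>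
  define R where "R n c \<longleftrightarrow> solves U (Isol U (cut U (\<phi>S n), splc K n c)) (cut U (\<phi>S n)) (splc K n c)" for n c
  note mS = meas_adapted_mapD(1)[OF S]
  have id: "(\<lambda>n. n) \<in> PN \<rightarrow>\<^sub>M PS W" by (simp add: measurable_PN)
  have sR: "{z \<in> space N. R (f z) (g z)} \<in> sets N" if "f \<in> N \<rightarrow>\<^sub>M PS W" "g \<in> N \<rightarrow>\<^sub>M PS W" for f g and N :: "'z measure"
    unfolding R_def
    by (intro sets_solves[OF U] measurable_Isol[OF U] measurable_splc that 
         measurable_cut[OF measurable_compose[OF that(1) mS] pa_sub])
  have *: "AE m in PN. AE c in PN. R (splc K m n1) c" if n1: "n1 \<in> space PN" for n1
  proof -
    have n1': "n1 \<in> cadlag_fam T W" using n1 by (simp add: space_PN)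
    \<comment> \<open>With the foreign noises of the input frozen at \<open>n1\<close>, the input
      depends on the noises in \<open>K\<close> only. It is then the same for
      \<open>splc K m c\<close> and for \<open>m\<close>, and solvability at the noise
      \<open>splc K m c\<close> becomes a statement about \<open>R (splc K m n1) c\<close>.\<close>
    define \<psi> where "\<psi> n = cut U (\<phi>S (splc K n n1))" for n
    have \<psi>: "meas_adapted_map T W (V - U) \<psi>" unfolding \<psi>_def[abs_def]
      by (intro adapted_cut[OF _ pa_sub] adapted_comp[OF S] adapted_splc n1')
    have "AE n in PN. solves U (Isol U (\<psi> n, n)) (\<psi> n) n" by (rule Isol_solves[OF U \<psi>])
    then have "AE m in PN. AE c in PN. solves U (Isol U (\<psi> (splc K m c), splc K m c)) (\<psi> (splc K m c)) (splc K m c)"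
      using AE_splice[of "\<lambda>n. solves U (Isol U (\<psi> n, n)) (\<psi> n) n" K] meas_adapted_mapD(1)[OF \<psi>]
      by (simp add: sets_solves[OF U] measurable_Isol[OF U])
    then show ?thesis by (simp add: \<psi>_def R_def splc_splc)
  qed
  have m3: "(\<lambda>z. fst z) \<in> PN \<Otimes>\<^sub>M PN \<Otimes>\<^sub>M PN \<rightarrow>\<^sub>M PS W" "(\<lambda>z. fst (snd z)) \<in> PN \<Otimes>\<^sub>M PN \<Otimes>\<^sub>M PN \<rightarrow>\<^sub>M PS W"
    "(\<lambda>z. snd (snd z)) \<in> PN \<Otimes>\<^sub>M PN \<Otimes>\<^sub>M PN \<rightarrow>\<^sub>M PS W"
    by (auto simp: measurable_to_PN[symmetric])
  have m2: "(\<lambda>z. fst z) \<in> PN \<Otimes>\<^sub>M PN \<rightarrow>\<^sub>M PS W" "(\<lambda>z. snd z) \<in> PN \<Otimes>\<^sub>M PN \<rightarrow>\<^sub>M PS W"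
    by (auto simp: measurable_to_PN[symmetric])
  have "AE c in PN. AE m in PN. R (splc K m n1) c" if n1: "n1 \<in> space PN" for n1
  proof (rule PP.AE_commute[THEN iffD1, OF _ *[OF n1]])
    show "{x \<in> space (PN \<Otimes>\<^sub>M PN). R (splc K (fst x) n1) (snd x)} \<in> sets (PN \<Otimes>\<^sub>M PN)"
      using n1 by (intro sR measurable_splc m2 measurable_const) (simp add: space_PN space_path_space[OF T_pos])
  qed
  then have "AE n1 in PN. AE c in PN. AE m in PN. R (splc K m n1) c" by (rule AE_I2)
  \<comment> \<open>With \<open>c\<close> outermost and fixed, the independent copies
    \<open>m\<close> and \<open>n1\<close> can be merged again into one noise \<open>n\<close> by
    \<open>AE_splice\<close>.\<close>
  then have "AE c in PN. AE n1 in PN. AE m in PN. R (splc K m n1) c"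
  proof (rule PP.AE_commute[THEN iffD1, rotated])
    show "{x \<in> space (PN \<Otimes>\<^sub>M PN). AE m in PN. R (splc K m (fst x)) (snd x)} \<in> sets (PN \<Otimes>\<^sub>M PN)"
    proof (rule PN.sets_Collect_AE)
      have m: "(\<lambda>z. snd z) \<in> (PN \<Otimes>\<^sub>M PN) \<Otimes>\<^sub>M PN \<rightarrow>\<^sub>M PS W" "(\<lambda>z. fst (fst z)) \<in> (PN \<Otimes>\<^sub>M PN) \<Otimes>\<^sub>M PN \<rightarrow>\<^sub>M PS W"
        "(\<lambda>z. snd (fst z)) \<in> (PN \<Otimes>\<^sub>M PN) \<Otimes>\<^sub>M PN \<rightarrow>\<^sub>M PS W"
        by (auto simp: measurable_to_PN[symmetric])
      show "{z \<in> space ((PN \<Otimes>\<^sub>M PN) \<Otimes>\<^sub>M PN). R (splc K (snd z) (fst (fst z))) (snd (fst z))} \<in> sets ((PN \<Otimes>\<^sub>M PN) \<Otimes>\<^sub>M PN)"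
        by (intro sR measurable_splc m)
    qed
  qed
  then show ?thesis using AE_space
  proof eventually_elim
    fix c assume c: "AE n1 in PN. AE m in PN. R (splc K m n1) c" and "c \<in> space PN"
    then have c': "c \<in> cadlag_fam T W" by (simp add: space_PN)
    have sRc: "{n \<in> space (PS W). R n c} \<in> sets (PS W)"
      using c' by (intro sR measurable_ident_sets refl measurable_const) (simp add: space_path_space[OF T_pos])
    have "AE m in PN. AE n1 in PN. R (splc K m n1) c"
    proof (rule PP.AE_commute[THEN iffD1, OF _ c])
      show "{x \<in> space (PN \<Otimes>\<^sub>M PN). R (splc K (snd x) (fst x)) c} \<in> sets (PN \<Otimes>\<^sub>M PN)"
        using c' by (intro sR measurable_splc m2 measurable_const) (simp add: space_path_space[OF T_pos])
    qed
    then have R: "AE n in PN. R n c" using AE_splice[OF sRc, of K] by simp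
    \<comment> \<open>For fixed \<open>c\<close> this is an adapted map of the noise. By
      \<open>R\<close> it solves the equations at the replaced inputs, and by
      \<open>solves_cong\<close> also those at the true inputs.\<close>
    define \<phi>' where "\<phi>' n = Jsol U c (\<phi>S n, n)" for n
    have \<phi>': "meas_adapted_map T W U \<phi>'"
      unfolding \<phi>'_def[abs_def] Jsol_def split
      by (intro adapted_Isol[OF U] adapted_cut[OF S pa_sub] adapted_splc c')
    have "AE n in PN. solves U (\<phi>' n) (\<phi>S n) n"
      using R AE_space
    proof eventually_elim
      fix n assume Rn: "R n c" and "n \<in> space PN"
      then have n: "n \<in> space (PS W)" "n \<in> cadlag_fam T W" by (simp_all add: space_PN space_path_space[OF T_pos])
      note i = measurable_path_space_in[OF T_pos meas_adapted_mapD(1)[OF \<phi>'] n(1)]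
        measurable_path_space_in[OF T_pos mS n(1)]
      have "solves U (\<phi>' n) (cut U (\<phi>S n)) (splc K n c)"
        using Rn by (simp add: R_def \<phi>'_def Jsol_def K_def)
      moreover have "solves U (\<phi>' n) (cut U (\<phi>S n)) (splc K n c) \<longleftrightarrow> solves U (\<phi>' n) (\<phi>S n) n"
      proof (rule solves_cong[OF U i(1) cut_in[OF i(2) pa_sub] splc_in[OF n(2) c'] i(2) n(2)])
        show "cut U (\<phi>S n) u = \<phi>S n u" if "u \<in> pa U" for u using that pa_sub by (auto simp: cut_def)
        show "splc K n c u = n u" if "u \<in> nz U" for u using that nz_sub by (auto simp: splc_def K_def)
      qed
      ultimately show "solves U (\<phi>' n) (\<phi>S n) n" by simp
    qed
    from Isol_unique[OF U S \<phi>' this] Isol_unique[OF U S \<phi> sol]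
    show "AE n in PN. \<phi> n = Jsol U c (\<phi>S n, n)"
      by eventually_elim (simp add: \<phi>'_def)
  qed
qed

end


context sde_context
begin

subsection \<open>Observational and interventional solutions\<close>

definition sol0 :: "('n \<Rightarrow> path) \<Rightarrow> 'n \<Rightarrow> path" where
  "sol0 = (SOME \<phi>. solution M T \<Psi> D \<phi>)"

text \<open>A single formula for all \<open>xB\<close>. It is jointly measurable in
  \<open>xB\<close> and the noise, which a solution chosen separately for each \<open>xB\<close>
  would not be; randomising the intervention depends on this.\<close>

definition xdo :: "'n set \<Rightarrow> ('n \<Rightarrow> path) \<Rightarrow> ('n \<Rightarrow> path) \<Rightarrow> 'n \<Rightarrow> path" where
  "xdo B xB n = (\<lambda>v\<in>V. if v \<in> B then xB v else Isol (V - B) (xB, n) v)"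

lemma merge_restrict: "x \<in> cadlag_fam T V \<Longrightarrow> U \<subseteq> V \<Longrightarrow> merge U (V - U) (restrict x U, restrict x (V - U)) = x"
  by (rule ext) (auto simp: merge_def cadlag_fam_def PiE_def extensional_def)

lemma solves_restrict:
  assumes "x \<in> cadlag_fam T V" "U \<subseteq> V"
  shows "solves U (restrict x U) (restrict x (V - U)) n \<longleftrightarrow> (\<forall>v\<in>U. x v = sde_map T \<Psi> D v (x, n))"
  unfolding solves_def merge_restrict[OF assms] by simp

lemma adapted_restrict:
  assumes "meas_adapted_map T W P \<phi>" "U \<subseteq> P"
  shows "meas_adapted_map T W U (\<lambda>n. restrict (\<phi> n) U)"
  unfolding meas_adapted_map_iff
proof (intro conjI ballI)
  show "(\<lambda>n. restrict (\<phi> n) U) \<in> PS W \<rightarrow>\<^sub>M PS U"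
    by (rule measurable_restrict_path[OF meas_adapted_mapD(1)[OF assms(1)] assms(2)])
  fix u assume u: "u \<in> U"
  then have "u \<in> P" using assms(2) by blast
  from meas_adapted_mapD(2)[OF assms(1) this] u show "adp T W (\<lambda>n. restrict (\<phi> n) U u)" by simp
qed

lemma adapted_const: "x \<in> cadlag_fam T P \<Longrightarrow> meas_adapted_map T W P (\<lambda>_. x)"
  by (simp add: meas_adapted_map_iff adp_const space_path_space[OF T_pos])

lemma sets_eqs:
  assumes "U \<subseteq> V" "f \<in> N \<rightarrow>\<^sub>M PS V" "g \<in> N \<rightarrow>\<^sub>M PS W"
  shows "{z \<in> space N. \<forall>v\<in>U. f z v = sde_map T \<Psi> D v (f z, g z)} \<in> sets N"
proof (rule sets.sets_Collect_finite_All[OF _ fin_sub(1)[OF assms(1)]])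
  fix v assume "v \<in> U"
  then have v: "v \<in> V" using assms(1) by blast
  from measurable_compose[OF measurable_Pair[OF assms(2,3)] measurable_sde_map[OF v]]
  show "{z \<in> space N. f z v = sde_map T \<Psi> D v (f z, g z)} \<in> sets N"
    by (intro pred_eq_D_real[OF T_pos] measurable_path_space_component[OF assms(2) v])
qed

lemma AE_eqs_iff:
  assumes "U \<subseteq> V" "\<phi> \<in> PS W \<rightarrow>\<^sub>M PS V"
  shows "(AE \<omega> in M. \<forall>v\<in>U. \<phi> (noise_path D \<omega>) v = sde_map T \<Psi> D v (\<phi> (noise_path D \<omega>), noise_path D \<omega>)) \<longleftrightarrow>
    (AE n in PN. \<forall>v\<in>U. \<phi> n v = sde_map T \<Psi> D v (\<phi> n, n))"
  by (rule AE_noise_iff) (intro sets_eqs assms measurable_ident_sets refl)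

lemma VB: "B \<subseteq> V \<Longrightarrow> V - (V - B) = B" by blast

lemma measurable_xdo:
  assumes B: "B \<subseteq> V" and f: "f \<in> N \<rightarrow>\<^sub>M PS B" and g: "g \<in> N \<rightarrow>\<^sub>M PS W"
  shows "(\<lambda>z. xdo B (f z) (g z)) \<in> N \<rightarrow>\<^sub>M PS V"
proof (rule measurable_path_space_components[OF T_pos])
  fix v assume v: "v \<in> V"
  have "(\<lambda>z. Isol (V - B) (f z, g z)) \<in> N \<rightarrow>\<^sub>M PS (V - B)"
    using f g by (intro measurable_Isol) (auto simp: VB[OF B])
  from measurable_path_space_component[OF this, of v] measurable_path_space_component[OF f, of v]
  show "(\<lambda>z. xdo B (f z) (g z) v) \<in> N \<rightarrow>\<^sub>M D_real T"
    using v by (cases "v \<in> B") (auto simp: xdo_def)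
qed (simp add: xdo_def)

lemma adapted_xdo:
  assumes B: "B \<subseteq> V" and x: "xB \<in> cadlag_fam T B"
  shows "meas_adapted_map T W V (xdo B xB)"
  unfolding meas_adapted_map_iff
proof (intro conjI ballI)
  show "xdo B xB \<in> PS W \<rightarrow>\<^sub>M PS V"
    using x by (intro measurable_xdo[OF B] measurable_const measurable_ident_sets refl) (simp add: space_path_space[OF T_pos])
  fix v assume v: "v \<in> V"
  have "meas_adapted_map T W (V - B) (\<lambda>n. Isol (V - B) (xB, n))"
    using adapted_const[OF x] by (intro adapted_Isol adapted_id) (auto simp: VB[OF B])
  from meas_adapted_mapD(2)[OF this, of v] v
  show "adp T W (\<lambda>n. xdo B xB n v)"
    by (cases "v \<in> B") (auto simp: xdo_def adp_const)
qed

lemma xdo_B: "v \<in> V \<Longrightarrow> v \<in> B \<Longrightarrow> xdo B xB n v = xB v"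
  by (simp add: xdo_def)

lemma xdo_restrict: "B \<subseteq> V \<Longrightarrow> xB \<in> cadlag_fam T B \<Longrightarrow> restrict (xdo B xB n) B = xB"
  by (rule ext) (auto simp: xdo_def cadlag_fam_def PiE_def extensional_def)

lemma xdo_solves:
  assumes B: "B \<subseteq> V" and x: "xB \<in> cadlag_fam T B"
  shows "AE n in PN. \<forall>v\<in>V - B. xdo B xB n v = sde_map T \<Psi> D v (xdo B xB n, n)"
proof -
  have c: "meas_adapted_map T W (V - (V - B)) (\<lambda>_. xB)" unfolding VB[OF B] by (rule adapted_const[OF x])
  have "AE n in PN. solves (V - B) (Isol (V - B) (xB, n)) xB n"
    by (rule Isol_solves[OF _ c]) auto
  then show ?thesis using AE_space
  proof eventually_elim
    fix n assume s: "solves (V - B) (Isol (V - B) (xB, n)) xB n" and "n \<in> space PN"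
    then have n: "n \<in> space (PS W)" by (simp add: space_PN space_path_space[OF T_pos])
    note X = measurable_path_space_in[OF T_pos meas_adapted_mapD(1)[OF adapted_xdo[OF B x]] n]
    have "meas_adapted_map T W (V - B) (\<lambda>n. Isol (V - B) (xB, n))"
      using c by (intro adapted_Isol adapted_id) auto
    note I = measurable_path_space_in[OF T_pos meas_adapted_mapD(1)[OF this] n]
    have 1: "restrict (xdo B xB n) (V - B) = Isol (V - B) (xB, n)"
      using I by (intro ext) (auto simp: xdo_def cadlag_fam_def PiE_def extensional_def)
    have "solves (V - B) (restrict (xdo B xB n) (V - B)) (restrict (xdo B xB n) (V - (V - B))) n"
      unfolding VB[OF B] 1 xdo_restrict[OF B x] by (rule s)
    then show "\<forall>v\<in>V - B. xdo B xB n v = sde_map T \<Psi> D v (xdo B xB n, n)"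
      by (subst (asm) solves_restrict[OF X]) auto
  qed
qed

text \<open>The part of a global adapted map outside \<open>U\<close> is an admissible adapted input
  for the equations of \<open>U\<close>, so \<open>AE_generic\<close> applies to any block of
  equations that the map satisfies.\<close>

lemma generic_restrict:
  assumes U: "U \<subseteq> V" and \<phi>: "meas_adapted_map T W V \<phi>"
    and sol: "AE n in PN. \<forall>v\<in>U. \<phi> n v = sde_map T \<Psi> D v (\<phi> n, n)"
  shows "AE c in PN. AE n in PN. restrict (\<phi> n) U = Jsol U c (\<phi> n, n)"
proof -
  have "AE n in PN. solves U (restrict (\<phi> n) U) (restrict (\<phi> n) (V - U)) n"
    using sol AE_space
  proof eventually_elim
    fix n assume s: "\<forall>v\<in>U. \<phi> n v = sde_map T \<Psi> D v (\<phi> n, n)" and "n \<in> space PN"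
    then have "n \<in> space (PS W)" by (simp add: space_PN space_path_space[OF T_pos])
    from solves_restrict[OF measurable_path_space_in[OF T_pos meas_adapted_mapD(1)[OF \<phi>] this] U] s
    show "solves U (restrict (\<phi> n) U) (restrict (\<phi> n) (V - U)) n" by simp
  qed
  from AE_generic[OF U _ _ this] adapted_restrict[OF \<phi>] U
  have "AE c in PN. AE n in PN. restrict (\<phi> n) U = Jsol U c (restrict (\<phi> n) (V - U), n)" by simp
  moreover have "Jsol U c (restrict (\<phi> n) (V - U), n) = Jsol U c (\<phi> n, n)" for c n
    using pa_sub[of U] by (intro Jsol_cong) (simp_all add: restrict_restrict Int_absorb1)
  ultimately show ?thesis by simp
qed

text \<open>The intervention on no node at all provides a solution of the full system.\<close>

lemma sol0_do: "solution M T \<Psi> D sol0"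
proof -
  define u :: "'n \<Rightarrow> path" where "u = (\<lambda>_. undefined)"
  have u: "u \<in> cadlag_fam T {}" by (simp add: u_def cadlag_fam_def)
  have "solution M T \<Psi> D (xdo {} u)"
    unfolding do_solution_def
    using adapted_xdo[OF _ u] xdo_solves[OF _ u] AE_eqs_iff[of V "xdo {} u", OF _ meas_adapted_mapD(1)[OF adapted_xdo[OF _ u]]]
    by simp
  then show ?thesis unfolding sol0_def by (rule someI[of "solution M T \<Psi> D" "xdo {} u"])
qed

lemma adapted_sol0: "meas_adapted_map T W V sol0"
  using sol0_do by (simp add: do_solution_def)

lemma measurable_sol0: "sol0 \<in> PS W \<rightarrow>\<^sub>M PS V"
  by (rule meas_adapted_mapD(1)[OF adapted_sol0])

lemma sol0_solves: "AE n in PN. \<forall>v\<in>V. sol0 n v = sde_map T \<Psi> D v (sol0 n, n)"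
  using sol0_do AE_eqs_iff[OF subset_refl measurable_sol0] by (simp add: do_solution_def)

lemma obs_dist_eq: "obs_dist M T \<Psi> D = distr PN (PS V) sol0"
  unfolding obs_dist_def sol0_def[symmetric] PN_def
  by (simp add: distr_distr[OF measurable_sol0 measurable_noise_path] comp_def)

text \<open>\<open>do_dist\<close> is built from a chosen solution. Uniqueness with respect to
  \<open>V - B\<close> shows that any choice has the law of \<open>xdo\<close>, so the explicit map
  can replace it.\<close>

lemma do_dist_eq:
  assumes B: "B \<subseteq> V" and x: "xB \<in> cadlag_fam T B"
  shows "do_dist M T \<Psi> D B xB = distr PN (PS (V - B)) (\<lambda>n. restrict (xdo B xB n) (V - B))"
proof -
  define \<phi> where "\<phi> = (SOME \<phi>. do_solution M T \<Psi> D B xB \<phi>)"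
  note mx = meas_adapted_mapD(1)[OF adapted_xdo[OF B x]]
  have "AE \<omega> in M. \<forall>v\<in>V - B. xdo B xB (noise_path D \<omega>) v = sde_map T \<Psi> D v (xdo B xB (noise_path D \<omega>), noise_path D \<omega>)"
    using xdo_solves[OF B x] AE_eqs_iff[OF _ mx, of "V - B"] by auto
  then have "AE \<omega> in M. \<forall>v\<in>V. xdo B xB (noise_path D \<omega>) v =
      (if v \<in> B then xB v else sde_map T \<Psi> D v (xdo B xB (noise_path D \<omega>), noise_path D \<omega>))"
    by eventually_elim (simp add: xdo_B)
  then have "do_solution M T \<Psi> D B xB (xdo B xB)"
    unfolding do_solution_def by (intro conjI adapted_xdo[OF B x])
  then have \<phi>: "do_solution M T \<Psi> D B xB \<phi>" unfolding \<phi>_def by (rule someI[of "do_solution M T \<Psi> D B xB"])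
  then have a\<phi>: "meas_adapted_map T W V \<phi>" by (simp add: do_solution_def)
  note m\<phi> = meas_adapted_mapD(1)[OF a\<phi>]
  have full: "AE \<omega> in M. \<forall>v\<in>V. \<phi> (noise_path D \<omega>) v =
      (if v \<in> B then xB v else sde_map T \<Psi> D v (\<phi> (noise_path D \<omega>), noise_path D \<omega>))"
    using \<phi> by (simp add: do_solution_def)
  have "AE \<omega> in M. \<forall>v\<in>V - B. \<phi> (noise_path D \<omega>) v = sde_map T \<Psi> D v (\<phi> (noise_path D \<omega>), noise_path D \<omega>)"
    using full by eventually_elim auto
  then have s\<phi>: "AE n in PN. \<forall>v\<in>V - B. \<phi> n v = sde_map T \<Psi> D v (\<phi> n, n)"
    using AE_eqs_iff[OF _ m\<phi>, of "V - B"] by auto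
  have "AE \<omega> in M. restrict (\<phi> (noise_path D \<omega>)) B = xB"
    using full
  proof eventually_elim
    fix \<omega> assume "\<forall>v\<in>V. \<phi> (noise_path D \<omega>) v = (if v \<in> B then xB v else sde_map T \<Psi> D v (\<phi> (noise_path D \<omega>), noise_path D \<omega>))"
    then show "restrict (\<phi> (noise_path D \<omega>)) B = xB"
      using B x by (intro ext) (auto simp: cadlag_fam_def PiE_def extensional_def)
  qed
  moreover have sb: "{n \<in> space (PS W). restrict (\<phi> n) B = xB} \<in> sets (PS W)"
    by (rule pred_eq_path_space[OF T_pos fin_sub(1)[OF B] measurable_restrict_path[OF m\<phi> B]])
       (simp add: x space_path_space[OF T_pos])
  ultimately have b\<phi>: "AE n in PN. restrict (\<phi> n) B = xB"
    using AE_noise_iff[OF sb] by simp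
  have c: "meas_adapted_map T W (V - (V - B)) (\<lambda>_. xB)" unfolding VB[OF B] by (rule adapted_const[OF x])
  have "AE n in PN. solves (V - B) (restrict (\<phi> n) (V - B)) xB n"
    using s\<phi> b\<phi> AE_space
  proof eventually_elim
    fix n assume s: "\<forall>v\<in>V - B. \<phi> n v = sde_map T \<Psi> D v (\<phi> n, n)" and b: "restrict (\<phi> n) B = xB" and "n \<in> space PN"
    then have "n \<in> space (PS W)" by (simp add: space_PN space_path_space[OF T_pos])
    from solves_restrict[OF measurable_path_space_in[OF T_pos m\<phi> this], of "V - B" n] s b
    show "solves (V - B) (restrict (\<phi> n) (V - B)) xB n" by (simp add: VB[OF B])
  qed
  from Isol_unique[OF _ c adapted_restrict[OF a\<phi>] this]
  have "AE n in PN. restrict (\<phi> n) (V - B) = Isol (V - B) (xB, n)" by auto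
  then have "AE n in PN. restrict (\<phi> n) (V - B) = restrict (xdo B xB n) (V - B)"
    using AE_space
  proof eventually_elim
    fix n assume s: "restrict (\<phi> n) (V - B) = Isol (V - B) (xB, n)"
    show "restrict (\<phi> n) (V - B) = restrict (xdo B xB n) (V - B)"
      unfolding s by (rule ext) (auto simp: xdo_def s[symmetric])
  qed
  then have "distr PN (PS (V - B)) (\<lambda>n. restrict (\<phi> n) (V - B)) = distr PN (PS (V - B)) (\<lambda>n. restrict (xdo B xB n) (V - B))"
    by (rule distr_cong_AE[OF refl refl])
       (use measurable_restrict_path[OF m\<phi>] measurable_restrict_path[OF mx] in \<open>auto simp: measurable_PN\<close>)
  moreover have "do_dist M T \<Psi> D B xB = distr PN (PS (V - B)) (\<lambda>n. restrict (\<phi> n) (V - B))"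
    unfolding do_dist_def \<phi>_def[symmetric] PN_def
    using distr_distr[OF measurable_restrict_path[OF m\<phi>, of "V - B"] measurable_noise_path] by (simp add: comp_def)
  ultimately show ?thesis by simp
qed

text \<open>Genericity holds for almost every \<open>c\<close> in each regime, hence for some
  \<open>c\<close> in both; a common \<open>c\<close> is what makes the representing function the
  same in both regimes. Every \<open>x\<close> has its own null set of bad \<open>c\<close>, and
  Fubini exchanges the quantifiers so that one \<open>c\<close> serves almost all
  \<open>x\<close>.\<close>

lemma common_generic:
  assumes U: "U \<subseteq> V" and B: "B \<subseteq> V" and \<nu>: "prob_space \<nu>" "sets \<nu> = sets (PS B)"
  obtains c where "c \<in> cadlag_fam T W" "AE n in PN. restrict (sol0 n) U = Jsol U c (sol0 n, n)"
    "U \<inter> B = {} \<Longrightarrow> AE x in \<nu>. AE n in PN. restrict (xdo B x n) U = Jsol U c (xdo B x n, n)"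
proof -
  interpret \<nu>: prob_space \<nu> by (rule \<nu>(1))
  interpret PP: pair_prob_space \<nu> PN ..
  have sp: "space \<nu> = cadlag_fam T B" using sets_eq_imp_space_eq[OF \<nu>(2)] by (simp add: space_path_space[OF T_pos])
  have "AE n in PN. \<forall>v\<in>U. sol0 n v = sde_map T \<Psi> D v (sol0 n, n)"
    using sol0_solves by eventually_elim (use U in auto)
  from generic_restrict[OF U adapted_sol0 this]
  have o: "AE c in PN. AE n in PN. restrict (sol0 n) U = Jsol U c (sol0 n, n)" .
  have "AE c in PN. U \<inter> B = {} \<longrightarrow> (AE x in \<nu>. AE n in PN. restrict (xdo B x n) U = Jsol U c (xdo B x n, n))"
  proof (cases "U \<inter> B = {}")
    case True
    have "AE c in PN. AE n in PN. restrict (xdo B x n) U = Jsol U c (xdo B x n, n)" if "x \<in> space \<nu>" for x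
    proof -
      have x: "x \<in> cadlag_fam T B" using that sp by simp
      have "AE n in PN. \<forall>v\<in>U. xdo B x n v = sde_map T \<Psi> D v (xdo B x n, n)"
        using xdo_solves[OF B x] by eventually_elim (use U True in auto)
      from generic_restrict[OF U adapted_xdo[OF B x] this] show ?thesis .
    qed
    then have "AE x in \<nu>. AE c in PN. AE n in PN. restrict (xdo B x n) U = Jsol U c (xdo B x n, n)" by (rule AE_I2)
    then have "AE c in PN. AE x in \<nu>. AE n in PN. restrict (xdo B x n) U = Jsol U c (xdo B x n, n)"
    proof (rule PP.AE_commute[THEN iffD1, rotated])
      show "{z \<in> space (\<nu> \<Otimes>\<^sub>M PN). AE n in PN. restrict (xdo B (fst z) n) U = Jsol U (snd z) (xdo B (fst z) n, n)} \<in> sets (\<nu> \<Otimes>\<^sub>M PN)"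
      proof (rule PN.sets_Collect_AE)
        let ?Q = "(\<nu> \<Otimes>\<^sub>M PN) \<Otimes>\<^sub>M PN"
        have mc: "measurable ?Q \<nu> = measurable ?Q (PS B)"
          by (rule measurable_cong_sets) (simp_all add: \<nu>(2))
        have m0: "(\<lambda>z. snd z) \<in> ?Q \<rightarrow>\<^sub>M PN" "(\<lambda>z. fst (fst z)) \<in> ?Q \<rightarrow>\<^sub>M \<nu>" "(\<lambda>z. snd (fst z)) \<in> ?Q \<rightarrow>\<^sub>M PN"
          by measurable
        note m = m0(1)[unfolded measurable_to_PN] m0(2)[unfolded mc] m0(3)[unfolded measurable_to_PN]
        note mx = measurable_xdo[OF B m(2) m(1)]
        have "pa U \<subseteq> V" using pa_sub by blast
        show "{z \<in> space ((\<nu> \<Otimes>\<^sub>M PN) \<Otimes>\<^sub>M PN). restrict (xdo B (fst (fst z)) (snd z)) U = Jsol U (snd (fst z)) (xdo B (fst (fst z)) (snd z), snd z)} \<in> sets ((\<nu> \<Otimes>\<^sub>M PN) \<Otimes>\<^sub>M PN)"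
          by (intro pred_eq_path_space[OF T_pos fin_sub(1)[OF U]] measurable_restrict_path[OF mx U] 
              measurable_Jsol[OF U mx] m) fact
      qed
    qed
    then show ?thesis by simp
  qed simp
  with o have "AE c in PN. (AE n in PN. restrict (sol0 n) U = Jsol U c (sol0 n, n)) \<and>
     (U \<inter> B = {} \<longrightarrow> (AE x in \<nu>. AE n in PN. restrict (xdo B x n) U = Jsol U c (xdo B x n, n)))" by eventually_elim auto
  from eventually_happens[OF eventually_conj[OF this AE_space]] PN.not_empty 
  obtain c where "c \<in> space PN" "AE n in PN. restrict (sol0 n) U = Jsol U c (sol0 n, n)"
     "U \<inter> B = {} \<longrightarrow> (AE x in \<nu>. AE n in PN. restrict (xdo B x n) U = Jsol U c (xdo B x n, n))"
    by (auto simp: trivial_limit_def PN.AE_False)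
  then show ?thesis using that by (simp add: space_PN)
qed

end


section \<open>Conditional independence\<close>

text \<open>\<open>r\<close> is a version of \<open>P(Y \<in> E | X, Z)\<close> that depends on \<open>Z\<close> only.\<close>

definition cond_indep :: "'o measure \<Rightarrow> 'b measure \<Rightarrow> ('o \<Rightarrow> 'b) \<Rightarrow> 'a measure \<Rightarrow> ('o \<Rightarrow> 'a) \<Rightarrow>
    'z measure \<Rightarrow> ('o \<Rightarrow> 'z) \<Rightarrow> bool" where
  "cond_indep Q SB Y SA X SZ Z \<longleftrightarrow> (\<forall>E\<in>sets SB. \<exists>r\<in>borel_measurable SZ. \<forall>e\<in>sets (SA \<Otimes>\<^sub>M SZ).
     emeasure Q {\<omega>\<in>space Q. Y \<omega> \<in> E \<and> (X \<omega>, Z \<omega>) \<in> e} =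
       (\<integral>\<^sup>+\<omega>. r (Z \<omega>) * indicator e (X \<omega>, Z \<omega>) \<partial>Q))"

text \<open>The law of \<open>Z\<close> restricted to \<open>A\<close> and the law of
  \<open>Z\<close> weighted by \<open>r\<close> agree on events and so on all functions of
  \<open>Z\<close>. This trades an indicator for its conditional probability.\<close>

lemma cond_weight_integral:
  assumes A: "A \<in> sets Q" and [measurable]: "Z \<in> Q \<rightarrow>\<^sub>M SZ" "r \<in> borel_measurable SZ" "h \<in> borel_measurable SZ"
    and eq: "\<And>G. G \<in> sets SZ \<Longrightarrow> emeasure Q (A \<inter> (Z -` G \<inter> space Q)) = (\<integral>\<^sup>+\<omega>. r (Z \<omega>) * indicator G (Z \<omega>) \<partial>Q)"
  shows "(\<integral>\<^sup>+\<omega>. indicator A \<omega> * h (Z \<omega>) \<partial>Q) = (\<integral>\<^sup>+\<omega>. r (Z \<omega>) * h (Z \<omega>) \<partial>Q)"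
proof -
  have A'[measurable]: "A \<in> sets Q" by (rule A)
  have m: "distr (density Q (indicator A)) SZ Z = distr (density Q (\<lambda>\<omega>. r (Z \<omega>))) SZ Z"
  proof (rule measure_eqI)
    fix G assume "G \<in> sets (distr (density Q (indicator A)) SZ Z)"
    then have G[measurable]: "G \<in> sets SZ" by simp
    have Gm[measurable]: "Z -` G \<inter> space Q \<in> sets Q" by measurable
    have "emeasure (distr (density Q (indicator A)) SZ Z) G = (\<integral>\<^sup>+\<omega>. indicator A \<omega> * indicator (Z -` G \<inter> space Q) \<omega> \<partial>Q)"
      by (simp add: emeasure_distr emeasure_density)
    also have "\<dots> = (\<integral>\<^sup>+\<omega>. indicator (A \<inter> (Z -` G \<inter> space Q)) \<omega> \<partial>Q)"
      by (intro nn_integral_cong) (auto split: split_indicator)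
    also have "\<dots> = emeasure Q (A \<inter> (Z -` G \<inter> space Q))" by simp
    also have "\<dots> = (\<integral>\<^sup>+\<omega>. r (Z \<omega>) * indicator G (Z \<omega>) \<partial>Q)" by (rule eq[OF G])
    also have "\<dots> = (\<integral>\<^sup>+\<omega>. r (Z \<omega>) * indicator (Z -` G \<inter> space Q) \<omega> \<partial>Q)"
      by (intro nn_integral_cong) (auto split: split_indicator)
    also have "\<dots> = emeasure (distr (density Q (\<lambda>\<omega>. r (Z \<omega>))) SZ Z) G"
      by (simp add: emeasure_distr emeasure_density)
    finally show "emeasure (distr (density Q (indicator A)) SZ Z) G = emeasure (distr (density Q (\<lambda>\<omega>. r (Z \<omega>))) SZ Z) G" .
  qed simp
  have "(\<integral>\<^sup>+\<omega>. indicator A \<omega> * h (Z \<omega>) \<partial>Q) = (\<integral>\<^sup>+z. h z \<partial>distr (density Q (indicator A)) SZ Z)"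
    by (simp add: nn_integral_distr nn_integral_density)
  also have "\<dots> = (\<integral>\<^sup>+\<omega>. r (Z \<omega>) * h (Z \<omega>) \<partial>Q)"
    unfolding m by (simp add: nn_integral_distr nn_integral_density)
  finally show ?thesis .
qed

text \<open>The conditional probability of \<open>A\<close> given \<open>Z\<close>, obtained
  directly as a function of \<open>Z\<close>: it is the Radon-Nikodym derivative of the law of
  \<open>Z\<close> on \<open>A\<close> by the law of \<open>Z\<close>.\<close>

lemma (in finite_measure) cond_weight_exists:
  assumes A: "A \<in> sets M" and Z[measurable]: "Z \<in> M \<rightarrow>\<^sub>M SZ"
  obtains s where "s \<in> borel_measurable SZ"
    "\<And>G. G \<in> sets SZ \<Longrightarrow> emeasure M (A \<inter> (Z -` G \<inter> space M)) = (\<integral>\<^sup>+\<omega>. s (Z \<omega>) * indicator G (Z \<omega>) \<partial>M)"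
proof -
  have A'[measurable]: "A \<in> sets M" by (rule A)
  let ?D = "distr M SZ Z" and ?L = "distr (density M (indicator A)) SZ Z"
  interpret D: finite_measure ?D by (rule finite_measure_distr[OF Z])
  have L: "emeasure ?L G = emeasure M (A \<inter> (Z -` G \<inter> space M))" if G[measurable]: "G \<in> sets SZ" for G
  proof -
    have Gm[measurable]: "Z -` G \<inter> space M \<in> sets M" by measurable
    have "emeasure ?L G = (\<integral>\<^sup>+\<omega>. indicator A \<omega> * indicator (Z -` G \<inter> space M) \<omega> \<partial>M)"
      by (simp add: emeasure_distr emeasure_density)
    also have "\<dots> = (\<integral>\<^sup>+\<omega>. indicator (A \<inter> (Z -` G \<inter> space M)) \<omega> \<partial>M)"
      by (intro nn_integral_cong) (auto split: split_indicator)
    finally show ?thesis by simp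
  qed
  have "absolutely_continuous ?D ?L"
    unfolding absolutely_continuous_def
  proof
    fix G assume "G \<in> null_sets ?D"
    then have G[measurable]: "G \<in> sets SZ" and 0: "emeasure M (Z -` G \<inter> space M) = 0"
      by (auto simp: null_sets_def emeasure_distr)
    have "emeasure M (A \<inter> (Z -` G \<inter> space M)) \<le> emeasure M (Z -` G \<inter> space M)"
      by (rule emeasure_mono) auto
    then have "emeasure ?L G = 0" using 0 by (simp add: L[OF G])
    then show "G \<in> null_sets ?L" by (simp add: null_sets_def)
  qed
  from D.Radon_Nikodym[OF this] obtain s where s: "s \<in> borel_measurable ?D" "density ?D s = ?L" by auto
  have s'[measurable]: "s \<in> borel_measurable SZ" using s(1) by simp
  show ?thesis
  proof (rule that[OF s'])
    fix G assume G[measurable]: "G \<in> sets SZ"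
    have "emeasure M (A \<inter> (Z -` G \<inter> space M)) = emeasure (density ?D s) G" by (simp add: L[OF G] s(2))
    also have "\<dots> = (\<integral>\<^sup>+\<omega>. s (Z \<omega>) * indicator G (Z \<omega>) \<partial>M)"
      by (simp add: emeasure_density nn_integral_distr)
    finally show "emeasure M (A \<inter> (Z -` G \<inter> space M)) = (\<integral>\<^sup>+\<omega>. s (Z \<omega>) * indicator G (Z \<omega>) \<partial>M)" .
  qed
qed

text \<open>Rectangles form an Int-stable generator of the product, and the restricted law is
  finite, so the identity extends from rectangles to all events.\<close>

lemma cond_weight_rect:
  assumes Q: "finite_measure Q" and A: "A \<in> sets Q" 
    and [measurable]: "X \<in> Q \<rightarrow>\<^sub>M SA" "Z \<in> Q \<rightarrow>\<^sub>M SZ" "r \<in> borel_measurable SZ"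
    and eq: "\<And>F G. F \<in> sets SA \<Longrightarrow> G \<in> sets SZ \<Longrightarrow> emeasure Q {\<omega>\<in>space Q. \<omega> \<in> A \<and> X \<omega> \<in> F \<and> Z \<omega> \<in> G} =
       (\<integral>\<^sup>+\<omega>. r (Z \<omega>) * indicator F (X \<omega>) * indicator G (Z \<omega>) \<partial>Q)"
    and e: "e \<in> sets (SA \<Otimes>\<^sub>M SZ)"
  shows "emeasure Q {\<omega>\<in>space Q. \<omega> \<in> A \<and> (X \<omega>, Z \<omega>) \<in> e} = (\<integral>\<^sup>+\<omega>. r (Z \<omega>) * indicator e (X \<omega>, Z \<omega>) \<partial>Q)"
proof -
  interpret finite_measure Q by (rule Q)
  have A'[measurable]: "A \<in> sets Q" by (rule A)
  let ?f = "\<lambda>\<omega>. (X \<omega>, Z \<omega>)"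
  let ?M1 = "distr (density Q (indicator A)) (SA \<Otimes>\<^sub>M SZ) ?f" and ?M2 = "distr (density Q (\<lambda>\<omega>. r (Z \<omega>))) (SA \<Otimes>\<^sub>M SZ) ?f"
  have e1: "emeasure ?M1 e = emeasure Q {\<omega>\<in>space Q. \<omega> \<in> A \<and> ?f \<omega> \<in> e}" if e[measurable]: "e \<in> sets (SA \<Otimes>\<^sub>M SZ)" for e
  proof -
    have em[measurable]: "?f -` e \<inter> space Q \<in> sets Q" by measurable
    have "emeasure ?M1 e = (\<integral>\<^sup>+\<omega>. indicator A \<omega> * indicator (?f -` e \<inter> space Q) \<omega> \<partial>Q)"
      by (simp add: emeasure_distr emeasure_density)
    also have "\<dots> = (\<integral>\<^sup>+\<omega>. indicator {\<omega>\<in>space Q. \<omega> \<in> A \<and> ?f \<omega> \<in> e} \<omega> \<partial>Q)"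
      by (intro nn_integral_cong) (auto split: split_indicator)
    also have "\<dots> = emeasure Q {\<omega>\<in>space Q. \<omega> \<in> A \<and> ?f \<omega> \<in> e}"
      by (rule nn_integral_indicator) measurable
    finally show ?thesis .
  qed
  have e2: "emeasure ?M2 e = (\<integral>\<^sup>+\<omega>. r (Z \<omega>) * indicator e (?f \<omega>) \<partial>Q)" if e[measurable]: "e \<in> sets (SA \<Otimes>\<^sub>M SZ)" for e
  proof -
    have em[measurable]: "?f -` e \<inter> space Q \<in> sets Q" by measurable
    have "emeasure ?M2 e = (\<integral>\<^sup>+\<omega>. r (Z \<omega>) * indicator (?f -` e \<inter> space Q) \<omega> \<partial>Q)"
      by (simp add: emeasure_distr emeasure_density)
    also have "\<dots> = (\<integral>\<^sup>+\<omega>. r (Z \<omega>) * indicator e (?f \<omega>) \<partial>Q)"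
      by (intro nn_integral_cong) (auto split: split_indicator)
    finally show ?thesis .
  qed
  have "?M1 = ?M2"
  proof (rule measure_eqI_generator_eq[OF Int_stable_pair_measure_generator[of SA SZ], where \<Omega>="space SA \<times> space SZ" 
        and A="\<lambda>_. space SA \<times> space SZ"])
    show "{a \<times> b |a b. a \<in> sets SA \<and> b \<in> sets SZ} \<subseteq> Pow (space SA \<times> space SZ)"
      by (rule pair_measure_closed)
    show "sets ?M1 = sigma_sets (space SA \<times> space SZ) {a \<times> b |a b. a \<in> sets SA \<and> b \<in> sets SZ}"
      "sets ?M2 = sigma_sets (space SA \<times> space SZ) {a \<times> b |a b. a \<in> sets SA \<and> b \<in> sets SZ}"
      by (simp_all add: sets_pair_measure)
    fix R assume "R \<in> {a \<times> b |a b. a \<in> sets SA \<and> b \<in> sets SZ}"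
    then obtain F G where R: "R = F \<times> G" and FG[measurable]: "F \<in> sets SA" "G \<in> sets SZ" by auto
    have "emeasure ?M1 R = emeasure Q {\<omega>\<in>space Q. \<omega> \<in> A \<and> X \<omega> \<in> F \<and> Z \<omega> \<in> G}"
      unfolding R by (subst e1) auto
    also have "\<dots> = (\<integral>\<^sup>+\<omega>. r (Z \<omega>) * indicator F (X \<omega>) * indicator G (Z \<omega>) \<partial>Q)" by (rule eq) fact+
    also have "\<dots> = emeasure ?M2 R"
      unfolding R by (subst e2) (auto simp: indicator_times mult.assoc)
    finally show "emeasure ?M1 R = emeasure ?M2 R" .
  next
    show "range (\<lambda>_. space SA \<times> space SZ) \<subseteq> {a \<times> b |a b. a \<in> sets SA \<and> b \<in> sets SZ}" by blast
    show "emeasure ?M1 (space SA \<times> space SZ) \<noteq> \<infinity>" for i :: nat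
    proof -
      have "space SA \<times> space SZ \<in> sets (SA \<Otimes>\<^sub>M SZ)" by auto
      from e1[OF this] show ?thesis by simp
    qed
  qed auto
  then show ?thesis using e1[OF e] e2[OF e] by simp
qed

text \<open>The definition provides weights only for events of \<open>Y\<close>. The weight of an
  event of \<open>X\<close> is built anew by \<open>cond_weight_exists\<close> and checked on
  rectangles.\<close>

lemma cond_indep_sym:
  assumes Q: "finite_measure Q" and [measurable]: "Y \<in> Q \<rightarrow>\<^sub>M SB" "X \<in> Q \<rightarrow>\<^sub>M SA" "Z \<in> Q \<rightarrow>\<^sub>M SZ"
    and ci: "cond_indep Q SB Y SA X SZ Z"
  shows "cond_indep Q SA X SB Y SZ Z"
  unfolding cond_indep_def
proof
  interpret finite_measure Q by (rule Q)
  fix F assume F[measurable]: "F \<in> sets SA"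
  define A where "A = X -` F \<inter> space Q"
  have A[measurable]: "A \<in> sets Q" unfolding A_def by measurable
  obtain s where s[measurable]: "s \<in> borel_measurable SZ"
    and sG: "\<And>G. G \<in> sets SZ \<Longrightarrow> emeasure Q (A \<inter> (Z -` G \<inter> space Q)) = (\<integral>\<^sup>+\<omega>. s (Z \<omega>) * indicator G (Z \<omega>) \<partial>Q)"
    using cond_weight_exists[of A Z SZ] by auto
  show "\<exists>r\<in>borel_measurable SZ. \<forall>e\<in>sets (SB \<Otimes>\<^sub>M SZ).
      emeasure Q {\<omega> \<in> space Q. X \<omega> \<in> F \<and> (Y \<omega>, Z \<omega>) \<in> e} = (\<integral>\<^sup>+ \<omega>. r (Z \<omega>) * indicator e (Y \<omega>, Z \<omega>) \<partial>Q)"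
  proof (intro bexI[OF _ s] ballI)
    fix e assume e: "e \<in> sets (SB \<Otimes>\<^sub>M SZ)"
    have "emeasure Q {\<omega> \<in> space Q. \<omega> \<in> A \<and> (Y \<omega>, Z \<omega>) \<in> e} = (\<integral>\<^sup>+ \<omega>. s (Z \<omega>) * indicator e (Y \<omega>, Z \<omega>) \<partial>Q)"
    proof (rule cond_weight_rect[OF Q A _ _ s _ e])
      fix E G assume E[measurable]: "E \<in> sets SB" and G[measurable]: "G \<in> sets SZ"
      from ci E obtain r where r[measurable]: "r \<in> borel_measurable SZ" and
        re: "\<And>e. e\<in>sets (SA \<Otimes>\<^sub>M SZ) \<Longrightarrow> emeasure Q {\<omega>\<in>space Q. Y \<omega> \<in> E \<and> (X \<omega>, Z \<omega>) \<in> e} =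
          (\<integral>\<^sup>+\<omega>. r (Z \<omega>) * indicator e (X \<omega>, Z \<omega>) \<partial>Q)" unfolding cond_indep_def by blast
      define BB where "BB = Y -` E \<inter> space Q"
      have BB[measurable]: "BB \<in> sets Q" unfolding BB_def by measurable
      have rG: "emeasure Q (BB \<inter> (Z -` G' \<inter> space Q)) = (\<integral>\<^sup>+\<omega>. r (Z \<omega>) * indicator G' (Z \<omega>) \<partial>Q)"
        if G': "G' \<in> sets SZ" for G'
      proof -
        have "space SA \<times> G' \<in> sets (SA \<Otimes>\<^sub>M SZ)" using G' by auto
        have "BB \<inter> (Z -` G' \<inter> space Q) = {\<omega>\<in>space Q. Y \<omega> \<in> E \<and> (X \<omega>, Z \<omega>) \<in> space SA \<times> G'}"
          using measurable_space[of X Q SA] by (auto simp: BB_def)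
        then have "emeasure Q (BB \<inter> (Z -` G' \<inter> space Q)) = (\<integral>\<^sup>+\<omega>. r (Z \<omega>) * indicator (space SA \<times> G') (X \<omega>, Z \<omega>) \<partial>Q)"
          using re[of "space SA \<times> G'"] G' by auto
        also have "\<dots> = (\<integral>\<^sup>+\<omega>. r (Z \<omega>) * indicator G' (Z \<omega>) \<partial>Q)"
          using measurable_space[of X Q SA] by (intro nn_integral_cong) (auto split: split_indicator)
        finally show ?thesis .
      qed
      have "{\<omega>\<in>space Q. \<omega> \<in> A \<and> Y \<omega> \<in> E \<and> Z \<omega> \<in> G} = {\<omega>\<in>space Q. Y \<omega> \<in> E \<and> (X \<omega>, Z \<omega>) \<in> F \<times> G}"
        by (auto simp: A_def)
      then have "emeasure Q {\<omega>\<in>space Q. \<omega> \<in> A \<and> Y \<omega> \<in> E \<and> Z \<omega> \<in> G} = (\<integral>\<^sup>+\<omega>. r (Z \<omega>) * indicator (F \<times> G) (X \<omega>, Z \<omega>) \<partial>Q)"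
        using re[of "F \<times> G"] by auto
      \<comment> \<open>Both sides equal the integral of \<open>r s\<close> over
        \<open>Z \<in> G\<close>: the indicator of \<open>A\<close> is traded for \<open>s\<close>,
        and \<open>r\<close> is traded back for the indicator of \<open>BB\<close>.\<close>
      also have "\<dots> = (\<integral>\<^sup>+\<omega>. indicator A \<omega> * (r (Z \<omega>) * indicator G (Z \<omega>)) \<partial>Q)"
        by (intro nn_integral_cong) (auto simp: A_def split: split_indicator)
      also have "\<dots> = (\<integral>\<^sup>+\<omega>. s (Z \<omega>) * (r (Z \<omega>) * indicator G (Z \<omega>)) \<partial>Q)"
        by (rule cond_weight_integral[where SZ=SZ and h="\<lambda>z. r z * indicator G z"]) (use sG in auto)
      also have "\<dots> = (\<integral>\<^sup>+\<omega>. r (Z \<omega>) * (s (Z \<omega>) * indicator G (Z \<omega>)) \<partial>Q)"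
        by (intro nn_integral_cong) (simp add: mult_ac)
      also have "\<dots> = (\<integral>\<^sup>+\<omega>. indicator BB \<omega> * (s (Z \<omega>) * indicator G (Z \<omega>)) \<partial>Q)"
        by (rule cond_weight_integral[symmetric, where SZ=SZ and h="\<lambda>z. s z * indicator G z"]) (use rG in auto)
      also have "\<dots> = (\<integral>\<^sup>+\<omega>. s (Z \<omega>) * indicator E (Y \<omega>) * indicator G (Z \<omega>) \<partial>Q)"
        by (intro nn_integral_cong) (auto simp: BB_def split: split_indicator)
      finally show "emeasure Q {\<omega>\<in>space Q. \<omega> \<in> A \<and> Y \<omega> \<in> E \<and> Z \<omega> \<in> G} = (\<integral>\<^sup>+\<omega>. s (Z \<omega>) * indicator E (Y \<omega>) * indicator G (Z \<omega>) \<partial>Q)" .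
    qed measurable
    moreover have "{\<omega> \<in> space Q. \<omega> \<in> A \<and> (Y \<omega>, Z \<omega>) \<in> e} = {\<omega> \<in> space Q. X \<omega> \<in> F \<and> (Y \<omega>, Z \<omega>) \<in> e}"
      by (auto simp: A_def)
    ultimately show "emeasure Q {\<omega> \<in> space Q. X \<omega> \<in> F \<and> (Y \<omega>, Z \<omega>) \<in> e} = (\<integral>\<^sup>+ \<omega>. s (Z \<omega>) * indicator e (Y \<omega>, Z \<omega>) \<partial>Q)"
      by simp
  qed
qed

text \<open>Both the third variable and the conditioning variable may be replaced by almost sure
  functions of \<open>(X, Z)\<close>, as long as \<open>Z\<close> can be recovered from the new conditioning variable.\<close>

lemma cond_indep_image:
  assumes [measurable]: "Y \<in> Q \<rightarrow>\<^sub>M SB" "X \<in> Q \<rightarrow>\<^sub>M SA" "Z \<in> Q \<rightarrow>\<^sub>M SZ" "X' \<in> Q \<rightarrow>\<^sub>M SA'" "Z' \<in> Q \<rightarrow>\<^sub>M SZ'"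
    and p[measurable]: "p \<in> SZ' \<rightarrow>\<^sub>M SZ" and k[measurable]: "k \<in> SA \<Otimes>\<^sub>M SZ \<rightarrow>\<^sub>M SA' \<Otimes>\<^sub>M SZ'"
    and pZ: "\<And>\<omega>. \<omega> \<in> space Q \<Longrightarrow> p (Z' \<omega>) = Z \<omega>"
    and kk: "AE \<omega> in Q. (X' \<omega>, Z' \<omega>) = k (X \<omega>, Z \<omega>)"
    and ci: "cond_indep Q SB Y SA X SZ Z"
  shows "cond_indep Q SB Y SA' X' SZ' Z'"
  unfolding cond_indep_def
proof
  fix E assume E[measurable]: "E \<in> sets SB"
  from ci E obtain r where r[measurable]: "r \<in> borel_measurable SZ" and
    re: "\<And>e. e\<in>sets (SA \<Otimes>\<^sub>M SZ) \<Longrightarrow> emeasure Q {\<omega>\<in>space Q. Y \<omega> \<in> E \<and> (X \<omega>, Z \<omega>) \<in> e} =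
      (\<integral>\<^sup>+\<omega>. r (Z \<omega>) * indicator e (X \<omega>, Z \<omega>) \<partial>Q)" unfolding cond_indep_def by blast
  have rp: "(\<lambda>z. r (p z)) \<in> borel_measurable SZ'" by measurable
  show "\<exists>r\<in>borel_measurable SZ'. \<forall>e\<in>sets (SA' \<Otimes>\<^sub>M SZ').
      emeasure Q {\<omega> \<in> space Q. Y \<omega> \<in> E \<and> (X' \<omega>, Z' \<omega>) \<in> e} = (\<integral>\<^sup>+ \<omega>. r (Z' \<omega>) * indicator e (X' \<omega>, Z' \<omega>) \<partial>Q)"
  proof (rule bexI[OF _ rp], intro ballI)
    fix e assume e[measurable]: "e \<in> sets (SA' \<Otimes>\<^sub>M SZ')"
    define e' where "e' = k -` e \<inter> space (SA \<Otimes>\<^sub>M SZ)"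
    have e'[measurable]: "e' \<in> sets (SA \<Otimes>\<^sub>M SZ)" unfolding e'_def by measurable
    have XZ: "(X \<omega>, Z \<omega>) \<in> space (SA \<Otimes>\<^sub>M SZ)" if "\<omega> \<in> space Q" for \<omega>
      using that measurable_space[of X Q SA] measurable_space[of Z Q SZ] by (auto simp: space_pair_measure)
    have "emeasure Q {\<omega> \<in> space Q. Y \<omega> \<in> E \<and> (X' \<omega>, Z' \<omega>) \<in> e} = emeasure Q {\<omega> \<in> space Q. Y \<omega> \<in> E \<and> (X \<omega>, Z \<omega>) \<in> e'}"
    proof (rule emeasure_eq_AE)
      show "AE \<omega> in Q. (\<omega> \<in> {\<omega> \<in> space Q. Y \<omega> \<in> E \<and> (X' \<omega>, Z' \<omega>) \<in> e}) = (\<omega> \<in> {\<omega> \<in> space Q. Y \<omega> \<in> E \<and> (X \<omega>, Z \<omega>) \<in> e'})"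
        using kk by eventually_elim (use XZ in \<open>auto simp: e'_def\<close>)
    qed measurable
    also have "\<dots> = (\<integral>\<^sup>+ \<omega>. r (Z \<omega>) * indicator e' (X \<omega>, Z \<omega>) \<partial>Q)" by (rule re[OF e'])
    also have "\<dots> = (\<integral>\<^sup>+ \<omega>. r (p (Z' \<omega>)) * indicator e (X' \<omega>, Z' \<omega>) \<partial>Q)"
    proof (rule nn_integral_cong_AE)
      show "AE \<omega> in Q. r (Z \<omega>) * indicator e' (X \<omega>, Z \<omega>) = r (p (Z' \<omega>)) * indicator e (X' \<omega>, Z' \<omega>)"
        using kk AE_space by eventually_elim (use XZ pZ in \<open>auto simp: e'_def split: split_indicator\<close>)
    qed
    finally show "emeasure Q {\<omega> \<in> space Q. Y \<omega> \<in> E \<and> (X' \<omega>, Z' \<omega>) \<in> e} = (\<integral>\<^sup>+ \<omega>. r (p (Z' \<omega>)) * indicator e (X' \<omega>, Z' \<omega>) \<partial>Q)" .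
  qed
qed

text \<open>The start of the induction over components: as long as nothing has been observed, the
  conditioning variable is constant and conditional independence is independence.\<close>

lemma cond_indep_indep:
  assumes Q: "prob_space Q" and [measurable]: "Y \<in> Q \<rightarrow>\<^sub>M SB" "X \<in> Q \<rightarrow>\<^sub>M SA" "Z \<in> Q \<rightarrow>\<^sub>M SZ"
    and z: "\<And>\<omega>. \<omega> \<in> space Q \<Longrightarrow> Z \<omega> = z"
    and ind: "\<And>E F. E \<in> sets SB \<Longrightarrow> F \<in> sets SA \<Longrightarrow> emeasure Q {\<omega>\<in>space Q. Y \<omega> \<in> E \<and> X \<omega> \<in> F} =
      emeasure Q {\<omega>\<in>space Q. Y \<omega> \<in> E} * emeasure Q {\<omega>\<in>space Q. X \<omega> \<in> F}"
  shows "cond_indep Q SB Y SA X SZ Z"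
  unfolding cond_indep_def
proof
  interpret prob_space Q by (rule Q)
  obtain \<omega>0 where w0: "\<omega>0 \<in> space Q" using not_empty by auto
  have zS: "z \<in> space SZ" using measurable_space[of Z Q SZ, OF _ w0] z[OF w0] by simp
  fix E assume E[measurable]: "E \<in> sets SB"
  let ?c = "emeasure Q {\<omega>\<in>space Q. Y \<omega> \<in> E}"
  show "\<exists>r\<in>borel_measurable SZ. \<forall>e\<in>sets (SA \<Otimes>\<^sub>M SZ).
      emeasure Q {\<omega> \<in> space Q. Y \<omega> \<in> E \<and> (X \<omega>, Z \<omega>) \<in> e} = (\<integral>\<^sup>+ \<omega>. r (Z \<omega>) * indicator e (X \<omega>, Z \<omega>) \<partial>Q)"
  proof (rule bexI[of _ "\<lambda>_. ?c"], intro ballI)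
    fix e assume e[measurable]: "e \<in> sets (SA \<Otimes>\<^sub>M SZ)"
    define F where "F = (\<lambda>x. (x, z)) -` e"
    have F[measurable]: "F \<in> sets SA" unfolding F_def by (rule sets_Pair2[OF e])
    have FX: "{\<omega> \<in> space Q. X \<omega> \<in> F} \<in> sets Q" by measurable
    have "{\<omega> \<in> space Q. Y \<omega> \<in> E \<and> (X \<omega>, Z \<omega>) \<in> e} = {\<omega> \<in> space Q. Y \<omega> \<in> E \<and> X \<omega> \<in> F}"
      using z by (auto simp: F_def)
    then have "emeasure Q {\<omega> \<in> space Q. Y \<omega> \<in> E \<and> (X \<omega>, Z \<omega>) \<in> e} = ?c * emeasure Q {\<omega> \<in> space Q. X \<omega> \<in> F}"
      using ind[OF E F] by simp
    also have "\<dots> = (\<integral>\<^sup>+ \<omega>. ?c * indicator {\<omega> \<in> space Q. X \<omega> \<in> F} \<omega> \<partial>Q)"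
      using FX by (simp add: nn_integral_cmult_indicator)
    also have "\<dots> = (\<integral>\<^sup>+ \<omega>. ?c * indicator e (X \<omega>, Z \<omega>) \<partial>Q)"
      using z by (intro nn_integral_cong) (auto simp: F_def split: split_indicator)
    finally show "emeasure Q {\<omega> \<in> space Q. Y \<omega> \<in> E \<and> (X \<omega>, Z \<omega>) \<in> e} = (\<integral>\<^sup>+ \<omega>. ?c * indicator e (X \<omega>, Z \<omega>) \<partial>Q)" .
  qed simp
qed


section \<open>Conditional independence of the noises\<close>

definition gather :: "'n set \<Rightarrow> 'n set \<Rightarrow> ('n \<Rightarrow> path) \<Rightarrow> ('n \<Rightarrow> path) \<Rightarrow> 'n \<Rightarrow> path" where
  "gather A P x y = (\<lambda>v\<in>P. if v \<in> A then x v else y v)"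

lemma measurable_gather:
  assumes "0 < T" "f \<in> N \<rightarrow>\<^sub>M path_space T A" "g \<in> N \<rightarrow>\<^sub>M path_space T B" "P \<subseteq> A \<union> B"
  shows "(\<lambda>z. gather A P (f z) (g z)) \<in> N \<rightarrow>\<^sub>M path_space T P"
proof (rule measurable_path_space_components[OF assms(1)])
  fix v assume v: "v \<in> P"
  show "(\<lambda>z. gather A P (f z) (g z) v) \<in> N \<rightarrow>\<^sub>M D_real T"
  proof (cases "v \<in> A")
    case True
    with v measurable_path_space_component[OF assms(2)] show ?thesis by (simp add: gather_def)
  next
    case False
    then have "v \<in> B" using v assms(4) by blast
    with v False measurable_path_space_component[OF assms(3)] show ?thesis by (simp add: gather_def)
  qed
qed (simp add: gather_def)

lemma gather_restrict: "P \<subseteq> A \<union> B \<Longrightarrow> gather A P (restrict x A) (restrict x B) = restrict x P"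
  by (rule ext) (auto simp: gather_def)

definition determined :: "real \<Rightarrow> 'o measure \<Rightarrow> ('o \<Rightarrow> 'n \<Rightarrow> path) \<Rightarrow> 's measure \<Rightarrow> ('o \<Rightarrow> 's) \<Rightarrow> 'n set \<Rightarrow> 'n set \<Rightarrow> bool" where
  "determined T Q X SN N A Z \<longleftrightarrow> (\<exists>k\<in>SN \<Otimes>\<^sub>M path_space T Z \<rightarrow>\<^sub>M path_space T A.
     AE \<omega> in Q. restrict (X \<omega>) A = k (N \<omega>, restrict (X \<omega>) Z))"

lemma determined_subset:
  assumes "determined T Q X SN N A Z" "A' \<subseteq> A"
  shows "determined T Q X SN N A' Z"
proof -
  from assms(1) obtain k where k: "k \<in> SN \<Otimes>\<^sub>M path_space T Z \<rightarrow>\<^sub>M path_space T A"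
    "AE \<omega> in Q. restrict (X \<omega>) A = k (N \<omega>, restrict (X \<omega>) Z)" unfolding determined_def by blast
  have "AE \<omega> in Q. restrict (X \<omega>) A' = restrict (k (N \<omega>, restrict (X \<omega>) Z)) A'"
    using k(2)
  proof eventually_elim
    fix \<omega> assume "restrict (X \<omega>) A = k (N \<omega>, restrict (X \<omega>) Z)"
    then have "restrict (restrict (X \<omega>) A) A' = restrict (k (N \<omega>, restrict (X \<omega>) Z)) A'" by simp
    then show "restrict (X \<omega>) A' = restrict (k (N \<omega>, restrict (X \<omega>) Z)) A'"
      using assms(2) by (simp add: restrict_restrict Int_absorb1)
  qed
  with measurable_restrict_path[OF k(1) assms(2)] show ?thesis unfolding determined_def by (intro bexI) auto
qed

lemma determined_mono:
  assumes "determined T Q X SN N A Z" "Z \<subseteq> Z'"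
  shows "determined T Q X SN N A Z'"
proof -
  from assms(1) obtain k where k: "k \<in> SN \<Otimes>\<^sub>M path_space T Z \<rightarrow>\<^sub>M path_space T A"
    "AE \<omega> in Q. restrict (X \<omega>) A = k (N \<omega>, restrict (X \<omega>) Z)" unfolding determined_def by blast
  have m: "(\<lambda>z. k (fst z, restrict (snd z) Z)) \<in> SN \<Otimes>\<^sub>M path_space T Z' \<rightarrow>\<^sub>M path_space T A"
    by (rule measurable_compose[OF measurable_Pair[OF measurable_fst measurable_restrict_path[OF measurable_snd assms(2)]] k(1)])
  have "AE \<omega> in Q. restrict (X \<omega>) A = k (fst (N \<omega>, restrict (X \<omega>) Z'), restrict (snd (N \<omega>, restrict (X \<omega>) Z')) Z)"
    using k(2) by eventually_elim (use assms(2) in \<open>simp add: restrict_restrict Int_absorb1\<close>)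
  with m show ?thesis unfolding determined_def by (intro bexI[OF _ m])
qed

text \<open>Substitution along the graph: parents in \<open>A\<close> are computed by
  \<open>k\<close>, the others are read off the observed paths on \<open>Z\<close>.\<close>

lemma determined_trans:
  assumes T: "0 < T" and "determined T Q X SN N A Z" "determined T Q X SN N S P" "P \<subseteq> A \<union> Z"
  shows "determined T Q X SN N S Z"
proof -
  from assms obtain k k' where k: "k \<in> SN \<Otimes>\<^sub>M path_space T Z \<rightarrow>\<^sub>M path_space T A"
    "AE \<omega> in Q. restrict (X \<omega>) A = k (N \<omega>, restrict (X \<omega>) Z)" 
    and k': "k' \<in> SN \<Otimes>\<^sub>M path_space T P \<rightarrow>\<^sub>M path_space T S"
    "AE \<omega> in Q. restrict (X \<omega>) S = k' (N \<omega>, restrict (X \<omega>) P)" unfolding determined_def by blast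
  have m: "(\<lambda>z. k' (fst z, gather A P (k z) (snd z))) \<in> SN \<Otimes>\<^sub>M path_space T Z \<rightarrow>\<^sub>M path_space T S"
    by (rule measurable_compose[OF measurable_Pair[OF measurable_fst measurable_gather[OF T k(1) measurable_snd assms(4)]] k'(1)])
  have "AE \<omega> in Q. restrict (X \<omega>) S = k' (fst (N \<omega>, restrict (X \<omega>) Z), gather A P (k (N \<omega>, restrict (X \<omega>) Z)) (snd (N \<omega>, restrict (X \<omega>) Z)))"
    using k(2) k'(2) 
  proof eventually_elim
    fix \<omega> assume 1: "restrict (X \<omega>) A = k (N \<omega>, restrict (X \<omega>) Z)" and 2: "restrict (X \<omega>) S = k' (N \<omega>, restrict (X \<omega>) P)"
    show "restrict (X \<omega>) S = k' (fst (N \<omega>, restrict (X \<omega>) Z), gather A P (k (N \<omega>, restrict (X \<omega>) Z)) (snd (N \<omega>, restrict (X \<omega>) Z)))"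
      unfolding 1[symmetric] fst_conv snd_conv gather_restrict[OF assms(4)] by (rule 2)
  qed
  then show ?thesis unfolding determined_def by (intro bexI[OF _ m])
qed

lemma determined_Un:
  assumes T: "0 < T" and "determined T Q X SN N A Z" "determined T Q X SN N S Z"
  shows "determined T Q X SN N (A \<union> S) Z"
proof -
  from assms obtain k k' where k: "k \<in> SN \<Otimes>\<^sub>M path_space T Z \<rightarrow>\<^sub>M path_space T A"
    "AE \<omega> in Q. restrict (X \<omega>) A = k (N \<omega>, restrict (X \<omega>) Z)" 
    and k': "k' \<in> SN \<Otimes>\<^sub>M path_space T Z \<rightarrow>\<^sub>M path_space T S"
    "AE \<omega> in Q. restrict (X \<omega>) S = k' (N \<omega>, restrict (X \<omega>) Z)" unfolding determined_def by blast
  have m: "(\<lambda>z. gather A (A \<union> S) (k z) (k' z)) \<in> SN \<Otimes>\<^sub>M path_space T Z \<rightarrow>\<^sub>M path_space T (A \<union> S)"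
    by (rule measurable_gather[OF T k(1) k'(1)]) simp
  have "AE \<omega> in Q. restrict (X \<omega>) (A \<union> S) = gather A (A \<union> S) (k (N \<omega>, restrict (X \<omega>) Z)) (k' (N \<omega>, restrict (X \<omega>) Z))"
    using k(2) k'(2) 
  proof eventually_elim
    fix \<omega> assume 1: "restrict (X \<omega>) A = k (N \<omega>, restrict (X \<omega>) Z)" and 2: "restrict (X \<omega>) S = k' (N \<omega>, restrict (X \<omega>) Z)"
    show "restrict (X \<omega>) (A \<union> S) = gather A (A \<union> S) (k (N \<omega>, restrict (X \<omega>) Z)) (k' (N \<omega>, restrict (X \<omega>) Z))"
      unfolding 1[symmetric] 2[symmetric] by (rule gather_restrict[symmetric]) simp
  qed
  then show ?thesis unfolding determined_def by (intro bexI[OF _ m])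
qed

lemma determined_self:
  assumes "A \<subseteq> Z" shows "determined T Q X SN N A Z"
proof -
  have m: "(\<lambda>z. restrict (snd z) A) \<in> SN \<Otimes>\<^sub>M path_space T Z \<rightarrow>\<^sub>M path_space T A"
    by (rule measurable_restrict_path[OF measurable_snd assms])
  show ?thesis unfolding determined_def
    by (rule bexI[OF _ m]) (simp add: restrict_restrict Int_absorb1 assms)
qed

text \<open>The invariant of the induction over the strongly connected components: the nodes \<open>E\<close> treated
  so far split into a part driven by the noise \<open>NA\<close> and a part driven by \<open>NB\<close>.\<close>

definition split_inv :: "real \<Rightarrow> 'o measure \<Rightarrow> ('o \<Rightarrow> 'n \<Rightarrow> path) \<Rightarrow> 'n set \<Rightarrow> 'sa measure \<Rightarrow> ('o \<Rightarrow> 'sa) \<Rightarrow> 'n set \<Rightarrow>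
   'sb measure \<Rightarrow> ('o \<Rightarrow> 'sb) \<Rightarrow> 'n set \<Rightarrow> 'n set \<Rightarrow> bool" where
  "split_inv T Q X C SA NA OA SB NB OB E \<longleftrightarrow>
     cond_indep Q SB NB SA NA (path_space T (C \<inter> E)) (\<lambda>\<omega>. restrict (X \<omega>) (C \<inter> E)) \<and>
     determined T Q X SA NA (OA \<inter> E) (C \<inter> E) \<and> determined T Q X SB NB (OB \<inter> E) (C \<inter> E)"

text \<open>The parents of \<open>S\<close> are already determined by \<open>NA\<close> and the
  observed paths, or observed themselves. The newly observed paths of \<open>C \<inter> S\<close>
  are thus a function of \<open>NA\<close> and the earlier observations, and conditioning on them
  does not disturb the independence from \<open>NB\<close>. As \<open>S\<close> avoids
  \<open>OB\<close>, the other side only gains observed variables.\<close>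

lemma split_inv_step:
  assumes T: "0 < T" and X: "X \<in> Q \<rightarrow>\<^sub>M path_space T V" and C: "C \<subseteq> V"
    and NA: "NA \<in> Q \<rightarrow>\<^sub>M SA" and NB: "NB \<in> Q \<rightarrow>\<^sub>M SB"
    and inv: "split_inv T Q X C SA NA OA SB NB OB E"
    and S: "S \<subseteq> OA" "S \<inter> OB = {}" and d: "determined T Q X SA NA S P" and P: "P \<subseteq> E \<inter> (OA \<union> C)"
  shows "split_inv T Q X C SA NA OA SB NB OB (E \<union> S)"
proof -
  let ?Z = "C \<inter> E" and ?Z' = "C \<inter> (E \<union> S)"
  have ci: "cond_indep Q SB NB SA NA (path_space T ?Z) (\<lambda>\<omega>. restrict (X \<omega>) ?Z)"
    and dA: "determined T Q X SA NA (OA \<inter> E) ?Z" and dB: "determined T Q X SB NB (OB \<inter> E) ?Z"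
    using inv by (auto simp: split_inv_def)
  have dS: "determined T Q X SA NA S ?Z"
    by (rule determined_trans[OF T dA d]) (use P in blast)
  have dZ': "determined T Q X SA NA ?Z' ?Z"
    by (rule determined_subset[OF determined_Un[OF T determined_self[OF subset_refl] dS]]) blast
  then obtain k where k: "k \<in> SA \<Otimes>\<^sub>M path_space T ?Z \<rightarrow>\<^sub>M path_space T ?Z'"
    "AE \<omega> in Q. restrict (X \<omega>) ?Z' = k (NA \<omega>, restrict (X \<omega>) ?Z)" unfolding determined_def by blast
  have "cond_indep Q SB NB SA NA (path_space T ?Z') (\<lambda>\<omega>. restrict (X \<omega>) ?Z')"
  proof (rule cond_indep_image[OF NB NA _ NA _ _ _ _ _ ci])
    show "(\<lambda>\<omega>. restrict (X \<omega>) ?Z) \<in> Q \<rightarrow>\<^sub>M path_space T ?Z" "(\<lambda>\<omega>. restrict (X \<omega>) ?Z') \<in> Q \<rightarrow>\<^sub>M path_space T ?Z'"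
      using C by (intro measurable_restrict_path[OF X]; blast)+
    show "(\<lambda>z. restrict z ?Z) \<in> path_space T ?Z' \<rightarrow>\<^sub>M path_space T ?Z"
      by (rule measurable_restrict_path[OF measurable_ident_sets[OF refl]]) blast
    show "(\<lambda>z. (fst z, k z)) \<in> SA \<Otimes>\<^sub>M path_space T ?Z \<rightarrow>\<^sub>M SA \<Otimes>\<^sub>M path_space T ?Z'"
      by (intro measurable_Pair measurable_fst k)
    show "restrict (restrict (X \<omega>) ?Z') ?Z = restrict (X \<omega>) ?Z" for \<omega>
      by (rule ext) auto
    show "AE \<omega> in Q. (NA \<omega>, restrict (X \<omega>) ?Z') = (fst (NA \<omega>, restrict (X \<omega>) ?Z), k (NA \<omega>, restrict (X \<omega>) ?Z))"
      using k(2) by simp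
  qed
  moreover have "determined T Q X SA NA (OA \<inter> (E \<union> S)) ?Z'"
    by (rule determined_subset[OF determined_mono[OF determined_Un[OF T dA dS]]]) blast+
  moreover have "OB \<inter> (E \<union> S) = OB \<inter> E" using S by blast
  moreover have "determined T Q X SB NB (OB \<inter> E) ?Z'"
    by (rule determined_mono[OF dB]) blast
  ultimately show ?thesis by (simp add: split_inv_def)
qed

lemma split_inv_sym:
  assumes Q: "finite_measure Q" and X: "X \<in> Q \<rightarrow>\<^sub>M path_space T V" and C: "C \<subseteq> V"
    and NA: "NA \<in> Q \<rightarrow>\<^sub>M SA" and NB: "NB \<in> Q \<rightarrow>\<^sub>M SB"
    and inv: "split_inv T Q X C SA NA OA SB NB OB E"
  shows "split_inv T Q X C SB NB OB SA NA OA E"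
proof -
  have "C \<inter> E \<subseteq> V" using C by blast
  from cond_indep_sym[OF Q NB NA measurable_restrict_path[OF X this]] inv
  show ?thesis by (simp add: split_inv_def)
qed

text \<open>The topological order is implicit: each round picks an untreated node with the fewest
  untreated ancestors. All external parents of its component have then been treated, and the
  component joins whichever side contains it.\<close>

theorem split_inv_ancestral:
  assumes T: "0 < T" and Q: "prob_space Q" and X: "X \<in> Q \<rightarrow>\<^sub>M path_space T V" 
    and NA: "NA \<in> Q \<rightarrow>\<^sub>M SA" and NB: "NB \<in> Q \<rightarrow>\<^sub>M SB"
    and ind: "\<And>E F. E \<in> sets SB \<Longrightarrow> F \<in> sets SA \<Longrightarrow> emeasure Q {\<omega>\<in>space Q. NB \<omega> \<in> E \<and> NA \<omega> \<in> F} =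
      emeasure Q {\<omega>\<in>space Q. NB \<omega> \<in> E} * emeasure Q {\<omega>\<in>space Q. NA \<omega> \<in> F}"
    and H: "finite H" "\<And>u v. (u, v) \<in> R \<Longrightarrow> v \<in> H \<Longrightarrow> u \<in> H" and C: "C \<subseteq> V"
    and OAB: "OA \<union> OB = H" "OA \<inter> OB = {}"
    and scc: "\<And>u v. (u, v) \<in> R\<^sup>* \<Longrightarrow> (v, u) \<in> R\<^sup>* \<Longrightarrow> u \<in> OA \<Longrightarrow> v \<in> OA"
    and A: "\<And>v S P. v \<in> OA \<Longrightarrow> S = {u. (u, v) \<in> R\<^sup>* \<and> (v, u) \<in> R\<^sup>*} \<Longrightarrow> P = {u. u \<notin> S \<and> (\<exists>w\<in>S. (u, w) \<in> R)} \<Longrightarrow> 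
        P \<subseteq> OA \<union> C \<and> determined T Q X SA NA S P"
    and B: "\<And>v S P. v \<in> OB \<Longrightarrow> S = {u. (u, v) \<in> R\<^sup>* \<and> (v, u) \<in> R\<^sup>*} \<Longrightarrow> P = {u. u \<notin> S \<and> (\<exists>w\<in>S. (u, w) \<in> R)} \<Longrightarrow> 
        P \<subseteq> OB \<union> C \<and> determined T Q X SB NB S P"
  shows "split_inv T Q X C SA NA OA SB NB OB H"
proof -
  interpret prob_space Q by (rule Q)
  have FQ: "finite_measure Q" by unfold_locales
  have anc_closed: "u \<in> E" if "(u, v) \<in> R\<^sup>*" "v \<in> E" "\<And>u v. (u, v) \<in> R \<Longrightarrow> v \<in> E \<Longrightarrow> u \<in> E" for u v E
    using that by (induction rule: converse_rtrancl_induct) auto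
  have ind_step: "split_inv T Q X C SA NA OA SB NB OB H"
    if "E \<subseteq> H" "\<And>u v. (u, v) \<in> R \<Longrightarrow> v \<in> E \<Longrightarrow> u \<in> E" "split_inv T Q X C SA NA OA SB NB OB E" for E
    using that
  proof (induction "card (H - E)" arbitrary: E rule: less_induct)
    case less
    note E = less.prems
    show ?case
    proof (cases "E = H")
      case False
      then have ne: "H - E \<noteq> {}" using E(1) by blast
      \<comment> \<open>Untreated ancestors of \<open>v\<close>, including \<open>v\<close>. If
        \<open>v\<close> is minimal and \<open>u\<close> is one of them, then
        \<open>an u \<subseteq> an v\<close> forces equality, so \<open>v\<close> is an ancestor of
        \<open>u\<close> in turn and \<open>u\<close> lies in the component
        \<open>S\<close>.\<close>
      define an where "an v = {u. (u, v) \<in> R\<^sup>*} - E" for v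
      have anH: "an v \<subseteq> H" if "v \<in> H" for v using anc_closed[OF _ that H(2)] by (auto simp: an_def)
      have fan: "finite (an v)" if "v \<in> H" for v using finite_subset[OF anH[OF that] H(1)] .
      obtain v where v: "v \<in> H - E" and min: "\<And>w. w \<in> H - E \<Longrightarrow> card (an v) \<le> card (an w)"
        using ex_has_least_nat[of "\<lambda>v. v \<in> H - E" _ "\<lambda>v. card (an v)"] ne by blast
      define S where "S = {u. (u, v) \<in> R\<^sup>* \<and> (v, u) \<in> R\<^sup>*}"
      define P where "P = {u. u \<notin> S \<and> (\<exists>w\<in>S. (u, w) \<in> R)}"
      have vS: "v \<in> S" by (simp add: S_def)
      have anS: "u \<in> S" if u: "u \<in> an v" for u
      proof -
        have uH: "u \<in> H - E" using u anH[of v] v by (auto simp: an_def)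
        have sub: "an u \<subseteq> an v" using u by (auto simp: an_def intro: rtrancl_trans)
        have "an u = an v" using card_seteq[OF fan sub] min[OF uH] v by auto
        moreover have "v \<in> an v" using v by (simp add: an_def)
        ultimately have "(v, u) \<in> R\<^sup>*" by (auto simp: an_def)
        then show ?thesis using u by (simp add: S_def an_def)
      qed
      have SH: "S \<subseteq> H" using anc_closed[OF _ _ H(2), of _ v] v by (auto simp: S_def)
      have into: "u \<in> E \<union> S" if "(u, w) \<in> R" "w \<in> S" for u w
      proof -
        have "(u, v) \<in> R\<^sup>*" using that by (auto simp: S_def intro: converse_rtrancl_into_rtrancl)
        then show ?thesis using anS[of u] by (auto simp: an_def)
      qed
      have PE: "P \<subseteq> E" using into by (auto simp: P_def)
      have "split_inv T Q X C SA NA OA SB NB OB (E \<union> S)"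
      proof (cases "v \<in> OA")
        case True
        have SA: "S \<subseteq> OA" using scc[of v] True by (auto simp: S_def)
        from A[OF True S_def P_def] have "P \<subseteq> OA \<union> C" "determined T Q X SA NA S P" by auto
        then show ?thesis
          using SA OAB PE by (intro split_inv_step[OF T X C NA NB E(3), where P=P]) auto
      next
        case False
        then have vB: "v \<in> OB" using v OAB by auto
        have SB: "S \<inter> OA = {}" using scc[of _ v] False by (auto simp: S_def)
        then have SB': "S \<subseteq> OB" using SH OAB by auto
        from B[OF vB S_def P_def] have P: "P \<subseteq> OB \<union> C" "determined T Q X SB NB S P" by auto
        \<comment> \<open>The step is formulated for the first side; the invariant is symmetric by
          \<open>cond_indep_sym\<close>, so the roles are exchanged before and after.\<close>
        have "split_inv T Q X C SB NB OB SA NA OA (E \<union> S)"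
          by (rule split_inv_step[OF T X C NB NA split_inv_sym[OF FQ X C NA NB E(3)] SB' SB P(2)]) (use P PE in auto)
        then show ?thesis by (rule split_inv_sym[OF FQ X C NB NA])
      qed
      moreover have "card (H - (E \<union> S)) < card (H - E)"
        using H(1) v vS by (intro psubset_card_mono) auto
      moreover have "E \<union> S \<subseteq> H" using E SH by auto
      moreover have "u \<in> E \<union> S" if "(u, w) \<in> R" "w \<in> E \<union> S" for u w
        using that into E(2) by blast
      ultimately show ?thesis using less.hyps[of "E \<union> S"] by blast
    qed (use E in simp)
  qed
  have m0: "(\<lambda>\<omega>. restrict (X \<omega>) {}) \<in> Q \<rightarrow>\<^sub>M path_space T {}"
    by (rule measurable_restrict_path[OF X]) simp
  have "cond_indep Q SB NB SA NA (path_space T {}) (\<lambda>\<omega>. restrict (X \<omega>) {})"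
  proof (rule cond_indep_indep[OF Q NB NA m0])
    show "restrict (X \<omega>) {} = (\<lambda>_. undefined)" for \<omega> by (rule ext) simp
  qed (rule ind)
  then have "split_inv T Q X C SA NA OA SB NB OB {}"
    unfolding split_inv_def Int_empty_right by (intro conjI determined_self subset_refl)
  from ind_step[OF _ _ this] show ?thesis by blast
qed


section \<open>Sigma-open walks\<close>

text \<open>\<open>open_to G A C u h\<close>: some walk from \<open>A\<close> to \<open>u\<close> is \<open>\<sigma>\<close>-open at all inner nodes.  If \<open>h\<close> holds, its
  last edge has an arrowhead at \<open>u\<close>.  Otherwise the walk is trivial or its last edge leaves \<open>u\<close>, and
  \<open>u\<close> is not in \<open>C\<close> or cannot be blocked by this edge.\<close>

inductive open_to :: "'v mixed_graph \<Rightarrow> 'v set \<Rightarrow> 'v set \<Rightarrow> 'v \<Rightarrow> bool \<Rightarrow> bool" for G A C where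
  start: "a \<in> A \<Longrightarrow> a \<in> verts G \<Longrightarrow> a \<notin> C \<Longrightarrow> open_to G A C a False"
| forward: "open_to G A C u h \<Longrightarrow> (u, v) \<in> dir_edges G \<Longrightarrow> v \<in> verts G \<Longrightarrow> u \<notin> C \<or> same_scc G u v \<Longrightarrow>
    open_to G A C v True"
| backward_collider: "open_to G A C u True \<Longrightarrow> (v, u) \<in> dir_edges G \<Longrightarrow> v \<in> verts G \<Longrightarrow> u \<in> anc G C \<Longrightarrow>
    v \<notin> C \<or> same_scc G v u \<Longrightarrow> open_to G A C v False"
| backward: "open_to G A C u False \<Longrightarrow> (v, u) \<in> dir_edges G \<Longrightarrow> v \<in> verts G \<Longrightarrow>
    v \<notin> C \<or> same_scc G v u \<Longrightarrow> open_to G A C v False"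
| bidirected_collider: "open_to G A C u True \<Longrightarrow> (u, v) \<in> bidir_edges G \<Longrightarrow> v \<in> verts G \<Longrightarrow> u \<in> anc G C \<Longrightarrow>
    open_to G A C v True"
| bidirected: "open_to G A C u False \<Longrightarrow> (u, v) \<in> bidir_edges G \<Longrightarrow> v \<in> verts G \<Longrightarrow> open_to G A C v True"

definition inner_open :: "'v mixed_graph \<Rightarrow> 'v list \<Rightarrow> walk_edge list \<Rightarrow> 'v set \<Rightarrow> bool" where
  "inner_open G vs es C \<longleftrightarrow> (\<forall>i. 0 < i \<and> i < length es \<longrightarrow>
     \<not> (blockable G vs es i \<and> vs ! i \<in> C) \<and> \<not> (collider es i \<and> vs ! i \<notin> anc G C))"

lemma walk_extend:
  assumes w: "walk G vs es" and op: "inner_open G vs es C" and v: "v \<in> verts G"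
    and e: "case e of Forward \<Rightarrow> (last vs, v) \<in> dir_edges G | Backward \<Rightarrow> (v, last vs) \<in> dir_edges G
        | Bidirected \<Rightarrow> (last vs, v) \<in> bidir_edges G"
    and col: "es \<noteq> [] \<Longrightarrow> last es \<in> {Forward, Bidirected} \<Longrightarrow> e \<in> {Backward, Bidirected} \<Longrightarrow> last vs \<in> anc G C"
    and noncol: "es \<noteq> [] \<Longrightarrow> \<not> (last es \<in> {Forward, Bidirected} \<and> e \<in> {Backward, Bidirected}) \<Longrightarrow> last vs \<in> C \<Longrightarrow>
       (last es = Backward \<longrightarrow> same_scc G (last vs) (vs ! (length es - 1))) \<and> (e = Forward \<longrightarrow> same_scc G (last vs) v)"
  shows "walk G (vs @ [v]) (es @ [e])" "inner_open G (vs @ [v]) (es @ [e]) C"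
proof -
  have len: "length vs = Suc (length es)" using w by (simp add: walk_def)
  have last: "last vs = vs ! length es" using len by (cases vs rule: rev_cases) (auto simp: nth_append)
  have laste: "es \<noteq> [] \<Longrightarrow> last es = es ! (length es - 1)" by (simp add: last_conv_nth)
  show "walk G (vs @ [v]) (es @ [e])"
    unfolding walk_def
  proof (intro conjI allI impI)
    show "set (vs @ [v]) \<subseteq> verts G" using w v by (simp add: walk_def)
    fix i assume i: "i < length (es @ [e])"
    show "case (es @ [e]) ! i of Forward \<Rightarrow> ((vs @ [v]) ! i, (vs @ [v]) ! Suc i) \<in> dir_edges G
        | Backward \<Rightarrow> ((vs @ [v]) ! Suc i, (vs @ [v]) ! i) \<in> dir_edges G
        | Bidirected \<Rightarrow> ((vs @ [v]) ! i, (vs @ [v]) ! Suc i) \<in> bidir_edges G"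
    proof (cases "i < length es")
      case True
      then have eq: "(es @ [e]) ! i = es ! i" "(vs @ [v]) ! i = vs ! i" "(vs @ [v]) ! Suc i = vs ! Suc i"
        using len by (simp_all add: nth_append)
      show ?thesis unfolding eq using w True unfolding walk_def by blast
    next
      case False
      then have "i = length es" using i by simp
      then have eq: "(es @ [e]) ! i = e" "(vs @ [v]) ! i = last vs" "(vs @ [v]) ! Suc i = v"
        using len last by (simp_all add: nth_append)
      show ?thesis unfolding eq by (rule e)
    qed
  qed (simp add: len)
  show "inner_open G (vs @ [v]) (es @ [e]) C"
    unfolding inner_open_def
  proof (intro allI impI)
    fix i assume i: "0 < i \<and> i < length (es @ [e])"
    show "\<not> (blockable G (vs @ [v]) (es @ [e]) i \<and> (vs @ [v]) ! i \<in> C) \<and> \<not> (collider (es @ [e]) i \<and> (vs @ [v]) ! i \<notin> anc G C)"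
    proof (cases "i < length es")
      case True
      have eq: "(es @ [e]) ! i = es ! i" "(es @ [e]) ! (i - 1) = es ! (i - 1)" "(vs @ [v]) ! i = vs ! i"
        "(vs @ [v]) ! (i - 1) = vs ! (i - 1)" "(vs @ [v]) ! Suc i = vs ! Suc i"
        using True i len by (auto simp: nth_append)
      then have "collider (es @ [e]) i = collider es i" by (simp only: collider_def)
      moreover from this have "blockable G (vs @ [v]) (es @ [e]) i = blockable G vs es i"
        by (simp only: blockable_def eq)
      moreover have "(vs @ [v]) ! i = vs ! i" using True len by (simp add: nth_append)
      ultimately show ?thesis using op True i by (simp add: inner_open_def)
    next
      case False
      then have il: "i = length es" and ne: "es \<noteq> []" using i by auto
      have 1: "(es @ [e]) ! (i - 1) = last es" "(es @ [e]) ! i = e" "(vs @ [v]) ! i = last vs"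
        "(vs @ [v]) ! (i - 1) = vs ! (length es - 1)" "(vs @ [v]) ! Suc i = v"
        using ne len last laste by (auto simp: il nth_append)
      have c: "collider (es @ [e]) i \<longleftrightarrow> last es \<in> {Forward, Bidirected} \<and> e \<in> {Backward, Bidirected}"
        unfolding collider_def 1 ..
      show ?thesis unfolding blockable_def c 1 using col[OF ne] noncol[OF ne] by blast
    qed
  qed
qed

text \<open>Prolonging a walk turns only its end into a new inner node, and whether that node is a
  collider depends on the mark of the last edge there. The flag \<open>h\<close> records this mark;
  for \<open>h = False\<close> the clause about \<open>C\<close> certifies in advance that the last
  edge does not block \<open>u\<close>.\<close>

lemma open_to_walk:
  assumes "open_to G A C u h"
  shows "\<exists>vs es. walk G vs es \<and> inner_open G vs es C \<and> hd vs \<in> A \<and> hd vs \<notin> C \<and> last vs = u \<and>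
    (h \<longrightarrow> es \<noteq> [] \<and> last es \<in> {Forward, Bidirected}) \<and>
    (\<not> h \<longrightarrow> (es \<noteq> [] \<longrightarrow> last es = Backward \<and> (u \<in> C \<longrightarrow> same_scc G u (vs ! (length es - 1)))))"
  using assms
proof (induction rule: open_to.induct)
  case (start a)
  then show ?case by (intro exI[of _ "[a]"] exI[of _ "[]"]) (auto simp: walk_def inner_open_def)
next
  case (forward u h v)
  then obtain vs es where w: "walk G vs es" "inner_open G vs es C" "hd vs \<in> A" "hd vs \<notin> C" "last vs = u"
    "h \<longrightarrow> es \<noteq> [] \<and> last es \<in> {Forward, Bidirected}"
    "\<not> h \<longrightarrow> (es \<noteq> [] \<longrightarrow> last es = Backward \<and> (u \<in> C \<longrightarrow> same_scc G u (vs ! (length es - 1))))" by blast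
  have ne: "vs \<noteq> []" using w(1) by (auto simp: walk_def)
  have "walk G (vs @ [v]) (es @ [Forward])" "inner_open G (vs @ [v]) (es @ [Forward]) C"
    by (rule walk_extend[OF w(1,2)]; use w forward in \<open>cases h; auto\<close>)+
  then show ?case using w ne by (intro exI[of _ "vs @ [v]"] exI[of _ "es @ [Forward]"]) auto
next
  case (backward_collider u v)
  then obtain vs es where w: "walk G vs es" "inner_open G vs es C" "hd vs \<in> A" "hd vs \<notin> C" "last vs = u"
    "es \<noteq> []" "last es \<in> {Forward, Bidirected}" by blast
  have ne: "vs \<noteq> []" using w(1) by (auto simp: walk_def)
  have len: "length vs = Suc (length es)" using w(1) by (simp add: walk_def)
  have l: "(vs @ [v]) ! (length (es @ [Backward]) - 1) = u"
    using w(5) len by (cases vs rule: rev_cases) (auto simp: nth_append)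
  have "walk G (vs @ [v]) (es @ [Backward])" "inner_open G (vs @ [v]) (es @ [Backward]) C"
    by (rule walk_extend[OF w(1,2)]; use w backward_collider in auto)+
  then show ?case using w ne l backward_collider
    by (intro exI[of _ "vs @ [v]"] exI[of _ "es @ [Backward]"]) auto
next
  case (backward u v)
  then obtain vs es where w: "walk G vs es" "inner_open G vs es C" "hd vs \<in> A" "hd vs \<notin> C" "last vs = u"
    "es \<noteq> [] \<longrightarrow> last es = Backward \<and> (u \<in> C \<longrightarrow> same_scc G u (vs ! (length es - 1)))" by blast
  have ne: "vs \<noteq> []" using w(1) by (auto simp: walk_def)
  have len: "length vs = Suc (length es)" using w(1) by (simp add: walk_def)
  have l: "(vs @ [v]) ! (length (es @ [Backward]) - 1) = u"
    using w(5) len by (cases vs rule: rev_cases) (auto simp: nth_append)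
  have "walk G (vs @ [v]) (es @ [Backward])" "inner_open G (vs @ [v]) (es @ [Backward]) C"
    by (rule walk_extend[OF w(1,2)]; use w backward in auto)+
  then show ?case using w ne l backward
    by (intro exI[of _ "vs @ [v]"] exI[of _ "es @ [Backward]"]) auto
next
  case (bidirected_collider u v)
  then obtain vs es where w: "walk G vs es" "inner_open G vs es C" "hd vs \<in> A" "hd vs \<notin> C" "last vs = u"
    "es \<noteq> []" "last es \<in> {Forward, Bidirected}" by blast
  have ne: "vs \<noteq> []" using w(1) by (auto simp: walk_def)
  have "walk G (vs @ [v]) (es @ [Bidirected])" "inner_open G (vs @ [v]) (es @ [Bidirected]) C"
    by (rule walk_extend[OF w(1,2)]; use w bidirected_collider in auto)+
  then show ?case using w ne by (intro exI[of _ "vs @ [v]"] exI[of _ "es @ [Bidirected]"]) auto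
next
  case (bidirected u v)
  then obtain vs es where w: "walk G vs es" "inner_open G vs es C" "hd vs \<in> A" "hd vs \<notin> C" "last vs = u"
    "es \<noteq> [] \<longrightarrow> last es = Backward \<and> (u \<in> C \<longrightarrow> same_scc G u (vs ! (length es - 1)))" by blast
  have ne: "vs \<noteq> []" using w(1) by (auto simp: walk_def)
  have "walk G (vs @ [v]) (es @ [Bidirected])" "inner_open G (vs @ [v]) (es @ [Bidirected]) C"
    by (rule walk_extend[OF w(1,2)]; use w bidirected in auto)+
  then show ?case using w ne by (intro exI[of _ "vs @ [v]"] exI[of _ "es @ [Bidirected]"]) auto
qed

text \<open>A walk with an end point in \<open>C\<close> counts as blocked, so an open walk to
  \<open>b\<close> contradicts separation only if \<open>b\<close> lies outside
  \<open>C\<close>.\<close>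

lemma open_to_not_separated:
  assumes "sigma_separated G A B C" "open_to G A C b h" "b \<in> B" shows "b \<in> C"
proof (rule ccontr)
  assume b: "b \<notin> C"
  obtain vs es where w: "walk G vs es" "inner_open G vs es C" "hd vs \<in> A" "hd vs \<notin> C" "last vs = b"
    using open_to_walk[OF assms(2)] by blast
  then have "sigma_blocked G vs es C" using assms(1,3) by (auto simp: sigma_separated_def)
  then show False using w b by (auto simp: sigma_blocked_def inner_open_def)
qed

text \<open>A directed edge inside a strongly connected component never makes its tail blockable. An
  open walk can therefore spread through the whole component, even through nodes of
  \<open>C\<close>, and the reachable nodes form a union of components.\<close>

lemma open_to_scc:
  assumes dir: "dir_edges G \<subseteq> verts G \<times> verts G" and o: "open_to G A C u h" and s: "same_scc G u s"
  shows "\<exists>h. open_to G A C s h"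
proof -
  have us: "(u, s) \<in> (dir_edges G)\<^sup>*" and su: "(s, u) \<in> (dir_edges G)\<^sup>*" using s by (auto simp: same_scc_def)
  from us su show ?thesis
  proof (induction rule: rtrancl_induct)
    case base then show ?case using o by blast
  next
    case (step y z)
    have "(y, u) \<in> (dir_edges G)\<^sup>*" using step.hyps(2) step.prems by (rule converse_rtrancl_into_rtrancl)
    then obtain h where "open_to G A C y h" using step.IH by blast
    moreover have "same_scc G y z" unfolding same_scc_def
      using step by (auto intro: rtrancl_trans)
    ultimately show ?case using open_to.forward[of G A C y h z] step.hyps dir by blast
  qed
qed

text \<open>If \<open>s\<close> has no descendant in \<open>C\<close>, it cannot be left against an arrowhead as a collider, but then
  it is an ancestor of \<open>A\<close> and can be entered anew, backwards, from there.\<close>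

lemma open_to_leave:
  assumes dir: "dir_edges G \<subseteq> verts G \<times> verts G" and AV: "A \<subseteq> verts G" "A \<inter> C = {}"
    and s: "s \<in> anc G (A \<union> B \<union> C)" and o: "open_to G A C s h"
    and B: "\<And>b h. b \<in> B \<Longrightarrow> open_to G A C b h \<Longrightarrow> b \<in> C"
  shows "open_to G A C s False \<or> open_to G A C s True \<and> s \<in> anc G C"
proof (cases "s \<in> anc G C")
  case True then show ?thesis using o by (cases h) auto
next
  case False
  then have nC: "x \<notin> C" if "(s, x) \<in> (dir_edges G)\<^sup>*" for x using that by (auto simp: anc_def)
  obtain c where c: "c \<in> A \<union> B" "(s, c) \<in> (dir_edges G)\<^sup>*" using s False by (auto simp: anc_def)
  \<comment> \<open>A directed path from \<open>s\<close> to \<open>B\<close> would prolong the open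
    walk, since no node on it lies in \<open>C\<close>; its end would then have to be in
    \<open>C\<close>.\<close>
  have "c \<notin> B"
  proof
    assume cB: "c \<in> B"
    from c(2) have "\<exists>h. open_to G A C c h"
    proof (induction rule: rtrancl_induct)
      case base then show ?case using o by blast
    next
      case (step y z)
      then obtain h where "open_to G A C y h" by blast
      then show ?case using open_to.forward[of G A C y h z] step.hyps dir nC[OF step.hyps(1)] by blast
    qed
    then show False using B[OF cB] nC[OF c(2)] by blast
  qed
  then have cA: "c \<in> A" using c(1) by blast
  then have st: "open_to G A C c False" using AV by (intro open_to.start) auto
  \<comment> \<open>Walk backwards from \<open>c \<in> A\<close> along the directed path towards
    \<open>s\<close>. All its nodes are descendants of \<open>s\<close>, hence outside
    \<open>C\<close>, and none of them is a collider.\<close>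
  have "x \<in> {x. (s, x) \<in> (dir_edges G)\<^sup>*} \<longrightarrow> open_to G A C x False" if "(x, c) \<in> (dir_edges G)\<^sup>*" for x
    using that
  proof (induction rule: converse_rtrancl_induct)
    case base then show ?case using st by blast
  next
    case (step y z)
    show ?case
    proof
      assume y: "y \<in> {x. (s, x) \<in> (dir_edges G)\<^sup>*}"
      then have "open_to G A C z False" using step by (auto intro: rtrancl_into_rtrancl)
      then show "open_to G A C y False"
        using open_to.backward[of G A C z y] step.hyps(1) dir nC[of y] y by blast
    qed
  qed
  from this[OF c(2)] show ?thesis by simp
qed

lemma open_to_parent:
  assumes "open_to G A C s False \<or> open_to G A C s True \<and> s \<in> anc G C" 
    and "(p, s) \<in> dir_edges G" "p \<in> verts G" "p \<notin> C"
  shows "open_to G A C p False"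
  using assms by (auto intro: open_to.backward open_to.backward_collider)

lemma open_to_sibling:
  assumes "open_to G A C s False \<or> open_to G A C s True \<and> s \<in> anc G C" 
    and "(s, p) \<in> bidir_edges G" "p \<in> verts G"
  shows "open_to G A C p True"
  using assms by (auto intro: open_to.bidirected open_to.bidirected_collider)

section \<open>Splitting an ancestral set along sigma-separation\<close>

lemma anc_subset: "C \<subseteq> anc G C" by (auto simp: anc_def)

lemma anc_ancestral: "(u, v) \<in> dir_edges G \<Longrightarrow> v \<in> anc G C \<Longrightarrow> u \<in> anc G C"
  by (auto simp: anc_def intro: converse_rtrancl_into_rtrancl)

lemma anc_verts: 
  assumes "dir_edges G \<subseteq> verts G \<times> verts G" "C \<subseteq> verts G" shows "anc G C \<subseteq> verts G"
proof
  fix u assume "u \<in> anc G C"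
  then obtain c where "c \<in> C" "(u, c) \<in> (dir_edges G)\<^sup>*" by (auto simp: anc_def)
  from this(2,1) show "u \<in> verts G" using assms by (cases rule: converse_rtranclE) auto
qed

text \<open>\<open>U\<close> and \<open>H - U\<close> are unions of components when \<open>H\<close>
  is ancestral; every directed edge between them starts in \<open>C\<close>, and no bidirected edge
  joins them, so that no noise is shared. \<open>A\<close> lies on one side, and the part of
  \<open>B\<close> in \<open>H\<close> on the other.\<close>

definition separating_split :: "'v mixed_graph \<Rightarrow> 'v set \<Rightarrow> 'v set \<Rightarrow> 'v set \<Rightarrow> 'v set \<Rightarrow> 'v set \<Rightarrow> bool" where
  "separating_split G H A B C U \<longleftrightarrow> U \<subseteq> H \<and> A \<subseteq> U \<and> B \<inter> U = {} \<and>
     (\<forall>u v. (u, v) \<in> (dir_edges G)\<^sup>* \<longrightarrow> (v, u) \<in> (dir_edges G)\<^sup>* \<longrightarrow> u \<in> U \<longrightarrow> v \<in> U) \<and>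
     (\<forall>p s. (p, s) \<in> dir_edges G \<longrightarrow> s \<in> U \<longrightarrow> p \<notin> C \<longrightarrow> p \<in> U) \<and>
     (\<forall>p s. (p, s) \<in> dir_edges G \<longrightarrow> p \<in> U \<longrightarrow> p \<notin> C \<longrightarrow> s \<in> H \<longrightarrow> s \<in> U) \<and>
     (\<forall>p s. (p, s) \<in> bidir_edges G \<longrightarrow> p \<in> U \<longrightarrow> s \<in> H \<longrightarrow> s \<in> U)"

text \<open>\<open>U\<close> consists of the nodes of \<open>H\<close> reached by open walks from
  \<open>A\<close>, and each closure property says that such a walk can be prolonged by one edge.
  \<open>B\<close> contributes to \<open>H\<close>, because the paths on \<open>B\<close> will have
  to be functions of the second noise block and the observed paths.\<close>

lemma separating_split_obs:
  assumes sep: "sigma_separated G A B C" and dir: "dir_edges G \<subseteq> verts G \<times> verts G"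
    and bid: "bidir_edges G \<subseteq> verts G \<times> verts G"
    and ABC: "A \<subseteq> verts G" "B \<subseteq> verts G" "C \<subseteq> verts G" "A \<inter> C = {}" "B \<inter> C = {}"
  shows "\<exists>U. separating_split G (anc G (A \<union> B \<union> C)) A B C U"
proof -
  let ?H = "anc G (A \<union> B \<union> C)"
  have HV: "?H \<subseteq> verts G" using ABC by (intro anc_verts dir) auto
  note nb = open_to_not_separated[OF sep]
  have leave: "open_to G A C s False \<or> open_to G A C s True \<and> s \<in> anc G C" if "s \<in> ?H" "open_to G A C s h" for s h
    using that nb by (intro open_to_leave[OF dir ABC(1,4), where B = B]) auto
  have scc: "v \<in> ?H" if "(v, u) \<in> (dir_edges G)\<^sup>*" "u \<in> ?H" for u v
    using that by (induction rule: converse_rtrancl_induct) (auto intro: anc_ancestral)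
  show ?thesis unfolding separating_split_def
  proof (intro exI[of _ "{s \<in> ?H. \<exists>h. open_to G A C s h}"] conjI allI impI)
    show "A \<subseteq> {s \<in> ?H. \<exists>h. open_to G A C s h}"
      using ABC anc_subset[of "A \<union> B \<union> C" G] open_to.start[of _ A G C] by blast
    show "B \<inter> {s \<in> ?H. \<exists>h. open_to G A C s h} = {}" using nb ABC(5) by blast
    fix u v
    show "v \<in> {s \<in> ?H. \<exists>h. open_to G A C s h}" 
      if "(u, v) \<in> (dir_edges G)\<^sup>*" "(v, u) \<in> (dir_edges G)\<^sup>*" "u \<in> {s \<in> ?H. \<exists>h. open_to G A C s h}"
      using that scc[OF that(2)] open_to_scc[OF dir, of A C u _ v] by (auto simp: same_scc_def)
    show "u \<in> {s \<in> ?H. \<exists>h. open_to G A C s h}"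
      if "(u, v) \<in> dir_edges G" "v \<in> {s \<in> ?H. \<exists>h. open_to G A C s h}" "u \<notin> C"
      using that anc_ancestral[OF that(1)] open_to_parent[OF leave that(1) _ that(3)] dir by blast
    show "v \<in> {s \<in> ?H. \<exists>h. open_to G A C s h}"
      if "(u, v) \<in> dir_edges G" "u \<in> {s \<in> ?H. \<exists>h. open_to G A C s h}" "u \<notin> C" "v \<in> ?H"
      using that HV open_to.forward[of G A C u _ v] by blast
    show "v \<in> {s \<in> ?H. \<exists>h. open_to G A C s h}"
      if "(u, v) \<in> bidir_edges G" "u \<in> {s \<in> ?H. \<exists>h. open_to G A C s h}" "v \<in> ?H"
      using that HV open_to_sibling[OF leave that(1)] by blast
  qed auto
qed

lemma dir_edges_do: "(u, v) \<in> dir_edges G \<Longrightarrow> (Inl u, Inl v) \<in> dir_edges (do_graph G B)"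
  by (force simp: do_graph_def)

lemma rtrancl_do: "(u, v) \<in> (dir_edges G)\<^sup>* \<Longrightarrow> (Inl u, Inl v) \<in> (dir_edges (do_graph G B))\<^sup>*"
  by (induction rule: rtrancl_induct) (auto intro: rtrancl_into_rtrancl dir_edges_do)

text \<open>Walks run in the graph with regime nodes, while \<open>U\<close> and \<open>H\<close>
  contain original nodes only. \<open>H\<close> is generated by \<open>A \<union> C\<close> alone:
  the regime, rather than \<open>X_B\<close>, is what has to be independent of
  \<open>X_A\<close>.\<close>

lemma separating_split_do:
  assumes sep: "sigma_separated (do_graph G B) (Inl ` A) (Inr ` B) (Inl ` C)" and dir: "dir_edges G \<subseteq> verts G \<times> verts G"
    and bid: "bidir_edges G \<subseteq> verts G \<times> verts G"
    and ABC: "A \<subseteq> verts G" "B \<subseteq> verts G" "C \<subseteq> verts G" "A \<inter> C = {}"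
  shows "\<exists>U. separating_split G (anc G (A \<union> C)) A B C U"
proof -
  let ?H = "anc G (A \<union> C)" and ?G = "do_graph G B"
  let ?o = "open_to ?G (Inl ` A) (Inl ` C)"
  have HV: "?H \<subseteq> verts G" using ABC by (intro anc_verts dir) auto
  have V: "x \<in> verts G \<Longrightarrow> Inl x \<in> verts ?G" for x by (simp add: do_graph_def)
  have dir': "dir_edges ?G \<subseteq> verts ?G \<times> verts ?G" using dir ABC(2) by (auto simp: do_graph_def)
  have leave: "?o (Inl s) False \<or> ?o (Inl s) True \<and> Inl s \<in> anc ?G (Inl ` C)" if "s \<in> ?H" "?o (Inl s) h" for s h
  proof (rule open_to_leave[OF dir', where B = "{}"])
    show "Inl s \<in> anc ?G (Inl ` A \<union> {} \<union> Inl ` C)" using that(1) rtrancl_do[of s _ G B] by (auto simp: anc_def)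
  qed (use that ABC in \<open>auto simp: do_graph_def\<close>)
  have scc: "v \<in> ?H" if "(v, u) \<in> (dir_edges G)\<^sup>*" "u \<in> ?H" for u v
    using that by (induction rule: converse_rtrancl_induct) (auto intro: anc_ancestral)
  show ?thesis unfolding separating_split_def
  proof (intro exI[of _ "{s \<in> ?H. \<exists>h. ?o (Inl s) h}"] conjI allI impI)
    show "A \<subseteq> {s \<in> ?H. \<exists>h. ?o (Inl s) h}"
    proof
      fix a assume a: "a \<in> A"
      then have "?o (Inl a) False" using V ABC by (intro open_to.start) auto
      then show "a \<in> {s \<in> ?H. \<exists>h. ?o (Inl s) h}" using a anc_subset[of "A \<union> C" G] by auto
    qed
    show "B \<inter> {s \<in> ?H. \<exists>h. ?o (Inl s) h} = {}"
    proof (rule ccontr)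
      assume "B \<inter> {s \<in> ?H. \<exists>h. ?o (Inl s) h} \<noteq> {}"
      then obtain b h where b: "b \<in> B" "b \<in> ?H" "?o (Inl b) h" by auto
      \<comment> \<open>A node of \<open>H\<close> can be left towards any parent outside
        \<open>C\<close>, and the regime node is such a parent of \<open>b\<close>. An open walk to
        \<open>b\<close> would therefore reach it.\<close>
      have "?o (Inr b) False"
        by (rule open_to_parent[OF leave[OF b(2,3)]]) (use b in \<open>auto simp: do_graph_def\<close>)
      from open_to_not_separated[OF sep this] b show False by auto
    qed
    fix u v
    show "v \<in> {s \<in> ?H. \<exists>h. ?o (Inl s) h}" 
      if "(u, v) \<in> (dir_edges G)\<^sup>*" "(v, u) \<in> (dir_edges G)\<^sup>*" "u \<in> {s \<in> ?H. \<exists>h. ?o (Inl s) h}"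
      using that scc[OF that(2)] open_to_scc[OF dir', of "Inl ` A" "Inl ` C" "Inl u" _ "Inl v"] 
        rtrancl_do[OF that(1), of B] rtrancl_do[OF that(2), of B] by (auto simp: same_scc_def)
    show "u \<in> {s \<in> ?H. \<exists>h. ?o (Inl s) h}"
      if e: "(u, v) \<in> dir_edges G" and v: "v \<in> {s \<in> ?H. \<exists>h. ?o (Inl s) h}" and u: "u \<notin> C"
    proof -
      obtain h where h: "v \<in> ?H" "?o (Inl v) h" using v by auto
      have "?o (Inl u) False"
        by (rule open_to_parent[OF leave[OF h] dir_edges_do[OF e]]) (use V u dir e in auto)
      then show ?thesis using anc_ancestral[OF e h(1)] by auto
    qed
    show "v \<in> {s \<in> ?H. \<exists>h. ?o (Inl s) h}"
      if e: "(u, v) \<in> dir_edges G" and u: "u \<in> {s \<in> ?H. \<exists>h. ?o (Inl s) h}" "u \<notin> C" and v: "v \<in> ?H"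
    proof -
      obtain h where "?o (Inl u) h" using u by auto
      then have "?o (Inl v) True" using u v HV V by (intro open_to.forward[OF _ dir_edges_do[OF e]]) auto
      then show ?thesis using v by auto
    qed
    show "v \<in> {s \<in> ?H. \<exists>h. ?o (Inl s) h}"
      if e: "(u, v) \<in> bidir_edges G" and u: "u \<in> {s \<in> ?H. \<exists>h. ?o (Inl s) h}" and v: "v \<in> ?H"
    proof -
      obtain h where h: "u \<in> ?H" "?o (Inl u) h" using u by auto
      have "(Inl u, Inl v) \<in> bidir_edges ?G" using e by (force simp: do_graph_def)
      then have "?o (Inl v) True" using v HV V by (intro open_to_sibling[OF leave[OF h]]) auto
      then show ?thesis using v by auto
    qed
  qed auto
qed


text \<open>Randomising the regime: a fair coin decides between the observational solution and the
  solution under \<open>do(X\<^sub>B = x)\<close>, with \<open>x\<close> drawn from \<open>\<nu>\<close> independently of the noise.  The coin and \<open>x\<close> play the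
  role of the regime nodes \<open>R\<^sub>B\<close>, so that all three rules become conditional independences.\<close>

locale regime_mixture = sde_context +
  fixes B :: "'b set" and \<nu> :: "('b \<Rightarrow> path) measure"
  assumes B: "B \<subseteq> V" and nu: "prob_space \<nu>" and sets_nu: "sets \<nu> = sets (PS B)"
begin

definition coin :: "bool measure" where "coin = measure_pmf (bernoulli_pmf (1/2))"

definition Q :: "((bool \<times> ('b \<Rightarrow> path)) \<times> ('b \<Rightarrow> path)) measure" where
  "Q = (coin \<Otimes>\<^sub>M \<nu>) \<Otimes>\<^sub>M PN"

definition Xm :: "(bool \<times> ('b \<Rightarrow> path)) \<times> ('b \<Rightarrow> path) \<Rightarrow> 'b \<Rightarrow> path" where
  "Xm \<omega> = (if fst (fst \<omega>) then sol0 (snd \<omega>) else xdo B (snd (fst \<omega>)) (snd \<omega>))"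

sublocale nu: prob_space \<nu> by (rule nu)

lemma prob_coin: "prob_space coin" unfolding coin_def by unfold_locales

sublocale coin: prob_space coin by (rule prob_coin)

lemma sets_coin: "sets coin = sets (count_space UNIV)" by (simp add: coin_def)

lemma space_nu: "space \<nu> = cadlag_fam T B"
  using sets_eq_imp_space_eq[OF sets_nu] by (simp add: space_path_space[OF T_pos])

sublocale K: pair_prob_space coin \<nu> ..
sublocale Q: pair_prob_space "coin \<Otimes>\<^sub>M \<nu>" PN ..
sublocale nP: pair_prob_space \<nu> PN ..

lemma prob_Q: "prob_space Q" unfolding Q_def by unfold_locales

lemma sets_Q: "sets Q = sets ((count_space UNIV \<Otimes>\<^sub>M PS B) \<Otimes>\<^sub>M PS W)"
  unfolding Q_def by (intro sets_pair_measure_cong sets_coin sets_nu sets_PN)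

lemma measurable_Q: "measurable Q N = measurable ((count_space UNIV \<Otimes>\<^sub>M PS B) \<Otimes>\<^sub>M PS W) N"
  by (rule measurable_cong_sets[OF sets_Q refl])

lemma measurable_nP: "measurable (\<nu> \<Otimes>\<^sub>M PN) N = measurable (PS B \<Otimes>\<^sub>M PS W) N"
  by (intro measurable_cong_sets sets_pair_measure_cong sets_nu sets_PN refl)

lemma Q_proj:
  "(\<lambda>\<omega>. fst (fst \<omega>)) \<in> Q \<rightarrow>\<^sub>M count_space UNIV" "(\<lambda>\<omega>. snd (fst \<omega>)) \<in> Q \<rightarrow>\<^sub>M PS B" "(\<lambda>\<omega>. snd \<omega>) \<in> Q \<rightarrow>\<^sub>M PS W"
  "fst \<in> Q \<rightarrow>\<^sub>M count_space UNIV \<Otimes>\<^sub>M PS B"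
  unfolding measurable_Q by measurable

lemma measurable_bool_If:
  assumes c: "c \<in> N \<rightarrow>\<^sub>M count_space UNIV" and f: "f \<in> N \<rightarrow>\<^sub>M R" and g: "g \<in> N \<rightarrow>\<^sub>M R"
  shows "(\<lambda>z. if c z then f z else g z) \<in> N \<rightarrow>\<^sub>M R"
proof (rule measurable_If[OF f g])
  show "{z \<in> space N. c z} \<in> sets N"
    using measurable_sets[OF c, of "{True}"] by (simp add: vimage_def Int_def conj_commute)
qed

lemma measurable_Xm: "Xm \<in> Q \<rightarrow>\<^sub>M PS V"
  unfolding Xm_def[abs_def]
  by (intro measurable_bool_If Q_proj measurable_compose[OF Q_proj(3) measurable_sol0] measurable_xdo[OF B])

lemma AE_Q:
  assumes "AE n in PN. P n" "AE x in \<nu>. AE n in PN. R x n"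
    and "{\<omega> \<in> space Q. if fst (fst \<omega>) then P (snd \<omega>) else R (snd (fst \<omega>)) (snd \<omega>)} \<in> sets Q"
  shows "AE \<omega> in Q. if fst (fst \<omega>) then P (snd \<omega>) else R (snd (fst \<omega>)) (snd \<omega>)"
  unfolding Q_def
proof (rule Q.AE_pair_measure)
  have ms: "snd \<in> coin \<Otimes>\<^sub>M \<nu> \<rightarrow>\<^sub>M \<nu>" by measurable
  have ds: "distr (coin \<Otimes>\<^sub>M \<nu>) \<nu> snd = \<nu>"
  proof (rule measure_eqI)
    fix E assume "E \<in> sets (distr (coin \<Otimes>\<^sub>M \<nu>) \<nu> snd)"
    then have E: "E \<in> sets \<nu>" by simp
    have "snd -` E \<inter> space (coin \<Otimes>\<^sub>M \<nu>) = space coin \<times> E"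
      using sets.sets_into_space[OF E] by (auto simp: space_pair_measure)
    then show "emeasure (distr (coin \<Otimes>\<^sub>M \<nu>) \<nu> snd) E = emeasure \<nu> E"
      using nu.emeasure_pair_measure_Times[OF sets.top[of coin] E] 
      by (simp add: emeasure_distr[OF ms E] coin.emeasure_space_1)
  qed simp
  have "AE x in distr (coin \<Otimes>\<^sub>M \<nu>) \<nu> snd. AE n in PN. R x n" unfolding ds by (rule assms(2))
  from AE_distrD[OF ms this]
  show "AE x in coin \<Otimes>\<^sub>M \<nu>. AE y in PN. (\<lambda>\<omega>. if fst (fst \<omega>) then P (snd \<omega>) else R (snd (fst \<omega>)) (snd \<omega>)) (x, y)"
  proof eventually_elim
    fix x :: "bool \<times> ('b \<Rightarrow> path)" assume R: "AE n in PN. R (snd x) n"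
    show "AE y in PN. (\<lambda>\<omega>. if fst (fst \<omega>) then P (snd \<omega>) else R (snd (fst \<omega>)) (snd \<omega>)) (x, y)"
      using assms(1) R by eventually_elim simp
  qed
qed (use assms(3) in \<open>simp add: Q_def\<close>)

text \<open>Each regime carries half of the mass, so an identity under \<open>Q\<close> restricted
  to one regime becomes an identity for the intervention law and the noise.\<close>

lemma nn_integral_Q:
  assumes h: "h \<in> borel_measurable (\<nu> \<Otimes>\<^sub>M PN)"
  shows "(\<integral>\<^sup>+\<omega>. (if fst (fst \<omega>) = b then h (snd (fst \<omega>), snd \<omega>) else 0) \<partial>Q) = ennreal (1/2) * (\<integral>\<^sup>+z. h z \<partial>(\<nu> \<Otimes>\<^sub>M PN))"
proof -
  have h': "(\<lambda>\<omega>. h (snd (fst \<omega>), snd \<omega>)) \<in> borel_measurable ((coin \<Otimes>\<^sub>M \<nu>) \<Otimes>\<^sub>M PN)"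
    by (rule measurable_compose[OF _ h]) measurable
  have c: "(\<lambda>\<omega>. fst (fst \<omega>) = b) \<in> (coin \<Otimes>\<^sub>M \<nu>) \<Otimes>\<^sub>M PN \<rightarrow>\<^sub>M count_space UNIV"
    using measurable_compose[OF Q_proj(1), of "\<lambda>c. c = b" "count_space UNIV"] by (simp add: Q_def)
  have m: "(\<lambda>\<omega>. if fst (fst \<omega>) = b then h (snd (fst \<omega>), snd \<omega>) else 0) \<in> borel_measurable ((coin \<Otimes>\<^sub>M \<nu>) \<Otimes>\<^sub>M PN)"
    by (rule measurable_bool_If[OF c h']) simp
  have m2: "(\<lambda>z. \<integral>\<^sup>+n. (if fst z = b then h (snd z, n) else 0) \<partial>PN) \<in> borel_measurable (coin \<Otimes>\<^sub>M \<nu>)"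
    using PN.borel_measurable_nn_integral_fst[OF m] by (simp cong: if_cong)
  have "(\<integral>\<^sup>+\<omega>. (if fst (fst \<omega>) = b then h (snd (fst \<omega>), snd \<omega>) else 0) \<partial>Q) =
      (\<integral>\<^sup>+z. \<integral>\<^sup>+n. (if fst z = b then h (snd z, n) else 0) \<partial>PN \<partial>(coin \<Otimes>\<^sub>M \<nu>))"
    unfolding Q_def using PN.nn_integral_fst[OF m] by (simp cong: if_cong)
  also have "\<dots> = (\<integral>\<^sup>+c. \<integral>\<^sup>+x. \<integral>\<^sup>+n. (if c = b then h (x, n) else 0) \<partial>PN \<partial>\<nu> \<partial>coin)"
    using nu.nn_integral_fst[OF m2] by (simp cong: if_cong)
  also have "\<dots> = (\<integral>\<^sup>+c. (if c = b then \<integral>\<^sup>+x. \<integral>\<^sup>+n. h (x, n) \<partial>PN \<partial>\<nu> else 0) \<partial>coin)"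
    by (intro nn_integral_cong) auto
  also have "\<dots> = ennreal (1/2) * (\<integral>\<^sup>+x. \<integral>\<^sup>+n. h (x, n) \<partial>PN \<partial>\<nu>)"
    unfolding coin_def by (cases b) (simp_all add: mult.commute)
  also have "(\<integral>\<^sup>+x. \<integral>\<^sup>+n. h (x, n) \<partial>PN \<partial>\<nu>) = (\<integral>\<^sup>+z. h z \<partial>(\<nu> \<Otimes>\<^sub>M PN))"
    by (rule PN.nn_integral_fst[OF h])
  finally show ?thesis .
qed

section \<open>The two noise blocks of the mixture and their independence\<close>

definition NAm :: "'b set \<Rightarrow> (bool \<times> ('b \<Rightarrow> path)) \<times> ('b \<Rightarrow> path) \<Rightarrow> 'b \<Rightarrow> path" where
  "NAm K \<omega> = restrict (snd \<omega>) K"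

text \<open>The coin and the intervened paths count as noise of the side away from \<open>U\<close>.
  The side of \<open>U\<close> contains no intervened node, so its equations are the same in both
  regimes.\<close>

definition NBm :: "'b set \<Rightarrow> (bool \<times> ('b \<Rightarrow> path)) \<times> ('b \<Rightarrow> path) \<Rightarrow> ('b \<Rightarrow> path) \<times> bool \<times> ('b \<Rightarrow> path)" where
  "NBm K \<omega> = (restrict (snd \<omega>) (W - K), fst \<omega>)"

abbreviation SBm :: "'b set \<Rightarrow> (('b \<Rightarrow> path) \<times> bool \<times> ('b \<Rightarrow> path)) measure" where
  "SBm K \<equiv> PS (W - K) \<Otimes>\<^sub>M count_space UNIV \<Otimes>\<^sub>M PS B"

lemma measurable_NAm: "K \<subseteq> W \<Longrightarrow> NAm K \<in> Q \<rightarrow>\<^sub>M PS K"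
  unfolding NAm_def[abs_def] by (rule measurable_restrict_path[OF Q_proj(3)])

lemma measurable_NBm: "NBm K \<in> Q \<rightarrow>\<^sub>M SBm K"
  unfolding NBm_def[abs_def] by (intro measurable_Pair measurable_restrict_path[OF Q_proj(3)] Q_proj(4)) auto

text \<open>Splicing represents the noise by two independent copies, one read on \<open>K\<close>
  and the other on \<open>W - K\<close>; the event becomes a rectangle.\<close>

lemma PN_indep:
  assumes K: "K \<subseteq> W" and E: "E \<in> sets (PS (W - K))" and L: "L \<in> sets (PS K)"
  shows "emeasure PN {n \<in> space PN. restrict n (W - K) \<in> E \<and> restrict n K \<in> L} =
    emeasure PN {n \<in> space PN. restrict n (W - K) \<in> E} * emeasure PN {n \<in> space PN. restrict n K \<in> L}"
proof -
  have id: "(\<lambda>n. n) \<in> PN \<rightarrow>\<^sub>M PS W" by (simp add: measurable_PN)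
  have mE: "(\<lambda>n. restrict n (W - K)) \<in> PN \<rightarrow>\<^sub>M PS (W - K)" and mL: "(\<lambda>n. restrict n K) \<in> PN \<rightarrow>\<^sub>M PS K"
    using K by (intro measurable_restrict_path[OF id]; blast)+
  let ?E = "{n \<in> space PN. restrict n (W - K) \<in> E}" and ?L = "{n \<in> space PN. restrict n K \<in> L}"
  have sE: "?E \<in> sets PN" using measurable_sets[OF mE E] by (simp add: vimage_def Int_def conj_commute)
  have sL: "?L \<in> sets PN" using measurable_sets[OF mL L] by (simp add: vimage_def Int_def conj_commute)
  have m: "(\<lambda>(n, c). splc K n c) \<in> PN \<Otimes>\<^sub>M PN \<rightarrow>\<^sub>M PS W"
    unfolding case_prod_beta by (intro measurable_splc) (auto simp: measurable_to_PN[symmetric])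
  have r: "restrict (splc K n c) K = restrict n K" "restrict (splc K n c) (W - K) = restrict c (W - K)" for n c
    using K by (auto simp: splc_def fun_eq_iff)
  have EF: "?E \<inter> ?L \<in> sets (PS W)" using sE sL by (simp add: sets_PN[symmetric])
  have "emeasure PN (?E \<inter> ?L) = emeasure (distr (PN \<Otimes>\<^sub>M PN) (PS W) (\<lambda>(n, c). splc K n c)) (?E \<inter> ?L)"
    by (rule arg_cong[where f="\<lambda>\<mu>. emeasure \<mu> (?E \<inter> ?L)", OF distr_splice[symmetric]])
  also have "\<dots> = emeasure (PN \<Otimes>\<^sub>M PN) (?L \<times> ?E)"
  proof -
    have "(\<lambda>(n, c). splc K n c) -` (?E \<inter> ?L) \<inter> space (PN \<Otimes>\<^sub>M PN) = ?L \<times> ?E"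
      using splc_in by (auto simp: space_pair_measure r space_PN)
    then show ?thesis by (simp only: emeasure_distr[OF m EF])
  qed
  also have "\<dots> = emeasure PN ?L * emeasure PN ?E" by (rule PN.emeasure_pair_measure_Times[OF sL sE])
  finally show ?thesis by (simp add: Int_def mult.commute conj_ac cong: conj_cong)
qed

text \<open>For a fixed regime this is \<open>PN_indep\<close> applied to the section of
  \<open>E\<close>. The probability of the event on \<open>K\<close> does not depend on the regime,
  so it factors out of the integral.\<close>

lemma Q_indep:
  assumes K: "K \<subseteq> W" and E: "E \<in> sets (SBm K)" and L: "L \<in> sets (PS K)"
  shows "emeasure Q {\<omega>\<in>space Q. NBm K \<omega> \<in> E \<and> NAm K \<omega> \<in> L} =
      emeasure Q {\<omega>\<in>space Q. NBm K \<omega> \<in> E} * emeasure Q {\<omega>\<in>space Q. NAm K \<omega> \<in> L}"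
proof -
  note mN = measurable_NAm[OF K] measurable_NBm[of K]
  let ?E = "{\<omega>\<in>space Q. NBm K \<omega> \<in> E}" and ?L = "{\<omega>\<in>space Q. NAm K \<omega> \<in> L}"
  have sE: "?E \<in> sets Q" using measurable_sets[OF mN(2) E] by (simp add: vimage_def Int_def conj_commute)
  have sL: "?L \<in> sets Q" using measurable_sets[OF mN(1) L] by (simp add: vimage_def Int_def conj_commute)
  have sEF: "{\<omega>\<in>space Q. NBm K \<omega> \<in> E \<and> NAm K \<omega> \<in> L} \<in> sets Q"
    using sets.Int[OF sE sL] by (simp add: Int_def cong: conj_cong)
  define f where "f = emeasure PN {n \<in> space PN. restrict n K \<in> L}"
  have alt: "emeasure Q A = (\<integral>\<^sup>+x. emeasure PN (Pair x -` A) \<partial>(coin \<Otimes>\<^sub>M \<nu>))" if "A \<in> sets Q" for A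
    using PN.emeasure_pair_measure_alt that by (simp add: Q_def)
  have spK: "space (coin \<Otimes>\<^sub>M \<nu>) = space (count_space UNIV \<Otimes>\<^sub>M PS B)"
    by (rule sets_eq_imp_space_eq) (intro sets_pair_measure_cong sets_coin sets_nu)
  have "emeasure Q {\<omega>\<in>space Q. NBm K \<omega> \<in> E \<and> NAm K \<omega> \<in> L} = (\<integral>\<^sup>+x. emeasure PN (Pair x -` ?E) * f \<partial>(coin \<Otimes>\<^sub>M \<nu>))"
    unfolding alt[OF sEF]
  proof (rule nn_integral_cong)
    fix x assume x: "x \<in> space (coin \<Otimes>\<^sub>M \<nu>)"
    define Ex where "Ex = (\<lambda>n. (n, x)) -` E"
    have Ex: "Ex \<in> sets (PS (W - K))" unfolding Ex_def by (rule sets_Pair2[OF E])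
    have 1: "Pair x -` {\<omega>\<in>space Q. NBm K \<omega> \<in> E \<and> NAm K \<omega> \<in> L} = {n \<in> space PN. restrict n (W - K) \<in> Ex \<and> restrict n K \<in> L}"
      using x by (auto simp: Q_def space_pair_measure NBm_def NAm_def Ex_def)
    have 2: "Pair x -` ?E = {n \<in> space PN. restrict n (W - K) \<in> Ex}"
      using x by (auto simp: Q_def space_pair_measure NBm_def Ex_def)
    show "emeasure PN (Pair x -` {\<omega>\<in>space Q. NBm K \<omega> \<in> E \<and> NAm K \<omega> \<in> L}) = emeasure PN (Pair x -` ?E) * f"
      unfolding 1 2 f_def by (rule PN_indep[OF K Ex L])
  qed
  also have "\<dots> = emeasure Q ?E * f"
    unfolding alt[OF sE] using sE by (intro nn_integral_multc PN.measurable_emeasure_Pair) (simp add: Q_def)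
  also have "f = emeasure Q ?L"
  proof -
    have "emeasure Q ?L = (\<integral>\<^sup>+x. f \<partial>(coin \<Otimes>\<^sub>M \<nu>))"
      unfolding alt[OF sL]
    proof (rule nn_integral_cong)
      fix x assume x: "x \<in> space (coin \<Otimes>\<^sub>M \<nu>)"
      have "Pair x -` ?L = {n \<in> space PN. restrict n K \<in> L}"
        using x by (auto simp: Q_def space_pair_measure NAm_def)
      then show "emeasure PN (Pair x -` ?L) = f" by (simp add: f_def)
    qed
    then show ?thesis by (simp add: K.emeasure_space_1)
  qed
  finally show ?thesis .
qed

end


context sde_context
begin

abbreviation "CG \<equiv> causal_graph T D"

lemma CG_props: "verts CG = V" "dir_edges CG \<subseteq> V \<times> V" "bidir_edges CG \<subseteq> V \<times> V"
  by (auto simp: causal_graph_def)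

lemma dir_CG: "(u, v) \<in> dir_edges CG \<longleftrightarrow> (u, v) \<in> aug_edges T D \<and> u \<in> V \<and> v \<in> V"
  by (auto simp: causal_graph_def)

end

context regime_mixture
begin

section \<open>Both sides of the split as functions of their noise blocks\<close>

lemma Xm_simps: "Xm ((True, x), n) = sol0 n" "Xm ((False, x), n) = xdo B x n"
  by (auto simp: Xm_def)

lemma common_generic_ex:
  assumes "U \<subseteq> V"
  shows "\<exists>c. c \<in> cadlag_fam T W \<and> (AE n in PN. restrict (sol0 n) U = Jsol U c (sol0 n, n)) \<and>
    (U \<inter> B = {} \<longrightarrow> (AE x in \<nu>. AE n in PN. restrict (xdo B x n) U = Jsol U c (xdo B x n, n)))"
proof (rule common_generic[OF assms B nu sets_nu])
  fix c assume c: "c \<in> cadlag_fam T W" "AE n in PN. restrict (sol0 n) U = Jsol U c (sol0 n, n)"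
    "U \<inter> B = {} \<Longrightarrow> AE x in \<nu>. AE n in PN. restrict (xdo B x n) U = Jsol U c (xdo B x n, n)"
  show ?thesis by (intro exI[of _ c] conjI impI c)
qed

text \<open>A component \<open>S\<close> that contains no node of \<open>B\<close> has the same mechanism in both regimes.\<close>

lemma determined_noise_A:
  assumes S: "S \<subseteq> V" "S \<inter> B = {}" and K: "K \<subseteq> W" "nz S \<subseteq> K"
  shows "determined T Q Xm (PS K) (NAm K) S (pa S)"
proof -
  obtain c where c: "c \<in> cadlag_fam T W" "AE n in PN. restrict (sol0 n) S = Jsol S c (sol0 n, n)"
    "AE x in \<nu>. AE n in PN. restrict (xdo B x n) S = Jsol S c (xdo B x n, n)"
    using common_generic_ex[OF S(1)] S(2) by blast
  have "c \<in> space (PS W)" using c(1) by (simp add: space_path_space[OF T_pos])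
  note cc = measurable_const[OF this]
  \<comment> \<open>Noises outside \<open>K\<close> are filled with \<open>c\<close>. Since
    \<open>nz S \<subseteq> K\<close>, the value of \<open>Jsol\<close> does not depend on the
    filler.\<close>
  define k where "k = (\<lambda>z. Jsol S c (snd z, gather K W (fst z) c))"
  have k: "k \<in> PS K \<Otimes>\<^sub>M PS (pa S) \<rightarrow>\<^sub>M PS S"
    unfolding k_def
    by (rule measurable_Jsol[OF S(1) measurable_snd subset_refl measurable_gather[OF T_pos measurable_fst cc] cc]) blast
  have kk: "k (NAm K \<omega>, restrict (Xm \<omega>) (pa S)) = Jsol S c (Xm \<omega>, snd \<omega>)" for \<omega>
    unfolding k_def NAm_def fst_conv snd_conv
    using K nz_sub by (intro Jsol_cong) (auto simp: fun_eq_iff gather_def)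
  have paV: "pa S \<subseteq> V" using pa_sub by blast
  have "{\<omega> \<in> space Q. restrict (Xm \<omega>) S = Jsol S c (Xm \<omega>, snd \<omega>)} \<in> sets Q"
    by (intro pred_eq_path_space[OF T_pos fin_sub(1)[OF S(1)]] measurable_restrict_path[OF measurable_Xm S(1)]
         measurable_Jsol[OF S(1) measurable_Xm paV] Q_proj(3) cc)
  moreover have eq: "restrict (Xm \<omega>) S = Jsol S c (Xm \<omega>, snd \<omega>) \<longleftrightarrow> (if fst (fst \<omega>) 
      then restrict (sol0 (snd \<omega>)) S = Jsol S c (sol0 (snd \<omega>), snd \<omega>)
      else restrict (xdo B (snd (fst \<omega>)) (snd \<omega>)) S = Jsol S c (xdo B (snd (fst \<omega>)) (snd \<omega>), snd \<omega>))" for \<omega>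
    by (simp add: Xm_def)
  ultimately have "AE \<omega> in Q. restrict (Xm \<omega>) S = Jsol S c (Xm \<omega>, snd \<omega>)"
    unfolding eq by (intro AE_Q c)
  then show ?thesis unfolding determined_def by (intro bexI[OF _ k]) (simp add: kk)
qed

text \<open>\<open>S\<close> may meet \<open>B\<close>, and its mechanism then changes with the
  regime: under the intervention the nodes of \<open>S \<inter> B\<close> are prescribed and only
  \<open>S - B\<close> is solved. Coin and prescribed paths belong to this noise block, so one
  function can switch between the two solution maps. Solvability is applied to \<open>S - B\<close>,
  which need not be a component.\<close>

lemma determined_noise_B:
  assumes S: "S \<subseteq> V" and K: "nz S \<inter> K = {}"
  shows "determined T Q Xm (SBm K) (NBm K) S (pa S)"
proof -
  obtain c where c: "c \<in> cadlag_fam T W" "AE n in PN. restrict (sol0 n) S = Jsol S c (sol0 n, n)"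
    using common_generic_ex[OF S] by blast
  define S' where "S' = S - B"
  have S': "S' \<subseteq> V" "S' \<inter> B = {}" using S by (auto simp: S'_def)
  obtain c' where c': "c' \<in> cadlag_fam T W" "AE x in \<nu>. AE n in PN. restrict (xdo B x n) S' = Jsol S' c' (xdo B x n, n)"
    using common_generic_ex[OF S'(1)] S'(2) by blast
  have cW: "c \<in> space (PS W)" "c' \<in> space (PS W)"
    using c(1) c'(1) by (simp_all add: space_path_space[OF T_pos])
  note cc = measurable_const[OF cW(1)] measurable_const[OF cW(2)]
  \<comment> \<open>After the removal of \<open>B\<close> from the block, nodes of
    \<open>S \<inter> B\<close> can become parents; their paths are available from the intervention,
    which is part of the noise.\<close>
  let ?P = "pa S" and ?P' = "pa S \<union> (S \<inter> B)"
  have paV: "pa S \<subseteq> V" "pa S' \<subseteq> V" using pa_sub by blast+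
  have pa': "pa S' \<subseteq> ?P'" by (auto simp: pa_def S'_def)
  have nz': "nz S' \<subseteq> nz S" by (auto simp: nz_def S'_def)
  define k where "k = (\<lambda>z. if fst (snd (fst z)) then Jsol S c (snd z, gather (W - K) W (fst (fst z)) c)
     else gather B S (snd (snd (fst z))) (Jsol S' c' (gather B ?P' (snd (snd (fst z))) (snd z), gather (W - K) W (fst (fst z)) c')))"
  have m: "(\<lambda>z. fst (snd (fst z))) \<in> SBm K \<Otimes>\<^sub>M PS ?P \<rightarrow>\<^sub>M count_space UNIV"
    "(\<lambda>z. fst (fst z)) \<in> SBm K \<Otimes>\<^sub>M PS ?P \<rightarrow>\<^sub>M PS (W - K)" "(\<lambda>z. snd (snd (fst z))) \<in> SBm K \<Otimes>\<^sub>M PS ?P \<rightarrow>\<^sub>M PS B"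
    "(\<lambda>z. snd z) \<in> SBm K \<Otimes>\<^sub>M PS ?P \<rightarrow>\<^sub>M PS ?P"
    by measurable
  have g1: "(\<lambda>z. gather (W - K) W (fst (fst z)) c) \<in> SBm K \<Otimes>\<^sub>M PS ?P \<rightarrow>\<^sub>M PS W"
    "(\<lambda>z. gather (W - K) W (fst (fst z)) c') \<in> SBm K \<Otimes>\<^sub>M PS ?P \<rightarrow>\<^sub>M PS W"
    by (rule measurable_gather[OF T_pos m(2)], rule cc, blast)+
  have g2: "(\<lambda>z. gather B ?P' (snd (snd (fst z))) (snd z)) \<in> SBm K \<Otimes>\<^sub>M PS ?P \<rightarrow>\<^sub>M PS ?P'"
    by (intro measurable_gather[OF T_pos m(3,4)]) blast
  have g3: "(\<lambda>z. Jsol S' c' (gather B ?P' (snd (snd (fst z))) (snd z), gather (W - K) W (fst (fst z)) c')) \<in> SBm K \<Otimes>\<^sub>M PS ?P \<rightarrow>\<^sub>M PS S'"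
    by (intro measurable_Jsol[OF S'(1) g2 pa'] g1 cc)
  have k: "k \<in> SBm K \<Otimes>\<^sub>M PS ?P \<rightarrow>\<^sub>M PS S"
    unfolding k_def
    by (intro measurable_bool_If m(1) measurable_Jsol[OF S m(4) subset_refl] g1(1) cc measurable_gather[OF T_pos m(3) g3])
       (auto simp: S'_def)
  have kT: "k (NBm K ((True, x), n), restrict (sol0 n) ?P) = Jsol S c (sol0 n, n)" for x n
    unfolding k_def NBm_def fst_conv snd_conv if_True
    using K nz_sub[of S] by (intro Jsol_cong) (auto simp: fun_eq_iff gather_def)
  have kF: "k (NBm K ((False, x), n), restrict (xdo B x n) ?P) = gather B S x (Jsol S' c' (xdo B x n, n))" for x n
  proof -
    have "Jsol S' c' (gather B ?P' x (restrict (xdo B x n) ?P), gather (W - K) W (restrict n (W - K)) c') = Jsol S' c' (xdo B x n, n)"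
    proof (rule Jsol_cong)
      show "restrict (gather (W - K) W (restrict n (W - K)) c') (nz S') = restrict n (nz S')"
        using K nz' nz_sub[of S] by (auto simp: fun_eq_iff gather_def)
      show "restrict (gather B ?P' x (restrict (xdo B x n) ?P)) (pa S') = restrict (xdo B x n) (pa S')"
        using pa' paV B by (auto simp: fun_eq_iff gather_def xdo_B subset_iff)
    qed
    then show ?thesis by (simp add: k_def NBm_def)
  qed
  let ?R = "\<lambda>x n. restrict (xdo B x n) S = gather B S x (Jsol S' c' (xdo B x n, n))"
  have do: "AE x in \<nu>. AE n in PN. ?R x n"
    using c'(2)
  proof eventually_elim
    fix x assume "AE n in PN. restrict (xdo B x n) S' = Jsol S' c' (xdo B x n, n)"
    then show "AE n in PN. ?R x n"
    proof eventually_elim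
      fix n assume eq: "restrict (xdo B x n) S' = Jsol S' c' (xdo B x n, n)"
      show "?R x n" unfolding eq[symmetric] using S
        by (auto simp: fun_eq_iff gather_def S'_def xdo_B subset_iff)
    qed
  qed
  have "{\<omega> \<in> space Q. if fst (fst \<omega>) then restrict (sol0 (snd \<omega>)) S = Jsol S c (sol0 (snd \<omega>), snd \<omega>) else ?R (snd (fst \<omega>)) (snd \<omega>)}
    = {\<omega> \<in> space Q. restrict (Xm \<omega>) S = k (NBm K \<omega>, restrict (Xm \<omega>) ?P)}"
  proof (rule Collect_cong)
    fix \<omega> :: "(bool \<times> ('b \<Rightarrow> path)) \<times> ('b \<Rightarrow> path)"
    obtain b x n where \<omega>: "\<omega> = ((b, x), n)" by (metis surj_pair)
    show "(\<omega> \<in> space Q \<and> (if fst (fst \<omega>) then restrict (sol0 (snd \<omega>)) S = Jsol S c (sol0 (snd \<omega>), snd \<omega>) else ?R (snd (fst \<omega>)) (snd \<omega>))) =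
      (\<omega> \<in> space Q \<and> restrict (Xm \<omega>) S = k (NBm K \<omega>, restrict (Xm \<omega>) ?P))"
      unfolding \<omega> by (cases b) (simp_all add: Xm_simps kT kF)
  qed
  also have "\<dots> \<in> sets Q"
    by (intro pred_eq_path_space[OF T_pos fin_sub(1)[OF S]] measurable_restrict_path[OF measurable_Xm S]
        measurable_compose[OF measurable_Pair[OF measurable_NBm measurable_restrict_path[OF measurable_Xm paV(1)]] k])
  finally have ms: "{\<omega> \<in> space Q. if fst (fst \<omega>) then restrict (sol0 (snd \<omega>)) S = Jsol S c (sol0 (snd \<omega>), snd \<omega>) else ?R (snd (fst \<omega>)) (snd \<omega>)} \<in> sets Q" .
  from AE_Q[OF c(2) do ms] have "AE \<omega> in Q. restrict (Xm \<omega>) S = k (NBm K \<omega>, restrict (Xm \<omega>) ?P)"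
  proof eventually_elim
    fix \<omega> :: "(bool \<times> ('b \<Rightarrow> path)) \<times> ('b \<Rightarrow> path)"
    assume a: "if fst (fst \<omega>) then restrict (sol0 (snd \<omega>)) S = Jsol S c (sol0 (snd \<omega>), snd \<omega>) else ?R (snd (fst \<omega>)) (snd \<omega>)"
    obtain b x n where \<omega>: "\<omega> = ((b, x), n)" by (metis surj_pair)
    show "restrict (Xm \<omega>) S = k (NBm K \<omega>, restrict (Xm \<omega>) ?P)"
      using a unfolding \<omega> by (cases b) (simp_all add: Xm_simps kT kF)
  qed
  then show ?thesis unfolding determined_def by (intro bexI[OF _ k])
qed

text \<open>\<open>K\<close> collects the noises that feed into \<open>U\<close>. A component inside
  \<open>U\<close> uses only these and avoids \<open>B\<close>. A component outside \<open>U\<close>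
  uses none of them, since a shared noise would give a bidirected edge across the split.\<close>

lemma split_inv_mixture:
  assumes H: "H \<subseteq> V" "\<And>u v. (u, v) \<in> dir_edges CG \<Longrightarrow> v \<in> H \<Longrightarrow> u \<in> H" and C: "C \<subseteq> V"
    and sp: "separating_split CG H A B1 C U" and BU: "B \<inter> U = {}"
    and K: "K = nz U"
  shows "split_inv T Q Xm C (PS K) (NAm K) U (SBm K) (NBm K) (H - U) H"
proof -
  have KW: "K \<subseteq> W" using nz_sub K by simp
  have U: "U \<subseteq> H" using sp by (simp add: separating_split_def)
  have scc: "\<And>u v. (u, v) \<in> (dir_edges CG)\<^sup>* \<Longrightarrow> (v, u) \<in> (dir_edges CG)\<^sup>* \<Longrightarrow> u \<in> U \<Longrightarrow> v \<in> U"
    using sp unfolding separating_split_def by blast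
  have Hr: "u \<in> H" if "(u, v) \<in> (dir_edges CG)\<^sup>*" "v \<in> H" for u v
    using that by (induction rule: converse_rtrancl_induct) (auto intro: H(2))
  have PeqG: "{u. u \<notin> S \<and> (\<exists>w\<in>S. (u, w) \<in> dir_edges CG)} = pa S" if "S \<subseteq> V" for S
    using that by (auto simp: pa_def dir_CG)
  show ?thesis
  proof (rule split_inv_ancestral[OF T_pos prob_Q measurable_Xm measurable_NAm[OF KW] measurable_NBm Q_indep[OF KW]
        finite_subset[OF H(1) fin(1)] H(2) C _ _ scc])
    show "U \<union> (H - U) = H" "U \<inter> (H - U) = {}" using U by auto
  next
    fix v S P assume v: "v \<in> U" and S: "S = {u. (u, v) \<in> (dir_edges CG)\<^sup>* \<and> (v, u) \<in> (dir_edges CG)\<^sup>*}"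
      and P: "P = {u. u \<notin> S \<and> (\<exists>w\<in>S. (u, w) \<in> dir_edges CG)}"
    have SU: "S \<subseteq> U" using scc[of v] v by (auto simp: S)
    then have SV: "S \<subseteq> V" using U H(1) by blast
    have P': "P = pa S" using PeqG[OF SV] P by simp
    have "P \<subseteq> U \<union> C" using sp SU unfolding separating_split_def P by blast
    moreover have "nz S \<subseteq> K" using SU by (auto simp: K nz_def)
    then have "determined T Q Xm (PS K) (NAm K) S P" unfolding P'
      using SU BU by (intro determined_noise_A SV KW) auto
    ultimately show "P \<subseteq> U \<union> C \<and> determined T Q Xm (PS K) (NAm K) S P" by blast
  next
    fix v S P assume v: "v \<in> H - U" and S: "S = {u. (u, v) \<in> (dir_edges CG)\<^sup>* \<and> (v, u) \<in> (dir_edges CG)\<^sup>*}"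
      and P: "P = {u. u \<notin> S \<and> (\<exists>w\<in>S. (u, w) \<in> dir_edges CG)}"
    have SU: "S \<subseteq> H - U" using scc[of _ v] Hr[of _ v] v by (auto simp: S)
    then have SV: "S \<subseteq> V" using H(1) by blast
    have P': "P = pa S" using PeqG[OF SV] P by simp
    have "P \<subseteq> H" using SU H(2) unfolding P by blast
    then have "P \<subseteq> (H - U) \<union> C" using sp SU unfolding separating_split_def P by blast
    moreover have "nz S \<inter> K = {}"
    proof (rule ccontr)
      assume "nz S \<inter> K \<noteq> {}"
      then obtain w s u where w: "w \<in> W" "s \<in> S" "u \<in> U" "(w, s) \<in> aug_edges T D" "(w, u) \<in> aug_edges T D"
        by (auto simp: K nz_def)
      have "s \<noteq> u" using w SU by blast
      then have "(u, s) \<in> bidir_edges CG" using w SV U H(1) by (auto simp: causal_graph_def)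
      then have "s \<in> U" using sp w SU unfolding separating_split_def by blast
      then show False using w SU by blast
    qed
    then have "determined T Q Xm (SBm K) (NBm K) S P" unfolding P' by (rule determined_noise_B[OF SV])
    ultimately show "P \<subseteq> H - U \<union> C \<and> determined T Q Xm (SBm K) (NBm K) S P" by blast
  qed
qed

text \<open>\<open>r\<close> is a version of \<open>P(X\<^sub>A \<in> E | X\<^sub>C)\<close> that serves in both regimes.\<close>

lemma common_conditional:
  assumes H: "H \<subseteq> V" "\<And>u v. (u, v) \<in> dir_edges CG \<Longrightarrow> v \<in> H \<Longrightarrow> u \<in> H" and C: "C \<subseteq> H"
    and sp: "separating_split CG H A B1 C U" and BU: "B \<inter> U = {}" and B2: "B2 \<subseteq> H - U"
    and E: "E \<in> sets (PS A)"
  obtains r where "r \<in> borel_measurable (PS C)"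
    "\<And>e. e \<in> sets (PS B2 \<Otimes>\<^sub>M PS C) \<Longrightarrow>
       emeasure PN {n \<in> space PN. restrict (sol0 n) A \<in> E \<and> (restrict (sol0 n) B2, restrict (sol0 n) C) \<in> e} =
       (\<integral>\<^sup>+n. r (restrict (sol0 n) C) * indicator e (restrict (sol0 n) B2, restrict (sol0 n) C) \<partial>PN)"
    "\<And>e. e \<in> sets (PS B \<Otimes>\<^sub>M PS C) \<Longrightarrow>
       emeasure (\<nu> \<Otimes>\<^sub>M PN) {z \<in> space (\<nu> \<Otimes>\<^sub>M PN). restrict (xdo B (fst z) (snd z)) A \<in> E \<and> (fst z, restrict (xdo B (fst z) (snd z)) C) \<in> e} =
       (\<integral>\<^sup>+z. r (restrict (xdo B (fst z) (snd z)) C) * indicator e (fst z, restrict (xdo B (fst z) (snd z)) C) \<partial>(\<nu> \<Otimes>\<^sub>M PN))"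
proof -
  define K where "K = nz U"
  have KW: "K \<subseteq> W" using nz_sub K_def by simp
  have CV: "C \<subseteq> V" and B2V: "B2 \<subseteq> V" using C B2 H(1) by auto
  have AU: "A \<subseteq> U" and UH: "U \<subseteq> H" using sp by (auto simp: separating_split_def)
  then have AV: "A \<subseteq> V" using H(1) by blast
  interpret pQ: prob_space Q by (rule prob_Q)
  have fQ: "finite_measure Q" by unfold_locales
  have CH: "C \<inter> H = C" "U \<inter> H = U" "(H - U) \<inter> H = H - U" using C UH by auto
  let ?Z = "\<lambda>\<omega>. restrict (Xm \<omega>) C" and ?X = "\<lambda>\<omega>. restrict (Xm \<omega>) A" and ?X2 = "\<lambda>\<omega>. restrict (Xm \<omega>) B2"
  note mA = measurable_NAm[OF KW] and mB = measurable_NBm[of K]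
  note mZ = measurable_restrict_path[OF measurable_Xm CV] and mX = measurable_restrict_path[OF measurable_Xm AV]
    and mX2 = measurable_restrict_path[OF measurable_Xm B2V]
  from split_inv_mixture[OF H CV sp BU K_def]
  have ci: "cond_indep Q (SBm K) (NBm K) (PS K) (NAm K) (PS C) ?Z"
    and dA: "determined T Q Xm (PS K) (NAm K) U C" and dB: "determined T Q Xm (SBm K) (NBm K) (H - U) C"
    by (simp_all add: split_inv_def CH)
  obtain kA where kA: "kA \<in> PS K \<Otimes>\<^sub>M PS C \<rightarrow>\<^sub>M PS A" "AE \<omega> in Q. ?X \<omega> = kA (NAm K \<omega>, ?Z \<omega>)"
    using determined_subset[OF dA AU] unfolding determined_def by blast
  obtain kB where kB: "kB \<in> SBm K \<Otimes>\<^sub>M PS C \<rightarrow>\<^sub>M PS B2" "AE \<omega> in Q. ?X2 \<omega> = kB (NBm K \<omega>, ?Z \<omega>)"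
    using determined_subset[OF dB B2] unfolding determined_def by blast
  have idC: "(\<lambda>z. z) \<in> PS C \<rightarrow>\<^sub>M PS C" by simp
  \<comment> \<open>Noises are replaced by paths on both sides: \<open>X_A\<close> is a function of
    the first block and \<open>X_C\<close>, and, after exchanging the roles, the regime together
    with \<open>X_B2\<close> is a function of the second block and \<open>X_C\<close>.\<close>
  have "cond_indep Q (SBm K) (NBm K) (PS A) ?X (PS C) ?Z"
    by (rule cond_indep_image[OF mB mA mZ mX mZ idC measurable_Pair[OF kA(1) measurable_snd] _ _ ci])
       (use kA(2) in auto)
  then have "cond_indep Q (PS A) ?X (SBm K) (NBm K) (PS C) ?Z"
    by (rule cond_indep_sym[OF fQ mB mX mZ])
  moreover have mk: "(\<lambda>z. ((snd (fst z), kB z), snd z)) \<in> SBm K \<Otimes>\<^sub>M PS C \<rightarrow>\<^sub>M ((count_space UNIV \<Otimes>\<^sub>M PS B) \<Otimes>\<^sub>M PS B2) \<Otimes>\<^sub>M PS C"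
    by (intro measurable_Pair kB(1) measurable_snd measurable_compose[OF measurable_fst measurable_snd])
  have "cond_indep Q (PS A) ?X ((count_space UNIV \<Otimes>\<^sub>M PS B) \<Otimes>\<^sub>M PS B2) (\<lambda>\<omega>. (fst \<omega>, ?X2 \<omega>)) (PS C) ?Z"
    by (rule cond_indep_image[OF mX mB mZ measurable_Pair[OF Q_proj(4) mX2] mZ idC mk _ _ calculation])
       (use kB(2) in \<open>auto simp: NBm_def\<close>)
  then obtain r where r: "r \<in> borel_measurable (PS C)" and re: "\<And>e. e \<in> sets (((count_space UNIV \<Otimes>\<^sub>M PS B) \<Otimes>\<^sub>M PS B2) \<Otimes>\<^sub>M PS C) \<Longrightarrow>
     emeasure Q {\<omega>\<in>space Q. ?X \<omega> \<in> E \<and> ((fst \<omega>, ?X2 \<omega>), ?Z \<omega>) \<in> e} =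
       (\<integral>\<^sup>+\<omega>. r (?Z \<omega>) * indicator e ((fst \<omega>, ?X2 \<omega>), ?Z \<omega>) \<partial>Q)"
    using E unfolding cond_indep_def by blast
  have half: "a = b" if "ennreal (1/2) * a = ennreal (1/2) * b" for a b :: ennreal
    using that by (simp add: ennreal_mult_cancel_left)
  have spQ: "((b, x), n) \<in> space Q \<longleftrightarrow> x \<in> cadlag_fam T B \<and> n \<in> cadlag_fam T W" for b x n
    using sets_eq_imp_space_eq[OF sets_Q] by (simp add: space_pair_measure space_path_space[OF T_pos])
  \<comment> \<open>Specialises the identity under \<open>Q\<close> to the regime
    \<open>reg\<close>. The variable \<open>yy\<close> accompanies \<open>X_C\<close>: it is the
    intervened path in the interventional regime and \<open>X_B2\<close> in the observational
    one.\<close>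
  have transfer: "emeasure (\<nu> \<Otimes>\<^sub>M PN) {z \<in> space (\<nu> \<Otimes>\<^sub>M PN). restrict (Y (fst z) (snd z)) A \<in> E \<and> (yy (fst z) (snd z), restrict (Y (fst z) (snd z)) C) \<in> e} =
       (\<integral>\<^sup>+z. r (restrict (Y (fst z) (snd z)) C) * indicator e (yy (fst z) (snd z), restrict (Y (fst z) (snd z)) C) \<partial>(\<nu> \<Otimes>\<^sub>M PN))"
    if Y: "\<And>x n. Xm ((reg, x), n) = Y x n" and yy: "\<And>x n. x \<in> cadlag_fam T B \<Longrightarrow> yy' (((reg, x), restrict (Y x n) B2)) = yy x n"
      and yym: "yy' \<in> (count_space UNIV \<Otimes>\<^sub>M PS B) \<Otimes>\<^sub>M PS B2 \<rightarrow>\<^sub>M R" and e: "e \<in> sets (R \<Otimes>\<^sub>M PS C)"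
      and Ym: "(\<lambda>z. Y (fst z) (snd z)) \<in> \<nu> \<Otimes>\<^sub>M PN \<rightarrow>\<^sub>M PS V" "(\<lambda>z. yy (fst z) (snd z)) \<in> \<nu> \<Otimes>\<^sub>M PN \<rightarrow>\<^sub>M R"
    for Y yy yy' e reg and R :: "'r measure"
  proof -
    \<comment> \<open>The event \<open>e\<close>, pulled back and intersected with the coin showing
      \<open>reg\<close>, so that the other regime contributes nothing to either side.\<close>
    define e' where "e' = {z \<in> space (((count_space UNIV \<Otimes>\<^sub>M PS B) \<Otimes>\<^sub>M PS B2) \<Otimes>\<^sub>M PS C). fst (fst (fst z)) = reg \<and> (yy' (fst z), snd z) \<in> e}"
    let ?S = "((count_space UNIV \<Otimes>\<^sub>M PS B) \<Otimes>\<^sub>M PS B2) \<Otimes>\<^sub>M PS C"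
    have "(\<lambda>z. (fst (fst (fst z)), (yy' (fst z), snd z))) \<in> ?S \<rightarrow>\<^sub>M count_space UNIV \<Otimes>\<^sub>M R \<Otimes>\<^sub>M PS C"
      using yym by measurable
    moreover have "{reg} \<times> e \<in> sets (count_space UNIV \<Otimes>\<^sub>M R \<Otimes>\<^sub>M PS C)" using e by auto
    ultimately have "(\<lambda>z. (fst (fst (fst z)), (yy' (fst z), snd z))) -` ({reg} \<times> e) \<inter> space ?S \<in> sets ?S" by (rule measurable_sets)
    moreover have "(\<lambda>z. (fst (fst (fst z)), (yy' (fst z), snd z))) -` ({reg} \<times> e) \<inter> space ?S = e'" by (auto simp: e'_def)
    ultimately have e': "e' \<in> sets ?S" by simp
    note mYA = measurable_restrict_path[OF Ym(1) AV] and mYC = measurable_restrict_path[OF Ym(1) CV]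
    let ?g = "\<lambda>z. (yy (fst z) (snd z), restrict (Y (fst z) (snd z)) C)"
    have mg: "?g \<in> \<nu> \<Otimes>\<^sub>M PN \<rightarrow>\<^sub>M R \<Otimes>\<^sub>M PS C" by (rule measurable_Pair[OF Ym(2) mYC])
    let ?N = "{z \<in> space (\<nu> \<Otimes>\<^sub>M PN). restrict (Y (fst z) (snd z)) A \<in> E \<and> ?g z \<in> e}"
    have N: "?N \<in> sets (\<nu> \<Otimes>\<^sub>M PN)"
      using sets.Int[OF measurable_sets[OF mYA E] measurable_sets[OF mg e]]
      by (simp add: vimage_def Int_def conj_ac cong: conj_cong)
    have in_e': "((fst \<omega>, ?X2 \<omega>), ?Z \<omega>) \<in> e' \<longleftrightarrow> fst (fst \<omega>) = reg \<and> ?g (snd (fst \<omega>), snd \<omega>) \<in> e" if \<omega>: "\<omega> \<in> space Q" for \<omega>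
    proof -
      have s: "((fst \<omega>, ?X2 \<omega>), ?Z \<omega>) \<in> space ?S"
        using measurable_space[OF measurable_Pair[OF measurable_Pair[OF Q_proj(4) mX2] mZ] \<omega>] .
      obtain b x n where w: "\<omega> = ((b, x), n)" by (metis surj_pair)
      have x: "x \<in> cadlag_fam T B" using \<omega> spQ w by simp
      show ?thesis using s Y yy[OF x] unfolding w by (auto simp: e'_def)
    qed
    have eqset: "indicator {\<omega>\<in>space Q. ?X \<omega> \<in> E \<and> ((fst \<omega>, ?X2 \<omega>), ?Z \<omega>) \<in> e'} \<omega> =
       (if fst (fst \<omega>) = reg then indicator ?N (snd (fst \<omega>), snd \<omega>) else (0::ennreal))" if \<omega>: "\<omega> \<in> space Q" for \<omega>
    proof -
      obtain b x n where w: "\<omega> = ((b, x), n)" by (metis surj_pair)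
      have xn: "(x, n) \<in> space (\<nu> \<Otimes>\<^sub>M PN)" using \<omega> spQ w by (simp add: space_pair_measure space_nu space_PN)
      show ?thesis
      proof (cases "b = reg")
        case True
        then have X: "Xm \<omega> = Y x n" using Y w by simp
        have i: "((fst \<omega>, restrict (Y x n) B2), restrict (Y x n) C) \<in> e' \<longleftrightarrow> ?g (x, n) \<in> e"
          using in_e'[OF \<omega>] True unfolding X unfolding w by simp
        have "\<omega> \<in> {\<omega>\<in>space Q. ?X \<omega> \<in> E \<and> ((fst \<omega>, ?X2 \<omega>), ?Z \<omega>) \<in> e'} \<longleftrightarrow> (x, n) \<in> ?N"
          using \<omega> xn i by (simp add: X)
        then show ?thesis using True by (simp add: w indicator_def)
      next
        case False
        then have "\<omega> \<notin> {\<omega>\<in>space Q. ?X \<omega> \<in> E \<and> ((fst \<omega>, ?X2 \<omega>), ?Z \<omega>) \<in> e'}"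
          using in_e'[OF \<omega>] by (simp add: w)
        then show ?thesis using False by (simp add: w indicator_def)
      qed
    qed
    have sN: "{\<omega>\<in>space Q. ?X \<omega> \<in> E \<and> ((fst \<omega>, ?X2 \<omega>), ?Z \<omega>) \<in> e'} \<in> sets Q"
      using sets.Int[OF measurable_sets[OF mX E] measurable_sets[OF measurable_Pair[OF measurable_Pair[OF Q_proj(4) mX2] mZ] e']]
      by (simp add: vimage_def Int_def conj_ac cong: conj_cong)
    have "ennreal (1/2) * emeasure (\<nu> \<Otimes>\<^sub>M PN) ?N = ennreal (1/2) * (\<integral>\<^sup>+z. indicator ?N z \<partial>(\<nu> \<Otimes>\<^sub>M PN))"
      using N by simp
    also have "\<dots> = (\<integral>\<^sup>+\<omega>. (if fst (fst \<omega>) = reg then indicator ?N (snd (fst \<omega>), snd \<omega>) else 0) \<partial>Q)"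
      by (rule nn_integral_Q[symmetric]) (use N in simp)
    also have "\<dots> = (\<integral>\<^sup>+\<omega>. indicator {\<omega>\<in>space Q. ?X \<omega> \<in> E \<and> ((fst \<omega>, ?X2 \<omega>), ?Z \<omega>) \<in> e'} \<omega> \<partial>Q)"
      by (rule nn_integral_cong) (rule eqset[symmetric])
    also have "\<dots> = emeasure Q {\<omega>\<in>space Q. ?X \<omega> \<in> E \<and> ((fst \<omega>, ?X2 \<omega>), ?Z \<omega>) \<in> e'}" using sN by simp
    also have "\<dots> = (\<integral>\<^sup>+\<omega>. r (?Z \<omega>) * indicator e' ((fst \<omega>, ?X2 \<omega>), ?Z \<omega>) \<partial>Q)" by (rule re[OF e'])
    also have "\<dots> = (\<integral>\<^sup>+\<omega>. (if fst (fst \<omega>) = reg then (\<lambda>z. r (snd (?g z)) * indicator e (?g z)) (snd (fst \<omega>), snd \<omega>) else 0) \<partial>Q)"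
    proof (rule nn_integral_cong)
      fix \<omega> assume \<omega>: "\<omega> \<in> space Q"
      obtain b x n where w: "\<omega> = ((b, x), n)" by (metis surj_pair)
      show "r (?Z \<omega>) * indicator e' ((fst \<omega>, ?X2 \<omega>), ?Z \<omega>) =
        (if fst (fst \<omega>) = reg then (\<lambda>z. r (snd (?g z)) * indicator e (?g z)) (snd (fst \<omega>), snd \<omega>) else 0)"
      proof (cases "b = reg")
        case True
        then have X: "Xm \<omega> = Y x n" using Y w by simp
        have i: "((fst \<omega>, restrict (Y x n) B2), restrict (Y x n) C) \<in> e' \<longleftrightarrow> ?g (x, n) \<in> e"
          using in_e'[OF \<omega>] True unfolding X unfolding w by simp
        then show ?thesis using True unfolding X by (simp add: w indicator_def)
      next
        case False
        then have "((fst \<omega>, ?X2 \<omega>), ?Z \<omega>) \<notin> e'" using in_e'[OF \<omega>] by (simp add: w)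
        then show ?thesis using False by (simp add: w indicator_def)
      qed
    qed
    also have "\<dots> = ennreal (1/2) * (\<integral>\<^sup>+z. r (snd (?g z)) * indicator e (?g z) \<partial>(\<nu> \<Otimes>\<^sub>M PN))"
    proof (rule nn_integral_Q)
      have "(\<lambda>p. r (snd p) * indicator e p) \<in> borel_measurable (R \<Otimes>\<^sub>M PS C)"
        using r e by measurable
      from measurable_compose[OF mg this]
      show "(\<lambda>z. r (snd (?g z)) * indicator e (?g z)) \<in> borel_measurable (\<nu> \<Otimes>\<^sub>M PN)" .
    qed
    finally show ?thesis using half by simp
  qed
  show ?thesis
  proof (rule that[OF r])
    fix e assume e: "e \<in> sets (PS B \<Otimes>\<^sub>M PS C)"
    show "emeasure (\<nu> \<Otimes>\<^sub>M PN) {z \<in> space (\<nu> \<Otimes>\<^sub>M PN). restrict (xdo B (fst z) (snd z)) A \<in> E \<and> (fst z, restrict (xdo B (fst z) (snd z)) C) \<in> e} =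
       (\<integral>\<^sup>+z. r (restrict (xdo B (fst z) (snd z)) C) * indicator e (fst z, restrict (xdo B (fst z) (snd z)) C) \<partial>(\<nu> \<Otimes>\<^sub>M PN))"
    proof (rule transfer[of False "xdo B" "\<lambda>p. snd (fst p)" "\<lambda>x n. x" "PS B" e])
      show "(\<lambda>z. xdo B (fst z) (snd z)) \<in> \<nu> \<Otimes>\<^sub>M PN \<rightarrow>\<^sub>M PS V" "(\<lambda>z. fst z) \<in> \<nu> \<Otimes>\<^sub>M PN \<rightarrow>\<^sub>M PS B"
        unfolding measurable_nP by (intro measurable_xdo[OF B] measurable_fst measurable_snd)+
    qed (use e in \<open>auto simp: Xm_simps\<close>)
  next
    fix e assume e: "e \<in> sets (PS B2 \<Otimes>\<^sub>M PS C)"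
    let ?f = "\<lambda>n. r (restrict (sol0 n) C) * indicator e (restrict (sol0 n) B2, restrict (sol0 n) C)"
    let ?N = "{n \<in> space PN. restrict (sol0 n) A \<in> E \<and> (restrict (sol0 n) B2, restrict (sol0 n) C) \<in> e}"
    have ms: "sol0 \<in> PN \<rightarrow>\<^sub>M PS V" by (simp add: measurable_PN measurable_sol0)
    have ms2: "(\<lambda>z. sol0 (snd z)) \<in> \<nu> \<Otimes>\<^sub>M PN \<rightarrow>\<^sub>M PS V" by (rule measurable_compose[OF measurable_snd ms])
    note m1 = measurable_restrict_path[OF ms AV] measurable_Pair[OF measurable_restrict_path[OF ms B2V] measurable_restrict_path[OF ms CV]]
    have N: "?N \<in> sets PN" using sets.Int[OF measurable_sets[OF m1(1) E] measurable_sets[OF m1(2) e]]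
      by (simp add: vimage_def Int_def conj_ac cong: conj_cong)
    have "(\<lambda>p. r (snd p) * indicator e p) \<in> borel_measurable (PS B2 \<Otimes>\<^sub>M PS C)" using r e by measurable
    from measurable_compose[OF m1(2) this] have f: "?f \<in> borel_measurable PN" by simp
    \<comment> \<open>In the observational regime nothing depends on the intervened path, and the
      probability measure \<open>\<nu>\<close> integrates out.\<close>
    have "emeasure (\<nu> \<Otimes>\<^sub>M PN) {z \<in> space (\<nu> \<Otimes>\<^sub>M PN). restrict (sol0 (snd z)) A \<in> E \<and> (restrict (sol0 (snd z)) B2, restrict (sol0 (snd z)) C) \<in> e} =
       (\<integral>\<^sup>+z. r (restrict (sol0 (snd z)) C) * indicator e (restrict (sol0 (snd z)) B2, restrict (sol0 (snd z)) C) \<partial>(\<nu> \<Otimes>\<^sub>M PN))"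
      by (rule transfer[of True "\<lambda>x n. sol0 n" "\<lambda>p. snd p" "\<lambda>x n. restrict (sol0 n) B2" "PS B2" e])
         (use e ms2 measurable_restrict_path[OF ms2 B2V] in \<open>auto simp: Xm_simps\<close>)
    moreover have "{z \<in> space (\<nu> \<Otimes>\<^sub>M PN). restrict (sol0 (snd z)) A \<in> E \<and> (restrict (sol0 (snd z)) B2, restrict (sol0 (snd z)) C) \<in> e} = space \<nu> \<times> ?N"
      by (auto simp: space_pair_measure)
    moreover have "emeasure (\<nu> \<Otimes>\<^sub>M PN) (space \<nu> \<times> ?N) = emeasure PN ?N"
      using PN.emeasure_pair_measure_Times[OF sets.top[of \<nu>] N] by (simp add: nu.emeasure_space_1)
    moreover have "(\<integral>\<^sup>+z. ?f (snd z) \<partial>(\<nu> \<Otimes>\<^sub>M PN)) = (\<integral>\<^sup>+n. ?f n \<partial>PN)"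
      using PN.nn_integral_fst[OF measurable_compose[OF measurable_snd f], of \<nu>] by (simp add: nu.emeasure_space_1)
    ultimately show "emeasure PN ?N = (\<integral>\<^sup>+n. ?f n \<partial>PN)" by simp
  qed
qed

end


section \<open>The three rules\<close>

text \<open>Equal integrals over all events of \<open>f\<close> mean equal densities of its law, and
  densities are unique up to null sets. Versions of conditional probabilities are identified in this
  way.\<close>

lemma (in finite_measure) AE_eq_of_integrals:
  assumes f: "f \<in> M \<rightarrow>\<^sub>M N" and h: "h \<in> borel_measurable N" "h' \<in> borel_measurable N"
    and eq: "\<And>G. G \<in> sets N \<Longrightarrow> (\<integral>\<^sup>+\<omega>. h (f \<omega>) * indicator G (f \<omega>) \<partial>M) = (\<integral>\<^sup>+\<omega>. h' (f \<omega>) * indicator G (f \<omega>) \<partial>M)"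
  shows "AE z in distr M N f. h z = h' z"
proof -
  interpret d: finite_measure "distr M N f" by (rule finite_measure_distr[OF f])
  have h': "h \<in> borel_measurable (distr M N f)" "h' \<in> borel_measurable (distr M N f)" using h by auto
  have "density (distr M N f) h = density (distr M N f) h'"
  proof (rule measure_eqI)
    fix G assume "G \<in> sets (density (distr M N f) h)"
    then have G: "G \<in> sets N" by simp
    have m: "(\<lambda>z. h z * indicator G z) \<in> borel_measurable N" "(\<lambda>z. h' z * indicator G z) \<in> borel_measurable N"
      using h G by measurable
    show "emeasure (density (distr M N f) h) G = emeasure (density (distr M N f) h') G"
      using eq[OF G] G h' m f by (simp add: emeasure_density nn_integral_distr)
  qed simp
  with d.density_unique_iff[OF h'] show ?thesis by simp
qed

text \<open>Conditional distributions are defined under a law of paths; this moves their defining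
  identity to the noise space, where it can be compared with the common weight
  \<open>r\<close>.\<close>

lemma cond_dist_distr:
  assumes f: "f \<in> P \<rightarrow>\<^sub>M S" and Y: "Y \<in> S \<rightarrow>\<^sub>M NY" and Z: "Z \<in> S \<rightarrow>\<^sub>M NZ"
    and cd: "cond_dist (distr P S f) NY Y NZ Z \<kappa>" and E: "E \<in> sets NY"
  shows "(\<lambda>z. emeasure (\<kappa> z) E) \<in> borel_measurable NZ"
    "\<And>G. G \<in> sets NZ \<Longrightarrow> emeasure P {n \<in> space P. Y (f n) \<in> E \<and> Z (f n) \<in> G} =
      (\<integral>\<^sup>+n. emeasure (\<kappa> (Z (f n))) E * indicator G (Z (f n)) \<partial>P)"
proof -
  have "\<kappa> \<in> NZ \<rightarrow>\<^sub>M prob_algebra NY" using cd by (simp add: cond_dist_def)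
  then have k: "\<kappa> \<in> NZ \<rightarrow>\<^sub>M subprob_algebra NY" by (rule measurable_prob_algebraD)
  show m: "(\<lambda>z. emeasure (\<kappa> z) E) \<in> borel_measurable NZ" by (rule measurable_emeasure_kernel[OF k E])
  fix G assume G: "G \<in> sets NZ"
  have Zf: "(\<lambda>n. Z (f n)) \<in> P \<rightarrow>\<^sub>M NZ" by (rule measurable_compose[OF f Z])
  have s: "{x \<in> space S. Y x \<in> E \<and> Z x \<in> G} \<in> sets S"
    using sets.Int[OF measurable_sets[OF Y E] measurable_sets[OF Z G]]
    by (simp add: vimage_def Int_def conj_ac cong: conj_cong)
  have "f -` {x \<in> space S. Y x \<in> E \<and> Z x \<in> G} \<inter> space P = {n \<in> space P. Y (f n) \<in> E \<and> Z (f n) \<in> G}"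
    using measurable_space[OF f] by auto
  then have "emeasure P {n \<in> space P. Y (f n) \<in> E \<and> Z (f n) \<in> G} = emeasure (distr P S f) {x \<in> space S. Y x \<in> E \<and> Z x \<in> G}"
    by (simp add: emeasure_distr[OF f s])
  also have "\<dots> = (\<integral>\<^sup>+z\<in>G. emeasure (\<kappa> z) E \<partial>(distr (distr P S f) NZ Z))"
    using cd E G by (simp add: cond_dist_def)
  also have "\<dots> = (\<integral>\<^sup>+z. emeasure (\<kappa> z) E * indicator G z \<partial>(distr P NZ (\<lambda>n. Z (f n))))"
    by (simp add: distr_distr[OF Z f] comp_def)
  also have "\<dots> = (\<integral>\<^sup>+n. emeasure (\<kappa> (Z (f n))) E * indicator G (Z (f n)) \<partial>P)"
    by (rule nn_integral_distr[OF Zf]) (use m G in measurable)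
  finally show "emeasure P {n \<in> space P. Y (f n) \<in> E \<and> Z (f n) \<in> G} =
      (\<integral>\<^sup>+n. emeasure (\<kappa> (Z (f n))) E * indicator G (Z (f n)) \<partial>P)" .
qed

text \<open>The joint law of \<open>Z\<close> and \<open>Y\<close> is the law of \<open>Z\<close>
  followed by \<open>\<rho>\<close>, since both agree on rectangles. The measure of the exceptional
  set is then the integral of its null sections.\<close>

lemma AE_disintegration:
  assumes \<mu>: "prob_space \<mu>" and Y: "Y \<in> \<mu> \<rightarrow>\<^sub>M NY" and Z: "Z \<in> \<mu> \<rightarrow>\<^sub>M NZ" and cd: "cond_dist \<mu> NY Y NZ Z \<rho>"
    and P: "{p \<in> space (NZ \<Otimes>\<^sub>M NY). P (fst p) (snd p)} \<in> sets (NZ \<Otimes>\<^sub>M NY)"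
    and AE: "AE z in distr \<mu> NZ Z. AE y in \<rho> z. P z y"
  shows "AE p in distr \<mu> (NZ \<Otimes>\<^sub>M NY) (\<lambda>x. (Z x, Y x)). P (fst p) (snd p)"
proof -
  interpret prob_space \<mu> by (rule \<mu>)
  let ?\<nu> = "distr \<mu> NZ Z" and ?S = "NZ \<Otimes>\<^sub>M NY"
  interpret n: prob_space ?\<nu> by (rule prob_space_distr[OF Z])
  have rp: "\<rho> \<in> NZ \<rightarrow>\<^sub>M prob_algebra NY" using cd by (simp add: cond_dist_def)
  then have r: "\<rho> \<in> NZ \<rightarrow>\<^sub>M subprob_algebra NY" by (rule measurable_prob_algebraD)
  have rs: "sets (\<rho> z) = sets NY" if "z \<in> space NZ" for z using sets_kernel[OF r that] .
  define g where "g z = distr (\<rho> z) ?S (Pair z)" for z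
  have "(\<lambda>z. distr (\<rho> z) ?S (\<lambda>y. (z, y))) \<in> NZ \<rightarrow>\<^sub>M subprob_algebra ?S"
    by (rule measurable_distr2[OF _ r]) (simp add: case_prod_beta)
  then have g: "g \<in> NZ \<rightarrow>\<^sub>M subprob_algebra ?S" by (simp add: g_def[abs_def])
  then have g': "g \<in> ?\<nu> \<rightarrow>\<^sub>M subprob_algebra ?S" by simp
  have mp: "Pair z \<in> \<rho> z \<rightarrow>\<^sub>M ?S" if z: "z \<in> space NZ" for z
    using measurable_Pair1'[OF z, of NY] measurable_cong_sets[OF rs[OF z] refl, of ?S] by simp
  have eg: "emeasure (g z) N = emeasure (\<rho> z) (Pair z -` N)" if z: "z \<in> space NZ" and N: "N \<in> sets ?S" for z N
  proof -
    have "Pair z -` N \<inter> space (\<rho> z) = Pair z -` N"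
      using sets.sets_into_space[OF N] sets_eq_imp_space_eq[OF rs[OF z]] by (auto simp: space_pair_measure)
    then show ?thesis by (simp add: g_def emeasure_distr[OF mp[OF z] N])
  qed
  define L where "L = ?\<nu> \<bind> g"
  have eL: "emeasure L N = (\<integral>\<^sup>+z. emeasure (\<rho> z) (Pair z -` N) \<partial>?\<nu>)" if N: "N \<in> sets ?S" for N
  proof -
    have "emeasure L N = (\<integral>\<^sup>+z. emeasure (g z) N \<partial>?\<nu>)"
      unfolding L_def by (rule emeasure_bind[OF n.not_empty g' N])
    also have "\<dots> = (\<integral>\<^sup>+z. emeasure (\<rho> z) (Pair z -` N) \<partial>?\<nu>)"
      by (rule nn_integral_cong) (simp add: eg N)
    finally show ?thesis .
  qed
  have sL: "sets L = sets ?S" unfolding L_def by (rule sets_bind[OF sets_kernel[OF g'] n.not_empty])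
  have m: "(\<lambda>x. (Z x, Y x)) \<in> \<mu> \<rightarrow>\<^sub>M ?S" by (rule measurable_Pair[OF Z Y])
  let ?R = "distr \<mu> ?S (\<lambda>x. (Z x, Y x))"
  have "?R = L"
  proof (rule measure_eqI_generator_eq[OF Int_stable_pair_measure_generator[of NZ NY], where \<Omega>="space NZ \<times> space NY" 
        and A="\<lambda>_. space NZ \<times> space NY"])
    show "{a \<times> b |a b. a \<in> sets NZ \<and> b \<in> sets NY} \<subseteq> Pow (space NZ \<times> space NY)" by (rule pair_measure_closed)
    show "sets ?R = sigma_sets (space NZ \<times> space NY) {a \<times> b |a b. a \<in> sets NZ \<and> b \<in> sets NY}"
      "sets L = sigma_sets (space NZ \<times> space NY) {a \<times> b |a b. a \<in> sets NZ \<and> b \<in> sets NY}"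
      by (simp_all add: sets_pair_measure sL)
    fix R assume "R \<in> {a \<times> b |a b. a \<in> sets NZ \<and> b \<in> sets NY}"
    then obtain G E where R: "R = G \<times> E" and GE: "G \<in> sets NZ" "E \<in> sets NY" by auto
    have Rs: "R \<in> sets ?S" using GE R by auto
    have "emeasure ?R R = emeasure \<mu> ((\<lambda>x. (Z x, Y x)) -` R \<inter> space \<mu>)" by (rule emeasure_distr[OF m Rs])
    also have "\<dots> = emeasure \<mu> {x\<in>space \<mu>. Y x \<in> E \<and> Z x \<in> G}"
      by (rule arg_cong[where f="emeasure \<mu>"]) (auto simp: R)
    also have "\<dots> = (\<integral>\<^sup>+z\<in>G. emeasure (\<rho> z) E \<partial>?\<nu>)" using cd GE by (simp add: cond_dist_def)
    also have "\<dots> = (\<integral>\<^sup>+z. emeasure (\<rho> z) (Pair z -` R) \<partial>?\<nu>)"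
      by (rule nn_integral_cong) (auto simp: R split: split_indicator)
    finally show "emeasure ?R R = emeasure L R" by (simp add: eL[OF Rs])
  next
    show "range (\<lambda>_. space NZ \<times> space NY) \<subseteq> {a \<times> b |a b. a \<in> sets NZ \<and> b \<in> sets NY}" by blast
    show "emeasure ?R (space NZ \<times> space NY) \<noteq> \<infinity>" for i :: nat
      using emeasure_distr[OF m, of "space NZ \<times> space NY"] by (simp add: emeasure_eq_measure)
  qed auto
  define N where "N = space ?S - {p \<in> space ?S. P (fst p) (snd p)}"
  have N: "N \<in> sets ?S" using P by (simp add: N_def)
  have "emeasure ?R N = (\<integral>\<^sup>+z. emeasure (\<rho> z) (Pair z -` N) \<partial>?\<nu>)" unfolding \<open>?R = L\<close> by (rule eL[OF N])
  also have "\<dots> = (\<integral>\<^sup>+z. 0 \<partial>?\<nu>)"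
  proof (rule nn_integral_cong_AE)
    show "AE z in ?\<nu>. emeasure (\<rho> z) (Pair z -` N) = 0"
      using AE AE_space
    proof eventually_elim
      fix z assume z: "z \<in> space ?\<nu>" and a: "AE y in \<rho> z. P z y"
      then have z': "z \<in> space NZ" by simp
      show "emeasure (\<rho> z) (Pair z -` N) = 0"
      proof (subst AE_iff_measurable[OF _ _, symmetric, where P="P z"])
        show "Pair z -` N \<in> sets (\<rho> z)" using sets_Pair1[OF N] rs[OF z'] by simp
        show "{y \<in> space (\<rho> z). \<not> P z y} = Pair z -` N"
          using z' sets_eq_imp_space_eq[OF rs[OF z']] by (auto simp: N_def space_pair_measure)
      qed (rule a)
    qed
  qed
  finally have "emeasure ?R N = 0" by simp
  show ?thesis
  proof (subst AE_iff_measurable[where N = N])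
    show "N \<in> sets ?R" using N by simp
    show "{x \<in> space ?R. \<not> P (fst x) (snd x)} = N" by (auto simp: N_def)
    show "emeasure ?R N = 0" by fact
  qed
qed

context sde_context
begin

lemma CG_ancestral:
  assumes "C \<subseteq> V"
  shows "anc CG C \<subseteq> V" "\<And>u v. (u, v) \<in> dir_edges CG \<Longrightarrow> v \<in> anc CG C \<Longrightarrow> u \<in> anc CG C"
  using anc_verts[of CG C] CG_props assms by (auto intro: anc_ancestral)

end

lemma (in regime_mixture) common_conditional_ex:
  assumes Z: "Z \<subseteq> V" and C: "C \<subseteq> anc CG Z"
    and sp: "separating_split CG (anc CG Z) A B1 C U" and BU: "B \<inter> U = {}" and B2: "B2 \<subseteq> anc CG Z - U"
    and E: "E \<in> sets (PS A)"
  shows "\<exists>r. r \<in> borel_measurable (PS C) \<and>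
    (\<forall>e\<in>sets (PS B2 \<Otimes>\<^sub>M PS C).
       emeasure PN {n \<in> space PN. restrict (sol0 n) A \<in> E \<and> (restrict (sol0 n) B2, restrict (sol0 n) C) \<in> e} =
       (\<integral>\<^sup>+n. r (restrict (sol0 n) C) * indicator e (restrict (sol0 n) B2, restrict (sol0 n) C) \<partial>PN)) \<and>
    (\<forall>e\<in>sets (PS B \<Otimes>\<^sub>M PS C).
       emeasure (\<nu> \<Otimes>\<^sub>M PN) {z \<in> space (\<nu> \<Otimes>\<^sub>M PN). restrict (xdo B (fst z) (snd z)) A \<in> E \<and> (fst z, restrict (xdo B (fst z) (snd z)) C) \<in> e} =
       (\<integral>\<^sup>+z. r (restrict (xdo B (fst z) (snd z)) C) * indicator e (fst z, restrict (xdo B (fst z) (snd z)) C) \<partial>(\<nu> \<Otimes>\<^sub>M PN)))"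
proof (rule common_conditional[OF CG_ancestral(1)[OF Z] _ C sp BU B2 E])
  show "u \<in> anc CG Z" if "(u, v) \<in> dir_edges CG" "v \<in> anc CG Z" for u v
    using that by (rule CG_ancestral(2)[OF Z])
qed (rule exI, intro conjI ballI, assumption+)

context sde_context
begin

section \<open>Marginals and conditional laws expressed on the noise space\<close>

lemma measurable_sol0_restrict: "C \<subseteq> V \<Longrightarrow> (\<lambda>n. restrict (sol0 n) C) \<in> PN \<rightarrow>\<^sub>M PS C"
  by (rule measurable_restrict_path) (simp_all add: measurable_PN measurable_sol0)

lemma measurable_xdo_restrict: 
  assumes "B \<subseteq> V" "x \<in> cadlag_fam T B" "C \<subseteq> V" shows "(\<lambda>n. restrict (xdo B x n) C) \<in> PN \<rightarrow>\<^sub>M PS C"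
  using meas_adapted_mapD(1)[OF adapted_xdo[OF assms(1,2)]] assms(3)
  by (intro measurable_restrict_path) (simp_all add: measurable_PN)

lemma measurable_restrict_ident: "C \<subseteq> P \<Longrightarrow> (\<lambda>x. restrict x C) \<in> PS P \<rightarrow>\<^sub>M PS C"
  by (rule measurable_restrict_path[OF measurable_ident_sets[OF refl]])

lemma marginal_obs: "C \<subseteq> V \<Longrightarrow> marginal T (obs_dist M T \<Psi> D) C = distr PN (PS C) (\<lambda>n. restrict (sol0 n) C)"
  unfolding marginal_def obs_dist_eq
  by (subst distr_distr) (auto simp: measurable_PN measurable_sol0 comp_def intro!: measurable_restrict_ident)

lemma marginal2_obs: "B \<subseteq> V \<Longrightarrow> C \<subseteq> V \<Longrightarrow> marginal2 T (obs_dist M T \<Psi> D) B C = 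
   distr PN (PS B \<Otimes>\<^sub>M PS C) (\<lambda>n. (restrict (sol0 n) B, restrict (sol0 n) C))"
  unfolding marginal2_def obs_dist_eq
  by (subst distr_distr) (auto simp: measurable_PN measurable_sol0 comp_def intro!: measurable_Pair measurable_restrict_ident)

lemma marginal_do:
  assumes B: "B \<subseteq> V" and x: "x \<in> cadlag_fam T B" and C: "C \<subseteq> V - B"
  shows "marginal T (do_dist M T \<Psi> D B x) C = distr PN (PS C) (\<lambda>n. restrict (xdo B x n) C)"
  unfolding marginal_def do_dist_eq[OF B x]
  by (subst distr_distr[OF measurable_restrict_ident[OF C] measurable_xdo_restrict[OF B x]])
     (use C in \<open>auto simp: comp_def restrict_restrict Int_absorb1\<close>)

lemma path_cond_dist_obs:
  assumes cd: "path_cond_dist T (obs_dist M T \<Psi> D) A C \<kappa>" and A: "A \<subseteq> V" and C: "C \<subseteq> V" and E: "E \<in> sets (PS A)"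
  shows "(\<lambda>z. emeasure (\<kappa> z) E) \<in> borel_measurable (PS C)"
    "\<And>G. G \<in> sets (PS C) \<Longrightarrow> emeasure PN {n \<in> space PN. restrict (sol0 n) A \<in> E \<and> restrict (sol0 n) C \<in> G} =
      (\<integral>\<^sup>+n. emeasure (\<kappa> (restrict (sol0 n) C)) E * indicator G (restrict (sol0 n) C) \<partial>PN)"
  using cond_dist_distr[OF _ measurable_restrict_ident[OF A] measurable_restrict_ident[OF C] 
      cd[unfolded path_cond_dist_def obs_dist_eq] E]
  by (simp_all add: measurable_PN measurable_sol0)

lemma path_cond_dist2_obs:
  assumes cd: "path_cond_dist2 T (obs_dist M T \<Psi> D) A B C \<kappa>" and A: "A \<subseteq> V" and B: "B \<subseteq> V" and C: "C \<subseteq> V" and E: "E \<in> sets (PS A)"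
  shows "(\<lambda>z. emeasure (\<kappa> z) E) \<in> borel_measurable (PS B \<Otimes>\<^sub>M PS C)"
    "\<And>G. G \<in> sets (PS B \<Otimes>\<^sub>M PS C) \<Longrightarrow> emeasure PN {n \<in> space PN. restrict (sol0 n) A \<in> E \<and> (restrict (sol0 n) B, restrict (sol0 n) C) \<in> G} =
      (\<integral>\<^sup>+n. emeasure (\<kappa> (restrict (sol0 n) B, restrict (sol0 n) C)) E * indicator G (restrict (sol0 n) B, restrict (sol0 n) C) \<partial>PN)"
  using cond_dist_distr[OF _ measurable_restrict_ident[OF A] 
      measurable_Pair[OF measurable_restrict_ident[OF B] measurable_restrict_ident[OF C]] 
      cd[unfolded path_cond_dist2_def obs_dist_eq] E]
  by (simp_all add: measurable_PN measurable_sol0)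

lemma path_cond_dist_do:
  assumes cd: "path_cond_dist T (do_dist M T \<Psi> D B x) A C \<kappa>" and B: "B \<subseteq> V" and x: "x \<in> cadlag_fam T B" 
    and A: "A \<subseteq> V - B" and C: "C \<subseteq> V - B" and E: "E \<in> sets (PS A)" and G: "G \<in> sets (PS C)"
  shows "emeasure PN {n \<in> space PN. restrict (xdo B x n) A \<in> E \<and> restrict (xdo B x n) C \<in> G} =
      (\<integral>\<^sup>+n. emeasure (\<kappa> (restrict (xdo B x n) C)) E * indicator G (restrict (xdo B x n) C) \<partial>PN)"
proof -
  have r: "restrict (restrict y (V - B)) A = restrict y A" "restrict (restrict y (V - B)) C = restrict y C" for y :: "'n \<Rightarrow> path"
    using A C by (simp_all add: restrict_restrict Int_absorb1)
  show ?thesis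
    using cond_dist_distr(2)[OF measurable_xdo_restrict[OF B x Diff_subset] measurable_restrict_ident[OF A] measurable_restrict_ident[OF C] 
      cd[unfolded path_cond_dist_def do_dist_eq[OF B x]] E G]
    by (simp only: r)
qed

text \<open>The mixture is used with no intervened node, and \<open>B\<close> enters as the observed
  set on the far side of the split. One weight \<open>r\<close> is then a version of the conditional
  probability given \<open>(X_B, X_C)\<close> and given \<open>X_C\<close> alone.\<close>

theorem rule1:
  assumes ABC: "A \<subseteq> V" "B \<subseteq> V" "C \<subseteq> V" "A \<inter> C = {}" "B \<inter> C = {}"
    and sep: "sigma_separated CG A B C"
    and k: "path_cond_dist2 T (obs_dist M T \<Psi> D) A B C \<kappa>" and k': "path_cond_dist T (obs_dist M T \<Psi> D) A C \<kappa>'"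
  shows "AE z in marginal2 T (obs_dist M T \<Psi> D) B C. \<kappa> z = \<kappa>' (snd z)"
proof -
  let ?H = "anc CG (A \<union> B \<union> C)"
  have ABCV: "A \<union> B \<union> C \<subseteq> V" using ABC by auto
  obtain U where U: "separating_split CG ?H A B C U"
    using separating_split_obs[OF sep] CG_props ABC by auto
  \<comment> \<open>The only family indexed by the empty set; the law of the intervention is the
    point mass at it.\<close>
  define u :: "'n \<Rightarrow> path" where "u = (\<lambda>_. undefined)"
  have u: "u \<in> space (PS {})" by (simp add: u_def cadlag_fam_def space_path_space[OF T_pos])
  interpret mx: regime_mixture M F T \<Psi> D "{}" "return (PS {}) u"
    by (intro regime_mixture.intro sde_context_axioms regime_mixture_axioms.intro prob_space_return u) simp_all
  have mk: "\<kappa> \<in> PS B \<Otimes>\<^sub>M PS C \<rightarrow>\<^sub>M prob_algebra (PS A)" "\<kappa>' \<in> PS C \<rightarrow>\<^sub>M prob_algebra (PS A)"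
    using k k' by (simp_all add: path_cond_dist2_def path_cond_dist_def cond_dist_def)
  note kk = mk(1) measurable_compose[OF measurable_snd mk(2), of "PS B"]
  note mBC = measurable_Pair[OF measurable_sol0_restrict[OF ABC(2)] measurable_sol0_restrict[OF ABC(3)]]
  have AEE: "AE z in marginal2 T (obs_dist M T \<Psi> D) B C. emeasure (\<kappa> z) E = emeasure (\<kappa>' (snd z)) E"
    if E: "E \<in> sets (PS A)" for E
  proof -
    have "C \<subseteq> ?H" "B \<subseteq> ?H - U"
      using anc_subset[of "A \<union> B \<union> C" CG] U by (auto simp: separating_split_def)
    from mx.common_conditional_ex[OF ABCV this(1) U Int_empty_left this(2) E]
    obtain r where r: "r \<in> borel_measurable (PS C)" and re: "\<And>e. e \<in> sets (PS B \<Otimes>\<^sub>M PS C) \<Longrightarrow>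
       emeasure PN {n \<in> space PN. restrict (sol0 n) A \<in> E \<and> (restrict (sol0 n) B, restrict (sol0 n) C) \<in> e} =
       (\<integral>\<^sup>+n. r (restrict (sol0 n) C) * indicator e (restrict (sol0 n) B, restrict (sol0 n) C) \<partial>PN)"
      by blast
    note K = path_cond_dist2_obs[OF k ABC(1-3) E] and K' = path_cond_dist_obs[OF k' ABC(1,3) E]
    have r2: "(\<lambda>z. r (snd z)) \<in> borel_measurable (PS B \<Otimes>\<^sub>M PS C)" by (rule measurable_compose[OF measurable_snd r])
    have 1: "AE z in distr PN (PS B \<Otimes>\<^sub>M PS C) (\<lambda>n. (restrict (sol0 n) B, restrict (sol0 n) C)). emeasure (\<kappa> z) E = r (snd z)"
      by (rule PN.AE_eq_of_integrals[OF mBC K(1) r2]) (simp add: K(2)[symmetric] re)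
    have 2: "AE z in distr PN (PS C) (\<lambda>n. restrict (sol0 n) C). emeasure (\<kappa>' z) E = r z"
    proof (rule PN.AE_eq_of_integrals[OF measurable_sol0_restrict[OF ABC(3)] K'(1) r])
      fix G assume G: "G \<in> sets (PS C)"
      \<comment> \<open>Events that constrain \<open>X_C\<close> only; they show that
        \<open>r\<close> is also a weight given \<open>X_C\<close> alone.\<close>
      have sG: "space (PS B) \<times> G \<in> sets (PS B \<Otimes>\<^sub>M PS C)" using G by auto
      have "restrict (sol0 n) B \<in> space (PS B)" if "n \<in> space PN" for n
        using measurable_space[OF measurable_sol0_restrict[OF ABC(2)] that] .
      then have "emeasure PN {n \<in> space PN. restrict (sol0 n) A \<in> E \<and> restrict (sol0 n) C \<in> G} = 
        (\<integral>\<^sup>+n. r (restrict (sol0 n) C) * indicator G (restrict (sol0 n) C) \<partial>PN)"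
        using re[OF sG] by (simp add: indicator_times cong: conj_cong nn_integral_cong)
      then show "(\<integral>\<^sup>+n. emeasure (\<kappa>' (restrict (sol0 n) C)) E * indicator G (restrict (sol0 n) C) \<partial>PN) =
         (\<integral>\<^sup>+n. r (restrict (sol0 n) C) * indicator G (restrict (sol0 n) C) \<partial>PN)" by (simp add: K'(2)[OF G])
    qed
    have "AE z in distr PN (PS B \<Otimes>\<^sub>M PS C) (\<lambda>n. (restrict (sol0 n) B, restrict (sol0 n) C)). emeasure (\<kappa>' (snd z)) E = r (snd z)"
    proof (subst AE_distr_iff[OF mBC])
      show "{z \<in> space (PS B \<Otimes>\<^sub>M PS C). emeasure (\<kappa>' (snd z)) E = r (snd z)} \<in> sets (PS B \<Otimes>\<^sub>M PS C)"
        using measurable_compose[OF measurable_snd K'(1)] r2 by measurable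
      show "AE n in PN. emeasure (\<kappa>' (snd (restrict (sol0 n) B, restrict (sol0 n) C))) E = r (snd (restrict (sol0 n) B, restrict (sol0 n) C))"
        using AE_distrD[OF measurable_sol0_restrict[OF ABC(3)] 2] by simp
    qed
    with 1 have "AE z in distr PN (PS B \<Otimes>\<^sub>M PS C) (\<lambda>n. (restrict (sol0 n) B, restrict (sol0 n) C)). emeasure (\<kappa> z) E = emeasure (\<kappa>' (snd z)) E"
      by eventually_elim simp
    then show ?thesis unfolding marginal2_obs[OF ABC(2,3)] .
  qed
  show ?thesis
    by (rule AE_kernel_eqI[OF T_pos fin_sub(1)[OF ABC(1)] kk _ AEE]) (simp_all add: marginal2_def)
qed

end


text \<open>For almost every \<open>x\<close> the kernel \<open>\<kappa> (x, _)\<close> satisfies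
  the defining identity of the conditional law, and integrating over \<open>\<nu>\<close> turns
  these into one identity for the mixture. Uniqueness of densities then identifies
  \<open>\<kappa>\<close> with the common weight, and passing to sections returns to single
  \<open>x\<close>.\<close>

lemma (in regime_mixture) AE_do_conditional:
  assumes A: "A \<subseteq> V - B" and C: "C \<subseteq> V - B" and E: "E \<in> sets (PS A)"
    and k: "\<kappa> \<in> PS B \<Otimes>\<^sub>M PS C \<rightarrow>\<^sub>M prob_algebra (PS A)"
    and cd: "AE x in \<nu>. path_cond_dist T (do_dist M T \<Psi> D B x) A C (\<lambda>c. \<kappa> (x, c))"
    and r: "r \<in> borel_measurable (PS B \<Otimes>\<^sub>M PS C)"
    and re: "\<And>e. e \<in> sets (PS B \<Otimes>\<^sub>M PS C) \<Longrightarrow>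
       emeasure (\<nu> \<Otimes>\<^sub>M PN) {z \<in> space (\<nu> \<Otimes>\<^sub>M PN). restrict (xdo B (fst z) (snd z)) A \<in> E \<and> (fst z, restrict (xdo B (fst z) (snd z)) C) \<in> e} =
       (\<integral>\<^sup>+z. r (fst z, restrict (xdo B (fst z) (snd z)) C) * indicator e (fst z, restrict (xdo B (fst z) (snd z)) C) \<partial>(\<nu> \<Otimes>\<^sub>M PN))"
  shows "AE x in \<nu>. AE c in marginal T (do_dist M T \<Psi> D B x) C. emeasure (\<kappa> (x, c)) E = r (x, c)"
proof -
  have AV: "A \<subseteq> V" and CV: "C \<subseteq> V" using A C by auto
  let ?f = "\<lambda>z. (fst z, restrict (xdo B (fst z) (snd z)) C)"
  have mfst: "fst \<in> \<nu> \<Otimes>\<^sub>M PN \<rightarrow>\<^sub>M PS B" unfolding measurable_nP by (rule measurable_fst)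
  have mx: "(\<lambda>z. xdo B (fst z) (snd z)) \<in> \<nu> \<Otimes>\<^sub>M PN \<rightarrow>\<^sub>M PS V"
    unfolding measurable_nP by (intro measurable_xdo[OF B] measurable_fst measurable_snd)
  note mA = measurable_restrict_path[OF mx AV] and mC = measurable_restrict_path[OF mx CV]
  have mf: "?f \<in> \<nu> \<Otimes>\<^sub>M PN \<rightarrow>\<^sub>M PS B \<Otimes>\<^sub>M PS C" by (rule measurable_Pair[OF mfst mC])
  have kE: "(\<lambda>z. emeasure (\<kappa> z) E) \<in> borel_measurable (PS B \<Otimes>\<^sub>M PS C)"
    by (rule measurable_emeasure_kernel[OF measurable_prob_algebraD[OF k] E])
  have "AE z in distr (\<nu> \<Otimes>\<^sub>M PN) (PS B \<Otimes>\<^sub>M PS C) ?f. emeasure (\<kappa> z) E = r z"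
  proof (rule nP.AE_eq_of_integrals[OF mf kE r])
    fix e assume e: "e \<in> sets (PS B \<Otimes>\<^sub>M PS C)"
    let ?N = "{z \<in> space (\<nu> \<Otimes>\<^sub>M PN). restrict (xdo B (fst z) (snd z)) A \<in> E \<and> ?f z \<in> e}"
    have N: "?N \<in> sets (\<nu> \<Otimes>\<^sub>M PN)"
      using sets.Int[OF measurable_sets[OF mA E] measurable_sets[OF mf e]]
      by (simp add: vimage_def Int_def conj_ac cong: conj_cong)
    have "(\<lambda>z. emeasure (\<kappa> z) E * indicator e z) \<in> borel_measurable (PS B \<Otimes>\<^sub>M PS C)"
      using kE e by measurable
    from measurable_compose[OF mf this]
    have h: "(\<lambda>z. emeasure (\<kappa> (?f z)) E * indicator e (?f z)) \<in> borel_measurable (\<nu> \<Otimes>\<^sub>M PN)" .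
    have "(\<integral>\<^sup>+z. emeasure (\<kappa> (?f z)) E * indicator e (?f z) \<partial>(\<nu> \<Otimes>\<^sub>M PN)) =
        (\<integral>\<^sup>+x. \<integral>\<^sup>+n. emeasure (\<kappa> (x, restrict (xdo B x n) C)) E * indicator e (x, restrict (xdo B x n) C) \<partial>PN \<partial>\<nu>)"
      using PN.nn_integral_fst[OF h] by simp
    also have "\<dots> = (\<integral>\<^sup>+x. emeasure PN (Pair x -` ?N) \<partial>\<nu>)"
    proof (rule nn_integral_cong_AE)
      show "AE x in \<nu>. (\<integral>\<^sup>+n. emeasure (\<kappa> (x, restrict (xdo B x n) C)) E * indicator e (x, restrict (xdo B x n) C) \<partial>PN) = emeasure PN (Pair x -` ?N)"
        using cd AE_space
      proof eventually_elim
        fix x assume c: "path_cond_dist T (do_dist M T \<Psi> D B x) A C (\<lambda>c. \<kappa> (x, c))" and x: "x \<in> space \<nu>"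
        have x': "x \<in> cadlag_fam T B" using x by (simp add: space_nu)
        have ind: "indicator e (x, y) = (indicator (Pair x -` e) y :: ennreal)" for y by (simp add: indicator_def)
        have "Pair x -` ?N = {n \<in> space PN. restrict (xdo B x n) A \<in> E \<and> restrict (xdo B x n) C \<in> Pair x -` e}"
          using x by (auto simp: space_pair_measure)
        then show "(\<integral>\<^sup>+n. emeasure (\<kappa> (x, restrict (xdo B x n) C)) E * indicator e (x, restrict (xdo B x n) C) \<partial>PN) = emeasure PN (Pair x -` ?N)"
          using path_cond_dist_do[OF c B x' A C E sets_Pair1[OF e]] by (simp add: ind)
      qed
    qed
    also have "\<dots> = emeasure (\<nu> \<Otimes>\<^sub>M PN) ?N" by (rule PN.emeasure_pair_measure_alt[OF N, symmetric])
    also have "\<dots> = (\<integral>\<^sup>+z. r (?f z) * indicator e (?f z) \<partial>(\<nu> \<Otimes>\<^sub>M PN))" by (rule re[OF e])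
    finally show "(\<integral>\<^sup>+z. emeasure (\<kappa> (?f z)) E * indicator e (?f z) \<partial>(\<nu> \<Otimes>\<^sub>M PN)) = (\<integral>\<^sup>+z. r (?f z) * indicator e (?f z) \<partial>(\<nu> \<Otimes>\<^sub>M PN))" .
  qed
  from nP.AE_pair[OF AE_distrD[OF mf this]] AE_space show ?thesis
  proof eventually_elim
    fix x assume a: "AE n in PN. emeasure (\<kappa> (?f (x, n))) E = r (?f (x, n))" and x: "x \<in> space \<nu>"
    have x': "x \<in> cadlag_fam T B" using x by (simp add: space_nu)
    have P: "Pair x \<in> PS C \<rightarrow>\<^sub>M PS B \<Otimes>\<^sub>M PS C"
      by (rule measurable_Pair1') (use x' in \<open>simp add: space_path_space[OF T_pos]\<close>)
    have "{c \<in> space (PS C). emeasure (\<kappa> (x, c)) E = r (x, c)} \<in> sets (PS C)"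
      using measurable_compose[OF P kE] measurable_compose[OF P r] by measurable
    from AE_distr_iff[OF measurable_xdo_restrict[OF B x' CV] this] a
    show "AE c in marginal T (do_dist M T \<Psi> D B x) C. emeasure (\<kappa> (x, c)) E = r (x, c)"
      unfolding marginal_do[OF B x' C] by simp
  qed
qed

context sde_context
begin

text \<open>With a point mass as law of the intervention, a statement about almost every intervened
  path is a statement about the given \<open>x\<close>. The common weight is thereby identified with
  the conditional law in both regimes.\<close>

theorem rule3:
  assumes ABC: "A \<subseteq> V" "B \<subseteq> V" "C \<subseteq> V" "A \<inter> B = {}" "A \<inter> C = {}" "B \<inter> C = {}"
    and sep: "sigma_separated (do_graph CG B) (Inl ` A) (Inr ` B) (Inl ` C)"
    and x: "x \<in> cadlag_fam T B"
    and ac: "absolutely_continuous (marginal T (do_dist M T \<Psi> D B x) C) (marginal T (obs_dist M T \<Psi> D) C)"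
    and k: "path_cond_dist T (do_dist M T \<Psi> D B x) A C \<kappa>" and k': "path_cond_dist T (obs_dist M T \<Psi> D) A C \<kappa>'"
  shows "AE z in marginal T (obs_dist M T \<Psi> D) C. \<kappa> z = \<kappa>' z"
proof -
  let ?H = "anc CG (A \<union> C)"
  have ACV: "A \<union> C \<subseteq> V" using ABC by auto
  have AB: "A \<subseteq> V - B" "C \<subseteq> V - B" using ABC by auto
  obtain U where U: "separating_split CG ?H A B C U"
    using separating_split_do[OF sep] CG_props ABC by auto
  have xS: "x \<in> space (PS B)" using x by (simp add: space_path_space[OF T_pos])
  interpret mx: regime_mixture M F T \<Psi> D B "return (PS B) x"
    by (intro regime_mixture.intro sde_context_axioms regime_mixture_axioms.intro prob_space_return xS ABC(2)) simp
  have kk: "\<kappa> \<in> PS C \<rightarrow>\<^sub>M prob_algebra (PS A)" "\<kappa>' \<in> PS C \<rightarrow>\<^sub>M prob_algebra (PS A)"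
    using k k' by (simp_all add: path_cond_dist_def cond_dist_def)
  have AEE: "AE z in marginal T (obs_dist M T \<Psi> D) C. emeasure (\<kappa> z) E = emeasure (\<kappa>' z) E"
    if E: "E \<in> sets (PS A)" for E
  proof -
    have "C \<subseteq> ?H" "{} \<subseteq> ?H - U" "B \<inter> U = {}"
      using anc_subset[of "A \<union> C" CG] U by (auto simp: separating_split_def)
    from mx.common_conditional_ex[OF ACV this(1) U this(3,2) E]
    obtain r where r: "r \<in> borel_measurable (PS C)" and re: "\<And>e. e \<in> sets (PS {} \<Otimes>\<^sub>M PS C) \<Longrightarrow>
       emeasure PN {n \<in> space PN. restrict (sol0 n) A \<in> E \<and> (restrict (sol0 n) {}, restrict (sol0 n) C) \<in> e} =
       (\<integral>\<^sup>+n. r (restrict (sol0 n) C) * indicator e (restrict (sol0 n) {}, restrict (sol0 n) C) \<partial>PN)"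
     and rd: "\<And>e. e \<in> sets (PS B \<Otimes>\<^sub>M PS C) \<Longrightarrow>
       emeasure (return (PS B) x \<Otimes>\<^sub>M PN) {z \<in> space (return (PS B) x \<Otimes>\<^sub>M PN). restrict (xdo B (fst z) (snd z)) A \<in> E \<and> (fst z, restrict (xdo B (fst z) (snd z)) C) \<in> e} =
       (\<integral>\<^sup>+z. r (restrict (xdo B (fst z) (snd z)) C) * indicator e (fst z, restrict (xdo B (fst z) (snd z)) C) \<partial>(return (PS B) x \<Otimes>\<^sub>M PN))"
      by blast
    note K' = path_cond_dist_obs[OF k' ABC(1,3) E]
    have 2: "AE z in marginal T (obs_dist M T \<Psi> D) C. emeasure (\<kappa>' z) E = r z"
      unfolding marginal_obs[OF ABC(3)]
    proof (rule PN.AE_eq_of_integrals[OF measurable_sol0_restrict[OF ABC(3)] K'(1) r])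
      fix G assume G: "G \<in> sets (PS C)"
      have sG: "space (PS {}) \<times> G \<in> sets (PS {} \<Otimes>\<^sub>M PS C)" using G by auto
      have "restrict (sol0 n) {} \<in> space (PS {})" for n
        unfolding space_path_space[OF T_pos] cadlag_fam_def restrict_PiE_iff by simp
      then have "emeasure PN {n \<in> space PN. restrict (sol0 n) A \<in> E \<and> restrict (sol0 n) C \<in> G} = 
        (\<integral>\<^sup>+n. r (restrict (sol0 n) C) * indicator G (restrict (sol0 n) C) \<partial>PN)"
        using re[OF sG] by (simp add: indicator_times)
      then show "(\<integral>\<^sup>+n. emeasure (\<kappa>' (restrict (sol0 n) C)) E * indicator G (restrict (sol0 n) C) \<partial>PN) =
         (\<integral>\<^sup>+n. r (restrict (sol0 n) C) * indicator G (restrict (sol0 n) C) \<partial>PN)" by (simp add: K'(2)[OF G])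
    qed
    have km: "(\<lambda>z. \<kappa> (snd z)) \<in> PS B \<Otimes>\<^sub>M PS C \<rightarrow>\<^sub>M prob_algebra (PS A)"
      by (rule measurable_compose[OF measurable_snd kk(1)])
    have rm: "(\<lambda>z. r (snd z)) \<in> borel_measurable (PS B \<Otimes>\<^sub>M PS C)" by (rule measurable_compose[OF measurable_snd r])
    have kE: "(\<lambda>c. emeasure (\<kappa> c) E) \<in> borel_measurable (PS C)"
      by (rule measurable_emeasure_kernel[OF measurable_prob_algebraD[OF kk(1)] E])
    have eqx: "{y \<in> space (PS B). y = x} \<in> sets (PS B)"
      by (rule pred_eq_path_space[OF T_pos fin_sub(1)[OF ABC(2)] measurable_ident_sets[OF refl] measurable_const[OF xS]])
    \<comment> \<open>The singleton of \<open>x\<close> is measurable because coincidence of paths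
      is an event; the point mass therefore charges \<open>x\<close> only.\<close>
    have AEx: "AE y in return (PS B) x. y = x" by (subst AE_return[OF xS]) (use eqx in \<open>auto simp: pred_def\<close>)
    have "AE y in return (PS B) x. path_cond_dist T (do_dist M T \<Psi> D B y) A C (\<lambda>c. \<kappa> (snd (y, c)))"
      using AEx by eventually_elim (simp add: k)
    from mx.AE_do_conditional[OF AB E km this rm] rd
    have "AE y in return (PS B) x. AE c in marginal T (do_dist M T \<Psi> D B y) C. emeasure (\<kappa> c) E = r c" by simp
    with AEx have "AE y in return (PS B) x. AE c in marginal T (do_dist M T \<Psi> D B x) C. emeasure (\<kappa> c) E = r c"
      by eventually_elim simp
    then have "AE c in marginal T (do_dist M T \<Psi> D B x) C. emeasure (\<kappa> c) E = r c"
      by simp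
    \<comment> \<open>Absolute continuity carries the null set of the interventional law of
      \<open>X_C\<close> over to the observational one.\<close>
    then have "AE c in marginal T (obs_dist M T \<Psi> D) C. emeasure (\<kappa> c) E = r c"
      by (rule absolutely_continuous_AE[OF _ ac, rotated]) (simp add: marginal_def)
    with 2 show ?thesis by eventually_elim simp
  qed
  show ?thesis
    by (rule AE_kernel_eqI[OF T_pos fin_sub(1)[OF ABC(1)] kk _ AEE]) (simp_all add: marginal_def)
qed

text \<open>The split is taken relative to \<open>B \<union> C\<close>, and the intervened paths are
  drawn from the law of \<open>X_B\<close>. Then \<open>r\<close> is a weight given
  \<open>(X_B, X_C)\<close> in the observational regime, while under the intervention
  \<open>X_B\<close> is the drawn path, so \<open>r\<close> also weights the conditional law given
  \<open>X_C\<close>.\<close>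

theorem rule2:
  assumes ABC: "A \<subseteq> V" "B \<subseteq> V" "C \<subseteq> V" "A \<inter> B = {}" "A \<inter> C = {}" "B \<inter> C = {}"
    and sep: "sigma_separated (do_graph CG B) (Inl ` A) (Inr ` B) (Inl ` (B \<union> C))"
    and rho: "path_cond_dist T (obs_dist M T \<Psi> D) C B \<rho>"
    and ac: "AE x in marginal T (obs_dist M T \<Psi> D) B. absolutely_continuous (marginal T (do_dist M T \<Psi> D B x) C) (\<rho> x)"
    and k: "do_cond_kernel M T \<Psi> D A B C \<kappa>" and k': "path_cond_dist2 T (obs_dist M T \<Psi> D) A B C \<kappa>'"
  shows "AE z in marginal2 T (obs_dist M T \<Psi> D) B C. \<kappa> z = \<kappa>' z"
proof -
  let ?C = "B \<union> C"
  let ?H = "anc CG (A \<union> ?C)"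
  have ACV: "A \<union> ?C \<subseteq> V" using ABC by auto
  have AB: "A \<subseteq> V - B" "C \<subseteq> V - B" using ABC by auto
  have AC': "A \<inter> ?C = {}" and CV: "?C \<subseteq> V" using ABC by auto
  obtain U where U: "separating_split CG ?H A B ?C U"
    using separating_split_do[OF sep] CG_props ABC AC' CV by auto
  define \<nu> where "\<nu> = marginal T (obs_dist M T \<Psi> D) B"
  have nu: "\<nu> = distr PN (PS B) (\<lambda>n. restrict (sol0 n) B)" unfolding \<nu>_def by (rule marginal_obs[OF ABC(2)])
  have pnu: "prob_space \<nu>" unfolding nu by (rule PN.prob_space_distr[OF measurable_sol0_restrict[OF ABC(2)]])
  interpret mx: regime_mixture M F T \<Psi> D B \<nu>
    by (intro regime_mixture.intro sde_context_axioms regime_mixture_axioms.intro pnu ABC(2)) (simp add: nu)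
  have kk: "\<kappa> \<in> PS B \<Otimes>\<^sub>M PS C \<rightarrow>\<^sub>M prob_algebra (PS A)" "\<kappa>' \<in> PS B \<Otimes>\<^sub>M PS C \<rightarrow>\<^sub>M prob_algebra (PS A)"
    using k k' by (simp_all add: path_cond_dist2_def do_cond_kernel_def cond_dist_def)
  note mBC = measurable_Pair[OF measurable_sol0_restrict[OF ABC(2)] measurable_sol0_restrict[OF ABC(3)]]
  have AEE: "AE z in marginal2 T (obs_dist M T \<Psi> D) B C. emeasure (\<kappa> z) E = emeasure (\<kappa>' z) E"
    if E: "E \<in> sets (PS A)" for E
  proof -
    have "?C \<subseteq> ?H" "{} \<subseteq> ?H - U" "B \<inter> U = {}"
      using anc_subset[of "A \<union> ?C" CG] U by (auto simp: separating_split_def)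
    from mx.common_conditional_ex[OF ACV this(1) U this(3,2) E]
    obtain r0 where r0: "r0 \<in> borel_measurable (PS ?C)" and re: "\<And>e. e \<in> sets (PS {} \<Otimes>\<^sub>M PS ?C) \<Longrightarrow>
       emeasure PN {n \<in> space PN. restrict (sol0 n) A \<in> E \<and> (restrict (sol0 n) {}, restrict (sol0 n) ?C) \<in> e} =
       (\<integral>\<^sup>+n. r0 (restrict (sol0 n) ?C) * indicator e (restrict (sol0 n) {}, restrict (sol0 n) ?C) \<partial>PN)"
     and rd: "\<And>e. e \<in> sets (PS B \<Otimes>\<^sub>M PS ?C) \<Longrightarrow>
       emeasure (\<nu> \<Otimes>\<^sub>M PN) {z \<in> space (\<nu> \<Otimes>\<^sub>M PN). restrict (xdo B (fst z) (snd z)) A \<in> E \<and> (fst z, restrict (xdo B (fst z) (snd z)) ?C) \<in> e} =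
       (\<integral>\<^sup>+z. r0 (restrict (xdo B (fst z) (snd z)) ?C) * indicator e (fst z, restrict (xdo B (fst z) (snd z)) ?C) \<partial>(\<nu> \<Otimes>\<^sub>M PN))"
      by blast
    \<comment> \<open>The common weight, a function of the joined family on
      \<open>B \<union> C\<close>, is rewritten as a function of the pair
      \<open>(x_B, x_C)\<close>.\<close>
    define r where "r z = r0 (gather B ?C (fst z) (snd z))" for z
    have r: "r \<in> borel_measurable (PS B \<Otimes>\<^sub>M PS C)"
      unfolding r_def by (rule measurable_compose[OF measurable_gather[OF T_pos measurable_fst measurable_snd subset_refl] r0])
    note K' = path_cond_dist2_obs[OF k' ABC(1-3) E]
    have rr: "restrict (restrict y ?C) B = restrict y B" "restrict (restrict y ?C) C = restrict y C" for y :: "'n \<Rightarrow> path"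
      by (simp_all add: restrict_restrict Int_absorb1)
    have 2: "AE z in marginal2 T (obs_dist M T \<Psi> D) B C. emeasure (\<kappa>' z) E = r z"
      unfolding marginal2_obs[OF ABC(2,3)]
    proof (rule PN.AE_eq_of_integrals[OF mBC K'(1) r])
      fix G assume G: "G \<in> sets (PS B \<Otimes>\<^sub>M PS C)"
      let ?g = "\<lambda>z. (restrict (snd z) B, restrict (snd z) C)"
      let ?S = "PS ({} :: 'n set) \<Otimes>\<^sub>M PS ?C"
      have mg: "?g \<in> ?S \<rightarrow>\<^sub>M PS B \<Otimes>\<^sub>M PS C"
        by (intro measurable_Pair measurable_restrict_path[OF measurable_snd]) auto
      define e where "e = ?g -` G \<inter> space ?S"
      have e: "e \<in> sets ?S" unfolding e_def by (rule measurable_sets[OF mg G])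
      have ie: "(restrict (sol0 n) {}, restrict (sol0 n) ?C) \<in> e \<longleftrightarrow> (restrict (sol0 n) B, restrict (sol0 n) C) \<in> G" if n: "n \<in> space PN" for n
      proof -
        have "restrict (sol0 n) {} \<in> space (PS {})"
          unfolding space_path_space[OF T_pos] cadlag_fam_def restrict_PiE_iff by simp
        then show ?thesis using measurable_space[OF measurable_sol0_restrict[OF CV] n]
          by (simp add: e_def rr space_pair_measure)
      qed
      have ge: "r (restrict (sol0 n) B, restrict (sol0 n) C) = r0 (restrict (sol0 n) ?C)" for n
        by (simp add: r_def gather_restrict)
      have "emeasure PN {n \<in> space PN. restrict (sol0 n) A \<in> E \<and> (restrict (sol0 n) B, restrict (sol0 n) C) \<in> G} =
         emeasure PN {n \<in> space PN. restrict (sol0 n) A \<in> E \<and> (restrict (sol0 n) {}, restrict (sol0 n) ?C) \<in> e}"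
        by (rule arg_cong[where f="emeasure PN"]) (use ie in blast)
      also have "\<dots> = (\<integral>\<^sup>+n. r0 (restrict (sol0 n) ?C) * indicator e (restrict (sol0 n) {}, restrict (sol0 n) ?C) \<partial>PN)"
        by (rule re[OF e])
      also have "\<dots> = (\<integral>\<^sup>+n. r (restrict (sol0 n) B, restrict (sol0 n) C) * indicator G (restrict (sol0 n) B, restrict (sol0 n) C) \<partial>PN)"
        by (rule nn_integral_cong) (simp add: ge indicator_def ie)
      finally show "(\<integral>\<^sup>+n. emeasure (\<kappa>' (restrict (sol0 n) B, restrict (sol0 n) C)) E * indicator G (restrict (sol0 n) B, restrict (sol0 n) C) \<partial>PN) =
         (\<integral>\<^sup>+n. r (restrict (sol0 n) B, restrict (sol0 n) C) * indicator G (restrict (sol0 n) B, restrict (sol0 n) C) \<partial>PN)" by (simp add: K'(2)[OF G])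
    qed
    have cd: "AE x in \<nu>. path_cond_dist T (do_dist M T \<Psi> D B x) A C (\<lambda>c. \<kappa> (x, c))"
      using k by (intro AE_I2) (auto simp: do_cond_kernel_def mx.space_nu)
    have do: "AE x in \<nu>. AE c in marginal T (do_dist M T \<Psi> D B x) C. emeasure (\<kappa> (x, c)) E = r (x, c)"
    proof (rule mx.AE_do_conditional[OF AB E kk(1) cd r])
      fix G assume G: "G \<in> sets (PS B \<Otimes>\<^sub>M PS C)"
      let ?g = "\<lambda>z. (fst z, restrict (snd z) C)"
      have mg: "?g \<in> PS B \<Otimes>\<^sub>M PS ?C \<rightarrow>\<^sub>M PS B \<Otimes>\<^sub>M PS C"
        by (intro measurable_Pair measurable_fst measurable_restrict_path[OF measurable_snd]) auto
      define e where "e = ?g -` G \<inter> space (PS B \<Otimes>\<^sub>M PS ?C)"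
      have e: "e \<in> sets (PS B \<Otimes>\<^sub>M PS ?C)" unfolding e_def by (rule measurable_sets[OF mg G])
      have zz: "fst z \<in> cadlag_fam T B" "snd z \<in> cadlag_fam T W" if "z \<in> space (\<nu> \<Otimes>\<^sub>M PN)" for z
        using that by (auto simp: space_pair_measure mx.space_nu space_PN)
      have ie: "(fst z, restrict (xdo B (fst z) (snd z)) ?C) \<in> e \<longleftrightarrow> (fst z, restrict (xdo B (fst z) (snd z)) C) \<in> G" if z: "z \<in> space (\<nu> \<Otimes>\<^sub>M PN)" for z
        using measurable_space[OF measurable_xdo_restrict[OF ABC(2) zz(1)[OF z] CV], of "snd z"] zz[OF z]
        by (simp add: e_def rr space_pair_measure space_path_space[OF T_pos] space_PN)
      have ge: "r (fst z, restrict (xdo B (fst z) (snd z)) C) = r0 (restrict (xdo B (fst z) (snd z)) ?C)" if z: "z \<in> space (\<nu> \<Otimes>\<^sub>M PN)" for z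
      proof -
        have "gather B ?C (restrict (xdo B (fst z) (snd z)) B) (restrict (xdo B (fst z) (snd z)) C) = restrict (xdo B (fst z) (snd z)) ?C"
          by (rule gather_restrict) simp
        then show ?thesis by (simp add: r_def xdo_restrict[OF ABC(2) zz(1)[OF z]])
      qed
      have "emeasure (\<nu> \<Otimes>\<^sub>M PN) {z \<in> space (\<nu> \<Otimes>\<^sub>M PN). restrict (xdo B (fst z) (snd z)) A \<in> E \<and> (fst z, restrict (xdo B (fst z) (snd z)) C) \<in> G} =
        emeasure (\<nu> \<Otimes>\<^sub>M PN) {z \<in> space (\<nu> \<Otimes>\<^sub>M PN). restrict (xdo B (fst z) (snd z)) A \<in> E \<and> (fst z, restrict (xdo B (fst z) (snd z)) ?C) \<in> e}"
        by (rule arg_cong[where f="emeasure (\<nu> \<Otimes>\<^sub>M PN)"]) (use ie in blast)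
      also have "\<dots> = (\<integral>\<^sup>+z. r0 (restrict (xdo B (fst z) (snd z)) ?C) * indicator e (fst z, restrict (xdo B (fst z) (snd z)) ?C) \<partial>(\<nu> \<Otimes>\<^sub>M PN))"
        by (rule rd[OF e])
      also have "\<dots> = (\<integral>\<^sup>+z. r (fst z, restrict (xdo B (fst z) (snd z)) C) * indicator G (fst z, restrict (xdo B (fst z) (snd z)) C) \<partial>(\<nu> \<Otimes>\<^sub>M PN))"
        by (rule nn_integral_cong) (simp add: ge indicator_def ie)
      finally show "emeasure (\<nu> \<Otimes>\<^sub>M PN) {z \<in> space (\<nu> \<Otimes>\<^sub>M PN). restrict (xdo B (fst z) (snd z)) A \<in> E \<and> (fst z, restrict (xdo B (fst z) (snd z)) C) \<in> G} =
         (\<integral>\<^sup>+z. r (fst z, restrict (xdo B (fst z) (snd z)) C) * indicator G (fst z, restrict (xdo B (fst z) (snd z)) C) \<partial>(\<nu> \<Otimes>\<^sub>M PN))" .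
    qed
    have rs: "sets (\<rho> x) = sets (PS C)" if "x \<in> space \<nu>" for x
    proof -
      have "\<rho> \<in> PS B \<rightarrow>\<^sub>M prob_algebra (PS C)" using rho by (simp add: path_cond_dist_def cond_dist_def)
      then show ?thesis using that by (intro sets_kernel[OF measurable_prob_algebraD]) (auto simp: nu)
    qed
    \<comment> \<open>For almost every \<open>x\<close>, absolute continuity moves the null set from
      the interventional law of \<open>X_C\<close> to the conditional law \<open>\<rho> x\<close>;
      disintegration then reaches the joint law of \<open>X_B\<close> and
      \<open>X_C\<close>.\<close>
    have "AE x in \<nu>. AE c in \<rho> x. emeasure (\<kappa> (x, c)) E = r (x, c)"
      using do ac[folded \<nu>_def] AE_space
    proof eventually_elim
      fix x assume a: "AE c in marginal T (do_dist M T \<Psi> D B x) C. emeasure (\<kappa> (x, c)) E = r (x, c)"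
        and ac: "absolutely_continuous (marginal T (do_dist M T \<Psi> D B x) C) (\<rho> x)" and x: "x \<in> space \<nu>"
      show "AE c in \<rho> x. emeasure (\<kappa> (x, c)) E = r (x, c)"
        by (rule absolutely_continuous_AE[OF _ ac a]) (simp add: marginal_def rs[OF x])
    qed
    then have d1: "AE x in distr (obs_dist M T \<Psi> D) (PS B) (\<lambda>x. restrict x B). AE c in \<rho> x. emeasure (\<kappa> (x, c)) E = r (x, c)"
      unfolding \<nu>_def marginal_def .
    have kE: "(\<lambda>z. emeasure (\<kappa> z) E) \<in> borel_measurable (PS B \<Otimes>\<^sub>M PS C)"
      by (rule measurable_emeasure_kernel[OF measurable_prob_algebraD[OF kk(1)] E])
    have om: "measurable (obs_dist M T \<Psi> D) N = measurable (PS V) N" for N :: "('n \<Rightarrow> path) measure"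
      by (simp add: obs_dist_eq)
    have po: "prob_space (obs_dist M T \<Psi> D)" unfolding obs_dist_eq
      by (rule PN.prob_space_distr) (simp add: measurable_PN measurable_sol0)
    have "AE p in distr (obs_dist M T \<Psi> D) (PS B \<Otimes>\<^sub>M PS C) (\<lambda>x. (restrict x B, restrict x C)). 
       emeasure (\<kappa> (fst p, snd p)) E = r (fst p, snd p)"
    proof (rule AE_disintegration[OF po _ _ rho[unfolded path_cond_dist_def] _ d1])
      show "{p \<in> space (PS B \<Otimes>\<^sub>M PS C). emeasure (\<kappa> (fst p, snd p)) E = r (fst p, snd p)} \<in> sets (PS B \<Otimes>\<^sub>M PS C)"
        unfolding prod.collapse using kE r by measurable
    qed (simp_all add: om measurable_restrict_ident ABC)
    then have "AE p in marginal2 T (obs_dist M T \<Psi> D) B C. emeasure (\<kappa> p) E = r p"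
      unfolding marginal2_def prod.collapse .
    with 2 show ?thesis by eventually_elim simp
  qed
  show ?thesis
    by (rule AE_kernel_eqI[OF T_pos fin_sub(1)[OF ABC(1)] kk _ AEE]) (simp_all add: marginal2_def)
qed

end

theorem mainTheorem7:
  fixes M :: "'a measure" and F :: "real \<Rightarrow> 'a measure" and T :: real
    and \<Psi> :: "nat \<Rightarrow> (nat \<Rightarrow> path) \<times> (nat \<Rightarrow> path) \<Rightarrow> path"
    and D :: "('n, 'a) causal_sde" and A B C :: "'n set"
  assumes "usual_filtered_prob_space M F T"
    and "ito_map M F T \<Psi>"
    and "causal_sde_system M F T D"
    and "\<forall>U\<subseteq>endo D. ess_uniquely_solvable M T \<Psi> D U"
    and "A \<subseteq> endo D" "B \<subseteq> endo D" "C \<subseteq> endo D"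
    and "A \<inter> B = {}" "A \<inter> C = {}" "B \<inter> C = {}"
  shows
    "(sigma_separated (causal_graph T D) A B C \<longrightarrow>
       (\<forall>\<kappa> \<kappa>'. path_cond_dist2 T (obs_dist M T \<Psi> D) A B C \<kappa> \<and>
               path_cond_dist T (obs_dist M T \<Psi> D) A C \<kappa>' \<longrightarrow>
          (AE (xB, xC) in marginal2 T (obs_dist M T \<Psi> D) B C. \<kappa> (xB, xC) = \<kappa>' xC)))
     \<and>
     (sigma_separated (do_graph (causal_graph T D) B) (Inl ` A) (Inr ` B) (Inl ` (B \<union> C)) \<and>
      (\<exists>\<rho>. path_cond_dist T (obs_dist M T \<Psi> D) C B \<rho> \<and>
           (AE xB in marginal T (obs_dist M T \<Psi> D) B.
              absolutely_continuous (marginal T (do_dist M T \<Psi> D B xB) C) (\<rho> xB))) \<longrightarrow>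
       (\<forall>\<kappa> \<kappa>'. do_cond_kernel M T \<Psi> D A B C \<kappa> \<and>
               path_cond_dist2 T (obs_dist M T \<Psi> D) A B C \<kappa>' \<longrightarrow>
          (AE (xB, xC) in marginal2 T (obs_dist M T \<Psi> D) B C. \<kappa> (xB, xC) = \<kappa>' (xB, xC))))
     \<and>
     (sigma_separated (do_graph (causal_graph T D) B) (Inl ` A) (Inr ` B) (Inl ` C) \<longrightarrow>
       (\<forall>xB\<in>cadlag_fam T B.
          absolutely_continuous (marginal T (do_dist M T \<Psi> D B xB) C)
            (marginal T (obs_dist M T \<Psi> D) C) \<longrightarrow>
          (\<forall>\<kappa> \<kappa>'. path_cond_dist T (do_dist M T \<Psi> D B xB) A C \<kappa> \<and>
                  path_cond_dist T (obs_dist M T \<Psi> D) A C \<kappa>' \<longrightarrow>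
             (AE xC in marginal T (obs_dist M T \<Psi> D) C. \<kappa> xC = \<kappa>' xC))))"
proof -
  interpret sde_context M F T \<Psi> D
    using assms(1-4) by (intro sde_context.intro sde_context_axioms.intro) auto
  show ?thesis
  proof (intro conjI impI allI ballI; (elim conjE exE)?)
    fix \<kappa> \<kappa>'
    assume sep: "sigma_separated (causal_graph T D) A B C"
      and k: "path_cond_dist2 T (obs_dist M T \<Psi> D) A B C \<kappa>" "path_cond_dist T (obs_dist M T \<Psi> D) A C \<kappa>'"
    show "AE (xB, xC) in marginal2 T (obs_dist M T \<Psi> D) B C. \<kappa> (xB, xC) = \<kappa>' xC"
      using rule1[OF assms(5-7,9,10) sep k] by eventually_elim (simp add: case_prod_beta)
  next
    fix \<kappa> \<kappa>' \<rho>
    assume sep: "sigma_separated (do_graph (causal_graph T D) B) (Inl ` A) (Inr ` B) (Inl ` (B \<union> C))"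
      and rho: "path_cond_dist T (obs_dist M T \<Psi> D) C B \<rho>"
      and ac: "AE xB in marginal T (obs_dist M T \<Psi> D) B. absolutely_continuous (marginal T (do_dist M T \<Psi> D B xB) C) (\<rho> xB)"
      and k: "do_cond_kernel M T \<Psi> D A B C \<kappa>" "path_cond_dist2 T (obs_dist M T \<Psi> D) A B C \<kappa>'"
    show "AE (xB, xC) in marginal2 T (obs_dist M T \<Psi> D) B C. \<kappa> (xB, xC) = \<kappa>' (xB, xC)"
      using rule2[OF assms(5-10) sep rho ac k] by eventually_elim (simp add: case_prod_beta)
  next
    fix xB \<kappa> \<kappa>'
    assume sep: "sigma_separated (do_graph (causal_graph T D) B) (Inl ` A) (Inr ` B) (Inl ` C)"
      and x: "xB \<in> cadlag_fam T B"
      and ac: "absolutely_continuous (marginal T (do_dist M T \<Psi> D B xB) C) (marginal T (obs_dist M T \<Psi> D) C)"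
      and k: "path_cond_dist T (do_dist M T \<Psi> D B xB) A C \<kappa>" "path_cond_dist T (obs_dist M T \<Psi> D) A C \<kappa>'"
    show "AE xC in marginal T (obs_dist M T \<Psi> D) C. \<kappa> xC = \<kappa>' xC"
      by (rule rule3[OF assms(5-10) sep x ac k])
  qed
qed

end
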